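(* Let $u_0\in H^1(\mathbb{R})$ be such that $\partial_x u_0\in L^1(\mathbb{R})\cap BV(\mathbb{R})$. Then the Cauchy problem $$u_t-u_{txx}=\partial_x(2+\partial_x)\big[(2-\partial_x)u\big]^2,\quad t>0,\ x\in\mathbb{R},\qquad u(0,x)=u_0(x),$$ has a global entropy weak solution $u$.
   Context: Let $G(x)=\frac12 e^{-|x|}$, and let $\ast$ denote convolution in the space variable $x$, so that $G\ast f=(1-\partial_x^2)^{-1}f$ for $f\in L^2(\mathbb{R})$. For a function $u$ put $$P_1=G\ast\big[2(\partial_x u)^2+6u^2\big],\qquad P_2=G\ast\big[(\partial_x u)^2\big].$$ The equation can be rewritten as $$u_t-4uu_x=-u_x^2+G\ast\big[\partial_x(2u_x^2+6u^2)+u_x^2\big],\qquad\text{i.e.}\qquad u_t-4uu_x=\partial_xP_1+\partial_x^2P_2,$$ where $\partial_x^2P_2=P_2-(\partial_xu)^2$. Global weak solution: a function $u:\mathbb{R}_+\times\mathbb{R}\to\mathbb{R}$ is a global weak solution of the Cauchy problem if $u\in L^\infty((0,\infty);H^1(\mathbb{R}))$, $u$ satisfies the rewritten equation and $u(t,\cdot)\to u_0$ as $t\to0^+$ in the sense of distributions, that is, for all $\phi\in C_c^\infty([0,\infty)\times\mathbb{R})$, $$\int_{\mathbb{R}_+}\int_{\mathbb{R}}\big(u\,\partial_t\phi-2u^2\,\partial_x\phi+\partial_xP_1\,\phi+\partial_x^2P_2\,\phi\big)\,dx\,dt+\int_{\mathbb{R}}u_0(x)\phi(0,x)\,dx=0,$$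 and for any $t>0$, $\|u(t,\cdot)\|_{H^1(\mathbb{R})}\le\|u_0\|_{H^1(\mathbb{R})}$. Global entropy weak solution: a function $u:\mathbb{R}_+\times\mathbb{R}\to\mathbb{R}$ such that (i) $u$ is a global weak solution of the Cauchy problem, that is, $u\in L^\infty((0,\infty);H^1(\mathbb{R}))$, for all $\phi\in C_c^\infty([0,\infty)\times\mathbb{R})$ one has $$\int_{\mathbb{R}_+}\int_{\mathbb{R}}\big(u\,\partial_t\phi-2u^2\,\partial_x\phi+\partial_xP_1\,\phi+\partial_x^2P_2\,\phi\big)\,dx\,dt+\int_{\mathbb{R}}u_0(x)\phi(0,x)\,dx=0,$$ and $\|u(t,\cdot)\|_{H^1(\mathbb{R})}\le\|u_0\|_{H^1(\mathbb{R})}$ for any $t>0$; (ii) $\partial_xu\in L^\infty(0,T;L^1(\mathbb{R})\cap BV(\mathbb{R}))$ for any $T>0$; (iii) for any convex $C^2$ entropy $\eta:\mathbb{R}\to\mathbb{R}$ with corresponding entropy flux $q:\mathbb{R}\to\mathbb{R}$ defined by $q'(u)=u\,\eta'(u)$, one has $$\partial_t\eta(u)-4\partial_xq(u)-\eta'(u)\partial_xP_1-\eta'(u)\partial_x^2P_2\le0\quad\text{in }\mathcal{D}'([0,\infty)\times\mathbb{R}),$$ that is, for all $\phi\in C_c^\infty([0,\infty)\times\mathbb{R})$ with $\phi\ge0$, $$\int_{\mathbb{R}_+}\int_{\mathbb{R}}\big(\eta(u)\partial_t\phi-4q(u)\partial_x\phi+\eta'(u)\partial_xP_1\,\phi+\eta'(u)\partial_x^2P_2\,\phi\big)\,dx\,dt+\int_{\mathbb{R}}\eta(u_0(x))\phi(0,x)\,dx\ge0.$$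 *)

theory Defs
  imports "HOL-Analysis.Analysis"
begin

section \<open>Test functions\<close>

primrec Ck :: "nat \<Rightarrow> ('a::euclidean_space \<Rightarrow> real) \<Rightarrow> bool" where
  "Ck 0 f \<longleftrightarrow> continuous_on UNIV f"
| "Ck (Suc k) f \<longleftrightarrow>
     (\<exists>g. (\<forall>x. (f has_derivative (\<lambda>h. g x \<bullet> h)) (at x)) \<and> (\<forall>b\<in>Basis. Ck k (\<lambda>x. g x \<bullet> b)))"

definition test_function :: "('a::euclidean_space \<Rightarrow> real) \<Rightarrow> bool" where
  "test_function \<phi> \<longleftrightarrow> (\<forall>k. Ck k \<phi>) \<and> compact (closure {x. \<phi> x \<noteq> 0})"

text \<open>The class \<open>C\<^sub>c\<^sup>\<infinity>([0,\<infinity>) \<times> \<real>)\<close> is read as the restrictions to \<open>[0,\<infinity>) \<times> \<real>\<close> of the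
  functions in \<open>C\<^sub>c\<^sup>\<infinity>(\<real> \<times> \<real>)\<close>; such a function need not vanish at \<open>t = 0\<close>. Below it is represented by
  \<open>\<phi> :: real \<times> real \<Rightarrow> real\<close> with \<open>test_function \<phi>\<close>, of which only the values at \<open>t \<ge> 0\<close>
  are used.\<close>

abbreviation dt :: "(real \<times> real \<Rightarrow> real) \<Rightarrow> real \<Rightarrow> real \<Rightarrow> real" where
  "dt \<phi> t x \<equiv> deriv (\<lambda>s. \<phi> (s, x)) t"

abbreviation dx :: "(real \<times> real \<Rightarrow> real) \<Rightarrow> real \<Rightarrow> real \<Rightarrow> real" where
  "dx \<phi> t x \<equiv> deriv (\<lambda>y. \<phi> (t, y)) x"


section \<open>Function spaces on the line\<close>

text \<open>Elements of the spaces are functions rather than classes modulo null sets; all notions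
  below are invariant under changes on Lebesgue null sets.\<close>

definition L1 :: "(real \<Rightarrow> real) set" where
  "L1 = {f. integrable lebesgue f}"

definition L1_norm :: "(real \<Rightarrow> real) \<Rightarrow> real" where
  "L1_norm f = (LINT x|lebesgue. \<bar>f x\<bar>)"

definition L2 :: "(real \<Rightarrow> real) set" where
  "L2 = {f \<in> borel_measurable lebesgue. integrable lebesgue (\<lambda>x. (f x)\<^sup>2)}"

definition loc_integrable :: "(real \<Rightarrow> real) \<Rightarrow> bool" where
  "loc_integrable f \<longleftrightarrow> (\<forall>a b. set_integrable lebesgue {a..b} f)"

definition has_weak_deriv :: "(real \<Rightarrow> real) \<Rightarrow> (real \<Rightarrow> real) \<Rightarrow> bool" where
  "has_weak_deriv f g \<longleftrightarrow> loc_integrable f \<and> loc_integrable g \<and>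
     (\<forall>\<phi>. test_function \<phi> \<longrightarrow>
        (LINT x|lebesgue. f x * deriv \<phi> x) = - (LINT x|lebesgue. g x * \<phi> x))"

text \<open>The choice is unique up to a null set; it is arbitrary if there is no weak derivative.\<close>

definition weak_deriv :: "(real \<Rightarrow> real) \<Rightarrow> real \<Rightarrow> real" where
  "weak_deriv f = (SOME g. has_weak_deriv f g)"

definition H1 :: "(real \<Rightarrow> real) set" where
  "H1 = {f \<in> L2. \<exists>g\<in>L2. has_weak_deriv f g}"

definition H1_norm :: "(real \<Rightarrow> real) \<Rightarrow> real" where
  "H1_norm f = sqrt ((LINT x|lebesgue. (f x)\<^sup>2) + (LINT x|lebesgue. (weak_deriv f x)\<^sup>2))"

definition total_variation :: "(real \<Rightarrow> real) \<Rightarrow> ereal" where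
  "total_variation f =
     (SUP \<phi>\<in>{\<phi>. test_function \<phi> \<and> (\<forall>x. \<bar>\<phi> x\<bar> \<le> 1)}. ereal (LINT x|lebesgue. f x * deriv \<phi> x))"

definition BV :: "(real \<Rightarrow> real) set" where
  "BV = {f. loc_integrable f \<and> total_variation f < \<infinity>}"

definition L1_BV_norm :: "(real \<Rightarrow> real) \<Rightarrow> real" where
  "L1_BV_norm f = L1_norm f + real_of_ereal (total_variation f)"


section \<open>Bochner spaces in time\<close>

text \<open>Strong (Bochner) measurability of \<open>I \<ni> t \<mapsto> f t \<in> X\<close> with respect to the norm \<open>N\<close>:
  almost everywhere limit of simple functions.\<close>

definition strongly_measurable ::
    "real set \<Rightarrow> (real \<Rightarrow> real) set \<Rightarrow> ((real \<Rightarrow> real) \<Rightarrow> real) \<Rightarrow> (real \<Rightarrow> real \<Rightarrow> real) \<Rightarrow> bool" where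
  "strongly_measurable I X N f \<longleftrightarrow>
     (\<exists>s :: nat \<Rightarrow> real \<Rightarrow> real \<Rightarrow> real.
        (\<forall>n. simple_function (lebesgue_on I) (s n) \<and> s n ` I \<subseteq> X) \<and>
        (AE t in lebesgue_on I. f t \<in> X \<and> (\<lambda>n. N (\<lambda>x. f t x - s n t x)) \<longlonglongrightarrow> 0))"

definition ess_bounded ::
    "real set \<Rightarrow> (real \<Rightarrow> real) set \<Rightarrow> ((real \<Rightarrow> real) \<Rightarrow> real) \<Rightarrow> (real \<Rightarrow> real \<Rightarrow> real) \<Rightarrow> bool" where
  "ess_bounded I X N f \<longleftrightarrow> (\<exists>C. AE t in lebesgue_on I. f t \<in> X \<and> N (f t) \<le> C)"

definition Linf_H1 :: "(real \<Rightarrow> real \<Rightarrow> real) \<Rightarrow> bool" where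
  "Linf_H1 u \<longleftrightarrow> strongly_measurable {0<..} H1 H1_norm u \<and> ess_bounded {0<..} H1 H1_norm u"

text \<open>\<open>BV\<close> is not separable, and already a moving jump is not strongly measurable with values in
  \<open>BV\<close>. As usual for \<open>L\<^sup>\<infinity>(0,T; BV)\<close>, measurability is therefore meant with values in \<open>L\<^sup>1\<close>
  (equivalently, measurability against test functions), and only the bound involves the variation.\<close>

definition Linf_L1_BV :: "real \<Rightarrow> (real \<Rightarrow> real \<Rightarrow> real) \<Rightarrow> bool" where
  "Linf_L1_BV T v \<longleftrightarrow>
     strongly_measurable {0<..<T} L1 L1_norm v \<and> ess_bounded {0<..<T} (L1 \<inter> BV) L1_BV_norm v"


section \<open>Entropy weak solutions\<close>

definition G :: "real \<Rightarrow> real" where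
  "G x = exp (- \<bar>x\<bar>) / 2"

definition convolve :: "(real \<Rightarrow> real) \<Rightarrow> (real \<Rightarrow> real) \<Rightarrow> real \<Rightarrow> real" where
  "convolve g f x = (LINT y|lebesgue. g (x - y) * f y)"

definition P1 :: "(real \<Rightarrow> real) \<Rightarrow> real \<Rightarrow> real" where
  "P1 v = convolve G (\<lambda>x. 2 * (weak_deriv v x)\<^sup>2 + 6 * (v x)\<^sup>2)"

definition P2 :: "(real \<Rightarrow> real) \<Rightarrow> real \<Rightarrow> real" where
  "P2 v = convolve G (\<lambda>x. (weak_deriv v x)\<^sup>2)"

text \<open>Since \<open>G \<^bold>* (1 - \<partial>\<^sub>x\<^sup>2) f = f\<close>, the equation
  \<open>u\<^sub>t - u\<^sub>t\<^sub>x\<^sub>x = \<partial>\<^sub>x (2 + \<partial>\<^sub>x) [(2 - \<partial>\<^sub>x) u]\<^sup>2\<close> becomes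
  \<open>u\<^sub>t - 4 u u\<^sub>x = \<partial>\<^sub>x P\<^sub>1 + \<partial>\<^sub>x\<^sup>2 P\<^sub>2\<close>, whose weak form with initial datum \<open>u\<^sub>0\<close> is the integral
  identity below. For \<open>u\<close> satisfying \<open>Linf_H1 u\<close> all the integrals exist, and the inner ones
  do not depend on the chosen weak derivatives.\<close>

definition global_weak_solution :: "(real \<Rightarrow> real) \<Rightarrow> (real \<Rightarrow> real \<Rightarrow> real) \<Rightarrow> bool" where
  "global_weak_solution u0 u \<longleftrightarrow>
     Linf_H1 u \<and>
     (\<forall>\<phi>. test_function \<phi> \<longrightarrow>
        (LINT t:{0<..}|lebesgue. LINT x|lebesgue.
             u t x * dt \<phi> t x - 2 * (u t x)\<^sup>2 * dx \<phi> t x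
             + weak_deriv (P1 (u t)) x * \<phi> (t, x)
             + weak_deriv (weak_deriv (P2 (u t))) x * \<phi> (t, x))
        + (LINT x|lebesgue. u0 x * \<phi> (0, x)) = 0) \<and>
     (\<forall>t>0. u t \<in> H1 \<and> H1_norm (u t) \<le> H1_norm u0)"

definition entropy_inequality ::
    "(real \<Rightarrow> real) \<Rightarrow> (real \<Rightarrow> real) \<Rightarrow> (real \<Rightarrow> real) \<Rightarrow> (real \<Rightarrow> real \<Rightarrow> real) \<Rightarrow> bool" where
  "entropy_inequality \<eta> q u0 u \<longleftrightarrow>
     (\<forall>\<phi>. test_function \<phi> \<and> (\<forall>t\<ge>0. \<forall>x. \<phi> (t, x) \<ge> 0) \<longrightarrow>
        (LINT t:{0<..}|lebesgue. LINT x|lebesgue.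
             \<eta> (u t x) * dt \<phi> t x - 4 * q (u t x) * dx \<phi> t x
             + deriv \<eta> (u t x) * weak_deriv (P1 (u t)) x * \<phi> (t, x)
             + deriv \<eta> (u t x) * weak_deriv (weak_deriv (P2 (u t))) x * \<phi> (t, x))
        + (LINT x|lebesgue. \<eta> (u0 x) * \<phi> (0, x)) \<ge> 0)"

definition global_entropy_weak_solution ::
    "(real \<Rightarrow> real) \<Rightarrow> (real \<Rightarrow> real \<Rightarrow> real) \<Rightarrow> bool" where
  "global_entropy_weak_solution u0 u \<longleftrightarrow>
     global_weak_solution u0 u \<and>
     (\<forall>T>0. Linf_L1_BV T (\<lambda>t. weak_deriv (u t))) \<and>
     (\<forall>\<eta> q. convex_on UNIV \<eta> \<and> Ck 2 \<eta> \<and> (\<forall>v. (q has_real_derivative v * deriv \<eta> v) (at v))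
        \<longrightarrow> entropy_inequality \<eta> q u0 u)"

end

theory Submission
  imports Defs "HOL-Computational_Algebra.Polynomial" "HOL-Complex_Analysis.Great_Picard"
begin

text \<open>With \<open>w = (2 - \<partial>\<^sub>x) u\<close> the equation is a Degasperis--Procesi equation for \<open>w\<close>. It is solved approximately by an
  explicit Euler scheme with a small numerical viscosity, in which \<open>x\<close> stays continuous. Two properties survive the
  discretization: since \<open>u\<^sub>t = (2 + \<partial>\<^sub>x) (1 - \<partial>\<^sub>x\<^sup>2)\<^sup>-\<^sup>1 \<partial>\<^sub>x (w\<^sup>2)\<close>, the \<open>H\<^sup>1\<close> energy of \<open>u\<close> changes at the
  rate of the \<open>L\<^sup>2\<close> product of \<open>w\<close> and the flux difference, so it does not increase, and monotonicity of the scheme controls the \<open>L\<^sup>1\<close> modulus of continuity of \<open>w\<close>, hence of \<open>u\<^sub>x\<close>.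
  The approximations \<open>u\<close> are then equicontinuous in \<open>(t, x)\<close>, so a subsequence converges pointwise, and the uniform \<open>L\<^sup>1\<close>
  modulus of \<open>u\<^sub>x\<close> upgrades this to convergence of \<open>u\<^sub>x\<close> in \<open>L\<^sup>1\<close> on bounded intervals for each \<open>t\<close>. All
  nonlinear terms therefore pass to the limit. Since \<open>u\<close> is Lipschitz in \<open>x\<close>, no entropy is dissipated: the entropy
  inequality holds with equality for every \<open>C\<^sup>2\<close> entropy, and the weak form of the equation is the case \<open>\<eta>(u) = u\<close>.\<close>

section \<open>Smooth functions of one variable\<close>

text \<open>The explicit scheme works because its bounds are not circular. The viscosity
  \<open>M\<close> must dominate \<open>|w|\<close> at every time level, and \<open>|w|\<close> is
  dominated by the L^1 modulus of \<open>w\<close>, since a square integrable function cannot stay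
  away from 0. The modulus grows only through the nonlocal term, three times the x-derivative of G *
  w^2; differentiating once more gives 3 (G * w^2 - w^2), whose L^1 norm the energy controls. The
  growth is therefore linear in time at a rate fixed by the initial energy, and \<open>M\<close> can
  be chosen in advance for any time horizon. The horizon n + 1 of the n-th approximation tends to
  infinity, and \<open>M\<close> with it; the coupling h M^2 = 1 / (n + 1) still drives the
  numerical viscosity to 0. The factor 64 in the time step comes from the energy: the second-order
  error of the explicit Euler step has to be absorbed by the viscous dissipation, which asks for
  more than the CFL condition. Data in H^1 need not be integrable, so the L^1 bounds concern
  translation differences in x, increments in t, and u_x.\<close>

lemma Ck_Suc_real:
  fixes f :: "real \<Rightarrow> real"
  shows "Ck (Suc k) f \<longleftrightarrow> (\<exists>g. (\<forall>x. (f has_real_derivative g x) (at x)) \<and> Ck k g)"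
proof -
  have "(\<lambda>h. a * h) = (*) a" for a :: real by auto
  then show ?thesis by (simp add: has_field_derivative_def)
qed

declare Ck.simps(2) [simp del]

lemma Ck_cont:
  fixes f :: "real \<Rightarrow> real"
  shows "Ck k f \<Longrightarrow> continuous_on UNIV f"
  by (cases k) (auto simp: Ck_Suc_real continuous_on_eq_continuous_at intro: DERIV_isCont)

lemma Ck_SucD:
  fixes f :: "real \<Rightarrow> real"
  shows "Ck (Suc k) f \<Longrightarrow> Ck k f"
proof (induction k arbitrary: f)
  case 0 then show ?case using Ck_cont by auto
next
  case (Suc k) then show ?case unfolding Ck_Suc_real[of "Suc k"] Ck_Suc_real[of k] by blast
qed

lemma Ck_const: "Ck k (\<lambda>x::real. c)"
proof (induction k arbitrary: c)
  case (Suc k) then show ?case unfolding Ck_Suc_real by (intro exI[of _ "\<lambda>x. 0"]) auto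
qed auto

lemma Ck_add:
  fixes f g :: "real \<Rightarrow> real"
  shows "Ck k f \<Longrightarrow> Ck k g \<Longrightarrow> Ck k (\<lambda>x. f x + g x)"
proof (induction k arbitrary: f g)
  case (Suc k)
  then obtain f' g' where "\<forall>x. (f has_real_derivative f' x) (at x)" "Ck k f'"
     "\<forall>x. (g has_real_derivative g' x) (at x)" "Ck k g'" unfolding Ck_Suc_real by blast
  then show ?case unfolding Ck_Suc_real using Suc.IH[of f' g']
    by (intro exI[of _ "\<lambda>x. f' x + g' x"]) (auto intro!: derivative_intros)
qed (auto intro: continuous_intros)

lemma Ck_mult:
  fixes f g :: "real \<Rightarrow> real"
  shows "Ck k f \<Longrightarrow> Ck k g \<Longrightarrow> Ck k (\<lambda>x. f x * g x)"
proof (induction k arbitrary: f g)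
  case (Suc k)
  then obtain f' g' where d: "\<And>x. (f has_real_derivative f' x) (at x)" "Ck k f'"
     "\<And>x. (g has_real_derivative g' x) (at x)" "Ck k g'" unfolding Ck_Suc_real by blast
  have "Ck k (\<lambda>x. f' x * g x + f x * g' x)"
    using Suc.IH[of f' g] Suc.IH[of f g'] Ck_SucD[OF Suc.prems(1)] Ck_SucD[OF Suc.prems(2)] d
    by (intro Ck_add) auto
  then show ?case unfolding Ck_Suc_real using d(1,3)
    by (intro exI[of _ "\<lambda>x. f' x * g x + f x * g' x"]) (auto intro!: derivative_eq_intros)
qed (auto intro: continuous_intros)

lemma Ck_minus:
  fixes f :: "real \<Rightarrow> real"
  assumes "Ck k f" shows "Ck k (\<lambda>x. - f x)"
  using Ck_mult[OF Ck_const[of k "-1"] assms] by simp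

lemma Ck_diff:
  fixes f g :: "real \<Rightarrow> real"
  shows "Ck k f \<Longrightarrow> Ck k g \<Longrightarrow> Ck k (\<lambda>x. f x - g x)"
  using Ck_add[OF _ Ck_minus, of k f g] by simp

lemma Ck_exp:
  fixes f :: "real \<Rightarrow> real"
  shows "Ck k f \<Longrightarrow> Ck k (\<lambda>x. exp (f x))"
proof (induction k arbitrary: f)
  case (Suc k)
  then obtain f' where d: "\<And>x. (f has_real_derivative f' x) (at x)" "Ck k f'" unfolding Ck_Suc_real by blast
  have "Ck k (\<lambda>x. exp (f x) * f' x)"
    using Suc.IH[of f] Ck_SucD[OF Suc.prems] d by (intro Ck_mult) auto
  then show ?case unfolding Ck_Suc_real using d(1)
    by (intro exI[of _ "\<lambda>x. exp (f x) * f' x"]) (auto intro!: derivative_eq_intros)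
qed (auto intro: continuous_intros)

lemma Ck_affine:
  fixes f :: "real \<Rightarrow> real"
  shows "Ck k f \<Longrightarrow> Ck k (\<lambda>x. f (a + c * x))"
proof (induction k arbitrary: f)
  case 0 then show ?case by (auto intro!: continuous_on_compose2[of UNIV f] continuous_intros)
next
  case (Suc k)
  then obtain f' where d: "\<And>x. (f has_real_derivative f' x) (at x)" "Ck k f'" unfolding Ck_Suc_real by blast
  have "Ck k (\<lambda>x. f' (a + c * x) * c)"
    using Suc.IH[of f'] d by (intro Ck_mult Ck_const) auto
  moreover have "((\<lambda>x. f (a + c * x)) has_real_derivative f' (a + c * x) * c) (at x)" for x
    by (rule DERIV_chain2[OF d(1)]) (auto intro!: derivative_eq_intros)
  ultimately show ?case unfolding Ck_Suc_real by (intro exI[of _ "\<lambda>x. f' (a + c * x) * c"]) auto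
qed

lemma Ck_ident: "Ck k (\<lambda>x::real. x)"
proof (cases k)
  case (Suc j) then show ?thesis
    by (auto simp: Ck_Suc_real intro!: exI[of _ "\<lambda>x. 1"] Ck_const)
qed auto

lemma Ck_polynomial:
  fixes p :: "real \<Rightarrow> real"
  assumes "real_polynomial_function p" shows "Ck k p"
  using assms
proof induction
  case (linear f)
  have "f x = x * f 1" for x
    using linear_scale[OF bounded_linear.linear[OF linear], of x 1] by simp
  then have "f = (\<lambda>x. x * f 1)" by (rule ext)
  then show ?case using Ck_mult[OF Ck_ident Ck_const, of k "f 1"] by simp
next
  case (const c) show ?case by (rule Ck_const)
next
  case (add f g) show ?case by (rule Ck_add[OF add.IH])
next
  case (mult f g) show ?case by (rule Ck_mult[OF mult.IH])
qed

text \<open>The functions p(1/x) exp(-1/x), extended by 0, form a family closed under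
  differentiation. With the polynomial p as a parameter, smoothness reduces to one first-order
  computation.\<close>

definition flat_exp :: "real poly \<Rightarrow> real \<Rightarrow> real" where
  "flat_exp p x = (if x > 0 then poly p (inverse x) * exp (- inverse x) else 0)"

lemma poly_exp_decay: "((\<lambda>y. poly p y * exp (- y)) \<longlongrightarrow> (0::real)) at_top"
proof -
  \<comment> \<open>The factor y^k serves the induction: in a + y p(y) one power of y moves from the
    polynomial to y^k.\<close>
  have "((\<lambda>y. y ^ k * poly p y * exp (- y)) \<longlongrightarrow> (0::real)) at_top" for k
  proof (induction p arbitrary: k)
    case (pCons a p)
    have "((\<lambda>y. a * (y ^ k / exp y) + y ^ Suc k * poly p y * exp (- y)) \<longlongrightarrow> a * 0 + 0) at_top"
      by (intro tendsto_intros tendsto_power_div_exp_0 pCons)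
    moreover have "(\<lambda>y. a * (y ^ k / exp y) + y ^ Suc k * poly p y * exp (- y))
        = (\<lambda>y. y ^ k * poly (pCons a p) y * exp (- y))"
      by (auto simp: algebra_simps exp_minus divide_inverse)
    ultimately show ?case by simp
  qed auto
  from this[of 0] show ?thesis by simp
qed

text \<open>With y = 1/x the derivative is y^2 (p(y) - p'(y)) exp(-y), and \<open>[:0,0,1:]\<close>
  is the polynomial y^2.\<close>

lemma DERIV_flat_exp:
  "(flat_exp p has_real_derivative flat_exp ([:0,0,1:] * (p - pderiv p)) x) (at x)"
proof -
  consider "x > 0" | "x < 0" | "x = 0" by linarith
  then show ?thesis
  proof cases
    case 1
    have "((\<lambda>x. poly p (inverse x) * exp (- inverse x)) has_real_derivative
       flat_exp ([:0,0,1:] * (p - pderiv p)) x) (at x)"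
      using 1 by (auto intro!: derivative_eq_intros DERIV_chain2[OF poly_DERIV]
        simp: flat_exp_def algebra_simps power2_eq_square)
    then show ?thesis
      by (rule has_field_derivative_transform_within_open[where S="{0<..}"]) (use 1 in \<open>auto simp: flat_exp_def\<close>)
  next
    case 2
    have "((\<lambda>x. 0) has_real_derivative flat_exp ([:0,0,1:] * (p - pderiv p)) x) (at x)"
      using 2 by (auto simp: flat_exp_def)
    then show ?thesis
      by (rule has_field_derivative_transform_within_open[where S="{..<0}"]) (use 2 in \<open>auto simp: flat_exp_def\<close>)
  next
    case 3
    have "((\<lambda>y. (flat_exp p y - flat_exp p 0) / (y - 0)) \<longlongrightarrow> 0) (at_left 0)"
      by (rule tendsto_eventually) (auto simp: eventually_at_filter flat_exp_def)
    moreover have "((\<lambda>y. (flat_exp p y - flat_exp p 0) / (y - 0)) \<longlongrightarrow> 0) (at_right 0)"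
    proof -
      \<comment> \<open>To the right of 0 the difference quotient at 0 is again of the same kind,
        with one more factor 1/y in the polynomial.\<close>
      have "((\<lambda>y. poly ([:0,1:] * p) (inverse y) * exp (- inverse y)) \<longlongrightarrow> 0) (at_right (0::real))"
        using filterlim_compose[OF poly_exp_decay[of "[:0,1:] * p"] filterlim_inverse_at_top_right] .
      then show ?thesis
        by (rule Lim_transform_eventually) (auto simp: eventually_at_filter flat_exp_def divide_inverse)
    qed
    ultimately show ?thesis using 3
      by (simp add: has_field_derivative_iff filterlim_split_at flat_exp_def)
  qed
qed

lemma Ck_flat_exp: "Ck k (flat_exp p)"
proof (induction k arbitrary: p)
  case 0 then show ?case
    using DERIV_flat_exp by (auto simp: continuous_on_eq_continuous_at intro: DERIV_isCont)
next
  case (Suc k) then show ?case unfolding Ck_Suc_real using DERIV_flat_exp by blast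
qed

lemma test_functionI:
  fixes \<phi> :: "real \<Rightarrow> real"
  assumes "\<And>k. Ck k \<phi>" "\<And>x. x \<notin> {a..b} \<Longrightarrow> \<phi> x = 0"
  shows "test_function \<phi>"
proof -
  have "{x. \<phi> x \<noteq> 0} \<subseteq> {a..b}" using assms(2) by blast
  then have "bounded {x. \<phi> x \<noteq> 0}" by (rule bounded_subset[OF bounded_closed_interval])
  then show ?thesis using assms(1) by (auto simp: test_function_def compact_eq_bounded_closed)
qed

lemma test_function_support:
  fixes \<phi> :: "'a::euclidean_space \<Rightarrow> real"
  assumes "test_function \<phi>"
  obtains R where "R > 0" "\<And>x. norm x > R \<Longrightarrow> \<phi> x = 0"
proof -
  have "bounded (closure {x. \<phi> x \<noteq> 0})" using assms by (auto simp: test_function_def compact_imp_bounded)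
  then have "bounded {x. \<phi> x \<noteq> 0}" using bounded_subset closure_subset by blast
  then obtain R where R: "R > 0" "\<And>x. \<phi> x \<noteq> 0 \<Longrightarrow> norm x \<le> R" unfolding bounded_pos by auto
  show ?thesis by (rule that[OF R(1)]) (use R(2) in force)
qed

definition bump :: "real \<Rightarrow> real \<Rightarrow> real \<Rightarrow> real" where
  "bump a b x = flat_exp 1 (x - a) * flat_exp 1 (b - x)"

lemma bump_nonneg: "0 \<le> bump a b x" by (auto simp: bump_def flat_exp_def)

lemma bump_pos_iff: "0 < bump a b x \<longleftrightarrow> x \<in> {a<..<b}"
  by (auto simp: bump_def flat_exp_def zero_less_mult_iff)

lemma bump_eq_0: "x \<notin> {a<..<b} \<Longrightarrow> bump a b x = 0"
  using bump_pos_iff[of a b x] bump_nonneg[of a b x] by linarith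

lemma Ck_bump: "Ck k (bump a b)"
proof -
  have "Ck k (\<lambda>x. flat_exp 1 (- a + 1 * x) * flat_exp 1 (b + (-1) * x))"
    by (rule Ck_mult[OF Ck_affine[OF Ck_flat_exp] Ck_affine[OF Ck_flat_exp]])
  then show ?thesis by (simp add: bump_def[abs_def])
qed

text \<open>As \<open>n\<close> grows, these increase to the indicator of the open interval.\<close>

definition plateau :: "real \<Rightarrow> real \<Rightarrow> nat \<Rightarrow> real \<Rightarrow> real" where
  "plateau a b n x = 1 - exp (- (real n * bump a b x))"

lemma Ck_plateau: "Ck k (plateau a b n)"
  unfolding plateau_def[abs_def]
  by (rule Ck_diff[OF Ck_const Ck_exp[OF Ck_minus[OF Ck_mult[OF Ck_const Ck_bump]]]])

lemma plateau_range: "0 \<le> plateau a b n x" "plateau a b n x \<le> 1"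
  using bump_nonneg[of a b x] by (auto simp: plateau_def)

lemma plateau_outside: "x \<notin> {a<..<b} \<Longrightarrow> plateau a b n x = 0"
  by (simp add: plateau_def bump_eq_0)

lemma plateau_LIMSEQ: "(\<lambda>n. plateau a b n x) \<longlonglongrightarrow> indicator {a<..<b} x"
proof (cases "x \<in> {a<..<b}")
  case True
  then have "bump a b x > 0" by (simp only: bump_pos_iff)
  then have "filterlim (\<lambda>n. real n * bump a b x) at_top sequentially"
    using filterlim_real_sequentially by (intro filterlim_at_top_mult_tendsto_pos[where f="\<lambda>_. bump a b x" and c="bump a b x", OF tendsto_const]) (auto simp: mult.commute)
  then have "(\<lambda>n. exp (- (real n * bump a b x))) \<longlonglongrightarrow> 0"
    by (intro filterlim_compose[OF exp_at_bot]) (simp add: filterlim_uminus_at_bot)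
  from tendsto_diff[OF tendsto_const[of 1] this] show ?thesis using True by (simp add: plateau_def)
qed (auto simp: plateau_outside)

text \<open>Polynomials cut off by plateaus replace mollified functions: uniform approximation then
  comes from Stone-Weierstrass instead of a convolution with a smooth kernel.\<close>

lemma test_function_poly_plateau:
  assumes "real_polynomial_function p"
  shows "test_function (\<lambda>x. c * (p x * plateau a b n x))"
proof (rule test_functionI[where a=a and b=b])
  show "Ck k (\<lambda>x. c * (p x * plateau a b n x))" for k
    by (rule Ck_mult[OF Ck_const Ck_mult[OF Ck_polynomial[OF assms] Ck_plateau]])
  show "c * (p x * plateau a b n x) = 0" if "x \<notin> {a..b}" for x
    using that plateau_outside[of x a b n] by auto
qed

section \<open>Duality with test functions\<close>

lemma test_function_cont:
  fixes \<phi> :: "real \<Rightarrow> real"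
  shows "test_function \<phi> \<Longrightarrow> continuous_on UNIV \<phi>"
  unfolding test_function_def using Ck_cont by blast

lemma continuous_imp_lebesgue_measurable:
  fixes h :: "real \<Rightarrow> real"
  shows "continuous_on UNIV h \<Longrightarrow> h \<in> borel_measurable lebesgue"
  by (intro measurable_completion) (simp add: borel_measurable_continuous_onI)

lemma integrable_indicator_Icc: "integrable lborel (indicator {a..b} :: real \<Rightarrow> real)"
  for a b :: real
  by (rule integrable_real_indicator) (auto simp: emeasure_lborel_Icc_eq)

lemma integrable_lebesgue_indicator_Icc: "integrable lebesgue (indicator {a..b} :: real \<Rightarrow> real)"
  for a b :: real
  using integrable_indicator_Icc[of a b] by (simp add: integrable_completion)

text \<open>The L^1 norm on an interval is a supremum over test functions. The sign of g is an
  almost everywhere limit of continuous functions; these are clamped to [-1, 1], approximated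
  uniformly by polynomials, and cut off by plateaus, so that dominated convergence gives the
  integral of |g|.\<close>

lemma test_function_duality:
  fixes g :: "real \<Rightarrow> real"
  assumes g: "set_integrable lebesgue {a..b} g"
    and le: "\<And>\<phi>. test_function \<phi> \<Longrightarrow> (\<And>x. \<bar>\<phi> x\<bar> \<le> 1) \<Longrightarrow> (LINT x|lebesgue. g x * \<phi> x) \<le> C"
  shows "(LINT x|lebesgue. \<bar>indicator {a..b} x * g x\<bar>) \<le> C"
proof -
  define g0 where "g0 x = indicator {a..b} x * g x" for x
  have g0: "integrable lebesgue g0" using g by (simp add: set_integrable_def g0_def[abs_def])
  then have [measurable]: "g0 \<in> borel_measurable lebesgue" by auto
  have "(\<lambda>x. sgn (g0 x)) measurable_on UNIV"
    by (rule lebesgue_measurable_imp_measurable_on_real) auto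
  then obtain N c where N: "negligible N" and c: "\<And>n. continuous_on UNIV (c n)"
    and clim: "\<And>x. x \<notin> N \<Longrightarrow> (\<lambda>n::nat. c n x) \<longlonglongrightarrow> sgn (g0 x)"
    unfolding measurable_on_def by auto
  define c' where "c' n x = max (-1) (min 1 (c n x))" for n x
  have c': "continuous_on UNIV (c' n)" for n
    unfolding c'_def[abs_def] by (intro continuous_intros c)
  have c'lim: "(\<lambda>n. c' n x) \<longlonglongrightarrow> sgn (g0 x)" if "x \<notin> N" for x
  proof -
    have "(\<lambda>n. c' n x) \<longlonglongrightarrow> max (-1) (min 1 (sgn (g0 x)))"
      unfolding c'_def by (intro tendsto_intros clim that)
    then show ?thesis by (auto simp: sgn_if split: if_splits)
  qed
  have "\<exists>p. real_polynomial_function p \<and> (\<forall>x\<in>{a..b}. \<bar>c' n x - p x\<bar> < 1 / real (Suc n))" for n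
    by (rule Stone_Weierstrass_real_polynomial_function[of "{a..b}" "c' n" "1 / real (Suc n)"])
      (use continuous_on_subset[OF c'] in \<open>auto\<close>)
  then obtain p where p: "\<And>n. real_polynomial_function (p n)"
    and pc: "\<And>n x. x \<in> {a..b} \<Longrightarrow> \<bar>c' n x - p n x\<bar> < 1 / real (Suc n)" by metis
  \<comment> \<open>The polynomial may overshoot the clamped function by 1/(n+1); dividing by 1 +
    1/(n+1) restores the bound 1 and does not change the limit.\<close>
  define \<phi> where "\<phi> n x = 1 / (1 + 1 / real (Suc n)) * (p n x * plateau a b n x)" for n x
  have test: "test_function (\<phi> n)" for n
    unfolding \<phi>_def[abs_def] by (rule test_function_poly_plateau[OF p])
  have \<phi>0: "\<phi> n x = 0" if "x \<notin> {a..b}" for n x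
    using plateau_outside[of x a b n] that by (auto simp: \<phi>_def)
  have \<phi>1: "\<bar>\<phi> n x\<bar> \<le> 1" for n x
  proof (cases "x \<in> {a..b}")
    case True
    have "\<bar>p n x\<bar> \<le> 1 + 1 / real (Suc n)" using pc[OF True, of n] by (auto simp: c'_def)
    then have "\<bar>p n x\<bar> * \<bar>plateau a b n x\<bar> \<le> (1 + 1 / real (Suc n)) * 1"
      using plateau_range[of a b n x] by (intro mult_mono) auto
    moreover have "1 + 1 / real (Suc n) > 0" by (simp add: add_pos_nonneg)
    ultimately show ?thesis by (simp add: \<phi>_def abs_mult divide_le_eq)
  qed (simp add: \<phi>0)
  have \<phi>lim: "(\<lambda>n. g x * \<phi> n x) \<longlonglongrightarrow> \<bar>g0 x\<bar>" if "x \<notin> N" "x \<noteq> a" "x \<noteq> b" for x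
  proof (cases "x \<in> {a..b}")
    case True
    have z: "(\<lambda>n. 1 / real (Suc n)) \<longlonglongrightarrow> 0" using LIMSEQ_inverse_real_of_nat by (simp add: inverse_eq_divide)
    have "(\<lambda>n. c' n x - p n x) \<longlonglongrightarrow> 0"
      by (rule Lim_null_comparison[OF _ z]) (use pc[OF True] in \<open>auto intro!: always_eventually less_imp_le\<close>)
    from tendsto_diff[OF c'lim[OF that(1)] this] have pl: "(\<lambda>n. p n x) \<longlonglongrightarrow> sgn (g0 x)" by simp
    have "(\<lambda>n. g x * (1 / (1 + 1 / real (Suc n)) * (p n x * plateau a b n x)))
        \<longlonglongrightarrow> g x * (1 / (1 + 0) * (sgn (g0 x) * indicator {a<..<b} x))"
      by (intro tendsto_intros z pl plateau_LIMSEQ) auto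
    then show ?thesis using True that by (simp add: \<phi>_def g0_def abs_sgn mult.commute)
  qed (simp add: \<phi>0 g0_def)
  have AEN: "AE x in lebesgue. x \<notin> N \<and> x \<noteq> a \<and> x \<noteq> b"
  proof -
    have "negligible (N \<union> {a,b})" using N by auto
    then have "N \<union> {a,b} \<in> null_sets lebesgue" by (simp add: negligible_iff_null_sets)
    from AE_not_in[OF this] show ?thesis by eventually_elim auto
  qed
  have m[measurable]: "\<phi> n \<in> borel_measurable lebesgue" for n
    by (rule continuous_imp_lebesgue_measurable[OF test_function_cont[OF test]])
  have eq: "g x * \<phi> n x = g0 x * \<phi> n x" for n x
    by (cases "x \<in> {a..b}") (auto simp: g0_def \<phi>0)
  have "(\<lambda>n. LINT x|lebesgue. g0 x * \<phi> n x) \<longlonglongrightarrow> (LINT x|lebesgue. \<bar>g0 x\<bar>)"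
  proof (rule integral_dominated_convergence[where w="\<lambda>x. \<bar>g0 x\<bar>"])
    show "AE x in lebesgue. (\<lambda>n. g0 x * \<phi> n x) \<longlonglongrightarrow> \<bar>g0 x\<bar>"
      using AEN by eventually_elim (use \<phi>lim in \<open>simp add: eq\<close>)
    show "AE x in lebesgue. norm (g0 x * \<phi> n x) \<le> \<bar>g0 x\<bar>" for n
      using mult_left_mono[OF \<phi>1[of n]] by (auto simp: abs_mult)
  qed (use g0 in auto)
  then have "(LINT x|lebesgue. \<bar>g0 x\<bar>) \<le> C"
    by (rule LIMSEQ_le_const2) (use le[OF test \<phi>1] in \<open>auto simp: eq\<close>)
  then show ?thesis by (simp add: g0_def)
qed

text \<open>The fundamental lemma of the calculus of variations, as the duality bound with C = 0 on
  every interval {-n..n}.\<close>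

lemma AE_zero_if_test_function_zero:
  fixes g :: "real \<Rightarrow> real"
  assumes g: "loc_integrable g"
    and 0: "\<And>\<phi>. test_function \<phi> \<Longrightarrow> (LINT x|lebesgue. g x * \<phi> x) = 0"
  shows "AE x in lebesgue. g x = 0"
proof -
  have "AE x in lebesgue. indicator {-real n..real n} x * g x = 0" for n
  proof -
    have s: "set_integrable lebesgue {-real n..real n} g" using g by (auto simp: loc_integrable_def)
    then have i: "integrable lebesgue (\<lambda>x. indicator {-real n..real n} x * g x)" by (simp add: set_integrable_def)
    have "(LINT x|lebesgue. \<bar>indicator {-real n..real n} x * g x\<bar>) \<le> 0"
      by (rule test_function_duality[OF s]) (simp add: 0)
    moreover have "(LINT x|lebesgue. \<bar>indicator {-real n..real n} x * g x\<bar>) \<ge> 0" by simp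
    ultimately have "(LINT x|lebesgue. \<bar>indicator {-real n..real n} x * g x\<bar>) = 0" by linarith
    then show ?thesis using integral_nonneg_eq_0_iff_AE[OF integrable_abs[OF i]] by simp
  qed
  then have "AE x in lebesgue. \<forall>n. indicator {-real n..real n} x * g x = 0" by (intro iffD2[OF AE_all_countable] allI)
  then show ?thesis
  proof eventually_elim
    case (elim x)
    obtain n where "\<bar>x\<bar> \<le> real n" using real_arch_simple by blast
    then show ?case using elim[rule_format, of n] by (auto simp: abs_le_iff)
  qed
qed

lemma has_weak_deriv_weak_deriv: "has_weak_deriv f g \<Longrightarrow> has_weak_deriv f (weak_deriv f)"
  unfolding weak_deriv_def by (rule someI[of "has_weak_deriv f"])

lemma test_function_deriv_cont:
  fixes \<phi> :: "real \<Rightarrow> real"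
  assumes "test_function \<phi>"
  shows "continuous_on UNIV (deriv \<phi>)" "\<And>x. (\<phi> has_real_derivative deriv \<phi> x) (at x)"
proof -
  obtain g where g: "\<And>x. (\<phi> has_real_derivative g x) (at x)" "Ck 0 g"
    using assms Ck_Suc_real[of 0 \<phi>] unfolding test_function_def by blast
  then have "deriv \<phi> = g" by (intro ext DERIV_imp_deriv)
  then show "continuous_on UNIV (deriv \<phi>)" "\<And>x. (\<phi> has_real_derivative deriv \<phi> x) (at x)" using g by auto
qed

lemma test_function_deriv_support:
  fixes \<phi> :: "real \<Rightarrow> real"
  assumes "\<And>x. \<bar>x\<bar> > R \<Longrightarrow> \<phi> x = 0" "\<bar>x\<bar> > R"
  shows "deriv \<phi> x = 0"
proof -
  have "open {y::real. \<bar>y\<bar> > R}" by (intro open_Collect_less continuous_intros)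
  then have "\<forall>\<^sub>F y in nhds x. y \<in> {y. \<bar>y\<bar> > R}" using assms(2) by (intro eventually_nhds_in_open) auto
  then have "\<forall>\<^sub>F y in nhds x. \<phi> y = 0" by eventually_elim (use assms(1) in auto)
  then have "deriv \<phi> x = deriv (\<lambda>_. 0) x" by (rule deriv_cong_ev) simp
  then show ?thesis by simp
qed

lemma loc_integrable_mult:
  fixes f h :: "real \<Rightarrow> real"
  assumes f: "loc_integrable f" and h: "continuous_on UNIV h" and 0: "\<And>x. \<bar>x\<bar> > R \<Longrightarrow> h x = 0"
  shows "integrable lebesgue (\<lambda>x. f x * h x)"
proof -
  have "compact {-R..R}" by simp
  then have "bounded (h ` {-R..R})" by (intro compact_imp_bounded compact_continuous_image continuous_on_subset[OF h]) auto
  then have "\<exists>B. \<forall>x\<in>{-R..R}. \<bar>h x\<bar> \<le> B" unfolding bounded_iff by auto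
  then obtain B where B: "\<And>x. x \<in> {-R..R} \<Longrightarrow> \<bar>h x\<bar> \<le> B" by blast
  have i: "integrable lebesgue (\<lambda>x. indicator {-R..R} x * f x)" using f by (auto simp: loc_integrable_def set_integrable_def)
  have [measurable]: "h \<in> borel_measurable lebesgue"
    by (rule continuous_imp_lebesgue_measurable[OF h])
  have eq: "f x * h x = (indicator {-R..R} x * f x) * h x" for x
    using 0[of x] by (cases "\<bar>x\<bar> > R") (auto simp: abs_le_iff not_less split: split_indicator)
  show ?thesis unfolding eq
  proof (rule Bochner_Integration.integrable_bound[where f="\<lambda>x. B * (indicator {-R..R} x * f x)"])
    show "AE x in lebesgue. norm (indicator {-R..R} x * f x * h x) \<le> norm (B * (indicator {-R..R} x * f x))"
    proof (rule AE_I2)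
      fix x show "norm (indicator {-R..R} x * f x * h x) \<le> norm (B * (indicator {-R..R} x * f x))"
      proof (cases "x \<in> {-R..R}")
        case True
        then have "\<bar>f x\<bar> * \<bar>h x\<bar> \<le> \<bar>f x\<bar> * \<bar>B\<bar>" using B[OF True] by (intro mult_left_mono) auto
        then show ?thesis using True by (simp add: abs_mult mult.commute)
      qed auto
    qed
  qed (use i in auto)
qed

lemma weak_deriv_integrable:
  assumes "has_weak_deriv f g" "test_function \<phi>"
  shows "integrable lebesgue (\<lambda>x. f x * deriv \<phi> x)" "integrable lebesgue (\<lambda>x. g x * \<phi> x)"
    "integrable lebesgue (\<lambda>x. f x * \<phi> x)"
proof -
  obtain R where R: "\<And>x. \<bar>x\<bar> > R \<Longrightarrow> \<phi> x = 0" using test_function_support[OF assms(2)] by auto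
  show "integrable lebesgue (\<lambda>x. f x * deriv \<phi> x)" "integrable lebesgue (\<lambda>x. g x * \<phi> x)"
    "integrable lebesgue (\<lambda>x. f x * \<phi> x)"
    using assms(1) loc_integrable_mult[OF _ test_function_deriv_cont(1)[OF assms(2)] test_function_deriv_support[OF R]]
      loc_integrable_mult[OF _ test_function_cont[OF assms(2)] R] by (auto simp: has_weak_deriv_def)
qed

lemma weak_deriv_unique:
  assumes 1: "has_weak_deriv f g" and 2: "has_weak_deriv f' g'" and eq: "AE x in lebesgue. f x = f' x"
  shows "AE x in lebesgue. g x = g' x"
proof -
  have "AE x in lebesgue. g x - g' x = 0"
  proof (rule AE_zero_if_test_function_zero)
    show "loc_integrable (\<lambda>x. g x - g' x)"
      using 1 2 by (auto simp: has_weak_deriv_def loc_integrable_def intro!: set_integral_diff)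
    fix \<phi> :: "real \<Rightarrow> real" assume \<phi>: "test_function \<phi>"
    have "(LINT x|lebesgue. f x * deriv \<phi> x) = (LINT x|lebesgue. f' x * deriv \<phi> x)"
      using weak_deriv_integrable[OF 1 \<phi>] weak_deriv_integrable[OF 2 \<phi>]
      by (intro integral_cong_AE) (use eq in auto)
    then show "(LINT x|lebesgue. (g x - g' x) * \<phi> x) = 0"
      using 1 2 \<phi> weak_deriv_integrable[OF 1 \<phi>] weak_deriv_integrable[OF 2 \<phi>]
      by (simp add: has_weak_deriv_def left_diff_distrib)
  qed
  then show ?thesis by simp
qed

text \<open>This is how the arbitrary choice in \<open>weak_deriv\<close> is handled everywhere
  below: it is exchanged for any known weak derivative, up to a null set.\<close>

lemma AE_weak_deriv:
  "has_weak_deriv f g \<Longrightarrow> AE x in lebesgue. weak_deriv f x = g x"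
  using weak_deriv_unique[OF has_weak_deriv_weak_deriv] by simp

section \<open>Functions whose weak derivative vanishes\<close>

lemma test_function_antideriv:
  fixes \<phi> :: "real \<Rightarrow> real"
  assumes "test_function \<phi>"
  obtains F R where "\<And>x. (F has_real_derivative \<phi> x) (at x)" "\<And>k. Ck k F" "R > 0"
    "\<And>x. x \<le> - R \<Longrightarrow> F x = F (-R)" "\<And>x. R \<le> x \<Longrightarrow> F x = F R" "(LINT x|lborel. \<phi> x) = F R - F (-R)"
proof -
  obtain R0 where R0: "R0 > 0" "\<And>x. \<bar>x\<bar> > R0 \<Longrightarrow> \<phi> x = 0" using test_function_support[OF assms] by auto
  define R where "R = R0 + 1"
  have R: "R > 0" "\<And>x. \<bar>x\<bar> \<ge> R \<Longrightarrow> \<phi> x = 0" using R0 by (auto simp: R_def)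
  have cont: "isCont \<phi> x" for x using test_function_cont[OF assms] by (simp add: continuous_on_eq_continuous_at)
  obtain F where F0: "\<And>x. (F has_vector_derivative \<phi> x) (at x)"
    using einterval_antiderivative[of "-\<infinity>" "\<infinity>" \<phi>] cont by auto
  then have F: "\<And>x. (F has_real_derivative \<phi> x) (at x)" by (simp add: has_real_derivative_iff_has_vector_derivative)
  have "\<exists>c. \<forall>x\<in>{..-R}. F x = c"
  proof (rule has_field_derivative_zero_constant)
    show "(F has_real_derivative 0) (at x within {..-R})" if "x \<in> {..-R}" for x
      using F[of x] R(2)[of x] that by (auto intro: has_field_derivative_at_within)
  qed auto
  then have l: "F x = F (-R)" if "x \<le> -R" for x using that by (metis atMost_iff order_refl)
  have "\<exists>c. \<forall>x\<in>{R..}. F x = c"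
  proof (rule has_field_derivative_zero_constant)
    show "(F has_real_derivative 0) (at x within {R..})" if "x \<in> {R..}" for x
      using F[of x] R(2)[of x] that by (auto intro: has_field_derivative_at_within)
  qed auto
  then have r: "F x = F R" if "R \<le> x" for x using that by (metis atLeast_iff order_refl)
  have "(LINT x|lborel. \<phi> x) = (LINT x|lborel. \<phi> x * indicator {-R..R} x)"
    by (intro Bochner_Integration.integral_cong) (use R(2) in \<open>auto split: split_indicator\<close>)
  also have "\<dots> = F R - F (-R)" by (rule integral_FTC_Icc_real) (use R F cont in auto)
  finally have "(LINT x|lborel. \<phi> x) = F R - F (-R)" .
  moreover have "Ck k F" for k
    using F assms by (cases k) (auto simp: Ck_Suc_real test_function_def continuous_on_eq_continuous_at intro: DERIV_isCont)
  ultimately show ?thesis using that[OF F _ R(1) l r] by blast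
qed

lemma test_function_diff_scaled:
  fixes \<phi> \<rho> :: "real \<Rightarrow> real"
  assumes "test_function \<phi>" "test_function \<rho>"
  shows "test_function (\<lambda>x. \<phi> x - m * \<rho> x)"
proof -
  obtain R where R: "\<And>x. \<bar>x\<bar> > R \<Longrightarrow> \<phi> x = 0" using test_function_support[OF assms(1)] by auto
  obtain S where S: "\<And>x. \<bar>x\<bar> > S \<Longrightarrow> \<rho> x = 0" using test_function_support[OF assms(2)] by auto
  have "Ck k (\<lambda>x. \<phi> x - m * \<rho> x)" for k
    using assms by (intro Ck_diff Ck_mult[OF Ck_const]) (auto simp: test_function_def)
  then show ?thesis
    by (rule test_functionI[where a="-(max R S)" and b="max R S"]) (use R S in auto)
qed

text \<open>The argument of du Bois-Reymond. The antiderivative of a test function is constant on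
  both sides of the support, and the two constants agree exactly when the integral vanishes.
  Subtracting a multiple of a fixed bump \<open>\<rho>0\<close> from \<open>\<phi>\<close> achieves
  this, so the corrected function is the derivative of a test function and is annihilated by
  f.\<close>

lemma weak_deriv_zero_imp_const:
  assumes z: "has_weak_deriv f (\<lambda>_. 0)"
  obtains c where "AE x in lebesgue. f x = c"
proof -
  define \<rho>0 where "\<rho>0 = bump 0 1"
  have t0: "test_function \<rho>0" unfolding \<rho>0_def
    by (rule test_functionI[where a=0 and b=1]) (auto simp: Ck_bump bump_eq_0)
  obtain F S where F: "\<And>x. (F has_real_derivative \<rho>0 x) (at x)" "\<And>k. Ck k F" "S > 0"
    "\<And>x. x \<le> - S \<Longrightarrow> F x = F (-S)" "\<And>x. S \<le> x \<Longrightarrow> F x = F S" "(LINT x|lborel. \<rho>0 x) = F S - F (-S)"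
    by (rule test_function_antideriv[OF t0], rule that)
  define I where "I = F S - F (-S)"
  have mono: "F x \<le> F y" if "x \<le> y" for x y
    by (rule DERIV_nonneg_imp_nondecreasing[OF that])
      (intro exI conjI, rule F(1), simp add: \<rho>0_def bump_nonneg)
  have inc: "\<exists>y. (F has_real_derivative y) (at x) \<and> 0 < y" if "0 < x" "x < 1" for x
    using F(1)[of x] bump_pos_iff[of 0 1 x] that by (intro exI[of _ "\<rho>0 x"]) (simp add: \<rho>0_def)
  have "continuous_on {0..1} F"
    by (intro continuous_at_imp_continuous_on ballI DERIV_isCont[OF F(1)])
  from DERIV_pos_imp_increasing_open[OF _ inc this] have "F 0 < F 1" by simp
  moreover have "F (-S) \<le> F 0" "F 1 \<le> F S"
    using F(3) mono[of "-S" 0] mono[of 1 "max 1 S"] F(5)[of "max 1 S"] by auto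
  ultimately have I: "I > 0" by (simp add: I_def)
  \<comment> \<open>The mean of f weighted by \<open>\<rho>0\<close> is the only constant that can
    work.\<close>
  define c where "c = (LINT x|lebesgue. f x * \<rho>0 x) / I"
  have "AE x in lebesgue. f x - c = 0"
  proof (rule AE_zero_if_test_function_zero)
    have "loc_integrable f" using z by (simp add: has_weak_deriv_def)
    moreover have "set_integrable lebesgue {a..b} (\<lambda>x. c)" for a b :: real
      by (auto simp: set_integrable_def integrable_lebesgue_indicator_Icc)
    ultimately show lc: "loc_integrable (\<lambda>x. f x - c)"
      by (auto simp: loc_integrable_def intro!: set_integral_diff)
    fix \<phi> :: "real \<Rightarrow> real" assume \<phi>: "test_function \<phi>"
    define m where "m = (LINT x|lborel. \<phi> x) / I"
    have t: "test_function (\<lambda>x. \<phi> x - m * \<rho>0 x)" by (rule test_function_diff_scaled[OF \<phi> t0])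
    obtain H R where H: "\<And>x. (H has_real_derivative \<phi> x - m * \<rho>0 x) (at x)" "\<And>k. Ck k H" "R > 0"
      "\<And>x. x \<le> - R \<Longrightarrow> H x = H (-R)" "\<And>x. R \<le> x \<Longrightarrow> H x = H R"
      "(LINT x|lborel. \<phi> x - m * \<rho>0 x) = H R - H (-R)"
      by (rule test_function_antideriv[OF t], rule that)
    have int: "integrable lebesgue \<phi>'" if t': "test_function \<phi>'" for \<phi>' :: "real \<Rightarrow> real"
    proof -
      obtain R where R: "\<And>x. \<bar>x\<bar> > R \<Longrightarrow> \<phi>' x = 0" using test_function_support[OF t'] by auto
      have "loc_integrable (\<lambda>x. 1)" by (auto simp: loc_integrable_def set_integrable_def integrable_lebesgue_indicator_Icc)
      from loc_integrable_mult[OF this test_function_cont[OF that] R] show ?thesis by simp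
    qed
    have intb: "integrable lborel \<phi>'" if "test_function \<phi>'" for \<phi>' :: "real \<Rightarrow> real"
      using int[OF that] borel_measurable_continuous_onI[OF test_function_cont[OF that]] by (simp add: integrable_completion)
    have leb: "(LINT x|lebesgue. \<phi>' x) = (LINT x|lborel. \<phi>' x)" if "test_function \<phi>'" for \<phi>' :: "real \<Rightarrow> real"
      using borel_measurable_continuous_onI[OF test_function_cont[OF that]] by (simp add: integral_completion)
    have "(LINT x|lborel. \<phi> x - m * \<rho>0 x) = (LINT x|lborel. \<phi> x) - m * I"
      using intb[OF \<phi>] intb[OF t0] by (simp add: F(6) I_def)
    then have "H R = H (-R)" using H(6) I by (simp add: m_def)
    define \<psi> where "\<psi> x = H x - H (-R)" for x
    have t\<psi>: "test_function \<psi>"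
    proof (rule test_functionI[where a="-R" and b=R])
      show "Ck k \<psi>" for k unfolding \<psi>_def[abs_def] by (rule Ck_diff[OF H(2) Ck_const])
      show "\<psi> x = 0" if "x \<notin> {-R..R}" for x
        using that H(4)[of x] H(5)[of x] \<open>H R = H (-R)\<close> by (auto simp: \<psi>_def)
    qed
    have d\<psi>: "deriv \<psi> x = \<phi> x - m * \<rho>0 x" for x
      unfolding \<psi>_def[abs_def] using DERIV_diff[OF H(1)[of x] DERIV_const] by (intro DERIV_imp_deriv) simp
    have "(LINT x|lebesgue. f x * deriv \<psi> x) = 0"
      using z t\<psi> unfolding has_weak_deriv_def by simp
    then have "(LINT x|lebesgue. f x * (\<phi> x - m * \<rho>0 x)) = 0" by (simp only: d\<psi>)
    moreover have "f x * (\<phi> x - m * \<rho>0 x) = f x * \<phi> x - m * (f x * \<rho>0 x)" for x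
      by (simp add: algebra_simps)
    then have "(LINT x|lebesgue. f x * (\<phi> x - m * \<rho>0 x))
        = (LINT x|lebesgue. f x * \<phi> x) - m * (LINT x|lebesgue. f x * \<rho>0 x)"
      using weak_deriv_integrable(3)[OF z \<phi>] weak_deriv_integrable(3)[OF z t0] by simp
    moreover have "(LINT x|lebesgue. (f x - c) * \<phi> x) = (LINT x|lebesgue. f x * \<phi> x) - c * (LINT x|lebesgue. \<phi> x)"
      using weak_deriv_integrable(3)[OF z \<phi>] int[OF \<phi>] by (simp add: left_diff_distrib)
    ultimately show "(LINT x|lebesgue. (f x - c) * \<phi> x) = 0"
      using I by (simp add: m_def c_def leb[OF \<phi>])
  qed
  then show ?thesis using that by simp
qed

section \<open>Convolutions on the line\<close>

lemma integrable_shift: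
  fixes f :: "real \<Rightarrow> real"
  shows "integrable lborel f \<Longrightarrow> integrable lborel (\<lambda>x. f (x + a))"
  using lborel_integrable_real_affine[of f 1 a] by (simp add: add.commute)

lemma integral_shift:
  fixes f :: "real \<Rightarrow> real"
  shows "(LINT x|lborel. f (x + a)) = (LINT x|lborel. f x)"
  using lborel_integral_real_affine[of 1 f a] by (simp add: add.commute)

lemma integrable_shift_diff:
  fixes f :: "real \<Rightarrow> real"
  shows "integrable lborel f \<Longrightarrow> integrable lborel (\<lambda>x. f (x - a))"
  using integrable_shift[of f "-a"] by simp

lemma integral_shift_diff:
  fixes f :: "real \<Rightarrow> real"
  shows "(LINT x|lborel. f (x - a)) = (LINT x|lborel. f x)"
  using integral_shift[of f "-a"] by simp

lemma integral_reflect_shift: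
  fixes f :: "real \<Rightarrow> real"
  shows "(LINT x|lborel. f (a - x)) = (LINT x|lborel. f x)"
  using lborel_integral_real_affine[of "-1" f a] by simp

lemma integrable_reflect_shift:
  fixes f :: "real \<Rightarrow> real"
  shows "integrable lborel f \<Longrightarrow> integrable lborel (\<lambda>x. f (a - x))"
  using lborel_integrable_real_affine[of f "-1" a] by simp

lemma integral_le_abs:
  fixes f g :: "real \<Rightarrow> real"
  assumes "integrable lborel g" "\<And>x. \<bar>f x\<bar> \<le> g x" "f \<in> borel_measurable lborel"
  shows "integrable lborel f" "(LINT x|lborel. \<bar>f x\<bar>) \<le> (LINT x|lborel. g x)"
proof -
  show i: "integrable lborel f"
    by (rule Bochner_Integration.integrable_bound[OF assms(1,3)])
      (use order_trans[OF assms(2) abs_ge_self] in simp)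
  show "(LINT x|lborel. \<bar>f x\<bar>) \<le> (LINT x|lborel. g x)"
    by (rule integral_mono) (use i assms in auto)
qed

lemma continuous_measurable_lborel:
  fixes f :: "real \<Rightarrow> real"
  shows "continuous_on UNIV f \<Longrightarrow> f \<in> borel_measurable lborel"
  by (simp add: borel_measurable_continuous_onI)

definition bounded_measurable :: "(real \<Rightarrow> real) \<Rightarrow> bool" where
  "bounded_measurable f \<longleftrightarrow> f \<in> borel_measurable lborel \<and> (\<exists>B. \<forall>x. \<bar>f x\<bar> \<le> B)"

lemma bounded_measurableI:
  "f \<in> borel_measurable lborel \<Longrightarrow> (\<And>x. \<bar>f x\<bar> \<le> B) \<Longrightarrow> bounded_measurable f"
  by (auto simp: bounded_measurable_def)

lemma bounded_measurable_contI:
  "continuous_on UNIV f \<Longrightarrow> (\<And>x. \<bar>f x\<bar> \<le> B) \<Longrightarrow> bounded_measurable f"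
  by (rule bounded_measurableI[OF continuous_measurable_lborel])

lemma bounded_measurable_D [dest]: "bounded_measurable f \<Longrightarrow> f \<in> borel_measurable lborel"
  by (simp add: bounded_measurable_def)

lemma bounded_measurable_E:
  assumes "bounded_measurable f" obtains B where "B \<ge> 0" "\<And>x. \<bar>f x\<bar> \<le> B"
  using assms unfolding bounded_measurable_def by (meson abs_ge_zero order_trans)

lemma integrable_mult_bounded:
  assumes "integrable lborel k" "bounded_measurable f"
  shows "integrable lborel (\<lambda>x. k x * f x)" "integrable lborel (\<lambda>x. f x * k x)"
proof -
  obtain B where B: "\<And>x. \<bar>f x\<bar> \<le> B" using bounded_measurable_E[OF assms(2)] by blast
  have *: "\<bar>k x * f x\<bar> \<le> \<bar>k x\<bar> * B" for x using B[of x] by (simp add: abs_mult mult_left_mono)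
  show "integrable lborel (\<lambda>x. k x * f x)"
    by (rule integral_le_abs(1)[where g="\<lambda>x. \<bar>k x\<bar> * B"]) (use assms * in auto)
  then show "integrable lborel (\<lambda>x. f x * k x)" by (simp add: mult.commute)
qed

lemma bounded_measurable_shift:
  assumes "bounded_measurable f" shows "bounded_measurable (\<lambda>x. f (x + a))" "bounded_measurable (\<lambda>x. f (a - x))"
  using assms unfolding bounded_measurable_def by (auto 0 3)

text \<open>Convolution over Borel measure, where product measurability and Fubini are at hand;
  \<open>convolve\<close> uses the completed measure and is linked to it only at the end. The
  variable z belongs to the kernel, so a convolution is an average of translates of f.\<close>

definition cv :: "(real \<Rightarrow> real) \<Rightarrow> (real \<Rightarrow> real) \<Rightarrow> real \<Rightarrow> real" where
  "cv k f x = (LINT z|lborel. k z * f (x - z))"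

lemma cv_integrand:
  "integrable lborel k \<Longrightarrow> bounded_measurable f \<Longrightarrow> integrable lborel (\<lambda>z. k z * f (x - z))"
  by (rule integrable_mult_bounded(1)[OF _ bounded_measurable_shift(2)])

lemma cv_cmult: "cv k (\<lambda>x. c * f x) x = c * cv k f x"
proof -
  have "k z * (c * f (x - z)) = c * (k z * f (x - z))" for z by simp
  then show ?thesis unfolding cv_def by (simp only: integral_mult_right_zero)
qed

lemma cv_add:
  "integrable lborel k \<Longrightarrow> bounded_measurable f \<Longrightarrow> bounded_measurable g \<Longrightarrow>
    cv k (\<lambda>x. f x + g x) x = cv k f x + cv k g x"
  unfolding cv_def using cv_integrand[of k f x] cv_integrand[of k g x] by (simp add: distrib_left)

lemma cv_diff:
  "integrable lborel k \<Longrightarrow> bounded_measurable f \<Longrightarrow> bounded_measurable g \<Longrightarrow>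
    cv k (\<lambda>x. f x - g x) x = cv k f x - cv k g x"
  unfolding cv_def using cv_integrand[of k f x] cv_integrand[of k g x] by (simp add: right_diff_distrib)

lemma cv_bound:
  assumes "integrable lborel k" "f \<in> borel_measurable lborel" "\<And>x. \<bar>f x\<bar> \<le> B"
  shows "\<bar>cv k f x\<bar> \<le> B * (LINT z|lborel. \<bar>k z\<bar>)"
proof -
  have "\<bar>k z * f (x - z)\<bar> \<le> B * \<bar>k z\<bar>" for z
    using mult_right_mono[OF assms(3)[of "x - z"], of "\<bar>k z\<bar>"] by (simp add: abs_mult mult.commute)
  then have "(LINT z|lborel. \<bar>k z * f (x - z)\<bar>) \<le> (LINT z|lborel. B * \<bar>k z\<bar>)"
    using assms by (intro integral_le_abs(2)) auto
  moreover have "\<bar>cv k f x\<bar> \<le> (LINT z|lborel. \<bar>k z * f (x - z)\<bar>)" unfolding cv_def by (rule integral_abs_bound)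
  ultimately show ?thesis by simp
qed

text \<open>Function and evaluation point vary together, so one statement covers continuity in x and
  limits of difference quotients.\<close>

lemma cv_tendsto:
  assumes k: "integrable lborel k" and f: "\<And>n. f n \<in> borel_measurable lborel" "\<And>n x. \<bar>f n x\<bar> \<le> B"
    and g: "g \<in> borel_measurable lborel" and lim: "\<And>z. (\<lambda>n::nat. f n (y n - z)) \<longlonglongrightarrow> g (x - z)"
  shows "(\<lambda>n. cv k (f n) (y n)) \<longlonglongrightarrow> cv k g x"
  unfolding cv_def
proof (rule integral_dominated_convergence[where w="\<lambda>z. B * \<bar>k z\<bar>"])
  show "AE z in lborel. (\<lambda>n. k z * f n (y n - z)) \<longlonglongrightarrow> k z * g (x - z)"
    by (intro AE_I2 tendsto_mult tendsto_const lim)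
  show "AE z in lborel. norm (k z * f n (y n - z)) \<le> B * \<bar>k z\<bar>" for n
    using mult_right_mono[OF f(2), of "\<bar>k _\<bar>"] by (intro AE_I2) (simp add: abs_mult mult.commute)
qed (use k f g in auto)

lemma cv_continuous:
  assumes k: "integrable lborel k" and f: "continuous_on UNIV f" "\<And>x. \<bar>f x\<bar> \<le> B"
  shows "continuous_on UNIV (cv k f)"
proof (intro continuous_at_imp_continuous_on ballI continuous_at_sequentiallyI)
  fix x and y :: "nat \<Rightarrow> real" assume y: "y \<longlonglongrightarrow> x"
  have "isCont f a" for a using f(1) by (simp add: continuous_on_eq_continuous_at)
  then have "(\<lambda>n. f (y n - z)) \<longlonglongrightarrow> f (x - z)" for z
    by (rule isCont_tendsto_compose) (intro tendsto_intros y)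
  then show "(\<lambda>n. cv k f (y n)) \<longlonglongrightarrow> cv k f x"
    using k f continuous_measurable_lborel[OF f(1)] by (intro cv_tendsto) auto
qed

lemma cv_measurable:
  assumes [measurable]: "k \<in> borel_measurable lborel" "f \<in> borel_measurable lborel"
  shows "cv k f \<in> borel_measurable lborel"
  unfolding cv_def[abs_def] by measurable

lemma cv_pair_integrable:
  fixes k f :: "real \<Rightarrow> real"
  assumes k: "integrable lborel k" and f: "integrable lborel f"
  shows "integrable (lborel \<Otimes>\<^sub>M lborel) (\<lambda>(z, x). k z * f (x - z))"
proof (rule lborel_pair.Fubini_integrable)
  have [measurable]: "k \<in> borel_measurable borel" "f \<in> borel_measurable borel" using k f by auto
  show "(\<lambda>(z, x). k z * f (x - z)) \<in> borel_measurable (lborel \<Otimes>\<^sub>M lborel)" by measurable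
  have "(LINT y|lborel. \<bar>f (y - z)\<bar>) = (LINT y|lborel. \<bar>f y\<bar>)" for z
    using integral_shift_diff[of "\<lambda>y. \<bar>f y\<bar>" z] .
  then show "integrable lborel (\<lambda>z. LINT y|lborel. norm (case (z, y) of (z, x) \<Rightarrow> k z * f (x - z)))"
    using k by (simp add: abs_mult)
  show "AE z in lborel. integrable lborel (\<lambda>y. case (z, y) of (z, x) \<Rightarrow> k z * f (x - z))"
    using integrable_shift_diff[OF f] by simp
qed

lemma cv_integrable:
  assumes k: "integrable lborel k" and f: "integrable lborel f"
  shows "integrable lborel (cv k f)"
proof -
  have "integrable (lborel \<Otimes>\<^sub>M lborel) (\<lambda>(x, z). k z * f (x - z))"
    using lborel_pair.integrable_product_swap[OF cv_pair_integrable[OF k f]] by (simp add: case_prod_beta')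
  from lborel_pair.integrable_fst'[OF this] show ?thesis by (simp add: cv_def[abs_def])
qed

lemma cv_L1:
  assumes k: "integrable lborel k" and f: "integrable lborel f"
  shows "(LINT x|lborel. \<bar>cv k f x\<bar>) \<le> (LINT z|lborel. \<bar>k z\<bar>) * (LINT x|lborel. \<bar>f x\<bar>)"
proof -
  have ka: "integrable lborel (\<lambda>z. \<bar>k z\<bar>)" and fa: "integrable lborel (\<lambda>z. \<bar>f z\<bar>)" using k f by auto
  have "\<bar>cv k f x\<bar> \<le> cv (\<lambda>z. \<bar>k z\<bar>) (\<lambda>z. \<bar>f z\<bar>) x" for x
    unfolding cv_def by (rule order_trans[OF integral_abs_bound]) (simp add: abs_mult)
  then have "(LINT x|lborel. \<bar>cv k f x\<bar>) \<le> (LINT x|lborel. cv (\<lambda>z. \<bar>k z\<bar>) (\<lambda>z. \<bar>f z\<bar>) x)"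
    using cv_integrable[OF k f] cv_integrable[OF ka fa] by (intro integral_mono) auto
  also have "\<dots> = (LINT z|lborel. LINT x|lborel. \<bar>k z\<bar> * \<bar>f (x - z)\<bar>)"
    unfolding cv_def by (rule lborel_pair.Fubini_integral[OF cv_pair_integrable[OF ka fa]])
  also have "\<dots> = (LINT z|lborel. \<bar>k z\<bar>) * (LINT x|lborel. \<bar>f x\<bar>)"
    using integral_shift_diff[of "\<lambda>y. \<bar>f y\<bar>"] by simp
  finally show ?thesis .
qed

lemma cv_integral_nonneg_kernel:
  assumes k: "integrable lborel k" and f: "integrable lborel f"
  shows "(LINT x|lborel. cv k f x) = (LINT z|lborel. k z) * (LINT x|lborel. f x)"
proof -
  have "(LINT x|lborel. cv k f x) = (LINT z|lborel. LINT x|lborel. k z * f (x - z))"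
    unfolding cv_def by (rule lborel_pair.Fubini_integral[OF cv_pair_integrable[OF k f]])
  also have "\<dots> = (LINT z|lborel. k z) * (LINT x|lborel. f x)"
    using integral_shift_diff[of f] by simp
  finally show ?thesis .
qed

text \<open>Fubini followed by the translation x = y + z moves the convolution onto the other
  factor; the kernel is reflected on the way.\<close>

lemma cv_dual:
  assumes k: "integrable lborel k" and f: "integrable lborel f" and g: "bounded_measurable g"
  shows "(LINT x|lborel. cv k f x * g x) = (LINT y|lborel. f y * cv (\<lambda>z. k (- z)) g y)"
proof -
  have [measurable]: "k \<in> borel_measurable borel" "f \<in> borel_measurable borel" "g \<in> borel_measurable borel"
    using k f g by (auto simp: bounded_measurable_def)
  obtain B where B: "\<And>x. \<bar>g x\<bar> \<le> B" using bounded_measurable_E[OF g] by blast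
  have b: "\<bar>k z * f y * g x\<bar> \<le> \<bar>B * (k z * f y)\<bar>" for z y x
    using mult_left_mono[OF order_trans[OF B[of x] abs_ge_self], of "\<bar>k z * f y\<bar>"] by (simp add: abs_mult mult.commute)
  have i1: "integrable (lborel \<Otimes>\<^sub>M lborel) (\<lambda>(z, x). k z * f (x - z) * g x)"
    by (rule Bochner_Integration.integrable_bound[where f="\<lambda>p. B * (case p of (z, x) \<Rightarrow> k z * f (x - z))"])
      (use b cv_pair_integrable[OF k f] in \<open>auto split: prod.split\<close>)
  have "integrable (lborel \<Otimes>\<^sub>M lborel) (\<lambda>(z, y). k z * f y)"
    by (rule lborel_pair.Fubini_integrable) (use k f in \<open>auto simp: abs_mult\<close>)
  then have i2: "integrable (lborel \<Otimes>\<^sub>M lborel) (\<lambda>(z, y). k z * f y * g (y + z))"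
    by (intro Bochner_Integration.integrable_bound[where g="\<lambda>(z, y). k z * f y * g (y + z)" and f="\<lambda>p. B * (case p of (z, y) \<Rightarrow> k z * f y)"])
      (use b in \<open>auto split: prod.split\<close>)
  have "(LINT x|lborel. cv k f x * g x) = (LINT x|lborel. LINT z|lborel. k z * f (x - z) * g x)"
    unfolding cv_def by simp
  also have "\<dots> = (LINT z|lborel. LINT x|lborel. k z * f (x - z) * g x)"
    by (rule lborel_pair.Fubini_integral[OF i1])
  also have "\<dots> = (LINT z|lborel. LINT y|lborel. k z * f y * g (y + z))"
    using integral_shift[of "\<lambda>x. k z * f (x - z) * g x" z for z]
    by (simp only: add_diff_cancel_right')
  also have "\<dots> = (LINT y|lborel. LINT z|lborel. k z * f y * g (y + z))"
    by (rule lborel_pair.Fubini_integral[OF i2, symmetric])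
  also have "\<dots> = (LINT y|lborel. f y * (LINT z|lborel. k z * g (y + z)))"
  proof (intro Bochner_Integration.integral_cong refl)
    fix y
    have "k z * f y * g (y + z) = f y * (k z * g (y + z))" for z by simp
    then show "(LINT z|lborel. k z * f y * g (y + z)) = f y * (LINT z|lborel. k z * g (y + z))"
      by (simp only: integral_mult_right_zero)
  qed
  also have "(\<lambda>y. LINT z|lborel. k z * g (y + z)) = (\<lambda>y. cv (\<lambda>z. k (- z)) g y)"
    unfolding cv_def using integral_reflect_shift[of "\<lambda>z. k z * g (y + z)" 0 for y] by (intro ext) simp
  finally show ?thesis .
qed

text \<open>Jensen's inequality for the probability density k, read off from the nonnegativity of
  the variance of f around its mean c.\<close>

lemma cv_square_le:
  assumes k: "integrable lborel k" "\<And>z. 0 \<le> k z" "(LINT z|lborel. k z) = 1"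
    and f: "f \<in> borel_measurable lborel"
    and i1: "integrable lborel (\<lambda>z. k z * f (x - z))" and i2: "integrable lborel (\<lambda>z. k z * (f (x - z))\<^sup>2)"
  shows "(cv k f x)\<^sup>2 \<le> cv k (\<lambda>y. (f y)\<^sup>2) x"
proof -
  define c where "c = cv k f x"
  have "0 \<le> (LINT z|lborel. k z * (f (x - z) - c)\<^sup>2)" using k(2) by (intro integral_nonneg_AE AE_I2) auto
  also have "(\<lambda>z. k z * (f (x - z) - c)\<^sup>2) = (\<lambda>z. k z * (f (x - z))\<^sup>2 - 2 * c * (k z * f (x - z)) + c\<^sup>2 * k z)"
    by (auto simp: power2_eq_square algebra_simps)
  also have "(LINT z|lborel. k z * (f (x - z))\<^sup>2 - 2 * c * (k z * f (x - z)) + c\<^sup>2 * k z)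
     = cv k (\<lambda>y. (f y)\<^sup>2) x - 2 * c * c + c\<^sup>2"
    using i1 i2 k by (simp add: cv_def c_def)
  finally show ?thesis by (simp add: c_def power2_eq_square)
qed

section \<open>Exponential kernels\<close>

text \<open>The one-sided halves of G: at every point G = (ep + em) / 2. Convolution with
  \<open>ep\<close> inverts 1 + d/dx, convolution with \<open>em\<close> inverts 1 - d/dx. The point
  0 is given to \<open>ep\<close> alone to make the splitting of G exact; reflection then exchanges
  the two kernels only almost everywhere.\<close>

definition ep :: "real \<Rightarrow> real" where "ep z = (if 0 \<le> z then exp (- z) else 0)"

definition em :: "real \<Rightarrow> real" where "em z = (if z < 0 then exp z else 0)"

lemma ep_measurable [measurable]: "ep \<in> borel_measurable borel"
  unfolding ep_def[abs_def] by measurable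

lemma em_measurable [measurable]: "em \<in> borel_measurable borel"
  unfolding em_def[abs_def] by measurable

lemma ep_nonneg: "0 \<le> ep z" and em_nonneg: "0 \<le> em z" by (auto simp: ep_def em_def)

lemma AE_em_reflect: "AE z in lborel. em (- z) = ep z"
  using AE_lborel_singleton[of "0::real"] by eventually_elim (auto simp: ep_def em_def)

lemma AE_em_eq_ep: "AE z in lborel. em z = ep (- z)"
  using AE_lborel_singleton[of "0::real"] by eventually_elim (auto simp: ep_def em_def)

lemma ep_has_integral: "has_bochner_integral lborel ep 1"
proof (rule has_bochner_integral_nn_integral)
  have "((\<lambda>x::real. - exp (- x)) \<longlongrightarrow> - 0) at_top"
    by (intro tendsto_minus filterlim_compose[OF exp_at_bot]) (simp add: filterlim_uminus_at_bot_at_top)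
  then have "(\<integral>\<^sup>+x. ennreal (exp (- x)) * indicator {0..} x \<partial>lborel) = ennreal (- 0 - (- exp (- 0)))"
    by (intro nn_integral_FTC_atLeast) (auto intro!: derivative_eq_intros)
  also have "(\<integral>\<^sup>+x. ennreal (exp (- x)) * indicator {0..} x \<partial>lborel) = (\<integral>\<^sup>+x. ennreal (ep x) \<partial>lborel)"
    by (intro nn_integral_cong) (auto simp: ep_def split: split_indicator)
  finally show "(\<integral>\<^sup>+x. ennreal (ep x) \<partial>lborel) = ennreal 1" by simp
qed (auto simp: ep_nonneg)

lemma integrable_ep: "integrable lborel ep" and integral_ep: "(LINT z|lborel. ep z) = 1"
  using ep_has_integral by (auto simp: has_bochner_integral_iff)

lemma integrable_em: "integrable lborel em" and integral_em: "(LINT z|lborel. em z) = 1"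
proof -
  have i: "integrable lborel (\<lambda>z. ep (0 - z))" "(LINT z|lborel. ep (0 - z)) = 1"
    using integrable_reflect_shift[OF integrable_ep, of 0] integral_reflect_shift[of ep 0] integral_ep by auto
  have ae: "AE z in lborel. ep (0 - z) = em z" using AE_em_eq_ep by eventually_elim simp
  show "integrable lborel em" by (rule integrable_cong_AE_imp[OF i(1)]) (use ae in auto)
  show "(LINT z|lborel. em z) = 1" using i(2) integral_cong_AE[OF _ _ ae] by simp
qed

lemma cv_em_eq: "f \<in> borel_measurable lborel \<Longrightarrow> cv em f x = cv ep (\<lambda>y. f (- y)) (- x)"
proof -
  assume [measurable]: "f \<in> borel_measurable lborel"
  have "cv em f x = (LINT z|lborel. em (0 - z) * f (x - (0 - z)))"
    unfolding cv_def by (rule integral_reflect_shift[symmetric])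
  also have "\<dots> = (LINT z|lborel. ep z * f (- (- x - z)))"
    by (rule integral_cong_AE) (use AE_em_reflect in \<open>auto simp: add.commute\<close>)
  finally show ?thesis by (simp add: cv_def)
qed

lemma cv_cong_AE:
  assumes "AE z in lborel. k z = l z" "k \<in> borel_measurable lborel" "l \<in> borel_measurable lborel" "f \<in> borel_measurable lborel"
  shows "cv k f x = cv l f x"
  unfolding cv_def by (rule integral_cong_AE) (use assms in auto)

lemma cv_reflect_ep: "f \<in> borel_measurable lborel \<Longrightarrow> cv (\<lambda>z. ep (- z)) f x = cv em f x"
  by (rule cv_cong_AE) (use AE_em_eq_ep in auto)

lemma cv_reflect_em: "f \<in> borel_measurable lborel \<Longrightarrow> cv (\<lambda>z. em (- z)) f x = cv ep f x"
  by (rule cv_cong_AE) (use AE_em_reflect in auto)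

lemma isCont_continuous: "continuous_on UNIV f \<Longrightarrow> isCont f x"
  by (simp add: continuous_on_eq_continuous_at)

lemma DERIV_cont: "(\<And>x. (f has_real_derivative g x) (at x)) \<Longrightarrow> continuous_on UNIV f"
  by (intro continuous_at_imp_continuous_on ballI DERIV_isCont)

text \<open>The function -exp(-z) u(x - z) is an antiderivative of exp(-z) (u + g)(x - z).
  Integration over {0..n} and n to infinity leave only the boundary value u x.\<close>

lemma cv_ep_deriv:
  assumes u: "\<And>x. (u has_real_derivative g x) (at x)" and g: "continuous_on UNIV g"
    and B: "\<And>x. \<bar>u x\<bar> \<le> B" "\<And>x. \<bar>g x\<bar> \<le> C"
  shows "cv ep g x = u x - cv ep u x"
proof -
  have uc: "continuous_on UNIV u" using u by (rule DERIV_cont)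
  have bu: "bounded_measurable u" and bg: "bounded_measurable g"
    using bounded_measurable_contI uc g B by blast+
  have [measurable]: "u \<in> borel_measurable borel" "g \<in> borel_measurable borel"
    using bu bg by (auto simp: bounded_measurable_def)
  define h where "h z = exp (- z) * u (x - z) + exp (- z) * g (x - z)" for z
  have h: "isCont h z" for z
    unfolding h_def[abs_def]
    by (intro continuous_intros isCont_o2[where g=u, OF _ isCont_continuous[OF uc]] isCont_o2[where g=g, OF _ isCont_continuous[OF g]])
  have [measurable]: "h \<in> borel_measurable borel" unfolding h_def[abs_def] by measurable
  have F: "((\<lambda>z. - exp (- z) * u (x - z)) has_real_derivative h z) (at z)" for z
    unfolding h_def by (auto intro!: derivative_eq_intros DERIV_chain2[OF u])
  have "(\<lambda>n. LINT z|lborel. h z * indicator {0..real n} z) \<longlonglongrightarrow> (LINT z|lborel. ep z * (u (x - z) + g (x - z)))"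
  proof (rule integral_dominated_convergence[where w="\<lambda>z. (B + C) * ep z"])
    show "AE z in lborel. (\<lambda>n. h z * indicator {0..real n} z) \<longlonglongrightarrow> ep z * (u (x - z) + g (x - z))"
    proof (rule AE_I2)
      fix z
      obtain N where N: "z \<le> real N" using real_arch_simple by blast
      have "h z * indicator {0..real n} z = ep z * (u (x - z) + g (x - z))" if "n \<ge> N" for n
        using N that by (auto simp: ep_def h_def distrib_left split: split_indicator)
      then show "(\<lambda>n. h z * indicator {0..real n} z) \<longlonglongrightarrow> ep z * (u (x - z) + g (x - z))"
        by (intro tendsto_eventually) (auto simp: eventually_sequentially)
    qed
    show "AE z in lborel. norm (h z * indicator {0..real n} z) \<le> (B + C) * ep z" for n
    proof (rule AE_I2)
      fix z
      have "\<bar>h z\<bar> \<le> (B + C) * exp (- z)"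
      proof -
        have "\<bar>h z\<bar> \<le> \<bar>exp (- z) * u (x - z)\<bar> + \<bar>exp (- z) * g (x - z)\<bar>"
          unfolding h_def by (rule abs_triangle_ineq)
        also have "\<dots> = exp (- z) * \<bar>u (x - z)\<bar> + exp (- z) * \<bar>g (x - z)\<bar>" by (simp add: abs_mult)
        also have "\<dots> \<le> exp (- z) * B + exp (- z) * C" by (intro add_mono mult_left_mono B) auto
        finally show ?thesis by (simp add: algebra_simps)
      qed
      moreover have "0 \<le> B + C" using B(1)[of 0] B(2)[of 0] by linarith
      ultimately show "norm (h z * indicator {0..real n} z) \<le> (B + C) * ep z"
        by (auto simp: ep_def split: split_indicator)
    qed
  qed (use integrable_ep in auto)
  moreover have "(LINT z|lborel. h z * indicator {0..real n} z) = - exp (- real n) * u (x - real n) - (- exp (- 0) * u (x - 0))" for n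
    by (rule integral_FTC_Icc_real) (use F h in auto)
  moreover have "(\<lambda>n. - exp (- real n) * u (x - real n) - (- exp (- 0) * u (x - 0))) \<longlonglongrightarrow> 0 - (- exp (- 0) * u (x - 0))"
  proof (intro tendsto_diff tendsto_const)
    have e: "(\<lambda>n. B * exp (- real n)) \<longlonglongrightarrow> B * 0"
      by (intro tendsto_mult tendsto_const filterlim_compose[OF exp_at_bot])
        (simp add: filterlim_uminus_at_bot filterlim_real_sequentially)
    show "(\<lambda>n. - exp (- real n) * u (x - real n)) \<longlonglongrightarrow> 0"
    proof (rule Lim_null_comparison)
      show "\<forall>\<^sub>F n in sequentially. norm (- exp (- real n) * u (x - real n)) \<le> B * exp (- real n)"
        using mult_right_mono[OF B(1), of "exp (- real _)"] by (intro always_eventually) (simp add: abs_mult mult.commute)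
    qed (use e in simp)
  qed
  ultimately have "(LINT z|lborel. ep z * (u (x - z) + g (x - z))) = u x"
    using LIMSEQ_unique by fastforce
  moreover have "(LINT z|lborel. ep z * (u (x - z) + g (x - z))) = cv ep u x + cv ep g x"
    using cv_integrand[OF integrable_ep bu, of x] cv_integrand[OF integrable_ep bg, of x]
    by (simp add: cv_def distrib_left)
  ultimately show ?thesis by simp
qed

text \<open>The case of \<open>ep\<close> applied to the reflected function y to u(-y), whose
  derivative carries a minus sign.\<close>

lemma cv_em_deriv:
  assumes u: "\<And>x. (u has_real_derivative g x) (at x)" and g: "continuous_on UNIV g"
    and B: "\<And>x. \<bar>u x\<bar> \<le> B" "\<And>x. \<bar>g x\<bar> \<le> C"
  shows "cv em g x = cv em u x - u x"
proof -
  have uc: "continuous_on UNIV u" using u by (rule DERIV_cont)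
  have "cv ep (\<lambda>y. - g (- y)) (- x) = u (- (- x)) - cv ep (\<lambda>y. u (- y)) (- x)"
  proof (rule cv_ep_deriv)
    show "((\<lambda>y. u (- y)) has_real_derivative - g (- y)) (at y)" for y
    proof -
      have "((\<lambda>y. - y) has_real_derivative - 1) (at y)" by (auto intro!: derivative_eq_intros)
      from DERIV_chain2[OF u this] show ?thesis by simp
    qed
    show "continuous_on UNIV (\<lambda>y. - g (- y))"
      by (intro continuous_intros continuous_on_compose2[OF g]) auto
  qed (use B in auto)
  moreover have "cv ep (\<lambda>y. - g (- y)) (- x) = - cv ep (\<lambda>y. g (- y)) (- x)"
    using cv_cmult[of ep "-1"] by simp
  ultimately show ?thesis
    using cv_em_eq[OF continuous_measurable_lborel[OF g]] cv_em_eq[OF continuous_measurable_lborel[OF uc]] by simp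
qed

lemma continuous_antiderivative:
  fixes f :: "real \<Rightarrow> real"
  assumes "continuous_on UNIV f"
  obtains F where "\<And>x. (F has_real_derivative f x) (at x)"
proof -
  obtain F where F: "\<And>x. (F has_vector_derivative f x) (at x)"
    using einterval_antiderivative[of "-\<infinity>" "\<infinity>" f] isCont_continuous[OF assms] by auto
  show ?thesis by (rule that[of F]) (simp add: has_real_derivative_iff_has_vector_derivative F)
qed

lemma DERIV_bounded_imp_Lipschitz:
  fixes f :: "real \<Rightarrow> real"
  assumes f: "\<And>x. (f has_real_derivative g x) (at x)" and B: "\<And>x. \<bar>g x\<bar> \<le> B"
  shows "\<bar>f x - f y\<bar> \<le> B * \<bar>x - y\<bar>"
  using field_differentiable_bound[of UNIV f g B x y] f B
  by (auto intro: has_field_derivative_at_within)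

lemma LIMSEQ_inverse_Suc: "(\<lambda>n. 1 / real (Suc n)) \<longlonglongrightarrow> 0"
  using LIMSEQ_inverse_real_of_nat by (simp add: inverse_eq_divide)

lemma DERIV_quotient_LIMSEQ:
  assumes "(f has_real_derivative D) (at x)" "s \<longlonglongrightarrow> 0" "\<And>n. s n \<noteq> 0"
  shows "(\<lambda>n::nat. (f (x + s n) - f x) / s n) \<longlonglongrightarrow> D"
proof -
  have "((\<lambda>h. (f (x + h) - f x) / h) \<longlongrightarrow> D) (at 0)" using assms(1) by (simp add: DERIV_def)
  moreover have "filterlim s (at 0) sequentially"
    using assms(2,3) by (auto simp: filterlim_at intro!: always_eventually)
  ultimately show ?thesis by (rule filterlim_compose)
qed

text \<open>A formula for the convolution with derivatives of bounded functions differentiates under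
  the convolution sign: apply it to the difference \<open>F (\<cdot> + s) - F\<close> of an antiderivative.\<close>

lemma DERIV_cv_from_formula:
  fixes k :: "real \<Rightarrow> real"
  assumes k: "integrable lborel k"
    and formula: "\<And>u g x B C. (\<And>x. (u has_real_derivative g x) (at x)) \<Longrightarrow> continuous_on UNIV g \<Longrightarrow>
        (\<And>x. \<bar>u x\<bar> \<le> B) \<Longrightarrow> (\<And>x. \<bar>g x\<bar> \<le> C) \<Longrightarrow> cv k g x = \<alpha> * u x + \<beta> * cv k u x"
    and f: "continuous_on UNIV f" "\<And>x. \<bar>f x\<bar> \<le> B"
  shows "(cv k f has_real_derivative \<alpha> * f x + \<beta> * cv k f x) (at x)"
proof -
  obtain F where F: "\<And>x. (F has_real_derivative f x) (at x)" using continuous_antiderivative[OF f(1)] by blast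
  have L: "\<bar>F x - F y\<bar> \<le> B * \<bar>x - y\<bar>" for x y by (rule DERIV_bounded_imp_Lipschitz[OF F f(2)])
  have Fc: "continuous_on UNIV F" using F by (rule DERIV_cont)
  have fb: "bounded_measurable f" by (rule bounded_measurable_contI[OF f])
  have [measurable]: "F \<in> borel_measurable borel" "f \<in> borel_measurable borel"
    using continuous_measurable_lborel[OF Fc] continuous_measurable_lborel[OF f(1)] by auto
  have "((\<lambda>h. (cv k f (x + h) - cv k f x) / h) \<longlongrightarrow> \<alpha> * f x + \<beta> * cv k f x) (at 0)"
  proof (subst tendsto_at_iff_sequentially, intro allI impI)
    fix s :: "nat \<Rightarrow> real" assume s0: "\<forall>i. s i \<in> UNIV - {0}" and s: "s \<longlonglongrightarrow> 0"
    have nz: "s n \<noteq> 0" for n using s0 by auto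
    define D where "D n y = (F (y + s n) - F y) / s n" for n y
    have Db: "\<bar>D n y\<bar> \<le> B" for n y
      using L[of "y + s n" y] nz[of n] by (simp add: D_def pos_divide_le_eq)
    have Dd: "(D n has_real_derivative (f (y + s n) - f y) / s n) (at y)" for n y
      unfolding D_def[abs_def]
      by (auto intro!: derivative_eq_intros DERIV_chain2[OF F, of "\<lambda>y. y + s n" 1 y] F nz)
    have fsc: "continuous_on UNIV (\<lambda>y. (f (y + s n) - f y) / s n)" for n
      by (intro continuous_intros continuous_on_compose2[OF f(1)] f(1)) (use nz in auto)
    have fsb: "\<bar>(f (y + s n) - f y) / s n\<bar> \<le> 2 * B / \<bar>s n\<bar>" for n y
      using f(2)[of "y + s n"] f(2)[of y] by (simp add: divide_right_mono)
    have "cv k (\<lambda>y. (f (y + s n) - f y) / s n) x = \<alpha> * D n x + \<beta> * cv k (D n) x" for n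
      by (rule formula[OF Dd fsc Db fsb])
    moreover have "cv k (\<lambda>y. (f (y + s n) - f y) / s n) x = (cv k f (x + s n) - cv k f x) / s n" for n
    proof -
      have "cv k (\<lambda>y. (1 / s n) * (f (y + s n) - f y)) x = (1 / s n) * (cv k (\<lambda>y. f (y + s n)) x - cv k f x)"
        unfolding cv_cmult by (subst cv_diff[OF k bounded_measurable_shift(1)[OF fb] fb]) simp
      moreover have "cv k (\<lambda>y. f (y + s n)) x = cv k f (x + s n)"
        by (simp add: cv_def algebra_simps)
      ultimately show ?thesis by simp
    qed
    moreover have "(\<lambda>n. \<alpha> * D n x + \<beta> * cv k (D n) x) \<longlonglongrightarrow> \<alpha> * f x + \<beta> * cv k f x"
    proof (intro tendsto_intros)
      show "(\<lambda>n. D n x) \<longlonglongrightarrow> f x" unfolding D_def by (rule DERIV_quotient_LIMSEQ[OF F s nz])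
      show "(\<lambda>n. cv k (D n) x) \<longlonglongrightarrow> cv k f x"
      proof (rule cv_tendsto[OF k _ Db])
        show "D n \<in> borel_measurable lborel" for n unfolding D_def[abs_def] by measurable
        show "(\<lambda>n. D n (x - z)) \<longlonglongrightarrow> f (x - z)" for z unfolding D_def by (rule DERIV_quotient_LIMSEQ[OF F s nz])
      qed auto
    qed
    ultimately show "((\<lambda>h. (cv k f (x + h) - cv k f x) / h) \<circ> s) \<longlonglongrightarrow> \<alpha> * f x + \<beta> * cv k f x"
      by (simp add: o_def)
  qed
  then show ?thesis by (simp add: DERIV_def)
qed

lemma DERIV_cv_ep:
  assumes "continuous_on UNIV f" "\<And>x. \<bar>f x\<bar> \<le> B"
  shows "(cv ep f has_real_derivative f x - cv ep f x) (at x)"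
proof -
  have "(cv ep f has_real_derivative 1 * f x + (-1) * cv ep f x) (at x)"
  proof (rule DERIV_cv_from_formula[OF integrable_ep _ assms])
    fix u g :: "real \<Rightarrow> real" and x B C
    assume "\<And>x. (u has_real_derivative g x) (at x)" "continuous_on UNIV g" "\<And>x. \<bar>u x\<bar> \<le> B" "\<And>x. \<bar>g x\<bar> \<le> C"
    from cv_ep_deriv[OF this] show "cv ep g x = 1 * u x + (-1) * cv ep u x" by simp
  qed
  then show ?thesis by simp
qed

lemma DERIV_cv_em:
  assumes "continuous_on UNIV f" "\<And>x. \<bar>f x\<bar> \<le> B"
  shows "(cv em f has_real_derivative cv em f x - f x) (at x)"
proof -
  have "(cv em f has_real_derivative (-1) * f x + 1 * cv em f x) (at x)"
  proof (rule DERIV_cv_from_formula[OF integrable_em _ assms])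
    fix u g :: "real \<Rightarrow> real" and x B C
    assume "\<And>x. (u has_real_derivative g x) (at x)" "continuous_on UNIV g" "\<And>x. \<bar>u x\<bar> \<le> B" "\<And>x. \<bar>g x\<bar> \<le> C"
    from cv_em_deriv[OF this] show "cv em g x = (-1) * u x + 1 * cv em u x" by simp
  qed
  then show ?thesis by simp
qed

section \<open>The integrated modulus of continuity\<close>

text \<open>For integrable f this says that the total variation is at most V, as
  \<open>modl_if_variation_bounded\<close> and \<open>variation_le_modl\<close> show. Unlike the
  variation it is stated through translates, which commute with convolutions and with the scheme,
  and it makes sense for functions such as w whose differences alone are integrable.\<close>

definition modl :: "real \<Rightarrow> (real \<Rightarrow> real) \<Rightarrow> bool" where
  "modl V f \<longleftrightarrow> (\<forall>s\<ge>0. integrable lborel (\<lambda>x. f (x + s) - f x) \<and>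
     (LINT x|lborel. \<bar>f (x + s) - f x\<bar>) \<le> V * s)"

text \<open>The window lies to the left of 0, so that \<open>cv (win s) g x\<close> is the integral
  of g over [x, x + s].\<close>

definition win :: "real \<Rightarrow> real \<Rightarrow> real" where "win s = indicator {-s..0}"

lemma win_nonneg: "0 \<le> win s z" by (simp add: win_def)

lemma win_integrable: "integrable lborel (win s)"
  unfolding win_def by (rule integrable_indicator_Icc)

lemma win_integral: "s \<ge> 0 \<Longrightarrow> (LINT z|lborel. win s z) = s" "s \<ge> 0 \<Longrightarrow> (LINT z|lborel. \<bar>win s z\<bar>) = s"
  by (auto simp: win_def)

lemma win_measurable [measurable]: "win s \<in> borel_measurable borel"
  unfolding win_def by measurable

lemma DERIV_increment_eq_cv:
  fixes f :: "real \<Rightarrow> real"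
  assumes f: "\<And>x. (f has_real_derivative g x) (at x)" and g: "continuous_on UNIV g" and s: "s \<ge> 0"
  shows "f (x + s) - f x = cv (win s) g x"
proof -
  have "cv (win s) g x = (LINT z|lborel. win s (x - z) * g (x - (x - z)))"
    unfolding cv_def by (rule integral_reflect_shift[symmetric])
  also have "\<dots> = (LINT z|lborel. g z * indicator {x..x+s} z)"
    by (intro Bochner_Integration.integral_cong refl) (auto simp: win_def split: split_indicator)
  also have "\<dots> = f (x + s) - f x"
    by (rule integral_FTC_Icc_real) (use f g s isCont_continuous in auto)
  finally show ?thesis by simp
qed

lemma modl_DERIV:
  assumes f: "\<And>x. (f has_real_derivative g x) (at x)" and g: "continuous_on UNIV g" and i: "integrable lborel g"
  shows "modl (LINT x|lborel. \<bar>g x\<bar>) f"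
  unfolding modl_def
proof (intro allI impI conjI)
  fix s :: real assume s: "s \<ge> 0"
  have eq: "f (x + s) - f x = cv (win s) g x" for x by (rule DERIV_increment_eq_cv[OF f g s])
  show "integrable lborel (\<lambda>x. f (x + s) - f x)"
    unfolding eq by (rule cv_integrable[OF win_integrable i])
  show "(LINT x|lborel. \<bar>f (x + s) - f x\<bar>) \<le> (LINT x|lborel. \<bar>g x\<bar>) * s"
    unfolding eq using cv_L1[OF win_integrable i, of s] win_integral(2)[OF s] by (simp add: mult.commute)
qed

lemma modl_mono: "modl V f \<Longrightarrow> V \<le> V' \<Longrightarrow> modl V' f"
  unfolding modl_def by (meson mult_right_mono order_trans)

lemma modl_add:
  assumes "modl V f" "modl W g" shows "modl (V + W) (\<lambda>x. f x + g x)"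
  unfolding modl_def
proof (intro allI impI conjI)
  fix s :: real assume s: "s \<ge> 0"
  have 1: "integrable lborel (\<lambda>x. f (x + s) - f x)" "integrable lborel (\<lambda>x. g (x + s) - g x)"
    "(LINT x|lborel. \<bar>f (x + s) - f x\<bar>) \<le> V * s" "(LINT x|lborel. \<bar>g (x + s) - g x\<bar>) \<le> W * s"
    using assms s by (auto simp: modl_def)
  have eq: "f (x + s) + g (x + s) - (f x + g x) = (f (x + s) - f x) + (g (x + s) - g x)" for x by simp
  show "integrable lborel (\<lambda>x. f (x + s) + g (x + s) - (f x + g x))" unfolding eq using 1 by auto
  have "(LINT x|lborel. \<bar>f (x + s) + g (x + s) - (f x + g x)\<bar>)
     \<le> (LINT x|lborel. \<bar>f (x + s) - f x\<bar> + \<bar>g (x + s) - g x\<bar>)"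
    unfolding eq by (intro integral_mono) (use 1 in \<open>auto\<close>)
  also have "\<dots> \<le> (V + W) * s" using 1 by (simp add: distrib_right)
  finally show "(LINT x|lborel. \<bar>f (x + s) + g (x + s) - (f x + g x)\<bar>) \<le> (V + W) * s" .
qed

lemma modl_cmult:
  assumes "modl V f" shows "modl (\<bar>c\<bar> * V) (\<lambda>x. c * f x)"
proof -
  have eq: "c * f (x + s) - c * f x = c * (f (x + s) - f x)" for x s by (simp add: right_diff_distrib)
  show ?thesis
    using assms unfolding modl_def eq by (auto simp: abs_mult mult.assoc intro: mult_left_mono)
qed

lemma integrable_lower_bound_nonpos:
  fixes g :: "real \<Rightarrow> real"
  assumes "integrable lborel g" "\<And>x. c \<le> g x" shows "c \<le> 0"
proof (rule ccontr)
  assume c: "\<not> c \<le> 0"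
  have "\<bar>c\<bar> \<le> \<bar>g x\<bar>" for x using assms(2)[of x] c by linarith
  then have "integrable lborel (\<lambda>_::real. c)"
    by (intro Bochner_Integration.integrable_bound[OF assms(1)]) auto
  then show False using c by (simp add: integrable_iff_bounded ennreal_mult_eq_top_iff less_top[symmetric])
qed

lemma abs_integral_indicator_le:
  fixes g :: "real \<Rightarrow> real"
  assumes g: "integrable lborel g"
  shows "\<bar>LINT z|lborel. g z * indicator {a..b} z\<bar> \<le> (LINT z|lborel. \<bar>g z\<bar>)"
proof (rule order_trans[OF integral_abs_bound])
  have "integrable lborel (\<lambda>z. g z * indicator {a..b} z)" by (rule integrable_real_mult_indicator[OF _ g]) simp
  then show "(LINT z|lborel. \<bar>g z * indicator {a..b} z\<bar>) \<le> (LINT z|lborel. \<bar>g z\<bar>)"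
    by (intro integral_mono integrable_abs g) (auto split: split_indicator)
qed

text \<open>Let H be an antiderivative of w. The difference of its difference quotients at y and x
  with step s is the integral of (w(z + s) - w(z)) / s over [x, y], hence at most V; as s tends to 0
  it becomes w y - w x.\<close>

lemma modl_oscillation:
  assumes w: "continuous_on UNIV w" and V: "modl V w"
  shows "\<bar>w x - w y\<bar> \<le> V"
proof -
  have *: "\<bar>w y - w x\<bar> \<le> V" if xy: "x \<le> y" for x y
  proof -
    obtain H where H: "\<And>x. (H has_real_derivative w x) (at x)" using continuous_antiderivative[OF w] by blast
    let ?s = "\<lambda>n. 1 / real (Suc n)"
    have "\<bar>(H (y + ?s n) - H y) / ?s n - (H (x + ?s n) - H x) / ?s n\<bar> \<le> V" for n
    proof -
      define s where "s = ?s n"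
      have s: "s > 0" by (simp add: s_def)
      have i: "integrable lborel (\<lambda>z. w (z + s) - w z)" "(LINT z|lborel. \<bar>w (z + s) - w z\<bar>) \<le> V * s"
        using V s by (auto simp: modl_def)
      have "(LINT z|lborel. (w (z + s) - w z) * indicator {x..y} z) = (H (y + s) - H y) - (H (x + s) - H x)"
      proof (rule integral_FTC_Icc_real[OF xy])
        show "((\<lambda>z. H (z + s) - H z) has_real_derivative w (z + s) - w z) (at z)" for z
          by (auto intro!: derivative_eq_intros DERIV_chain2[OF H, of "\<lambda>z. z + s" 1 z] H)
        show "isCont (\<lambda>z. w (z + s) - w z) z" for z
          by (intro continuous_intros isCont_o2[where g=w, OF _ isCont_continuous[OF w]] isCont_continuous[OF w])
      qed
      moreover have "\<bar>LINT z|lborel. (w (z + s) - w z) * indicator {x..y} z\<bar> \<le> V * s"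
        using abs_integral_indicator_le[OF i(1), of x y] i(2) by linarith
      ultimately have "\<bar>(H (y + s) - H y) - (H (x + s) - H x)\<bar> / s \<le> V" using s by (simp add: divide_le_eq)
      then show ?thesis unfolding s_def[symmetric] diff_divide_distrib[symmetric]
        using s by (simp only: abs_divide abs_of_pos)
    qed
    moreover have "(\<lambda>n. \<bar>(H (y + ?s n) - H y) / ?s n - (H (x + ?s n) - H x) / ?s n\<bar>) \<longlonglongrightarrow> \<bar>w y - w x\<bar>"
      by (intro tendsto_intros DERIV_quotient_LIMSEQ[OF H LIMSEQ_inverse_Suc]) auto
    ultimately show ?thesis by (intro LIMSEQ_le_const2) auto
  qed
  show ?thesis using *[of x y] *[of y x] by (cases "x \<le> y") (auto simp: abs_minus_commute)
qed

text \<open>If |w x| exceeded V, the bounded oscillation would keep w^2 above a positive constant on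
  the whole line.\<close>

lemma modl_sup_bound:
  assumes w: "continuous_on UNIV w" and V: "modl V w" and i: "integrable lborel (\<lambda>x. (w x)\<^sup>2)"
  shows "\<bar>w x\<bar> \<le> V"
proof (rule ccontr)
  assume c: "\<not> \<bar>w x\<bar> \<le> V"
  have "(\<bar>w x\<bar> - V)\<^sup>2 \<le> (w y)\<^sup>2" for y
  proof -
    have "\<bar>w x\<bar> - V \<le> \<bar>w y\<bar>" using modl_oscillation[OF w V, of x y] by linarith
    then have "(\<bar>w x\<bar> - V)\<^sup>2 \<le> \<bar>w y\<bar>\<^sup>2" using c by (intro power_mono) auto
    then show ?thesis by simp
  qed
  from integrable_lower_bound_nonpos[OF i this] show False using c by (simp add: not_le)
qed

text \<open>The derivative 2 u u' of u^2 is bounded by u^2 + u'^2, so u^2 oscillates by at most E;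
  being integrable, it comes arbitrarily close to 0.\<close>

lemma sup_bound_from_energy:
  assumes u: "\<And>x. (u has_real_derivative g x) (at x)" and g: "continuous_on UNIV g"
    and i: "integrable lborel (\<lambda>x. (u x)\<^sup>2)" "integrable lborel (\<lambda>x. (g x)\<^sup>2)"
    and E: "(LINT x|lborel. (u x)\<^sup>2) + (LINT x|lborel. (g x)\<^sup>2) \<le> E"
  shows "(u x)\<^sup>2 \<le> E"
proof -
  have uc: "continuous_on UNIV u" using u by (rule DERIV_cont)
  have gi: "integrable lborel (\<lambda>z. 2 * u z * g z)" "(LINT z|lborel. \<bar>2 * u z * g z\<bar>) \<le> E"
  proof -
    have "\<bar>2 * u z * g z\<bar> \<le> (u z)\<^sup>2 + (g z)\<^sup>2" for z
      using sum_squares_bound[of "\<bar>u z\<bar>" "\<bar>g z\<bar>"] by (simp add: abs_mult)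
    note le = integral_le_abs[OF Bochner_Integration.integrable_add[OF i] this]
    have m: "(\<lambda>z. 2 * u z * g z) \<in> borel_measurable lborel"
      using continuous_measurable_lborel[OF uc] continuous_measurable_lborel[OF g] by measurable
    show "integrable lborel (\<lambda>z. 2 * u z * g z)" by (rule le(1)[OF m])
    show "(LINT z|lborel. \<bar>2 * u z * g z\<bar>) \<le> E"
      using le(2)[OF m] E by (simp only: Bochner_Integration.integral_add[OF i])
  qed
  have step: "\<bar>(u b)\<^sup>2 - (u a)\<^sup>2\<bar> \<le> E" if "a \<le> b" for a b
  proof -
    have "(LINT z|lborel. (2 * u z * g z) * indicator {a..b} z) = (u b)\<^sup>2 - (u a)\<^sup>2"
    proof (rule integral_FTC_Icc_real[OF that])
      show "((\<lambda>z. (u z)\<^sup>2) has_real_derivative 2 * u z * g z) (at z)" for z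
        by (auto intro!: derivative_eq_intros u)
      show "isCont (\<lambda>z. 2 * u z * g z) z" for z
        by (intro continuous_intros isCont_continuous uc g)
    qed
    moreover have "\<bar>LINT z|lborel. (2 * u z * g z) * indicator {a..b} z\<bar> \<le> E"
      using abs_integral_indicator_le[OF gi(1), of a b] gi(2) by linarith
    ultimately show ?thesis by simp
  qed
  have "(u x)\<^sup>2 - E \<le> (u y)\<^sup>2" for y
    using step[of x y] step[of y x] by (cases "x \<le> y") auto
  from integrable_lower_bound_nonpos[OF i(1) this] show ?thesis by simp
qed

text \<open>The difference is the integral of f(x - z) - f x over the window. By Fubini each of the
  r translates contributes at most V r in L^1. This measures the L^1 distance between a difference
  quotient and the derivative.\<close>

lemma modl_average:
  assumes f: "f \<in> borel_measurable lborel" and V: "modl V f" and r: "r \<ge> 0"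
    and i: "\<And>x. integrable lborel (\<lambda>z. win r z * f (x - z))"
  shows "integrable lborel (\<lambda>x. cv (win r) f x - r * f x)"
    "(LINT x|lborel. \<bar>cv (win r) f x - r * f x\<bar>) \<le> V * r\<^sup>2"
proof -
  have [measurable]: "f \<in> borel_measurable borel" using f by simp
  have b: "integrable lborel (\<lambda>x. f (x - z) - f x) \<and> (LINT x|lborel. \<bar>f (x - z) - f x\<bar>) \<le> V * r" if "z \<in> {-r..0}" for z
  proof -
    have 1: "integrable lborel (\<lambda>x. f (x + - z) - f x)" "(LINT x|lborel. \<bar>f (x + - z) - f x\<bar>) \<le> V * - z"
      using V[unfolded modl_def, rule_format, of "- z"] that by auto
    have "0 \<le> (LINT x|lborel. \<bar>f (x + 1) - f x\<bar>)" by (rule Bochner_Integration.integral_nonneg) simp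
    from order_trans[OF this conjunct2[OF V[unfolded modl_def, rule_format, of 1]]] have "0 \<le> V" by simp
    then have "V * - z \<le> V * r" using that by (intro mult_left_mono) auto
    then show ?thesis using 1 by simp
  qed
  have V0: "0 \<le> V * r" using b[of 0] r by auto
  have c: "\<bar>LINT y|lborel. \<bar>win r z * (f (y - z) - f y)\<bar>\<bar> \<le> V * r * win r z" for z
    using b[of z] by (auto simp: win_def abs_mult split: split_indicator)
  have ci: "integrable lborel (\<lambda>z. LINT y|lborel. \<bar>win r z * (f (y - z) - f y)\<bar>)"
    by (rule integral_le_abs(1)[where g="\<lambda>z. V * r * win r z"]) (use c win_integrable in auto)
  have p: "integrable (lborel \<Otimes>\<^sub>M lborel) (\<lambda>(z, x). win r z * (f (x - z) - f x))"
  proof (rule lborel_pair.Fubini_integrable)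
    show "integrable lborel (\<lambda>z. LINT y|lborel. norm (case (z, y) of (z, x) \<Rightarrow> win r z * (f (x - z) - f x)))"
      using ci by simp
    show "AE z in lborel. integrable lborel (\<lambda>y. case (z, y) of (z, x) \<Rightarrow> win r z * (f (x - z) - f x))"
      using b by (intro AE_I2) (auto simp: win_def split: split_indicator)
  qed measurable
  have eq: "cv (win r) f x - r * f x = (LINT z|lborel. win r z * (f (x - z) - f x))" for x
    using i[of x] win_integrable[of r] win_integral(1)[OF r] by (simp add: cv_def right_diff_distrib)
  have p': "integrable (lborel \<Otimes>\<^sub>M lborel) (\<lambda>(x, z). win r z * (f (x - z) - f x))"
    using lborel_pair.integrable_product_swap[OF p] by (simp add: case_prod_beta')
  from lborel_pair.integrable_fst'[OF this] show I: "integrable lborel (\<lambda>x. cv (win r) f x - r * f x)"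
    unfolding eq by simp
  have pa: "integrable (lborel \<Otimes>\<^sub>M lborel) (\<lambda>(z, x). \<bar>win r z * (f (x - z) - f x)\<bar>)"
    using integrable_abs[OF p] by (simp add: case_prod_beta')
  have pa': "integrable (lborel \<Otimes>\<^sub>M lborel) (\<lambda>(x, z). \<bar>win r z * (f (x - z) - f x)\<bar>)"
    using integrable_abs[OF p'] by (simp add: case_prod_beta')
  have "(LINT x|lborel. \<bar>cv (win r) f x - r * f x\<bar>) \<le> (LINT x|lborel. LINT z|lborel. \<bar>win r z * (f (x - z) - f x)\<bar>)"
    using I lborel_pair.integrable_fst'[OF pa'] integral_abs_bound unfolding eq by (intro integral_mono) auto
  also have "\<dots> = (LINT z|lborel. LINT x|lborel. \<bar>win r z * (f (x - z) - f x)\<bar>)"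
    by (rule lborel_pair.Fubini_integral[OF pa])
  also have "\<dots> \<le> (LINT z|lborel. V * r * win r z)"
    by (rule integral_mono) (use ci win_integrable c abs_le_D1 in auto)
  also have "\<dots> = V * r\<^sup>2" using win_integral(1)[OF r] by (simp add: power2_eq_square)
  finally show "(LINT x|lborel. \<bar>cv (win r) f x - r * f x\<bar>) \<le> V * r\<^sup>2" .
qed

section \<open>Resolvent operators\<close>

text \<open>With A the inverse of 1 - d^2/dx^2, \<open>Gc\<close> is A and \<open>Dc\<close> is its
  derivative. \<open>Lc\<close> is (2 + d/dx) A, the operator that turns increments of the flux into
  increments of u, and \<open>Nc\<close> is defined so that the derivative of \<open>Lc f\<close> is
  \<open>Nc f - f\<close>.\<close>

definition Lc :: "(real \<Rightarrow> real) \<Rightarrow> real \<Rightarrow> real" where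
  "Lc f x = cv ep f x / 2 + 3 * cv em f x / 2"

definition Nc :: "(real \<Rightarrow> real) \<Rightarrow> real \<Rightarrow> real" where
  "Nc f x = 3 * cv em f x / 2 - cv ep f x / 2"

definition Gc :: "(real \<Rightarrow> real) \<Rightarrow> real \<Rightarrow> real" where
  "Gc f x = cv ep f x / 2 + cv em f x / 2"

definition Dc :: "(real \<Rightarrow> real) \<Rightarrow> real \<Rightarrow> real" where
  "Dc f x = cv em f x / 2 - cv ep f x / 2"

lemma DERIV_Lc:
  assumes "continuous_on UNIV f" "\<And>x. \<bar>f x\<bar> \<le> B"
  shows "(Lc f has_real_derivative Nc f x - f x) (at x)"
  unfolding Lc_def[abs_def] Nc_def
  by (rule derivative_eq_intros DERIV_cv_ep[OF assms] DERIV_cv_em[OF assms] refl | simp)+ (simp add: field_simps)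

lemma DERIV_Gc:
  assumes "continuous_on UNIV f" "\<And>x. \<bar>f x\<bar> \<le> B"
  shows "(Gc f has_real_derivative Dc f x) (at x)"
  unfolding Gc_def[abs_def] Dc_def
  by (rule derivative_eq_intros DERIV_cv_ep[OF assms] DERIV_cv_em[OF assms] refl | simp)+ (simp add: field_simps)

lemma DERIV_Dc:
  assumes "continuous_on UNIV f" "\<And>x. \<bar>f x\<bar> \<le> B"
  shows "(Dc f has_real_derivative Gc f x - f x) (at x)"
  unfolding Gc_def Dc_def[abs_def]
  by (rule derivative_eq_intros DERIV_cv_ep[OF assms] DERIV_cv_em[OF assms] refl | simp)+ (simp add: field_simps)

lemma cv_ep_bound: "f \<in> borel_measurable lborel \<Longrightarrow> (\<And>x. \<bar>f x\<bar> \<le> B) \<Longrightarrow> \<bar>cv ep f x\<bar> \<le> B"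
  using cv_bound[OF integrable_ep, of f B x] integral_ep by (simp add: abs_of_nonneg[OF ep_nonneg])

lemma cv_em_bound: "f \<in> borel_measurable lborel \<Longrightarrow> (\<And>x. \<bar>f x\<bar> \<le> B) \<Longrightarrow> \<bar>cv em f x\<bar> \<le> B"
  using cv_bound[OF integrable_em, of f B x] integral_em by (simp add: abs_of_nonneg[OF em_nonneg])

lemma cv_ep_L1: "integrable lborel f \<Longrightarrow> (LINT x|lborel. \<bar>cv ep f x\<bar>) \<le> (LINT x|lborel. \<bar>f x\<bar>)"
  using cv_L1[OF integrable_ep, of f] integral_ep by (simp add: abs_of_nonneg[OF ep_nonneg])

lemma cv_em_L1: "integrable lborel f \<Longrightarrow> (LINT x|lborel. \<bar>cv em f x\<bar>) \<le> (LINT x|lborel. \<bar>f x\<bar>)"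
  using cv_L1[OF integrable_em, of f] integral_em by (simp add: abs_of_nonneg[OF em_nonneg])

lemma lincomb_L1:
  fixes f g :: "real \<Rightarrow> real"
  assumes f: "integrable lborel f" "(LINT x|lborel. \<bar>f x\<bar>) \<le> A" and g: "integrable lborel g" "(LINT x|lborel. \<bar>g x\<bar>) \<le> B"
  shows "integrable lborel (\<lambda>x. a * f x + b * g x)" "(LINT x|lborel. \<bar>a * f x + b * g x\<bar>) \<le> \<bar>a\<bar> * A + \<bar>b\<bar> * B"
proof -
  show i: "integrable lborel (\<lambda>x. a * f x + b * g x)" using f g by simp
  have "(LINT x|lborel. \<bar>a * f x + b * g x\<bar>) \<le> (LINT x|lborel. \<bar>a\<bar> * \<bar>f x\<bar> + \<bar>b\<bar> * \<bar>g x\<bar>)"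
  proof (rule integral_mono)
    show "\<bar>a * f x + b * g x\<bar> \<le> \<bar>a\<bar> * \<bar>f x\<bar> + \<bar>b\<bar> * \<bar>g x\<bar>" for x
      using abs_triangle_ineq[of "a * f x" "b * g x"] by (simp add: abs_mult)
  qed (use i f g in auto)
  also have "\<dots> = \<bar>a\<bar> * (LINT x|lborel. \<bar>f x\<bar>) + \<bar>b\<bar> * (LINT x|lborel. \<bar>g x\<bar>)" using f g by simp
  also have "\<dots> \<le> \<bar>a\<bar> * A + \<bar>b\<bar> * B" using f g by (intro add_mono mult_left_mono) auto
  finally show "(LINT x|lborel. \<bar>a * f x + b * g x\<bar>) \<le> \<bar>a\<bar> * A + \<bar>b\<bar> * B" .
qed

lemma resolvent_lincomb:
  "Lc f = (\<lambda>x. (1/2) * cv ep f x + (3/2) * cv em f x)" "Nc f = (\<lambda>x. (-1/2) * cv ep f x + (3/2) * cv em f x)"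
  "Gc f = (\<lambda>x. (1/2) * cv ep f x + (1/2) * cv em f x)" "Dc f = (\<lambda>x. (-1/2) * cv ep f x + (1/2) * cv em f x)"
  by (auto simp: Lc_def Nc_def Gc_def Dc_def)

text \<open>The constants are the sums of absolute coefficients of \<open>ep\<close> and
  \<open>em\<close>, both of mass 1: 1/2 + 3/2 for \<open>Lc\<close> and \<open>Nc\<close>, 1/2 +
  1/2 for \<open>Gc\<close> and \<open>Dc\<close>.\<close>

lemma resolvent_L1:
  assumes f: "integrable lborel f" "(LINT x|lborel. \<bar>f x\<bar>) \<le> A"
  shows "integrable lborel (Lc f)" "(LINT x|lborel. \<bar>Lc f x\<bar>) \<le> 2 * A"
    "integrable lborel (Nc f)" "(LINT x|lborel. \<bar>Nc f x\<bar>) \<le> 2 * A"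
    "integrable lborel (Gc f)" "(LINT x|lborel. \<bar>Gc f x\<bar>) \<le> A"
    "integrable lborel (Dc f)" "(LINT x|lborel. \<bar>Dc f x\<bar>) \<le> A"
  using lincomb_L1[OF cv_integrable[OF integrable_ep f(1)] order_trans[OF cv_ep_L1[OF f(1)] f(2)]
      cv_integrable[OF integrable_em f(1)] order_trans[OF cv_em_L1[OF f(1)] f(2)], of "1/2" "3/2"]
    lincomb_L1[OF cv_integrable[OF integrable_ep f(1)] order_trans[OF cv_ep_L1[OF f(1)] f(2)]
      cv_integrable[OF integrable_em f(1)] order_trans[OF cv_em_L1[OF f(1)] f(2)], of "-1/2" "3/2"]
    lincomb_L1[OF cv_integrable[OF integrable_ep f(1)] order_trans[OF cv_ep_L1[OF f(1)] f(2)]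
      cv_integrable[OF integrable_em f(1)] order_trans[OF cv_em_L1[OF f(1)] f(2)], of "1/2" "1/2"]
    lincomb_L1[OF cv_integrable[OF integrable_ep f(1)] order_trans[OF cv_ep_L1[OF f(1)] f(2)]
      cv_integrable[OF integrable_em f(1)] order_trans[OF cv_em_L1[OF f(1)] f(2)], of "-1/2" "1/2"]
  by (simp_all add: resolvent_lincomb)

lemma resolvent_bound:
  assumes f: "f \<in> borel_measurable lborel" "\<And>x. \<bar>f x\<bar> \<le> B"
  shows "\<bar>Lc f x\<bar> \<le> 2 * B" "\<bar>Nc f x\<bar> \<le> 2 * B" "\<bar>Gc f x\<bar> \<le> B" "\<bar>Dc f x\<bar> \<le> B"
  using cv_ep_bound[OF f, of x] cv_em_bound[OF f, of x] unfolding Lc_def Nc_def Gc_def Dc_def by linarith+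

lemma resolvent_cont:
  assumes f: "continuous_on UNIV f" "\<And>x. \<bar>f x\<bar> \<le> B"
  shows "continuous_on UNIV (Lc f)" "continuous_on UNIV (Nc f)" "continuous_on UNIV (Gc f)" "continuous_on UNIV (Dc f)"
  unfolding resolvent_lincomb
  by (intro continuous_intros cv_continuous[OF integrable_ep f] cv_continuous[OF integrable_em f])+

lemma bounded_measurable_add: "bounded_measurable f \<Longrightarrow> bounded_measurable g \<Longrightarrow> bounded_measurable (\<lambda>x. f x + g x)"
  unfolding bounded_measurable_def by (blast intro: borel_measurable_add order_trans[OF abs_triangle_ineq] add_mono)

lemma resolvent_add:
  assumes f: "bounded_measurable f" and g: "bounded_measurable g"
  shows "Lc (\<lambda>x. f x + g x) x = Lc f x + Lc g x" "Gc (\<lambda>x. f x + g x) x = Gc f x + Gc g x"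
    "Nc (\<lambda>x. f x + g x) x = Nc f x + Nc g x" "Dc (\<lambda>x. f x + g x) x = Dc f x + Dc g x"
  unfolding Lc_def Nc_def Gc_def Dc_def cv_add[OF integrable_ep f g] cv_add[OF integrable_em f g]
  by (simp_all add: field_simps)

lemma resolvent_increment:
  assumes f: "bounded_measurable f"
  shows "Lc (\<lambda>x. c * (f (x + h) - f x)) x = c * (Lc f (x + h) - Lc f x)"
    "Dc (\<lambda>x. c * (f (x + h) - f x)) x = c * (Dc f (x + h) - Dc f x)"
proof -
  have s: "cv k (\<lambda>x. f (x + h)) x = cv k f (x + h)" for k by (simp add: cv_def algebra_simps)
  show "Lc (\<lambda>x. c * (f (x + h) - f x)) x = c * (Lc f (x + h) - Lc f x)"
    "Dc (\<lambda>x. c * (f (x + h) - f x)) x = c * (Dc f (x + h) - Dc f x)"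
    unfolding Lc_def Dc_def cv_cmult cv_diff[OF integrable_ep bounded_measurable_shift(1)[OF f] f]
      cv_diff[OF integrable_em bounded_measurable_shift(1)[OF f] f] s
    by (simp_all add: field_simps)
qed

text \<open>The \<open>H\<^sup>1\<close> inner product of \<open>u\<close> with \<open>(2 + \<partial>\<^sub>x) (1 - \<partial>\<^sub>x\<^sup>2)\<^sup>-\<^sup>1 d\<close> is the \<open>L\<^sup>2\<close> inner product of
  \<open>(2 - \<partial>\<^sub>x) u\<close> with \<open>d\<close>.\<close>

lemma energy_pairing:
  assumes u: "\<And>x. (u has_real_derivative g x) (at x)" and g: "continuous_on UNIV g"
    and B: "\<And>x. \<bar>u x\<bar> \<le> B" "\<And>x. \<bar>g x\<bar> \<le> C"
    and d: "integrable lborel d"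
  shows "(LINT x|lborel. u x * Lc d x + g x * (Nc d x - d x)) = (LINT x|lborel. d x * (2 * u x - g x))"
proof -
  have uc: "continuous_on UNIV u" using u by (rule DERIV_cont)
  have bu: "bounded_measurable u" and bg: "bounded_measurable g"
    using bounded_measurable_contI uc g B by blast+
  have mu: "u \<in> borel_measurable lborel" and mg: "g \<in> borel_measurable lborel"
    using bu bg by auto
  have cb: "bounded_measurable (cv ep u)" "bounded_measurable (cv em u)"
    using bounded_measurable_contI[OF cv_continuous[OF integrable_ep uc B(1)] cv_ep_bound[OF mu B(1)]]
      bounded_measurable_contI[OF cv_continuous[OF integrable_em uc B(1)] cv_em_bound[OF mu B(1)]] by auto
  define a b where "a = cv ep d" and "b = cv em d"
  have iab: "integrable lborel a" "integrable lborel b"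
    unfolding a_def b_def by (intro cv_integrable integrable_ep integrable_em d)+
  note int = integrable_mult_bounded(1)[OF iab(1) bu] integrable_mult_bounded(1)[OF iab(2) bu]
    integrable_mult_bounded(1)[OF iab(1) bg] integrable_mult_bounded(1)[OF iab(2) bg]
    integrable_mult_bounded(1)[OF d bg] integrable_mult_bounded(1)[OF d bu]
    integrable_mult_bounded(1)[OF d cb(1)] integrable_mult_bounded(1)[OF d cb(2)]
  \<comment> \<open>All convolutions are moved onto u and g. There the formulas for derivatives of
    bounded functions eliminate the convolutions of g, and the remaining ones cancel.\<close>
  have 1: "(LINT x|lborel. a x * u x) = (LINT x|lborel. d x * cv em u x)"
    unfolding a_def cv_dual[OF integrable_ep d bu] cv_reflect_ep[OF mu] ..
  have 2: "(LINT x|lborel. b x * u x) = (LINT x|lborel. d x * cv ep u x)"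
    unfolding b_def cv_dual[OF integrable_em d bu] cv_reflect_em[OF mu] ..
  have "(LINT x|lborel. a x * g x) = (LINT x|lborel. d x * (cv em u x - u x))"
    unfolding a_def cv_dual[OF integrable_ep d bg] cv_reflect_ep[OF mg] cv_em_deriv[OF u g B] ..
  then have 3: "(LINT x|lborel. a x * g x) = (LINT x|lborel. d x * cv em u x) - (LINT x|lborel. d x * u x)"
    using int by (simp add: right_diff_distrib)
  have "(LINT x|lborel. b x * g x) = (LINT x|lborel. d x * (u x - cv ep u x))"
    unfolding b_def cv_dual[OF integrable_em d bg] cv_reflect_em[OF mg] cv_ep_deriv[OF u g B] ..
  then have 4: "(LINT x|lborel. b x * g x) = (LINT x|lborel. d x * u x) - (LINT x|lborel. d x * cv ep u x)"
    using int by (simp add: right_diff_distrib)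
  have "u x * Lc d x + g x * (Nc d x - d x)
      = (1/2) * (a x * u x) + (3/2) * (b x * u x) - (1/2) * (a x * g x) + (3/2) * (b x * g x) - d x * g x" for x
    by (simp add: Lc_def Nc_def a_def b_def field_simps)
  then have "(LINT x|lborel. u x * Lc d x + g x * (Nc d x - d x))
      = (1/2) * (LINT x|lborel. a x * u x) + (3/2) * (LINT x|lborel. b x * u x)
        - (1/2) * (LINT x|lborel. a x * g x) + (3/2) * (LINT x|lborel. b x * g x) - (LINT x|lborel. d x * g x)"
    using int by simp
  also have "\<dots> = 2 * (LINT x|lborel. d x * u x) - (LINT x|lborel. d x * g x)"
    unfolding 1 2 3 4 by (simp add: field_simps)
  also have "\<dots> = (LINT x|lborel. d x * (2 * u x - g x))"
  proof -
    have "d x * (2 * u x - g x) = 2 * (d x * u x) - d x * g x" for x by (simp add: algebra_simps)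
    then show ?thesis using int by simp
  qed
  finally show ?thesis .
qed

text \<open>Young's inequality reduces the product to the squares of d and of its convolution;
  Jensen bounds the latter by the convolution of d^2, which has the same integral as d^2.\<close>

lemma cv_quadratic_form_le:
  assumes k: "integrable lborel k" "\<And>z. 0 \<le> k z" "(LINT z|lborel. k z) = 1"
    and d: "integrable lborel d" "bounded_measurable d"
  shows "(LINT x|lborel. d x * cv k d x) \<le> (LINT x|lborel. (d x)\<^sup>2)"
proof -
  have d2: "integrable lborel (\<lambda>x. (d x)\<^sup>2)"
    using integrable_mult_bounded(1)[OF d] by (simp add: power2_eq_square)
  have bd2: "bounded_measurable (\<lambda>x. (d x)\<^sup>2)"
  proof -
    obtain B where "\<And>x. \<bar>d x\<bar> \<le> B" using bounded_measurable_E[OF d(2)] by blast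
    then have "\<bar>(d x)\<^sup>2\<bar> \<le> B\<^sup>2" for x using power_mono[of "\<bar>d x\<bar>" B 2] by simp
    moreover have [measurable]: "d \<in> borel_measurable borel" using d(2) by (auto simp: bounded_measurable_def)
    ultimately show ?thesis by (intro bounded_measurableI) auto
  qed
  have i: "integrable lborel (cv k (\<lambda>x. (d x)\<^sup>2))" by (rule cv_integrable[OF k(1) d2])
  have le: "d x * cv k d x \<le> (d x)\<^sup>2 / 2 + cv k (\<lambda>x. (d x)\<^sup>2) x / 2" for x
    using cv_square_le[OF k bounded_measurable_D[OF d(2)] cv_integrand[OF k(1) d(2)] cv_integrand[OF k(1) bd2], of x]
      sum_squares_bound[of "d x" "cv k d x"] by simp
  have "(LINT x|lborel. d x * cv k d x) \<le> (LINT x|lborel. (d x)\<^sup>2 / 2 + cv k (\<lambda>x. (d x)\<^sup>2) x / 2)"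
    by (rule integral_mono) (use le integrable_mult_bounded(2)[OF cv_integrable[OF k(1) d(1)] d(2)] d2 i in auto)
  also have "\<dots> = (LINT x|lborel. (d x)\<^sup>2)"
    using d2 i cv_integral_nonneg_kernel[OF k(1) d2] k(3) by simp
  finally show ?thesis .
qed

section \<open>One step of the scheme\<close>

text \<open>With \<open>w = (2 - \<partial>\<^sub>x) u\<close> the equation becomes the Degasperis--Procesi equation
  \<open>w\<^sub>t = \<partial>\<^sub>x (w\<^sup>2) + 3 \<partial>\<^sub>x G * w\<^sup>2\<close>. One explicit Euler step of length \<open>h / (64 M)\<close> replaces \<open>\<partial>\<^sub>x (w\<^sup>2)\<close> in both
  places by the same viscous difference quotient.\<close>

definition flux :: "real \<Rightarrow> real \<Rightarrow> (real \<Rightarrow> real) \<Rightarrow> real \<Rightarrow> real" where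
  "flux M h w x = M * (w x - w (x - h)) + ((w x)\<^sup>2 + (w (x - h))\<^sup>2) / 2"

definition incr :: "real \<Rightarrow> real \<Rightarrow> (real \<Rightarrow> real) \<Rightarrow> real \<Rightarrow> real" where
  "incr M h w x = 1 / (64 * M) * (flux M h w (x + h) - flux M h w x)"

text \<open>The invariant of the iteration. The derivative condition encodes w = (2 - d/dx) u with w
  as a function of its own, which is what the flux acts on; u_x is always written 2 u - w. E bounds
  the energy and is kept, V bounds the modulus and will grow.\<close>

definition admissible :: "real \<Rightarrow> real \<Rightarrow> (real \<Rightarrow> real) \<Rightarrow> (real \<Rightarrow> real) \<Rightarrow> bool" where
  "admissible E V u w \<longleftrightarrow> (\<forall>x. (u has_real_derivative 2 * u x - w x) (at x)) \<and> continuous_on UNIV w \<and>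
     integrable lborel (\<lambda>x. (u x)\<^sup>2) \<and> integrable lborel (\<lambda>x. (2 * u x - w x)\<^sup>2) \<and>
     (LINT x|lborel. (u x)\<^sup>2) + (LINT x|lborel. (2 * u x - w x)\<^sup>2) \<le> E \<and> modl V w"

lemma integrable_mult_abs_bounded:
  fixes f g :: "real \<Rightarrow> real"
  assumes "integrable lborel f" "continuous_on UNIV g" "\<And>x. \<bar>g x\<bar> \<le> B"
  shows "integrable lborel (\<lambda>x. f x * g x)" "integrable lborel (\<lambda>x. g x * f x)"
  using integrable_mult_bounded[OF assms(1) bounded_measurable_contI[OF assms(2,3)]] by auto

text \<open>\<open>VM\<close> makes the viscosity dominate |w|, which gives monotonicity and
  dissipation. \<open>hM\<close> keeps the L^1 norm of the viscous part of the flux below 1,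
  uniformly in M.\<close>

locale scheme_step =
  fixes u w :: "real \<Rightarrow> real" and E V M h :: real
  assumes adm: "admissible E V u w" and VM: "V \<le> M" and M: "M > 0" and h: "h > 0" and hM: "h * M\<^sup>2 \<le> 1"
begin

definition g where "g x = 2 * u x - w x"

definition \<kappa> where "\<kappa> = 1 / (64 * M)"

definition \<tau> where "\<tau> = h / (64 * M)"

definition C1 where "C1 = 1 + 8 * E"

definition F where "F = flux M h w"

definition d where "d = incr M h w"

section \<open>Bounds for the state and the flux before the step\<close>

lemma du: "(u has_real_derivative g x) (at x)" and wc: "continuous_on UNIV w"
  and iu: "integrable lborel (\<lambda>x. (u x)\<^sup>2)" and ig: "integrable lborel (\<lambda>x. (g x)\<^sup>2)"
  and en: "(LINT x|lborel. (u x)\<^sup>2) + (LINT x|lborel. (g x)\<^sup>2) \<le> E" and mw: "modl V w"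
  using adm by (auto simp: admissible_def g_def)

lemma \<kappa>: "\<kappa> > 0" "\<kappa> * h = \<tau>" "\<kappa> * M = 1 / 64" "\<tau> > 0"
  using M h by (auto simp: \<kappa>_def \<tau>_def)

lemma uc: "continuous_on UNIV u" using du by (rule DERIV_cont)

lemma gc: "continuous_on UNIV g" unfolding g_def[abs_def] by (intro continuous_intros uc wc)

text \<open>The factor 8 comes from (2u - g)^2 + (2u + g)^2 = 8 u^2 + 2 g^2.\<close>

lemma w_square_le: "(w x)\<^sup>2 \<le> 8 * ((u x)\<^sup>2 + (g x)\<^sup>2)"
proof -
  have "(w x)\<^sup>2 = 4 * (u x)\<^sup>2 - 4 * (u x * g x) + (g x)\<^sup>2"
    by (simp add: g_def power2_eq_square algebra_simps)
  moreover have "0 \<le> (2 * u x + g x)\<^sup>2" by simp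
  then have "0 \<le> 4 * (u x)\<^sup>2 + 4 * (u x * g x) + (g x)\<^sup>2"
    by (simp add: power2_eq_square algebra_simps)
  ultimately show ?thesis using zero_le_power2[of "g x"] unfolding distrib_left by linarith
qed

lemma iw: "integrable lborel (\<lambda>x. (w x)\<^sup>2)" and iw_le: "(LINT x|lborel. (w x)\<^sup>2) \<le> 8 * E"
proof -
  have i: "integrable lborel (\<lambda>x. 8 * ((u x)\<^sup>2 + (g x)\<^sup>2))" using iu ig by simp
  have m: "(\<lambda>x. (w x)\<^sup>2) \<in> borel_measurable lborel" using continuous_measurable_lborel[OF wc] by measurable
  have le: "\<bar>(w x)\<^sup>2\<bar> \<le> 8 * ((u x)\<^sup>2 + (g x)\<^sup>2)" for x using w_square_le[of x] by simp
  show "integrable lborel (\<lambda>x. (w x)\<^sup>2)" by (rule integral_le_abs(1)[OF i le m])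
  have "(LINT x|lborel. (w x)\<^sup>2) \<le> (LINT x|lborel. 8 * ((u x)\<^sup>2 + (g x)\<^sup>2))"
    using integral_le_abs(2)[OF i le m] by simp
  also have "\<dots> = 8 * ((LINT x|lborel. (u x)\<^sup>2) + (LINT x|lborel. (g x)\<^sup>2))" using iu ig by simp
  also have "\<dots> \<le> 8 * E" by (rule mult_left_mono[OF en]) simp
  finally show "(LINT x|lborel. (w x)\<^sup>2) \<le> 8 * E" .
qed

lemma wV: "\<bar>w x\<bar> \<le> V" by (rule modl_sup_bound[OF wc mw iw])

lemma V0: "0 \<le> V" using wV[of 0] by linarith

lemma wM: "\<bar>w x\<bar> \<le> M" using wV[of x] VM by linarith

lemma uE: "(u x)\<^sup>2 \<le> E" by (rule sup_bound_from_energy[OF du gc iu ig en])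

lemma E0: "0 \<le> E" using uE[of 0] zero_le_power2[of "u 0"] by linarith

lemma uB: "\<bar>u x\<bar> \<le> sqrt E" using uE[of x] real_le_rsqrt[of "\<bar>u x\<bar>"] by simp

lemma gB: "\<bar>g x\<bar> \<le> 2 * sqrt E + V" using uB[of x] wV[of x] unfolding g_def by linarith

lemma dw: "integrable lborel (\<lambda>x. w x - w (x - h))" "(LINT x|lborel. \<bar>w x - w (x - h)\<bar>) \<le> V * h"
  "integrable lborel (\<lambda>x. w (x + h) - w x)" "(LINT x|lborel. \<bar>w (x + h) - w x\<bar>) \<le> V * h"
proof -
  have 1: "integrable lborel (\<lambda>x. w (x + h) - w x)" "(LINT x|lborel. \<bar>w (x + h) - w x\<bar>) \<le> V * h"
    using mw h by (auto simp: modl_def)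
  then show "integrable lborel (\<lambda>x. w (x + h) - w x)" "(LINT x|lborel. \<bar>w (x + h) - w x\<bar>) \<le> V * h" by auto
  show "integrable lborel (\<lambda>x. w x - w (x - h))"
    using integrable_shift_diff[OF 1(1), of h] by simp
  show "(LINT x|lborel. \<bar>w x - w (x - h)\<bar>) \<le> V * h"
    using integral_shift_diff[of "\<lambda>x. \<bar>w (x + h) - w x\<bar>" h] 1(2) by simp
qed

lemma wshift_cont: "continuous_on UNIV (\<lambda>x. w (x - h))"
  by (rule continuous_on_compose2[OF wc]) (auto intro: continuous_intros)

lemma F_cont: "continuous_on UNIV F"
  unfolding F_def flux_def[abs_def] by (intro continuous_intros wc wshift_cont) auto

lemma F_bound: "\<bar>F x\<bar> \<le> 3 * M\<^sup>2"
proof -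
  have a: "(w y)\<^sup>2 \<le> M\<^sup>2" for y using power_mono[OF wM[of y], of 2] by simp
  have "\<bar>M * (w x - w (x - h))\<bar> \<le> M * (2 * M)"
    using wM[of x] wM[of "x - h"] M unfolding abs_mult by (intro mult_mono) auto
  then have "\<bar>M * (w x - w (x - h))\<bar> \<le> 2 * M\<^sup>2" by (simp add: power2_eq_square)
  then show ?thesis using a[of x] a[of "x - h"] zero_le_power2[of "w x"] zero_le_power2[of "w (x - h)"]
    unfolding F_def flux_def add_divide_distrib by linarith
qed

text \<open>In \<open>C1\<close> the summand 1 bounds the viscous difference, through M V h at most
  h M^2, and 8 E bounds the integral of w^2. No bound on M or V enters, and this keeps the growth of
  the modulus linear.\<close>

lemma F_int: "integrable lborel F" and F_L1: "(LINT x|lborel. \<bar>F x\<bar>) \<le> C1"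
proof -
  have i2: "integrable lborel (\<lambda>x. (w (x - h))\<^sup>2)" by (rule integrable_shift_diff[OF iw])
  have e2: "(LINT x|lborel. (w (x - h))\<^sup>2) = (LINT x|lborel. (w x)\<^sup>2)"
    using integral_shift_diff[of "\<lambda>x. (w x)\<^sup>2" h] .
  have i3: "integrable lborel (\<lambda>x. (1/2) * (w x)\<^sup>2 + (1/2) * (w (x - h))\<^sup>2)" using iw i2 by simp
  have l3: "(LINT x|lborel. \<bar>(1/2) * (w x)\<^sup>2 + (1/2) * (w (x - h))\<^sup>2\<bar>) \<le> 8 * E"
    using iw i2 e2 iw_le by simp
  have eq: "F = (\<lambda>x. M * (w x - w (x - h)) + 1 * ((1/2) * (w x)\<^sup>2 + (1/2) * (w (x - h))\<^sup>2))"
    by (auto simp: F_def flux_def)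
  show "integrable lborel F" unfolding eq by (rule lincomb_L1(1)[OF dw(1,2) i3 l3])
  have "M * (V * h) \<le> M * (M * h)" using M VM h by (intro mult_left_mono mult_right_mono) auto
  then have "M * (V * h) \<le> 1" using hM by (simp add: power2_eq_square mult.commute mult.left_commute)
  then show "(LINT x|lborel. \<bar>F x\<bar>) \<le> C1"
    unfolding eq using lincomb_L1(2)[OF dw(1,2) i3 l3, of M 1] M by (simp add: C1_def)
qed

lemma F_bm: "bounded_measurable F" by (rule bounded_measurable_contI[OF F_cont F_bound])

lemma d_eq: "d = (\<lambda>x. \<kappa> * (F (x + h) - F x))"
  by (auto simp: d_def incr_def \<kappa>_def F_def)

lemma d_cont: "continuous_on UNIV d"
  unfolding d_eq by (intro continuous_intros F_cont continuous_on_compose2[OF F_cont]) auto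

lemma d_bound: "\<bar>d x\<bar> \<le> \<kappa> * (6 * M\<^sup>2)"
  using F_bound[of x] F_bound[of "x + h"] \<kappa>(1) unfolding d_eq abs_mult by (intro mult_mono) auto

lemma d_bm: "bounded_measurable d" by (rule bounded_measurable_contI[OF d_cont d_bound])

lemma d_int: "integrable lborel d"
  unfolding d_eq using F_int integrable_shift[OF F_int, of h] by auto

lemma d2_int: "integrable lborel (\<lambda>x. (d x)\<^sup>2)"
  using integrable_mult_bounded(1)[OF d_int d_bm] by (simp add: power2_eq_square)

section \<open>Dissipation: the increments of w and the energy balance\<close>

definition p where "p x = w (x + h) - w x"

lemma p_bound: "\<bar>p x\<bar> \<le> 2 * M" using wM[of x] wM[of "x + h"] unfolding p_def by linarith

lemma p_cont: "continuous_on UNIV p"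
  unfolding p_def[abs_def] by (intro continuous_intros wc continuous_on_compose2[OF wc]) auto

lemma p2_int: "integrable lborel (\<lambda>x. (p x)\<^sup>2)"
  using integrable_mult_abs_bounded(1)[OF dw(3)[folded p_def] p_cont p_bound] by (simp add: power2_eq_square p_def)

definition Q where "Q = (LINT x|lborel. (p x)\<^sup>2)"

lemma Q0: "0 \<le> Q" unfolding Q_def by simp

lemma d2_le: "(LINT x|lborel. (d x)\<^sup>2) \<le> 16 * \<kappa>\<^sup>2 * M\<^sup>2 * Q"
proof -
  have le: "(d x)\<^sup>2 \<le> 8 * \<kappa>\<^sup>2 * M\<^sup>2 * ((p x)\<^sup>2 + (p (x - h))\<^sup>2)" for x
  proof -
    \<comment> \<open>The flux difference is a combination of the two neighbouring increments of w;
      since |w| is at most M, its coefficients lie between -2M and 2M.\<close>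
    have eq: "d x = \<kappa> * ((M + (w (x + h) + w x) / 2) * p x - (M - (w x + w (x - h)) / 2) * p (x - h))"
      by (simp add: d_eq F_def flux_def p_def power2_eq_square field_simps)
    have a: "\<bar>M + (w (x + h) + w x) / 2\<bar> \<le> 2 * M" "\<bar>M - (w x + w (x - h)) / 2\<bar> \<le> 2 * M"
      using wM[of x] wM[of "x + h"] wM[of "x - h"] M unfolding add_divide_distrib by linarith+
    have "\<bar>(M + (w (x + h) + w x) / 2) * p x - (M - (w x + w (x - h)) / 2) * p (x - h)\<bar>
        \<le> \<bar>M + (w (x + h) + w x) / 2\<bar> * \<bar>p x\<bar> + \<bar>M - (w x + w (x - h)) / 2\<bar> * \<bar>p (x - h)\<bar>"
      by (rule order_trans[OF abs_triangle_ineq4]) (simp add: abs_mult)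
    also have "\<dots> \<le> 2 * M * \<bar>p x\<bar> + 2 * M * \<bar>p (x - h)\<bar>" by (intro add_mono mult_right_mono a) auto
    also have "\<dots> = 2 * M * (\<bar>p x\<bar> + \<bar>p (x - h)\<bar>)" by (simp add: distrib_left)
    finally have "\<bar>\<kappa>\<bar> * \<bar>(M + (w (x + h) + w x) / 2) * p x - (M - (w x + w (x - h)) / 2) * p (x - h)\<bar>
        \<le> \<bar>\<kappa>\<bar> * (2 * M * (\<bar>p x\<bar> + \<bar>p (x - h)\<bar>))" by (rule mult_left_mono) simp
    then have "\<bar>d x\<bar> \<le> \<kappa> * (2 * M * (\<bar>p x\<bar> + \<bar>p (x - h)\<bar>))"
      unfolding eq abs_mult[symmetric] using \<kappa>(1) by (simp only: abs_of_pos)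
    then have "\<bar>d x\<bar>\<^sup>2 \<le> (\<kappa> * (2 * M * (\<bar>p x\<bar> + \<bar>p (x - h)\<bar>)))\<^sup>2" by (intro power_mono) auto
    also have "\<dots> = 4 * \<kappa>\<^sup>2 * M\<^sup>2 * (\<bar>p x\<bar> + \<bar>p (x - h)\<bar>)\<^sup>2" by (simp add: power_mult_distrib)
    also have "\<dots> \<le> 4 * \<kappa>\<^sup>2 * M\<^sup>2 * (2 * ((p x)\<^sup>2 + (p (x - h))\<^sup>2))"
    proof (rule mult_left_mono)
      show "(\<bar>p x\<bar> + \<bar>p (x - h)\<bar>)\<^sup>2 \<le> 2 * ((p x)\<^sup>2 + (p (x - h))\<^sup>2)"
        using sum_squares_bound[of "\<bar>p x\<bar>" "\<bar>p (x - h)\<bar>"] by (simp add: power2_sum)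
    qed simp
    finally show ?thesis by (simp add: algebra_simps)
  qed
  have i: "integrable lborel (\<lambda>x. (p (x - h))\<^sup>2)" by (rule integrable_shift_diff[OF p2_int])
  have "(LINT x|lborel. (d x)\<^sup>2) \<le> (LINT x|lborel. 8 * \<kappa>\<^sup>2 * M\<^sup>2 * ((p x)\<^sup>2 + (p (x - h))\<^sup>2))"
    by (rule integral_mono) (use d2_int p2_int i le in auto)
  also have "\<dots> = 8 * \<kappa>\<^sup>2 * M\<^sup>2 * (Q + Q)"
    using p2_int i integral_shift_diff[of "\<lambda>x. (p x)\<^sup>2" h] by (simp add: Q_def)
  finally show ?thesis by simp
qed

text \<open>A discrete summation by parts. After a shift of one term the integrand is -M p^2 - p^3/6
  plus the difference of \<open>T\<close> at x + h and x, which integrates to 0. Viscosity supplies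
  -M p^2; the cubic remainder of the convective flux is at most M p^2 / 3, because |p| is at most
  2M. This leaves the factor 2/3.\<close>

lemma wd_le: "(LINT x|lborel. d x * w x) \<le> - (2 / 3) * \<kappa> * M * Q"
proof -
  define a where "a x = M * (w x * w (x + h) - 2 * (w x)\<^sup>2) + w x * (w (x + h))\<^sup>2 / 2" for x
  define B where "B x = M * (w (x + h) * w x) - w (x + h) * (w x)\<^sup>2 / 2" for x
  define T where "T x = M * (w x)\<^sup>2 + w x * (w x)\<^sup>2 / 6" for x
  have wsc: "continuous_on UNIV (\<lambda>x. w (x + h))"
    by (rule continuous_on_compose2[OF wc]) (auto intro: continuous_intros)
  have wsb: "\<bar>w (x + h)\<bar> \<le> M" for x by (rule wM)
  have i1: "integrable lborel (\<lambda>x. (w (x + h))\<^sup>2)" by (rule integrable_shift[OF iw])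
  have i2: "integrable lborel (\<lambda>x. w x * w (x + h))"
  proof (rule integral_le_abs(1)[where g="\<lambda>x. (w x)\<^sup>2 + (w (x + h))\<^sup>2"])
    show "\<bar>w x * w (x + h)\<bar> \<le> (w x)\<^sup>2 + (w (x + h))\<^sup>2" for x
    proof -
      have "2 * \<bar>w x * w (x + h)\<bar> \<le> (w x)\<^sup>2 + (w (x + h))\<^sup>2"
        using sum_squares_bound[of "\<bar>w x\<bar>" "\<bar>w (x + h)\<bar>"] by (simp add: abs_mult)
      then show ?thesis using abs_ge_zero[of "w x * w (x + h)"] by linarith
    qed
    show "(\<lambda>x. w x * w (x + h)) \<in> borel_measurable lborel"
      by (rule continuous_measurable_lborel) (intro continuous_intros wc wsc)
  qed (use iw i1 in auto)
  have i3: "integrable lborel (\<lambda>x. w x * (w (x + h))\<^sup>2)" by (rule integrable_mult_abs_bounded(2)[OF i1 wc wM])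
  have i4: "integrable lborel (\<lambda>x. w (x + h) * (w x)\<^sup>2)" by (rule integrable_mult_abs_bounded(2)[OF iw wsc wsb])
  have i5: "integrable lborel (\<lambda>x. w x * (w x)\<^sup>2)" by (rule integrable_mult_abs_bounded(2)[OF iw wc wM])
  have ia: "integrable lborel a" unfolding a_def[abs_def] using iw i2 i3 by auto
  have iB: "integrable lborel B" unfolding B_def[abs_def] using i2 i4 by (auto simp: mult.commute)
  have iT: "integrable lborel T" unfolding T_def[abs_def] using iw i5 by auto
  have "(LINT x|lborel. d x * w x) = (LINT x|lborel. \<kappa> * (a x + B (x - h)))"
    by (intro Bochner_Integration.integral_cong refl)
      (simp add: d_eq F_def flux_def a_def B_def power2_eq_square field_simps)
  also have "\<dots> = \<kappa> * (LINT x|lborel. a x + B x)"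
    using ia iB integrable_shift_diff[OF iB, of h] integral_shift_diff[of B h] by simp
  also have "(LINT x|lborel. a x + B x) \<le> (LINT x|lborel. - (2 / 3) * M * (p x)\<^sup>2 + (T (x + h) - T x))"
  proof (rule integral_mono)
    show "a x + B x \<le> - (2 / 3) * M * (p x)\<^sup>2 + (T (x + h) - T x)" for x
    proof -
      have "a x + B x = - M * (p x)\<^sup>2 - p x * (p x)\<^sup>2 / 6 + (T (x + h) - T x)"
        by (simp add: a_def B_def T_def p_def power2_eq_square field_simps)
      moreover have "- (p x * (p x)\<^sup>2) \<le> 2 * M * (p x)\<^sup>2"
        using mult_right_mono[of "- p x" "2 * M" "(p x)\<^sup>2"] p_bound[of x] by auto
      ultimately show ?thesis by simp
    qed
  qed (use ia iB iT integrable_shift[OF iT, of h] p2_int in auto)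
  also have "\<dots> = - (2 / 3) * M * Q"
    using iT integrable_shift[OF iT, of h] p2_int integral_shift[of T h] by (simp add: Q_def)
  finally show ?thesis using \<kappa>(1) by (simp add: mult.assoc)
qed

definition v where "v = Lc d"

definition v' where "v' x = Nc d x - d x"

lemma dv: "(v has_real_derivative v' x) (at x)"
  unfolding v_def v'_def by (rule DERIV_Lc[OF d_cont d_bound])

lemma v_cont: "continuous_on UNIV v" using dv by (rule DERIV_cont)

lemma v'_cont: "continuous_on UNIV v'"
  unfolding v'_def[abs_def] by (intro continuous_intros d_cont resolvent_cont[OF d_cont d_bound])

lemma v_int: "integrable lborel v" and v'_int: "integrable lborel v'"
  unfolding v_def v'_def[abs_def]
  using resolvent_L1[OF d_int order_refl] d_int by auto

lemma v_bound: "\<bar>v x\<bar> \<le> 2 * (\<kappa> * (6 * M\<^sup>2))" and v'_bound: "\<bar>v' x\<bar> \<le> 3 * (\<kappa> * (6 * M\<^sup>2))"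
  using resolvent_bound[OF continuous_measurable_lborel[OF d_cont] d_bound, of x] d_bound[of x]
  unfolding v_def v'_def by linarith+

text \<open>\<open>v\<close> is the increment of u in the step. By the pairing identity the
  first-order change of the energy is twice the integral of d w. The second-order part, the squared
  H^1 norm of v, is the integral of d (2v - v') with 2v - v' = d + (3/2) ep * d + (3/2) em * d,
  hence at most 1 + 3/2 + 3/2 = 4 times the integral of d^2.\<close>

lemma energy: "integrable lborel (\<lambda>x. (u x + v x)\<^sup>2)" "integrable lborel (\<lambda>x. (g x + v' x)\<^sup>2)"
  "(LINT x|lborel. (u x + v x)\<^sup>2) + (LINT x|lborel. (g x + v' x)\<^sup>2) \<le> E"
proof -
  have i: "integrable lborel (\<lambda>x. u x * v x)" "integrable lborel (\<lambda>x. g x * v' x)"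
    "integrable lborel (\<lambda>x. v x * v x)" "integrable lborel (\<lambda>x. v' x * v' x)"
    using integrable_mult_abs_bounded(2)[OF v_int uc uB] integrable_mult_abs_bounded(2)[OF v'_int gc gB]
      integrable_mult_abs_bounded(2)[OF v_int v_cont v_bound] integrable_mult_abs_bounded(2)[OF v'_int v'_cont v'_bound] by auto
  have e: "(u x + v x)\<^sup>2 = (u x)\<^sup>2 + 2 * (u x * v x) + v x * v x"
    "(g x + v' x)\<^sup>2 = (g x)\<^sup>2 + 2 * (g x * v' x) + v' x * v' x" for x
    by (auto simp: power2_eq_square algebra_simps)
  show "integrable lborel (\<lambda>x. (u x + v x)\<^sup>2)" "integrable lborel (\<lambda>x. (g x + v' x)\<^sup>2)"
    unfolding e using i iu ig by auto
  have "(LINT x|lborel. u x * v x + g x * v' x) = (LINT x|lborel. d x * (2 * u x - g x))"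
    unfolding v_def v'_def by (rule energy_pairing[OF du gc uB gB d_int])
  also have "\<dots> = (LINT x|lborel. d x * w x)" by (simp add: g_def)
  finally have 1: "(LINT x|lborel. u x * v x) + (LINT x|lborel. g x * v' x) = (LINT x|lborel. d x * w x)"
    using i by simp
  have i3: "integrable lborel (\<lambda>x. d x * cv ep d x)" "integrable lborel (\<lambda>x. d x * cv em d x)"
    using integrable_mult_bounded(2)[OF cv_integrable[OF integrable_ep d_int] d_bm]
      integrable_mult_bounded(2)[OF cv_integrable[OF integrable_em d_int] d_bm] by auto
  have "(LINT x|lborel. v x * v x + v' x * v' x) = (LINT x|lborel. d x * (2 * v x - v' x))"
    using energy_pairing[OF dv v'_cont v_bound v'_bound d_int] by (simp add: v_def v'_def)
  also have "\<dots> = (LINT x|lborel. (d x)\<^sup>2 + (3/2) * (d x * cv ep d x) + (3/2) * (d x * cv em d x))"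
    by (intro Bochner_Integration.integral_cong refl) (simp add: v_def v'_def Lc_def Nc_def power2_eq_square field_simps)
  also have "\<dots> = (LINT x|lborel. (d x)\<^sup>2) + (3/2) * (LINT x|lborel. d x * cv ep d x) + (3/2) * (LINT x|lborel. d x * cv em d x)"
    using d2_int i3 by simp
  also have "\<dots> \<le> 4 * (LINT x|lborel. (d x)\<^sup>2)"
    using cv_quadratic_form_le[OF integrable_ep ep_nonneg integral_ep d_int d_bm]
      cv_quadratic_form_le[OF integrable_em em_nonneg integral_em d_int d_bm] by linarith
  finally have 2: "(LINT x|lborel. v x * v x) + (LINT x|lborel. v' x * v' x) \<le> 4 * (LINT x|lborel. (d x)\<^sup>2)"
    using i by simp
  \<comment> \<open>The origin of 64: with \<kappa> M = 1/64 the loss 4 * 16 \<kappa>^2 M^2 Q equals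
    \<kappa> M Q, which the gain (4/3) \<kappa> M Q outweighs.\<close>
  have "64 * \<kappa>\<^sup>2 * M\<^sup>2 * Q = \<kappa> * M * Q"
  proof -
    have "64 * \<kappa>\<^sup>2 * M\<^sup>2 * Q = 64 * (\<kappa> * M) * (\<kappa> * M * Q)" by (simp add: power2_eq_square)
    then show ?thesis by (simp add: \<kappa>(3))
  qed
  moreover have "0 \<le> \<kappa> * M * Q" using \<kappa>(1) M Q0 by simp
  moreover have "2 * X + 4 * Z \<le> 0" if "X \<le> - (2 / 3) * \<kappa> * M * Q" "Z \<le> 16 * \<kappa>\<^sup>2 * M\<^sup>2 * Q"
      "64 * \<kappa>\<^sup>2 * M\<^sup>2 * Q = \<kappa> * M * Q" "0 \<le> \<kappa> * M * Q" for X Z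
  proof -
    have "X \<le> - (2 / 3) * (\<kappa> * M * Q)" using that(1) by (simp add: mult.assoc)
    moreover have "4 * (16 * \<kappa>\<^sup>2 * M\<^sup>2 * Q) = \<kappa> * M * Q" using that(3) by (simp add: mult.assoc)
    ultimately show ?thesis using that(2,4) by linarith
  qed
  ultimately have 3: "2 * (LINT x|lborel. d x * w x) + 4 * (LINT x|lborel. (d x)\<^sup>2) \<le> 0"
    using wd_le d2_le by blast
  have arith: "S \<le> E" if "S = a + b + 2 * X + Z" "X = q" "Z \<le> 4 * r" "2 * q + 4 * r \<le> 0" "a + b \<le> E"
    for S a b X Z q r :: real using that by linarith
  have "(LINT x|lborel. (u x + v x)\<^sup>2) + (LINT x|lborel. (g x + v' x)\<^sup>2)
      = (LINT x|lborel. (u x)\<^sup>2) + (LINT x|lborel. (g x)\<^sup>2)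
        + 2 * ((LINT x|lborel. u x * v x) + (LINT x|lborel. g x * v' x))
        + ((LINT x|lborel. v x * v x) + (LINT x|lborel. v' x * v' x))"
    unfolding e using i iu ig by simp
  then show "(LINT x|lborel. (u x + v x)\<^sup>2) + (LINT x|lborel. (g x + v' x)\<^sup>2) \<le> E"
    by (rule arith[OF _ 1 2 3 en])
qed

text \<open>The local part of the step is monotone under the CFL condition, hence an \<open>L\<^sup>1\<close> contraction.\<close>

lemma modl_local: "modl V (\<lambda>x. w x + d x)"
  unfolding modl_def
proof (intro allI impI conjI)
  fix s :: real assume s: "s \<ge> 0"
  define \<delta> where "\<delta> x = w (x + s) - w x" for x
  define \<sigma> where "\<sigma> x = (w (x + s) + w x) / 2" for x
  have \<delta>: "integrable lborel \<delta>" "(LINT x|lborel. \<bar>\<delta> x\<bar>) \<le> V * s"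
    using mw s by (auto simp: modl_def \<delta>_def[abs_def])
  have \<sigma>: "\<bar>\<sigma> x\<bar> \<le> M" for x using wM[of x] wM[of "x + s"] unfolding \<sigma>_def by (simp add: abs_le_iff)
  have \<sigma>c: "continuous_on UNIV \<sigma>"
    unfolding \<sigma>_def[abs_def] by (intro continuous_intros wc continuous_on_compose2[OF wc]) auto
  define P N where "P x = (M + \<sigma> x) * \<bar>\<delta> x\<bar>" and "N x = (M - \<sigma> x) * \<bar>\<delta> x\<bar>" for x
  have \<sigma>\<delta>: "integrable lborel (\<lambda>x. \<sigma> x * \<bar>\<delta> x\<bar>)"
    by (rule integrable_mult_abs_bounded(2)[OF integrable_abs[OF \<delta>(1)] \<sigma>c \<sigma>])
  have PN: "integrable lborel P" "integrable lborel N"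
    unfolding P_def[abs_def] N_def[abs_def] using \<sigma>\<delta> \<delta>(1) by (auto simp: distrib_right left_diff_distrib)
  have PNs: "(LINT x|lborel. P x) + (LINT x|lborel. N x) = 2 * M * (LINT x|lborel. \<bar>\<delta> x\<bar>)"
  proof -
    have "(LINT x|lborel. P x) + (LINT x|lborel. N x) = (LINT x|lborel. P x + N x)" using PN by simp
    also have "\<dots> = (LINT x|lborel. 2 * M * \<bar>\<delta> x\<bar>)"
      by (intro Bochner_Integration.integral_cong refl) (simp add: P_def N_def algebra_simps)
    finally show ?thesis by simp
  qed
  \<comment> \<open>The new difference of translates combines the old ones at x, x + h and x - h.
    All weights are nonnegative, and the weights received from one point add up to 1, which becomes
    visible after integration as the sum of \<open>P\<close> and \<open>N\<close>.\<close>
  have eq: "w (x + s) + d (x + s) - (w x + d x)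
      = (1 - 2 * (\<kappa> * M)) * \<delta> x + \<kappa> * ((M + \<sigma> (x + h)) * \<delta> (x + h)) + \<kappa> * ((M - \<sigma> (x - h)) * \<delta> (x - h))" for x
  proof -
    have a: "x + s + h = x + h + s" "x + s - h = x - h + s" by auto
    show ?thesis
      by (simp add: d_eq F_def flux_def \<delta>_def \<sigma>_def a power2_eq_square field_simps)
  qed
  have le: "\<bar>w (x + s) + d (x + s) - (w x + d x)\<bar>
      \<le> (1 - 2 * (\<kappa> * M)) * \<bar>\<delta> x\<bar> + \<kappa> * P (x + h) + \<kappa> * N (x - h)" for x
  proof -
    have "\<bar>(1 - 2 * (\<kappa> * M)) * \<delta> x\<bar> = (1 - 2 * (\<kappa> * M)) * \<bar>\<delta> x\<bar>" by (simp add: \<kappa>(3) abs_mult)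
    moreover have "\<bar>\<kappa> * ((M + \<sigma> (x + h)) * \<delta> (x + h))\<bar> = \<kappa> * P (x + h)"
      using \<kappa>(1) \<sigma>[of "x + h"] by (simp add: P_def abs_mult abs_le_iff)
    moreover have "\<bar>\<kappa> * ((M - \<sigma> (x - h)) * \<delta> (x - h))\<bar> = \<kappa> * N (x - h)"
      using \<kappa>(1) \<sigma>[of "x - h"] by (simp add: N_def abs_mult abs_le_iff)
    ultimately show ?thesis unfolding eq by linarith
  qed
  have i: "integrable lborel (\<lambda>x. (1 - 2 * (\<kappa> * M)) * \<bar>\<delta> x\<bar> + \<kappa> * P (x + h) + \<kappa> * N (x - h))"
    using \<delta>(1) integrable_shift[OF PN(1), of h] integrable_shift_diff[OF PN(2), of h] by auto
  have m: "(\<lambda>x. w (x + s) + d (x + s) - (w x + d x)) \<in> borel_measurable lborel"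
    using continuous_measurable_lborel[OF wc] continuous_measurable_lborel[OF d_cont] by measurable
  show "integrable lborel (\<lambda>x. w (x + s) + d (x + s) - (w x + d x))" by (rule integral_le_abs(1)[OF i le m])
  have "(LINT x|lborel. \<bar>w (x + s) + d (x + s) - (w x + d x)\<bar>)
      \<le> (LINT x|lborel. (1 - 2 * (\<kappa> * M)) * \<bar>\<delta> x\<bar> + \<kappa> * P (x + h) + \<kappa> * N (x - h))"
    by (rule integral_le_abs(2)[OF i le m])
  also have "\<dots> = (1 - 2 * (\<kappa> * M)) * (LINT x|lborel. \<bar>\<delta> x\<bar>) + \<kappa> * ((LINT x|lborel. P x) + (LINT x|lborel. N x))"
    using \<delta>(1) integrable_shift[OF PN(1), of h] integrable_shift_diff[OF PN(2), of h]
      integral_shift[of P h] integral_shift_diff[of N h] by (simp add: distrib_left)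
  also have "\<dots> = (LINT x|lborel. \<bar>\<delta> x\<bar>)" unfolding PNs by (simp add: algebra_simps)
  finally show "(LINT x|lborel. \<bar>w (x + s) + d (x + s) - (w x + d x)\<bar>) \<le> V * s" using \<delta>(2) by linarith
qed

text \<open>The spatial difference of \<open>Lc F\<close> over h costs a factor h, which turns
  \<kappa> into the time step \<tau>; the derivative \<open>Nc F - F\<close> has L^1 norm at most 2
  C1 + C1.\<close>

lemma v_L1: "(LINT x|lborel. \<bar>v x\<bar>) \<le> 3 * C1 * \<tau>"
proof -
  note r = resolvent_L1[OF F_int F_L1]
  have i: "integrable lborel (\<lambda>x. 1 * Nc F x + (-1) * F x)" "(LINT x|lborel. \<bar>1 * Nc F x + (-1) * F x\<bar>) \<le> 3 * C1"
    using lincomb_L1[OF r(3,4) F_int F_L1, of 1 "-1"] by auto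
  have c: "continuous_on UNIV (\<lambda>x. Nc F x - F x)" by (intro continuous_intros F_cont resolvent_cont[OF F_cont F_bound])
  have "modl (LINT x|lborel. \<bar>Nc F x - F x\<bar>) (Lc F)"
    by (rule modl_DERIV[OF DERIV_Lc[OF F_cont F_bound] c]) (use i in simp)
  then have "modl (3 * C1) (Lc F)" by (rule modl_mono) (use i in simp)
  then have "(LINT x|lborel. \<bar>Lc F (x + h) - Lc F x\<bar>) \<le> 3 * C1 * h" using h by (simp add: modl_def)
  then have "\<kappa> * (LINT x|lborel. \<bar>Lc F (x + h) - Lc F x\<bar>) \<le> \<kappa> * (3 * C1 * h)"
    using \<kappa>(1) by (intro mult_left_mono) auto
  moreover have "v = (\<lambda>x. \<kappa> * (Lc F (x + h) - Lc F x))"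
    unfolding v_def by (rule ext, subst d_eq, rule resolvent_increment(1)[OF F_bm])
  ultimately show ?thesis using \<kappa>(1) by (simp add: abs_mult \<kappa>(2)[symmetric] mult.commute mult.left_commute)
qed

text \<open>The derivative of \<open>Gc d\<close> is \<open>Dc d\<close>, which is \<kappa> times a
  difference of \<open>Dc F\<close> over h. Since \<open>Dc F\<close> has the integrable derivative
  \<open>Gc F - F\<close>, only the L^1 norm of the flux enters and never its variation.\<close>

lemma modl_nonlocal: "modl (2 * C1 * \<tau>) (Gc d)"
proof -
  note r = resolvent_L1[OF F_int F_L1]
  have i: "integrable lborel (\<lambda>x. 1 * Gc F x + (-1) * F x)" "(LINT x|lborel. \<bar>1 * Gc F x + (-1) * F x\<bar>) \<le> 2 * C1"
    using lincomb_L1[OF r(5,6) F_int F_L1, of 1 "-1"] by auto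
  have c: "continuous_on UNIV (\<lambda>x. Gc F x - F x)" by (intro continuous_intros F_cont resolvent_cont[OF F_cont F_bound])
  have "modl (LINT x|lborel. \<bar>Gc F x - F x\<bar>) (Dc F)"
    by (rule modl_DERIV[OF DERIV_Dc[OF F_cont F_bound] c]) (use i in simp)
  then have "modl (2 * C1) (Dc F)" by (rule modl_mono) (use i in simp)
  then have "(LINT x|lborel. \<bar>Dc F (x + h) - Dc F x\<bar>) \<le> 2 * C1 * h" using h by (simp add: modl_def)
  then have "\<kappa> * (LINT x|lborel. \<bar>Dc F (x + h) - Dc F x\<bar>) \<le> \<kappa> * (2 * C1 * h)"
    using \<kappa>(1) by (intro mult_left_mono) auto
  moreover have eq: "Dc d = (\<lambda>x. \<kappa> * (Dc F (x + h) - Dc F x))"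
    by (rule ext, subst d_eq, rule resolvent_increment(2)[OF F_bm])
  ultimately have le: "(LINT x|lborel. \<bar>Dc d x\<bar>) \<le> 2 * C1 * \<tau>"
    using \<kappa>(1) by (simp add: abs_mult \<kappa>(2)[symmetric] mult.commute mult.left_commute)
  have "modl (LINT x|lborel. \<bar>Dc d x\<bar>) (Gc d)"
    by (rule modl_DERIV[OF DERIV_Gc[OF d_cont d_bound] resolvent_cont(4)[OF d_cont d_bound] resolvent_L1(7)[OF d_int order_refl]])
  then show ?thesis by (rule modl_mono[OF _ le])
qed

text \<open>The update of w is forced by the update of u: 2v - v' = d + 3 Gc d. The local part d
  leaves the modulus unchanged, and the nonlocal part adds 3 times 2 C1 \<tau>.\<close>

lemma admissible_next: "admissible E (V + 6 * C1 * \<tau>) (\<lambda>x. u x + Lc d x) (\<lambda>x. w x + d x + 3 * Gc d x)"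
proof -
  have e: "2 * (u x + Lc d x) - (w x + d x + 3 * Gc d x) = g x + v' x" for x
    by (simp add: g_def v'_def Lc_def Nc_def Gc_def field_simps)
  have "modl (V + \<bar>3\<bar> * (2 * C1 * \<tau>)) (\<lambda>x. (w x + d x) + 3 * Gc d x)"
    by (rule modl_add[OF modl_local modl_cmult[OF modl_nonlocal]])
  moreover have "continuous_on UNIV (\<lambda>x. w x + d x + 3 * Gc d x)"
    by (intro continuous_intros wc d_cont resolvent_cont[OF d_cont d_bound])
  moreover have "((\<lambda>x. u x + Lc d x) has_real_derivative g x + v' x) (at x)" for x
    using DERIV_add[OF du dv] by (simp add: v_def)
  ultimately show ?thesis
    unfolding admissible_def e using energy by (simp add: v_def mult.assoc)
qed

section \<open>Consistency of one step with the rewritten equation\<close>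

definition Y where "Y x = 4 * u x * g x + Dc (\<lambda>x. 2 * (g x)\<^sup>2 + 6 * (u x)\<^sup>2) x + Gc (\<lambda>x. (g x)\<^sup>2) x - (g x)\<^sup>2"

text \<open>\<open>Y\<close> is 4 u u_x plus the two source terms. The identity says that it equals
  the derivative of \<open>Lc\<close> applied to w^2, so both forms of the equation agree. It rests
  on w^2 = 4u^2 - 2 (2 u g) + g^2, where 2 u g is the derivative of u^2 and can be integrated under
  the kernels.\<close>

lemma Y_eq: "Y x = Nc (\<lambda>x. (w x)\<^sup>2) x - (w x)\<^sup>2"
proof -
  have bu: "bounded_measurable (\<lambda>x. (u x)\<^sup>2)"
    by (rule bounded_measurable_contI[where B=E]) (use uE in \<open>auto intro!: continuous_intros uc\<close>)
  have gb2: "\<bar>(g x)\<^sup>2\<bar> \<le> (2 * sqrt E + V)\<^sup>2" for x using power_mono[OF gB[of x], of 2] by simp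
  have bg: "bounded_measurable (\<lambda>x. (g x)\<^sup>2)"
    by (rule bounded_measurable_contI[OF _ gb2]) (intro continuous_intros gc)
  have ugb: "\<bar>2 * u x * g x\<bar> \<le> 2 * (sqrt E * (2 * sqrt E + V))" for x
    using mult_mono[OF uB[of x] gB[of x]] E0 by (simp add: abs_mult)
  have ugc: "continuous_on UNIV (\<lambda>x. 2 * u x * g x)" by (intro continuous_intros uc gc)
  have bug: "bounded_measurable (\<lambda>x. 2 * u x * g x)" by (rule bounded_measurable_contI[OF ugc ugb])
  have du2: "((\<lambda>x. (u x)\<^sup>2) has_real_derivative 2 * u x * g x) (at x)" for x
    by (auto intro!: derivative_eq_intros du)
  have E2: "\<bar>(u x)\<^sup>2\<bar> \<le> E" for x using uE[of x] by simp
  have 1: "cv ep (\<lambda>x. 2 * u x * g x) x = (u x)\<^sup>2 - cv ep (\<lambda>x. (u x)\<^sup>2) x"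
    by (rule cv_ep_deriv[OF du2 ugc E2 ugb])
  have 2: "cv em (\<lambda>x. 2 * u x * g x) x = cv em (\<lambda>x. (u x)\<^sup>2) x - (u x)\<^sup>2"
    by (rule cv_em_deriv[OF du2 ugc E2 ugb])
  have w2: "(\<lambda>x. (w x)\<^sup>2) = (\<lambda>x. (4 * (u x)\<^sup>2 + (g x)\<^sup>2) + (-2) * (2 * u x * g x))"
    by (auto simp: g_def power2_eq_square algebra_simps)
  have lin: "cv k (\<lambda>x. (w x)\<^sup>2) x = 4 * cv k (\<lambda>x. (u x)\<^sup>2) x + cv k (\<lambda>x. (g x)\<^sup>2) x - 2 * cv k (\<lambda>x. 2 * u x * g x) x"
    if k: "integrable lborel k" for k
  proof -
    have b1: "bounded_measurable (\<lambda>x. 4 * (u x)\<^sup>2)"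
      by (rule bounded_measurable_contI[where B="4 * E"]) (use uE in \<open>auto intro!: continuous_intros uc\<close>)
    have b2: "bounded_measurable (\<lambda>x. (-2) * (2 * u x * g x))"
      by (rule bounded_measurable_contI[where B="2 * (2 * (sqrt E * (2 * sqrt E + V)))"])
        (use ugb in \<open>auto intro!: continuous_intros uc gc simp: abs_mult\<close>)
    show ?thesis
      unfolding w2 cv_add[OF k bounded_measurable_add[OF b1 bg] b2] cv_add[OF k b1 bg] cv_cmult by simp
  qed
  have lin2: "cv k (\<lambda>x. 2 * (g x)\<^sup>2 + 6 * (u x)\<^sup>2) x = 2 * cv k (\<lambda>x. (g x)\<^sup>2) x + 6 * cv k (\<lambda>x. (u x)\<^sup>2) x"
    if k: "integrable lborel k" for k
  proof -
    have b1: "bounded_measurable (\<lambda>x. 6 * (u x)\<^sup>2)"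
      by (rule bounded_measurable_contI[where B="6 * E"]) (use uE in \<open>auto intro!: continuous_intros uc\<close>)
    have b2: "bounded_measurable (\<lambda>x. 2 * (g x)\<^sup>2)"
      by (rule bounded_measurable_contI[where B="2 * (2 * sqrt E + V)\<^sup>2"])
        (use gb2 in \<open>auto intro!: continuous_intros gc\<close>)
    show ?thesis unfolding cv_add[OF k b2 b1] cv_cmult ..
  qed
  have "(w x)\<^sup>2 = 4 * (u x)\<^sup>2 - 4 * u x * g x + (g x)\<^sup>2" by (auto simp: g_def power2_eq_square algebra_simps)
  then show ?thesis
    unfolding Y_def Nc_def Dc_def Gc_def lin[OF integrable_ep] lin[OF integrable_em]
      lin2[OF integrable_ep] lin2[OF integrable_em] 1 2
    by (simp add: field_simps)
qed

text \<open>The flux is w^2 plus a remainder \<open>R\<close> of L^1 norm at most 2 h M^2. For w^2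
  the difference of \<open>Lc\<close> is the average of \<open>Y\<close> over a window of length h;
  for \<open>R\<close> it is moved onto the Lipschitz function \<open>\<psi>\<close>. Each error
  thus gains a factor h beyond the step length, without a derivative of w.\<close>

lemma consistency:
  assumes \<psi>: "continuous_on UNIV \<psi>" "\<And>x. \<bar>\<psi> x\<bar> \<le> B" "\<And>x y. \<bar>\<psi> x - \<psi> y\<bar> \<le> \<Lambda> * \<bar>x - y\<bar>"
  shows "\<bar>(LINT x|lborel. \<psi> x * v x) - \<tau> * (LINT x|lborel. \<psi> x * Y x)\<bar> \<le> \<tau> * (\<Lambda> * (24 * E * h + 4 * h * M\<^sup>2))"
    "integrable lborel Y"
proof -
  have \<Lambda>: "0 \<le> \<Lambda>" using \<psi>(3)[of 0 1] by simp
  define W where "W x = (w x)\<^sup>2" for x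
  define R where "R x = M * (w x - w (x - h)) + ((w (x - h))\<^sup>2 - (w x)\<^sup>2) / 2" for x
  have Wc: "continuous_on UNIV W" unfolding W_def[abs_def] by (intro continuous_intros wc)
  have Wb: "\<bar>W x\<bar> \<le> M\<^sup>2" for x using power_mono[OF wM[of x], of 2] by (simp add: W_def)
  have Wi: "integrable lborel W" "(LINT x|lborel. \<bar>W x\<bar>) \<le> 8 * E" using iw iw_le by (auto simp: W_def[abs_def])
  have F_eq: "F = (\<lambda>x. W x + R x)"
    by (auto simp: F_def flux_def W_def R_def field_simps)
  have Wbm: "bounded_measurable W" by (rule bounded_measurable_contI[OF Wc Wb])
  have Rc: "continuous_on UNIV R" unfolding R_def[abs_def] by (intro continuous_intros wc wshift_cont) auto
  have Rb: "\<bar>R x\<bar> \<le> 3 * M\<^sup>2 + M\<^sup>2" for x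
    using F_bound[of x] Wb[of x] unfolding F_eq by linarith
  have Rbm: "bounded_measurable R" by (rule bounded_measurable_contI[OF Rc Rb])
  have Ri: "integrable lborel R" "(LINT x|lborel. \<bar>R x\<bar>) \<le> 2 * (h * M\<^sup>2)"
  proof -
    have le: "\<bar>R x\<bar> \<le> 2 * M * \<bar>w x - w (x - h)\<bar>" for x
    proof -
      have "R x = (w x - w (x - h)) * (M - (w (x - h) + w x) / 2)"
        by (simp add: R_def power2_eq_square field_simps)
      moreover have "\<bar>M - (w (x - h) + w x) / 2\<bar> \<le> 2 * M" using wM[of x] wM[of "x - h"] M unfolding add_divide_distrib by linarith
      then have "\<bar>M - (w (x - h) + w x) / 2\<bar> * \<bar>w x - w (x - h)\<bar> \<le> 2 * M * \<bar>w x - w (x - h)\<bar>"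
        by (rule mult_right_mono) simp
      ultimately show ?thesis by (simp add: abs_mult mult.commute)
    qed
    have i: "integrable lborel (\<lambda>x. 2 * M * \<bar>w x - w (x - h)\<bar>)" using dw(1) by simp
    show "integrable lborel R" by (rule integral_le_abs(1)[OF i le continuous_measurable_lborel[OF Rc]])
    have "(LINT x|lborel. \<bar>R x\<bar>) \<le> 2 * M * (LINT x|lborel. \<bar>w x - w (x - h)\<bar>)"
      using integral_le_abs(2)[OF i le continuous_measurable_lborel[OF Rc]] by simp
    also have "\<dots> \<le> 2 * M * (M * h)"
      using dw(2) M VM h by (intro mult_left_mono order_trans[OF dw(2)] mult_right_mono) auto
    finally show "(LINT x|lborel. \<bar>R x\<bar>) \<le> 2 * (h * M\<^sup>2)" by (simp add: power2_eq_square mult.commute mult.left_commute)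
  qed
  have YW: "Y = (\<lambda>x. 1 * Nc W x + (-1) * W x)" using Y_eq by (auto simp: W_def[abs_def])
  note rW = resolvent_L1[OF Wi]
  show Yi: "integrable lborel Y" unfolding YW by (rule lincomb_L1(1)[OF rW(3,4) Wi])
  have YL1: "(LINT x|lborel. \<bar>Y x\<bar>) \<le> 24 * E" using lincomb_L1(2)[OF rW(3,4) Wi, of 1 "-1"] unfolding YW by simp
  have Yc: "continuous_on UNIV Y" unfolding YW by (intro continuous_intros Wc resolvent_cont[OF Wc Wb])
  have \<psi>bm: "bounded_measurable \<psi>" by (rule bounded_measurable_contI[OF \<psi>(1,2)])
  define a where "a x = Lc W (x + h) - Lc W x" for x
  define z where "z = Lc R"
  have zi: "integrable lborel z" "(LINT x|lborel. \<bar>z x\<bar>) \<le> 2 * (2 * (h * M\<^sup>2))"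
    using resolvent_L1[OF Ri] by (auto simp: z_def)
  have a_eq: "a x = cv (win h) Y x" for x
  proof -
    have "Lc W (x + h) - Lc W x = cv (win h) Y x"
      by (rule DERIV_increment_eq_cv[OF _ Yc]) (use DERIV_Lc[OF Wc Wb] h in \<open>auto simp: YW\<close>)
    then show ?thesis by (simp add: a_def)
  qed
  have ai: "integrable lborel a" unfolding a_eq[abs_def] by (rule cv_integrable[OF win_integrable Yi])
  have v_eq: "v x = \<kappa> * (a x + (z (x + h) - z x))" for x
  proof -
    have "v x = \<kappa> * (Lc F (x + h) - Lc F x)"
      unfolding v_def by (subst d_eq, rule resolvent_increment(1)[OF F_bm])
    then show ?thesis unfolding F_eq resolvent_add(1)[OF Wbm Rbm] by (simp add: a_def z_def)
  qed
  have p1: "\<bar>(LINT x|lborel. \<psi> x * a x) - h * (LINT x|lborel. \<psi> x * Y x)\<bar> \<le> \<Lambda> * h\<^sup>2 * (24 * E)"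
  proof -
    \<comment> \<open>By duality the window average acts on \<open>\<psi>\<close>; \<open>c\<close>
      is what averaging changes there, at most \<Lambda> h over a window of length h.\<close>
    define c where "c x = cv (\<lambda>z. win h (- z)) \<psi> x - h * \<psi> x" for x
    have wi: "integrable lborel (\<lambda>z. win h (- z))" using integrable_reflect_shift[OF win_integrable, of h 0] by simp
    have wint: "(LINT z|lborel. win h (- z)) = h"
      using integral_reflect_shift[of "win h" 0] win_integral(1) h by simp
    have cb: "\<bar>c x\<bar> \<le> \<Lambda> * h\<^sup>2" for x
    proof -
      have "c x = (LINT z|lborel. win h (- z) * (\<psi> (x - z) - \<psi> x))"
        using cv_integrand[OF wi \<psi>bm, of x] wi wint by (simp add: c_def cv_def right_diff_distrib)
      then have "\<bar>c x\<bar> \<le> (LINT z|lborel. \<bar>win h (- z) * (\<psi> (x - z) - \<psi> x)\<bar>)" by (simp only: integral_abs_bound)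
      also have "\<dots> \<le> (LINT z|lborel. \<Lambda> * h * win h (- z))"
      proof (rule integral_mono)
        show "integrable lborel (\<lambda>z. \<bar>win h (- z) * (\<psi> (x - z) - \<psi> x)\<bar>)"
          using cv_integrand[OF wi \<psi>bm, of x] wi by (simp add: right_diff_distrib)
        show "\<bar>win h (- z) * (\<psi> (x - z) - \<psi> x)\<bar> \<le> \<Lambda> * h * win h (- z)" for z
          using \<psi>(3)[of "x - z" x] mult_left_mono[of "\<bar>z\<bar>" h \<Lambda>] \<Lambda> by (auto simp: win_def split: split_indicator)
      qed (use wi in simp)
      also have "\<dots> = \<Lambda> * h\<^sup>2" using wint by (simp add: power2_eq_square)
      finally show ?thesis .
    qed
    have "(LINT x|lborel. \<psi> x * a x) = (LINT x|lborel. cv (win h) Y x * \<psi> x)" by (simp add: a_eq mult.commute)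
    also have "\<dots> = (LINT x|lborel. Y x * cv (\<lambda>z. win h (- z)) \<psi> x)" by (rule cv_dual[OF win_integrable Yi \<psi>bm])
    finally have 1: "(LINT x|lborel. \<psi> x * a x) = (LINT x|lborel. Y x * cv (\<lambda>z. win h (- z)) \<psi> x)" .
    have cc: "continuous_on UNIV (cv (\<lambda>z. win h (- z)) \<psi>)" by (rule cv_continuous[OF wi \<psi>(1,2)])
    have ccb: "\<bar>cv (\<lambda>z. win h (- z)) \<psi> x\<bar> \<le> \<Lambda> * h\<^sup>2 + h * B" for x
    proof -
      have "\<bar>h * \<psi> x\<bar> \<le> h * B" using mult_left_mono[OF \<psi>(2)[of x], of h] h by (simp add: abs_mult)
      then show ?thesis using cb[of x] unfolding c_def by linarith
    qed
    have i1: "integrable lborel (\<lambda>x. Y x * cv (\<lambda>z. win h (- z)) \<psi> x)"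
      by (rule integrable_mult_abs_bounded(1)[OF Yi cc ccb])
    have i2: "integrable lborel (\<lambda>x. \<psi> x * Y x)" by (rule integrable_mult_abs_bounded(2)[OF Yi \<psi>(1,2)])
    have "(LINT x|lborel. \<psi> x * a x) - h * (LINT x|lborel. \<psi> x * Y x)
        = (LINT x|lborel. Y x * cv (\<lambda>z. win h (- z)) \<psi> x - h * (\<psi> x * Y x))" unfolding 1 using i1 i2 by simp
    moreover have "\<bar>LINT x|lborel. Y x * cv (\<lambda>z. win h (- z)) \<psi> x - h * (\<psi> x * Y x)\<bar> \<le> (LINT x|lborel. \<Lambda> * h\<^sup>2 * \<bar>Y x\<bar>)"
    proof (rule order_trans[OF integral_abs_bound], rule integral_mono)
      show "\<bar>Y x * cv (\<lambda>z. win h (- z)) \<psi> x - h * (\<psi> x * Y x)\<bar> \<le> \<Lambda> * h\<^sup>2 * \<bar>Y x\<bar>" for x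
      proof -
        have "Y x * cv (\<lambda>z. win h (- z)) \<psi> x - h * (\<psi> x * Y x) = c x * Y x" by (simp add: c_def algebra_simps)
        then show ?thesis using mult_right_mono[OF cb[of x], of "\<bar>Y x\<bar>"] by (simp add: abs_mult)
      qed
    qed (use i1 i2 Yi in auto)
    moreover have "(LINT x|lborel. \<Lambda> * h\<^sup>2 * \<bar>Y x\<bar>) \<le> \<Lambda> * h\<^sup>2 * (24 * E)" using YL1 \<Lambda> by (simp add: mult_left_mono)
    ultimately show ?thesis by linarith
  qed
  have p2: "\<bar>LINT x|lborel. \<psi> x * (z (x + h) - z x)\<bar> \<le> \<Lambda> * h * (4 * (h * M\<^sup>2))"
  proof -
    have i1: "integrable lborel (\<lambda>x. \<psi> x * z x)" by (rule integrable_mult_abs_bounded(2)[OF zi(1) \<psi>(1,2)])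
    have \<psi>s: "continuous_on UNIV (\<lambda>x. \<psi> (x - h))" by (rule continuous_on_compose2[OF \<psi>(1)]) (auto intro: continuous_intros)
    have i2: "integrable lborel (\<lambda>x. \<psi> (x - h) * z x)" by (rule integrable_mult_abs_bounded(2)[OF zi(1) \<psi>s \<psi>(2)])
    have i3: "integrable lborel (\<lambda>x. \<psi> x * z (x + h))" using integrable_shift[OF i2, of h] by simp
    have "(LINT x|lborel. \<psi> x * (z (x + h) - z x)) = (LINT x|lborel. \<psi> x * z (x + h)) - (LINT x|lborel. \<psi> x * z x)"
      using i1 i3 by (simp add: right_diff_distrib)
    also have "(LINT x|lborel. \<psi> x * z (x + h)) = (LINT x|lborel. \<psi> (x - h) * z x)"
      using integral_shift[of "\<lambda>x. \<psi> (x - h) * z x" h] by simp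
    also have "(LINT x|lborel. \<psi> (x - h) * z x) - (LINT x|lborel. \<psi> x * z x) = (LINT x|lborel. (\<psi> (x - h) - \<psi> x) * z x)"
      using i1 i2 by (simp add: left_diff_distrib)
    finally have "(LINT x|lborel. \<psi> x * (z (x + h) - z x)) = (LINT x|lborel. (\<psi> (x - h) - \<psi> x) * z x)" .
    moreover have "\<bar>LINT x|lborel. (\<psi> (x - h) - \<psi> x) * z x\<bar> \<le> (LINT x|lborel. \<Lambda> * h * \<bar>z x\<bar>)"
    proof (rule order_trans[OF integral_abs_bound], rule integral_mono)
      show "\<bar>(\<psi> (x - h) - \<psi> x) * z x\<bar> \<le> \<Lambda> * h * \<bar>z x\<bar>" for x
        using \<psi>(3)[of "x - h" x] h unfolding abs_mult by (intro mult_right_mono) auto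
    qed (use i1 i2 zi in \<open>auto simp: left_diff_distrib\<close>)
    moreover have "(LINT x|lborel. \<Lambda> * h * \<bar>z x\<bar>) \<le> \<Lambda> * h * (4 * (h * M\<^sup>2))" using zi(2) \<Lambda> h by (simp add: mult_left_mono)
    ultimately show ?thesis by linarith
  qed
  have i4: "integrable lborel (\<lambda>x. \<psi> x * a x)" by (rule integrable_mult_abs_bounded(2)[OF ai \<psi>(1,2)])
  have i5: "integrable lborel (\<lambda>x. \<psi> x * (z (x + h) - z x))"
    by (rule integrable_mult_abs_bounded(2)[OF _ \<psi>(1,2)]) (use zi integrable_shift[OF zi(1), of h] in auto)
  have "\<psi> x * v x = \<kappa> * (\<psi> x * a x + \<psi> x * (z (x + h) - z x))" for x by (simp add: v_eq algebra_simps)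
  then have "(LINT x|lborel. \<psi> x * v x) = \<kappa> * ((LINT x|lborel. \<psi> x * a x) + (LINT x|lborel. \<psi> x * (z (x + h) - z x)))"
    using i4 i5 by simp
  then have "(LINT x|lborel. \<psi> x * v x) - \<tau> * (LINT x|lborel. \<psi> x * Y x)
    = \<kappa> * (((LINT x|lborel. \<psi> x * a x) - h * (LINT x|lborel. \<psi> x * Y x)) + (LINT x|lborel. \<psi> x * (z (x + h) - z x)))"
    by (simp add: \<kappa>(2)[symmetric] algebra_simps)
  then have "\<bar>(LINT x|lborel. \<psi> x * v x) - \<tau> * (LINT x|lborel. \<psi> x * Y x)\<bar>
    = \<kappa> * \<bar>((LINT x|lborel. \<psi> x * a x) - h * (LINT x|lborel. \<psi> x * Y x)) + (LINT x|lborel. \<psi> x * (z (x + h) - z x))\<bar>"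
    using \<kappa>(1) by (simp only: abs_mult abs_of_pos)
  also have "\<dots> \<le> \<kappa> * (\<Lambda> * h\<^sup>2 * (24 * E) + \<Lambda> * h * (4 * (h * M\<^sup>2)))"
    using \<kappa>(1) p1 p2 by (intro mult_left_mono order_trans[OF abs_triangle_ineq] add_mono) auto
  also have "\<dots> = \<tau> * (\<Lambda> * (24 * E * h + 4 * h * M\<^sup>2))"
    by (simp add: \<kappa>(2)[symmetric] power2_eq_square algebra_simps)
  finally show "\<bar>(LINT x|lborel. \<psi> x * v x) - \<tau> * (LINT x|lborel. \<psi> x * Y x)\<bar> \<le> \<tau> * (\<Lambda> * (24 * E * h + 4 * h * M\<^sup>2))" .
qed

end

section \<open>The entropy balance of one step\<close>

lemma integrable_continuous_compact_support:
  fixes f :: "real \<Rightarrow> real"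
  assumes "continuous_on UNIV f" "\<And>x. \<bar>x\<bar> > R \<Longrightarrow> f x = 0"
  shows "integrable lborel f"
proof -
  have "loc_integrable (\<lambda>x. 1)"
    by (auto simp: loc_integrable_def set_integrable_def integrable_lebesgue_indicator_Icc)
  from loc_integrable_mult[OF this assms] show ?thesis
    using continuous_measurable_lborel[OF assms(1)] by (simp add: integrable_completion)
qed

lemma integral_DERIV_compact_support:
  fixes F :: "real \<Rightarrow> real"
  assumes F: "\<And>x. (F has_real_derivative F' x) (at x)" and c: "continuous_on UNIV F'"
    and 0: "\<And>x. \<bar>x\<bar> > R \<Longrightarrow> F x = 0" "\<And>x. \<bar>x\<bar> > R \<Longrightarrow> F' x = 0"
  shows "(LINT x|lborel. F' x) = 0"
proof -
  define S where "S = \<bar>R\<bar> + 1"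
  have "(LINT x|lborel. F' x) = (LINT x|lborel. F' x * indicator {-S..S} x)"
    by (intro Bochner_Integration.integral_cong refl) (use 0(2) in \<open>auto simp: S_def split: split_indicator\<close>)
  also have "\<dots> = F S - F (- S)"
    by (rule integral_FTC_Icc_real) (use F isCont_continuous[OF c] in \<open>auto simp: S_def\<close>)
  also have "\<dots> = 0" using 0(1)[of S] 0(1)[of "- S"] by (simp add: S_def)
  finally show ?thesis .
qed

text \<open>The source d/dx P1 + d^2/dx^2 P2 for a function u with derivative g, in which the second
  derivative of P2 has been replaced by P2 - g^2.\<close>

definition Zc :: "(real \<Rightarrow> real) \<Rightarrow> (real \<Rightarrow> real) \<Rightarrow> real \<Rightarrow> real" where
  "Zc u g x = Dc (\<lambda>x. 2 * (g x)\<^sup>2 + 6 * (u x)\<^sup>2) x + Gc (\<lambda>x. (g x)\<^sup>2) x - (g x)\<^sup>2"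

text \<open>The mean value inequality is used twice, once for the first derivative and once for the
  function minus its tangent, hence the constant K instead of K/2.\<close>

lemma second_order_Taylor_bound:
  fixes \<eta> \<eta>1 \<eta>2 :: "real \<Rightarrow> real"
  assumes 1: "\<And>y. (\<eta> has_real_derivative \<eta>1 y) (at y)" and 2: "\<And>y. (\<eta>1 has_real_derivative \<eta>2 y) (at y)"
    and K: "\<And>y. \<bar>y\<bar> \<le> S \<Longrightarrow> \<bar>\<eta>2 y\<bar> \<le> K" and a: "\<bar>a\<bar> \<le> S" and b: "\<bar>b\<bar> \<le> S"
  shows "\<bar>\<eta> b - \<eta> a - \<eta>1 a * (b - a)\<bar> \<le> K * (b - a)\<^sup>2"
proof -
  let ?I = "{min a b..max a b}"
  have I: "\<bar>y\<bar> \<le> S" if "y \<in> ?I" for y using that a b by (auto simp: abs_le_iff)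
  have ab: "a \<in> ?I" "b \<in> ?I" by auto
  have "\<bar>\<eta>1 y - \<eta>1 a\<bar> \<le> K * \<bar>b - a\<bar>" if y: "y \<in> ?I" for y
  proof -
    have "norm (\<eta>1 y - \<eta>1 a) \<le> K * norm (y - a)"
      by (rule field_differentiable_bound[of ?I \<eta>1 \<eta>2]) (use 2 K I y ab in \<open>auto intro: has_field_derivative_at_within\<close>)
    moreover have "\<bar>y - a\<bar> \<le> \<bar>b - a\<bar>" using y by (auto simp: abs_if min_def max_def split: if_splits)
    moreover have "0 \<le> K" using K[OF a] by linarith
    ultimately show ?thesis using mult_left_mono[of "\<bar>y - a\<bar>" "\<bar>b - a\<bar>" K] by simp
  qed
  then have "norm ((\<eta> b - \<eta>1 a * b) - (\<eta> a - \<eta>1 a * a)) \<le> (K * \<bar>b - a\<bar>) * norm (b - a)"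
  proof (intro field_differentiable_bound[of ?I "\<lambda>y. \<eta> y - \<eta>1 a * y" "\<lambda>y. \<eta>1 y - \<eta>1 a"])
    show "((\<lambda>y. \<eta> y - \<eta>1 a * y) has_field_derivative \<eta>1 y - \<eta>1 a) (at y within ?I)" for y
      by (rule has_field_derivative_at_within) (auto intro!: derivative_eq_intros 1)
  qed (use ab in auto)
  moreover have "K * \<bar>b - a\<bar> * \<bar>b - a\<bar> = K * (b - a)\<^sup>2" by (simp add: power2_eq_square mult.assoc)
  moreover have "(\<eta> b - \<eta>1 a * b) - (\<eta> a - \<eta>1 a * a) = \<eta> b - \<eta> a - \<eta>1 a * (b - a)" by (simp add: algebra_simps)
  ultimately show ?thesis by simp
qed

text \<open>Here f is one time slice of a test function and fx its derivative. H and K bound the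
  entropy derivatives on the range |y| at most sqrt E, which contains u before and after the
  step.\<close>

locale scheme_entropy = scheme_step +
  fixes \<eta> \<eta>1 \<eta>2 q f fx :: "real \<Rightarrow> real" and H K B R :: real
  assumes \<eta>: "\<And>y. (\<eta> has_real_derivative \<eta>1 y) (at y)" "\<And>y. (\<eta>1 has_real_derivative \<eta>2 y) (at y)"
    and \<eta>c: "continuous_on UNIV \<eta>2"
    and HK: "\<And>y. \<bar>y\<bar> \<le> sqrt E \<Longrightarrow> \<bar>\<eta>1 y\<bar> \<le> H" "\<And>y. \<bar>y\<bar> \<le> sqrt E \<Longrightarrow> \<bar>\<eta>2 y\<bar> \<le> K"
    and q: "\<And>y. (q has_real_derivative y * \<eta>1 y) (at y)"
    and f: "\<And>x. (f has_real_derivative fx x) (at x)" "continuous_on UNIV fx"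
    and B: "\<And>x. \<bar>f x\<bar> \<le> B" "\<And>x. \<bar>fx x\<bar> \<le> B"
    and R: "\<And>x. \<bar>x\<bar> > R \<Longrightarrow> f x = 0" "\<And>x. \<bar>x\<bar> > R \<Longrightarrow> fx x = 0"
begin

lemma v_small: "\<bar>v x\<bar> \<le> 9 * M\<^sup>2 * \<tau>"
proof -
  have "\<bar>Nc F x - F x\<bar> \<le> 9 * M\<^sup>2" for x
    using resolvent_bound(2)[OF continuous_measurable_lborel[OF F_cont] F_bound, of x] F_bound[of x] by linarith
  then have "\<bar>Lc F (x + h) - Lc F x\<bar> \<le> 9 * M\<^sup>2 * \<bar>(x + h) - x\<bar>"
    by (rule DERIV_bounded_imp_Lipschitz[OF DERIV_Lc[OF F_cont F_bound]])
  then have "\<kappa> * \<bar>Lc F (x + h) - Lc F x\<bar> \<le> \<kappa> * (9 * M\<^sup>2 * h)"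
    using \<kappa>(1) h by (intro mult_left_mono) auto
  moreover have "v x = \<kappa> * (Lc F (x + h) - Lc F x)"
    unfolding v_def by (subst d_eq, rule resolvent_increment(1)[OF F_bm])
  ultimately show ?thesis using \<kappa>(1) by (simp add: abs_mult \<kappa>(2)[symmetric] mult.commute mult.left_commute)
qed

lemma \<eta>1c: "continuous_on UNIV \<eta>1" by (rule DERIV_cont[OF \<eta>(2)])

lemma \<eta>0c: "continuous_on UNIV \<eta>" by (rule DERIV_cont[OF \<eta>(1)])

lemma fc: "continuous_on UNIV f" by (rule DERIV_cont[OF f(1)])

lemma B0: "0 \<le> B" using B(1)[of 0] by linarith

lemma K0: "0 \<le> K" using HK(2)[of 0] E0 by auto

lemma uvE: "\<bar>u x + v x\<bar> \<le> sqrt E"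
proof -
  have "(u x + v x)\<^sup>2 \<le> E"
  proof (rule sup_bound_from_energy[of "\<lambda>x. u x + v x" "\<lambda>x. g x + v' x"])
    show "((\<lambda>x. u x + v x) has_real_derivative g x + v' x) (at x)" for x by (rule DERIV_add[OF du dv])
    show "continuous_on UNIV (\<lambda>x. g x + v' x)" by (intro continuous_intros gc v'_cont)
  qed (use energy in auto)
  then show ?thesis using real_le_rsqrt[of "\<bar>u x + v x\<bar>"] by simp
qed

definition \<psi> where "\<psi> x = f x * \<eta>1 (u x)"

lemma \<psi>_bound: "\<bar>\<psi> x\<bar> \<le> B * H"
  unfolding \<psi>_def abs_mult using B(1) HK(1)[OF uB] B0 by (intro mult_mono) auto

lemma \<psi>_cont: "continuous_on UNIV \<psi>"
  unfolding \<psi>_def[abs_def] by (intro continuous_intros fc continuous_on_compose2[OF \<eta>1c] uc) auto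

lemma \<psi>_Lipschitz: "\<bar>\<psi> x - \<psi> y\<bar> \<le> (B * H + B * (K * (2 * sqrt E + V))) * \<bar>x - y\<bar>"
proof (rule DERIV_bounded_imp_Lipschitz)
  show "(\<psi> has_real_derivative fx x * \<eta>1 (u x) + f x * (\<eta>2 (u x) * g x)) (at x)" for x
    unfolding \<psi>_def[abs_def] by (auto intro!: derivative_eq_intros f(1) DERIV_chain2[OF \<eta>(2) du])
  show "\<bar>fx x * \<eta>1 (u x) + f x * (\<eta>2 (u x) * g x)\<bar> \<le> B * H + B * (K * (2 * sqrt E + V))" for x
  proof (rule order_trans[OF abs_triangle_ineq], rule add_mono)
    show "\<bar>fx x * \<eta>1 (u x)\<bar> \<le> B * H"
      unfolding abs_mult using B(2) HK(1)[OF uB] B0 by (intro mult_mono) auto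
    show "\<bar>f x * (\<eta>2 (u x) * g x)\<bar> \<le> B * (K * (2 * sqrt E + V))"
      unfolding abs_mult using B(1) HK(2)[OF uB] gB B0 K0 by (intro mult_mono) auto
  qed
qed

lemma Y_eq_Zc: "Y x = 4 * u x * g x + Zc u g x"
  by (simp add: Y_def Zc_def)

text \<open>Taylor's formula splits the increment of the entropy. Its linear part is the increment v
  tested with \<open>\<psi>\<close>, covered by consistency. The quadratic remainder is estimated by
  one factor v in the supremum norm, at most 9 M^2 \<tau>, and one in L^1, at most 3 C1 \<tau>. As u
  is differentiable, the convective term is an exact derivative of 4 q(u) and is integrated by parts
  onto f.\<close>

lemma entropy_step:
  "\<bar>(LINT x|lborel. f x * (\<eta> (u x + v x) - \<eta> (u x)))
     - \<tau> * ((LINT x|lborel. f x * \<eta>1 (u x) * Zc u g x) - (LINT x|lborel. 4 * q (u x) * fx x))\<bar>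
   \<le> \<tau> * (27 * B * K * C1 * M\<^sup>2 * \<tau> + (B * H + B * (K * (2 * sqrt E + V))) * (24 * E * h + 4 * h * M\<^sup>2))"
proof -
  note cons = consistency[OF \<psi>_cont \<psi>_bound \<psi>_Lipschitz]
  define r where "r x = f x * (\<eta> (u x + v x) - \<eta> (u x) - \<eta>1 (u x) * v x)" for x
  have qc: "continuous_on UNIV q" by (rule DERIV_cont[OF q])
  have r_le: "\<bar>r x\<bar> \<le> B * K * (9 * M\<^sup>2 * \<tau>) * \<bar>v x\<bar>" for x
  proof -
    have "\<bar>\<eta> (u x + v x) - \<eta> (u x) - \<eta>1 (u x) * (u x + v x - u x)\<bar> \<le> K * (u x + v x - u x)\<^sup>2"
      by (rule second_order_Taylor_bound[OF \<eta> HK(2) uB uvE])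
    then have "\<bar>\<eta> (u x + v x) - \<eta> (u x) - \<eta>1 (u x) * v x\<bar> \<le> K * (v x)\<^sup>2" by simp
    also have "(v x)\<^sup>2 = \<bar>v x\<bar> * \<bar>v x\<bar>" by (simp add: power2_eq_square)
    also have "K * (\<bar>v x\<bar> * \<bar>v x\<bar>) \<le> K * ((9 * M\<^sup>2 * \<tau>) * \<bar>v x\<bar>)"
      by (intro mult_left_mono mult_right_mono v_small K0) auto
    finally have "\<bar>f x\<bar> * \<bar>\<eta> (u x + v x) - \<eta> (u x) - \<eta>1 (u x) * v x\<bar> \<le> B * (K * ((9 * M\<^sup>2 * \<tau>) * \<bar>v x\<bar>))"
      using B(1) B0 by (intro mult_mono) auto
    then show ?thesis by (simp add: r_def abs_mult mult.assoc)
  qed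
  have ri: "integrable lborel (\<lambda>x. B * K * (9 * M\<^sup>2 * \<tau>) * \<bar>v x\<bar>)" using v_int by simp
  have rc: "r \<in> borel_measurable lborel"
    unfolding r_def[abs_def]
    by (intro continuous_measurable_lborel continuous_intros fc continuous_on_compose2[OF \<eta>1c] continuous_on_compose2[OF \<eta>0c] uc v_cont) auto
  have rint: "integrable lborel r" by (rule integral_le_abs(1)[OF ri r_le rc])
  have "(LINT x|lborel. \<bar>r x\<bar>) \<le> B * K * (9 * M\<^sup>2 * \<tau>) * (LINT x|lborel. \<bar>v x\<bar>)"
    using integral_le_abs(2)[OF ri r_le rc] by simp
  also have "\<dots> \<le> B * K * (9 * M\<^sup>2 * \<tau>) * (3 * C1 * \<tau>)"
    using v_L1 B0 K0 \<kappa>(4) by (intro mult_left_mono) auto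
  also have "\<dots> = \<tau> * (27 * B * K * C1 * M\<^sup>2 * \<tau>)" by (simp add: power2_eq_square)
  finally have r_int_le: "\<bar>LINT x|lborel. r x\<bar> \<le> \<tau> * (27 * B * K * C1 * M\<^sup>2 * \<tau>)"
    using integral_abs_bound[of lborel r] by linarith
  have \<psi>v: "integrable lborel (\<lambda>x. \<psi> x * v x)" by (rule integrable_mult_abs_bounded(2)[OF v_int \<psi>_cont \<psi>_bound])
  have "f x * (\<eta> (u x + v x) - \<eta> (u x)) = \<psi> x * v x + r x" for x by (simp add: \<psi>_def r_def algebra_simps)
  then have 1: "(LINT x|lborel. f x * (\<eta> (u x + v x) - \<eta> (u x))) = (LINT x|lborel. \<psi> x * v x) + (LINT x|lborel. r x)"
    using \<psi>v rint by simp
  have c1: "continuous_on UNIV (\<lambda>x. f x * (4 * (u x * \<eta>1 (u x) * g x)))"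
    by (intro continuous_intros fc continuous_on_compose2[OF \<eta>1c] uc gc) auto
  have c2: "continuous_on UNIV (\<lambda>x. 4 * q (u x) * fx x)"
    by (intro continuous_intros f(2) continuous_on_compose2[OF qc] uc) auto
  have i1: "integrable lborel (\<lambda>x. f x * (4 * (u x * \<eta>1 (u x) * g x)))"
    by (rule integrable_continuous_compact_support[OF c1, of R]) (simp add: R)
  have i2: "integrable lborel (\<lambda>x. 4 * q (u x) * fx x)"
    by (rule integrable_continuous_compact_support[OF c2, of R]) (simp add: R)
  have "(LINT x|lborel. f x * (4 * (u x * \<eta>1 (u x) * g x)) + 4 * q (u x) * fx x) = 0"
  proof (rule integral_DERIV_compact_support[where R=R])
    show "((\<lambda>x. f x * (4 * q (u x))) has_real_derivative f x * (4 * (u x * \<eta>1 (u x) * g x)) + 4 * q (u x) * fx x) (at x)" for x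
      by (auto intro!: derivative_eq_intros f(1) DERIV_chain2[OF q du])
    show "continuous_on UNIV (\<lambda>x. f x * (4 * (u x * \<eta>1 (u x) * g x)) + 4 * q (u x) * fx x)"
      by (intro continuous_on_add c1 c2)
  qed (use R in auto)
  then have 2: "(LINT x|lborel. f x * (4 * (u x * \<eta>1 (u x) * g x))) = - (LINT x|lborel. 4 * q (u x) * fx x)"
    using i1 i2 by simp
  have \<psi>Y: "integrable lborel (\<lambda>x. \<psi> x * Y x)" by (rule integrable_mult_abs_bounded(2)[OF cons(2) \<psi>_cont \<psi>_bound])
  have e: "f x * \<eta>1 (u x) * Zc u g x = \<psi> x * Y x - f x * (4 * (u x * \<eta>1 (u x) * g x))" for x
    unfolding Y_eq_Zc \<psi>_def by (simp add: algebra_simps)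
  have 3: "(LINT x|lborel. f x * \<eta>1 (u x) * Zc u g x) - (LINT x|lborel. 4 * q (u x) * fx x) = (LINT x|lborel. \<psi> x * Y x)"
    unfolding e using \<psi>Y i1 2 by simp
  show ?thesis
    unfolding 1 3
    using cons(1) r_int_le distrib_left[of \<tau> "27 * B * K * C1 * M\<^sup>2 * \<tau>"
      "(B * H + B * (K * (2 * sqrt E + V))) * (24 * E * h + 4 * h * M\<^sup>2)"] by linarith
qed

end

section \<open>Iterating the scheme\<close>

definition scheme_map :: "real \<Rightarrow> real \<Rightarrow> (real \<Rightarrow> real) \<times> (real \<Rightarrow> real) \<Rightarrow> (real \<Rightarrow> real) \<times> (real \<Rightarrow> real)" where
  "scheme_map M h p = (\<lambda>x. fst p x + Lc (incr M h (snd p)) x,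
     \<lambda>x. snd p x + incr M h (snd p) x + 3 * Gc (incr M h (snd p)) x)"

text \<open>\<open>VT\<close> makes M dominate the modulus of w at every level up to T; the rate 6
  (1 + 8 E) is the growth per unit of time found for a single step.\<close>

locale scheme =
  fixes u0 w0 :: "real \<Rightarrow> real" and E V0 M h T :: real
  assumes adm0: "admissible E V0 u0 w0" and M: "M > 0" and h: "h > 0" and hM: "h * M\<^sup>2 \<le> 1"
    and T: "T \<ge> 0" and VT: "V0 + 6 * (1 + 8 * E) * T \<le> M"
begin

definition ts where "ts = h / (64 * M)"

definition us where "us k = fst ((scheme_map M h ^^ k) (u0, w0))"

definition ws where "ws k = snd ((scheme_map M h ^^ k) (u0, w0))"

definition Vk where "Vk k = V0 + 6 * (1 + 8 * E) * (real k * ts)"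

lemma ts_pos: "ts > 0" using M h by (simp add: ts_def)

lemma us_0: "us 0 = u0" "ws 0 = w0" by (auto simp: us_def ws_def)

lemma us_Suc: "us (Suc k) x = us k x + Lc (incr M h (ws k)) x"
  "ws (Suc k) x = ws k x + incr M h (ws k) x + 3 * Gc (incr M h (ws k)) x"
  by (simp_all add: us_def ws_def scheme_map_def)

lemma E_nonneg: "0 \<le> E"
proof -
  have "0 \<le> (LINT x|lborel. (u0 x)\<^sup>2) + (LINT x|lborel. (2 * u0 x - w0 x)\<^sup>2)" by simp
  then show ?thesis using adm0 unfolding admissible_def by (meson order_trans)
qed

lemma Vk_le:
  assumes "real k * ts \<le> T" shows "Vk k \<le> M"
proof -
  have "6 * (1 + 8 * E) * (real k * ts) \<le> 6 * (1 + 8 * E) * T"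
    by (rule mult_left_mono[OF assms]) (use E_nonneg in simp)
  then show ?thesis unfolding Vk_def using VT by linarith
qed

text \<open>The step from level k uses the bound by M at level k only, so the iteration reaches one
  level beyond T.\<close>

lemma us_admissible: "real k * ts \<le> T + ts \<Longrightarrow> admissible E (Vk k) (us k) (ws k)"
proof (induction k)
  case 0 then show ?case using adm0 by (simp add: us_0 Vk_def)
next
  case (Suc k)
  then have k: "real k * ts \<le> T" by (simp add: distrib_right)
  then have adm: "admissible E (Vk k) (us k) (ws k)" using Suc ts_pos by simp
  interpret s: scheme_step "us k" "ws k" E "Vk k" M h
    by unfold_locales (use adm Vk_le[OF k] M h hM in auto)
  have "us (Suc k) = (\<lambda>x. us k x + Lc s.d x)" "ws (Suc k) = (\<lambda>x. ws k x + s.d x + 3 * Gc s.d x)"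
    unfolding s.d_def by (auto simp: us_Suc)
  moreover have "s.\<tau> = ts" by (simp add: s.\<tau>_def ts_def)
  then have "Vk (Suc k) = Vk k + 6 * s.C1 * s.\<tau>"
    by (simp add: Vk_def s.C1_def algebra_simps)
  ultimately show ?case using s.admissible_next by simp
qed

lemma step_locale: "real k * ts \<le> T \<Longrightarrow> scheme_step (us k) (ws k) E (Vk k) M h"
  by unfold_locales (use us_admissible[of k] ts_pos Vk_le M h hM in auto)

text \<open>u is Lipschitz in time with values in L^1 in the sense of increments, although u itself
  may fail to be integrable.\<close>

lemma us_increment:
  assumes "j \<le> k" "real k * ts \<le> T + ts"
  shows "integrable lborel (\<lambda>x. us k x - us j x)"
    "(LINT x|lborel. \<bar>us k x - us j x\<bar>) \<le> 3 * (1 + 8 * E) * (real k * ts - real j * ts)"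
proof -
  have "integrable lborel (\<lambda>x. us k x - us j x) \<and>
    (LINT x|lborel. \<bar>us k x - us j x\<bar>) \<le> 3 * (1 + 8 * E) * (real k * ts - real j * ts)"
    using assms
  proof (induction k rule: dec_induct)
    case (step k)
    then have k: "real k * ts \<le> T" by (simp add: distrib_right)
    then have IH: "integrable lborel (\<lambda>x. us k x - us j x)"
      "(LINT x|lborel. \<bar>us k x - us j x\<bar>) \<le> 3 * (1 + 8 * E) * (real k * ts - real j * ts)" using step ts_pos by auto
    interpret s: scheme_step "us k" "ws k" E "Vk k" M h by (rule step_locale[OF k])
    have "us (Suc k) x - us j x = 1 * (us k x - us j x) + 1 * s.v x" for x
      by (simp add: us_Suc s.v_def s.d_def)
    moreover note lincomb_L1[OF IH s.v_int s.v_L1, of 1 1]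
    moreover have "s.\<tau> = ts" "s.C1 = 1 + 8 * E" by (auto simp: s.\<tau>_def ts_def s.C1_def)
    ultimately show ?case by (simp add: algebra_simps)
  qed simp
  then show "integrable lborel (\<lambda>x. us k x - us j x)"
    "(LINT x|lborel. \<bar>us k x - us j x\<bar>) \<le> 3 * (1 + 8 * E) * (real k * ts - real j * ts)" by auto
qed

end

text \<open>Intended for the changes f of u and \<omega> of w since time 0. Averaging 2 f - f' =
  \<omega> over a unit window expresses the average of \<omega> by f and f(x + 1), and the average
  is within W of \<omega> in L^1. This makes \<omega> integrable although only its modulus is
  known.\<close>

lemma DERIV_L1_companion:
  assumes f: "\<And>x. (f has_real_derivative 2 * f x - \<omega> x) (at x)" "integrable lborel f" "\<And>x. \<bar>f x\<bar> \<le> b"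
    and \<omega>: "continuous_on UNIV \<omega>" "\<And>x. \<bar>\<omega> x\<bar> \<le> c" "modl W \<omega>"
  shows "integrable lborel \<omega>" "(LINT x|lborel. \<bar>\<omega> x\<bar>) \<le> 4 * (LINT x|lborel. \<bar>f x\<bar>) + W"
proof -
  have fc: "continuous_on UNIV f" by (rule DERIV_cont[OF f(1)])
  have fb: "bounded_measurable f" and \<omega>b: "bounded_measurable \<omega>"
    using bounded_measurable_contI fc f(3) \<omega> by blast+
  have f2b: "bounded_measurable (\<lambda>x. 2 * f x)"
    by (rule bounded_measurable_contI[where B="2 * b"]) (auto intro!: continuous_intros fc simp: abs_mult f(3))
  have av: "integrable lborel (\<lambda>x. cv (win 1) \<omega> x - 1 * \<omega> x)" "(LINT x|lborel. \<bar>cv (win 1) \<omega> x - 1 * \<omega> x\<bar>) \<le> W * 1\<^sup>2"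
    by (rule modl_average[OF continuous_measurable_lborel[OF \<omega>(1)] \<omega>(3)], simp, rule cv_integrand[OF win_integrable \<omega>b])+
  have eq: "cv (win 1) \<omega> x = 2 * cv (win 1) f x + (-1) * (f (x + 1) - f x)" for x
  proof -
    have "f (x + 1) - f x = cv (win 1) (\<lambda>x. 2 * f x - \<omega> x) x"
      by (rule DERIV_increment_eq_cv[OF f(1)]) (auto intro!: continuous_intros fc \<omega>)
    then show ?thesis unfolding cv_diff[OF win_integrable f2b \<omega>b] cv_cmult by simp
  qed
  have i1: "integrable lborel (cv (win 1) f)" "(LINT x|lborel. \<bar>cv (win 1) f x\<bar>) \<le> (LINT x|lborel. \<bar>f x\<bar>)"
    using cv_integrable[OF win_integrable f(2)] cv_L1[OF win_integrable f(2), of 1] win_integral(2)[of 1] by auto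
  have sh: "(LINT x|lborel. \<bar>f (x + 1)\<bar>) \<le> (LINT x|lborel. \<bar>f x\<bar>)"
    by (simp add: integral_shift[of "\<lambda>x. \<bar>f x\<bar>"])
  have i2: "integrable lborel (\<lambda>x. 1 * f (x + 1) + (-1) * f x)"
    "(LINT x|lborel. \<bar>1 * f (x + 1) + (-1) * f x\<bar>) \<le> \<bar>1\<bar> * (LINT x|lborel. \<bar>f x\<bar>) + \<bar>-1\<bar> * (LINT x|lborel. \<bar>f x\<bar>)"
    by (rule lincomb_L1[OF integrable_shift[OF f(2)] sh f(2) order_refl])+
  have i3: "integrable lborel (cv (win 1) \<omega>)" "(LINT x|lborel. \<bar>cv (win 1) \<omega> x\<bar>) \<le> 4 * (LINT x|lborel. \<bar>f x\<bar>)"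
    using lincomb_L1[OF i1, of "\<lambda>x. f (x + 1) - f x" "2 * (LINT x|lborel. \<bar>f x\<bar>)" 2 "-1"] i2
    unfolding eq[abs_def] by auto
  have o: "\<omega> = (\<lambda>x. 1 * cv (win 1) \<omega> x + (-1) * (cv (win 1) \<omega> x - 1 * \<omega> x))" by auto
  show "integrable lborel \<omega>" by (subst o, rule lincomb_L1(1)[OF i3 av])
  show "(LINT x|lborel. \<bar>\<omega> x\<bar>) \<le> 4 * (LINT x|lborel. \<bar>f x\<bar>) + W"
    by (subst o, rule order_trans[OF lincomb_L1(2)[OF i3 av]]) simp
qed

text \<open>Sums over time levels become integrals of piecewise constant functions of t, to which
  dominated convergence can be applied.\<close>

lemma step_function_integral:
  fixes a :: "nat \<Rightarrow> real"
  assumes ts: "ts > 0"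
  shows "integrable lborel (\<lambda>t. indicator {0..<real N * ts} t * a (nat \<lfloor>t / ts\<rfloor>))"
    "(LINT t|lborel. indicator {0..<real N * ts} t * a (nat \<lfloor>t / ts\<rfloor>)) = (\<Sum>k<N. ts * a k)"
proof -
  have eq: "indicator {0..<real N * ts} t * a (nat \<lfloor>t / ts\<rfloor>)
      = (\<Sum>k<N. a k * indicator {real k * ts..<real (Suc k) * ts} t)" for t
  proof -
    have ind: "indicator {real k * ts..<real (Suc k) * ts} t = (if 0 \<le> t \<and> k = nat \<lfloor>t / ts\<rfloor> then 1 else (0::real))" for k
    proof -
      have "t \<in> {real k * ts..<real (Suc k) * ts} \<longleftrightarrow> real k \<le> t / ts \<and> t / ts < real k + 1"
        using ts by (auto simp: pos_le_divide_eq pos_divide_less_eq algebra_simps)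
      also have "\<dots> \<longleftrightarrow> \<lfloor>t / ts\<rfloor> = int k" by (simp add: floor_eq_iff)
      also have "\<dots> \<longleftrightarrow> 0 \<le> t \<and> k = nat \<lfloor>t / ts\<rfloor>"
      proof -
        have F: "0 \<le> \<lfloor>t / ts\<rfloor> \<longleftrightarrow> 0 \<le> t" using ts by (simp add: zero_le_divide_iff)
        show ?thesis
        proof
          assume "\<lfloor>t / ts\<rfloor> = int k"
          then show "0 \<le> t \<and> k = nat \<lfloor>t / ts\<rfloor>" using F by (metis nat_int of_nat_0_le_iff)
        next
          assume "0 \<le> t \<and> k = nat \<lfloor>t / ts\<rfloor>"
          then show "\<lfloor>t / ts\<rfloor> = int k" using F by (metis nat_0_le)
        qed
      qed
      finally show ?thesis by (auto simp: indicator_def)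
    qed
    have "(\<Sum>k<N. a k * indicator {real k * ts..<real (Suc k) * ts} t)
       = (\<Sum>k<N. if k = nat \<lfloor>t / ts\<rfloor> then (if 0 \<le> t then a k else 0) else 0)"
      unfolding ind by (intro sum.cong) auto
    also have "\<dots> = (if nat \<lfloor>t / ts\<rfloor> < N \<and> 0 \<le> t then a (nat \<lfloor>t / ts\<rfloor>) else 0)"
      by (subst sum.delta) auto
    also have "\<dots> = indicator {0..<real N * ts} t * a (nat \<lfloor>t / ts\<rfloor>)"
    proof -
      have "nat \<lfloor>t / ts\<rfloor> < N \<longleftrightarrow> t < real N * ts" if "0 \<le> t"
      proof -
        have "nat \<lfloor>t / ts\<rfloor> < N \<longleftrightarrow> \<lfloor>t / ts\<rfloor> < int N" using that ts by (simp add: nat_less_iff)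
        also have "\<dots> \<longleftrightarrow> t / ts < real N" by (simp add: floor_less_iff)
        finally show ?thesis using ts by (simp add: pos_divide_less_eq)
      qed
      then show ?thesis by (auto simp: indicator_def)
    qed
    finally show ?thesis by simp
  qed
  have i: "integrable lborel (\<lambda>t. a k * indicator {real k * ts..<real (Suc k) * ts} t)"
    "(LINT t|lborel. a k * indicator {real k * ts..<real (Suc k) * ts} t) = ts * a k" for k
    using ts by (auto simp: emeasure_lborel_Ico integrable_mult_right_iff distrib_right mult_right_mono)
  show "integrable lborel (\<lambda>t. indicator {0..<real N * ts} t * a (nat \<lfloor>t / ts\<rfloor>))"
    unfolding eq by (intro Bochner_Integration.integrable_sum i)
  show "(LINT t|lborel. indicator {0..<real N * ts} t * a (nat \<lfloor>t / ts\<rfloor>)) = (\<Sum>k<N. ts * a k)"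
    unfolding eq Bochner_Integration.integral_sum[OF i(1)] i(2) ..
qed

locale entropy_data =
  fixes \<eta> \<eta>1 \<eta>2 q :: "real \<Rightarrow> real" and f ft fx :: "real \<Rightarrow> real \<Rightarrow> real" and B R :: real
  assumes \<eta>: "\<And>y. (\<eta> has_real_derivative \<eta>1 y) (at y)" "\<And>y. (\<eta>1 has_real_derivative \<eta>2 y) (at y)"
    and \<eta>2c: "continuous_on UNIV \<eta>2"
    and q: "\<And>y. (q has_real_derivative y * \<eta>1 y) (at y)"
    and fx: "\<And>t x. (f t has_real_derivative fx t x) (at x)"
    and ft: "\<And>t x. ((\<lambda>s. f s x) has_real_derivative ft t x) (at t)"
    and fxc: "continuous_on UNIV (\<lambda>p. fx (fst p) (snd p))" and ftc: "continuous_on UNIV (\<lambda>p. ft (fst p) (snd p))"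
    and fB: "\<And>t x. \<bar>f t x\<bar> \<le> B" "\<And>t x. \<bar>fx t x\<bar> \<le> B" "\<And>t x. \<bar>ft t x\<bar> \<le> B"
    and R: "R > 0"
    and f0: "\<And>t x. \<bar>t\<bar> > R \<or> \<bar>x\<bar> > R \<Longrightarrow> f t x = 0" "\<And>t x. \<bar>t\<bar> > R \<or> \<bar>x\<bar> > R \<Longrightarrow> fx t x = 0"
      "\<And>t x. \<bar>t\<bar> > R \<or> \<bar>x\<bar> > R \<Longrightarrow> ft t x = 0"
begin

lemma fx_cont: "continuous_on UNIV (fx t)"
  by (rule continuous_on_compose2[OF fxc, of UNIV "\<lambda>x. (t, x)", simplified]) (intro continuous_intros)

lemma ft_cont: "continuous_on UNIV (\<lambda>s. ft s x)"
  by (rule continuous_on_compose2[OF ftc, of UNIV "\<lambda>s. (s, x)", simplified]) (intro continuous_intros)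

lemma f_cont: "continuous_on UNIV (f t)" by (rule DERIV_cont[OF fx])

lemma \<eta>1_cont: "continuous_on UNIV \<eta>1" by (rule DERIV_cont[OF \<eta>(2)])

lemma \<eta>_cont: "continuous_on UNIV \<eta>" by (rule DERIV_cont[OF \<eta>(1)])

lemma q_cont: "continuous_on UNIV q" by (rule DERIV_cont[OF q])

lemma bounds_on_range:
  obtains H K where "\<And>y. \<bar>y\<bar> \<le> S \<Longrightarrow> \<bar>\<eta>1 y\<bar> \<le> H" "\<And>y. \<bar>y\<bar> \<le> S \<Longrightarrow> \<bar>\<eta>2 y\<bar> \<le> K"
    "\<And>y. \<bar>y\<bar> \<le> S \<Longrightarrow> \<bar>\<eta> y\<bar> \<le> H" "\<And>y. \<bar>y\<bar> \<le> S \<Longrightarrow> \<bar>q y\<bar> \<le> H"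
proof -
  have b: "\<exists>B. \<forall>y. \<bar>y\<bar> \<le> S \<longrightarrow> \<bar>p y\<bar> \<le> B" if "continuous_on UNIV p" for p :: "real \<Rightarrow> real"
  proof -
    have "bounded (p ` {-S..S})"
      by (intro compact_imp_bounded compact_continuous_image continuous_on_subset[OF that]) auto
    then obtain B where "\<forall>z\<in>p ` {-S..S}. norm z \<le> B" unfolding bounded_iff by blast
    then show ?thesis by (intro exI[of _ B]) (auto simp: abs_le_iff)
  qed
  obtain b1 b2 b3 b4 where *: "\<forall>y. \<bar>y\<bar> \<le> S \<longrightarrow> \<bar>\<eta>1 y\<bar> \<le> b1" "\<forall>y. \<bar>y\<bar> \<le> S \<longrightarrow> \<bar>\<eta>2 y\<bar> \<le> b2"
    "\<forall>y. \<bar>y\<bar> \<le> S \<longrightarrow> \<bar>\<eta> y\<bar> \<le> b3" "\<forall>y. \<bar>y\<bar> \<le> S \<longrightarrow> \<bar>q y\<bar> \<le> b4"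
    using b[OF \<eta>1_cont] b[OF \<eta>2c] b[OF \<eta>_cont] b[OF q_cont] by blast
  show ?thesis
    by (rule that[of "max b1 (max b3 b4)" b2]) (use * in \<open>simp_all add: le_max_iff_disj\<close>)
qed

end

section \<open>Integrability of u_x along the iteration\<close>

context scheme
begin

definition gs where "gs k x = 2 * us k x - ws k x"

lemma gs_props:
  assumes k: "real k * ts \<le> T"
  shows "(us k has_real_derivative gs k x) (at x)" "continuous_on UNIV (gs k)"
    "integrable lborel (\<lambda>x. (us k x)\<^sup>2)" "integrable lborel (\<lambda>x. (gs k x)\<^sup>2)"
    "(LINT x|lborel. (us k x)\<^sup>2) + (LINT x|lborel. (gs k x)\<^sup>2) \<le> E"
    "\<bar>us k x\<bar> \<le> sqrt E" "\<bar>gs k x\<bar> \<le> 2 * sqrt E + Vk k"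
    "continuous_on UNIV (ws k)" "\<bar>ws k x\<bar> \<le> Vk k" "modl (Vk k) (ws k)" "0 \<le> Vk k"
proof -
  interpret s: scheme_step "us k" "ws k" E "Vk k" M h by (rule step_locale[OF k])
  have "s.g = gs k" by (auto simp: s.g_def gs_def)
  then show "(us k has_real_derivative gs k x) (at x)" "continuous_on UNIV (gs k)"
    "integrable lborel (\<lambda>x. (us k x)\<^sup>2)" "integrable lborel (\<lambda>x. (gs k x)\<^sup>2)"
    "(LINT x|lborel. (us k x)\<^sup>2) + (LINT x|lborel. (gs k x)\<^sup>2) \<le> E"
    "\<bar>us k x\<bar> \<le> sqrt E" "\<bar>gs k x\<bar> \<le> 2 * sqrt E + Vk k"
    "continuous_on UNIV (ws k)" "\<bar>ws k x\<bar> \<le> Vk k" "modl (Vk k) (ws k)" "0 \<le> Vk k"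
    using s.du[of x] s.gc s.iu s.ig s.en s.uB[of x] s.gB[of x] s.wc s.wV[of x] s.mw s.V0 by auto
qed

text \<open>Only the initial u_x is integrable by assumption; the later one differs from it by 2 f -
  \<omega>, with f and \<omega> the changes of u and w. Here 18 is 2 * 3 from f plus 12 from
  \<omega>. The modulus of u_x follows from u_x = 2 u - w, the modulus of u being the L^1 norm of
  u_x.\<close>

lemma gs_L1:
  assumes k: "real k * ts \<le> T" and g0: "integrable lborel (gs 0)"
  shows "integrable lborel (gs k)"
    "(LINT x|lborel. \<bar>gs k x\<bar>) \<le> (LINT x|lborel. \<bar>gs 0 x\<bar>) + (18 * (1 + 8 * E) * (real k * ts) + (Vk k + V0))"
    "modl (2 * ((LINT x|lborel. \<bar>gs 0 x\<bar>) + (18 * (1 + 8 * E) * (real k * ts) + (Vk k + V0))) + Vk k) (gs k)"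
proof -
  have z: "real 0 * ts \<le> T" using T by simp
  note p = gs_props[OF k] and p0 = gs_props[OF z]
  define f where "f x = us k x - us 0 x" for x
  define \<omega> where "\<omega> x = ws k x - ws 0 x" for x
  have f: "integrable lborel f" "(LINT x|lborel. \<bar>f x\<bar>) \<le> 3 * (1 + 8 * E) * (real k * ts)"
    using us_increment[of 0 k] k ts_pos unfolding f_def[abs_def] by auto
  have V0: "Vk 0 = V0" by (simp add: Vk_def)
  have df: "(f has_real_derivative 2 * f x - \<omega> x) (at x)" for x
    using DERIV_diff[OF p(1)[of x] p0(1)[of x]] unfolding f_def[abs_def] \<omega>_def gs_def by (simp add: algebra_simps)
  have "modl (Vk k + \<bar>-1\<bar> * Vk 0) (\<lambda>x. ws k x + (-1) * ws 0 x)"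
    by (intro modl_add modl_cmult p(10) p0(10))
  then have m\<omega>: "modl (Vk k + V0) \<omega>" by (simp add: \<omega>_def[abs_def] V0)
  have fb: "\<bar>f x\<bar> \<le> 2 * sqrt E" for x using p(6)[of x] p0(6)[of x] unfolding f_def by linarith
  have wb: "\<bar>\<omega> x\<bar> \<le> Vk k + Vk 0" for x using p(9)[of x] p0(9)[of x] unfolding \<omega>_def by linarith
  have wc: "continuous_on UNIV \<omega>" unfolding \<omega>_def[abs_def] by (intro continuous_intros p(8) p0(8))
  note \<omega> = DERIV_L1_companion[OF df f(1) fb wc wb m\<omega>]
  have \<omega>2: "(LINT x|lborel. \<bar>\<omega> x\<bar>) \<le> 12 * (1 + 8 * E) * (real k * ts) + (Vk k + V0)"
  proof -
    have "4 * (LINT x|lborel. \<bar>f x\<bar>) \<le> 4 * (3 * (1 + 8 * E) * (real k * ts))" by (rule mult_left_mono[OF f(2)]) simp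
    moreover have "4 * (3 * (1 + 8 * E) * (real k * ts)) = 12 * (1 + 8 * E) * (real k * ts)" by simp
    ultimately show ?thesis using \<omega>(2) by linarith
  qed
  note l1 = lincomb_L1[OF f \<omega>(1) \<omega>2, of 2 "-1"]
  note l2 = lincomb_L1[OF g0 order_refl l1, of 1 1]
  have eq: "gs k = (\<lambda>x. 1 * gs 0 x + 1 * (2 * f x + (-1) * \<omega> x))"
    by (auto simp: gs_def f_def \<omega>_def)
  show i: "integrable lborel (gs k)" unfolding eq by (rule l2(1))
  show le: "(LINT x|lborel. \<bar>gs k x\<bar>) \<le> (LINT x|lborel. \<bar>gs 0 x\<bar>) + (18 * (1 + 8 * E) * (real k * ts) + (Vk k + V0))"
    by (subst eq, rule order_trans[OF l2(2)]) (simp add: algebra_simps)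
  have "modl (LINT x|lborel. \<bar>gs k x\<bar>) (us k)" by (rule modl_DERIV[OF p(1,2) i])
  from modl_mono[OF this le] have "modl (\<bar>2\<bar> * ((LINT x|lborel. \<bar>gs 0 x\<bar>) + (18 * (1 + 8 * E) * (real k * ts) + (Vk k + V0))) + \<bar>-1\<bar> * Vk k) (\<lambda>x. 2 * us k x + (-1) * ws k x)"
    by (intro modl_add modl_cmult p(10))
  then show "modl (2 * ((LINT x|lborel. \<bar>gs 0 x\<bar>) + (18 * (1 + 8 * E) * (real k * ts) + (Vk k + V0))) + Vk k) (gs k)"
    by (simp add: gs_def[abs_def])
qed

end

section \<open>Summation of the entropy balance over the time levels\<close>

locale scheme_entropy_sum = scheme + entropy_data +
  fixes H K :: real
  assumes HK: "\<And>y. \<bar>y\<bar> \<le> sqrt E \<Longrightarrow> \<bar>\<eta>1 y\<bar> \<le> H" "\<And>y. \<bar>y\<bar> \<le> sqrt E \<Longrightarrow> \<bar>\<eta>2 y\<bar> \<le> K"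
    and RT: "R \<le> T"
begin

text \<open>The integrand of the weak formulation at level k. The forward difference of f meets the
  entropy at level k, and the spatial terms use f at level k + 1; this is the combination for which
  the sum over k telescopes.\<close>

definition J where
  "J k = (LINT x|lborel. \<eta> (us k x) * ((f (real (Suc k) * ts) x - f (real k * ts) x) / ts))
     + ((LINT x|lborel. f (real (Suc k) * ts) x * \<eta>1 (us k x) * Zc (us k) (gs k) x)
        - (LINT x|lborel. 4 * q (us k x) * fx (real (Suc k) * ts) x))"

definition S where "S k = (LINT x|lborel. f (real k * ts) x * \<eta> (us k x))"

definition err where
  "err = 27 * B * K * (1 + 8 * E) * M\<^sup>2 * ts
     + (B * H + B * (K * (2 * sqrt E + (V0 + 6 * (1 + 8 * E) * R)))) * (24 * E * h + 4 * h * M\<^sup>2)"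

text \<open>The increment of f \<eta>(u) is split into f at the new level times the increment of the
  entropy, which \<open>entropy_step\<close> treats, and the increment of f times the entropy at the
  old level, which belongs to \<open>J\<close> exactly.\<close>

lemma S_step:
  assumes k: "real k * ts \<le> R"
  shows "\<bar>(S (Suc k) - S k) - ts * J k\<bar> \<le> ts * err"
proof -
  have kT: "real k * ts \<le> T" using k RT by simp
  interpret s: scheme_step "us k" "ws k" E "Vk k" M h by (rule step_locale[OF kT])
  interpret s: scheme_entropy "us k" "ws k" E "Vk k" M h \<eta> \<eta>1 \<eta>2 q "f (real (Suc k) * ts)" "fx (real (Suc k) * ts)" H K B R
    by unfold_locales (use \<eta> \<eta>2c HK q fx fx_cont fB f0 in auto)
  have sg: "s.g = gs k" by (auto simp: s.g_def gs_def)
  have stau: "s.\<tau> = ts" by (simp add: s.\<tau>_def ts_def)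
  have next': "us (Suc k) x = us k x + s.v x" for x by (simp add: us_Suc s.v_def s.d_def)
  have c1: "continuous_on UNIV (\<lambda>x. f t x * \<eta> (us k x))" for t
    by (intro continuous_intros f_cont continuous_on_compose2[OF \<eta>_cont] s.uc) auto
  have c2: "continuous_on UNIV (\<lambda>x. f t x * \<eta> (us k x + s.v x))" for t
    by (intro continuous_intros f_cont continuous_on_compose2[OF \<eta>_cont] s.uc s.v_cont) auto
  have i1: "integrable lborel (\<lambda>x. f t x * \<eta> (us k x))" for t
    by (rule integrable_continuous_compact_support[OF c1, of R]) (simp add: f0)
  have i2: "integrable lborel (\<lambda>x. f t x * \<eta> (us k x + s.v x))" for t
    by (rule integrable_continuous_compact_support[OF c2, of R]) (simp add: f0)
  define A where "A = (LINT x|lborel. f (real (Suc k) * ts) x * (\<eta> (us k x + s.v x) - \<eta> (us k x)))"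
  have A: "A = S (Suc k) - (LINT x|lborel. f (real (Suc k) * ts) x * \<eta> (us k x))"
    using i1 i2 by (simp add: A_def S_def next' right_diff_distrib)
  have e: "\<eta> (us k x) * ((f (real (Suc k) * ts) x - f (real k * ts) x) / ts)
    = (1 / ts) * (f (real (Suc k) * ts) x * \<eta> (us k x) - f (real k * ts) x * \<eta> (us k x))" for x
    by (simp add: algebra_simps diff_divide_distrib)
  have D: "ts * (LINT x|lborel. \<eta> (us k x) * ((f (real (Suc k) * ts) x - f (real k * ts) x) / ts))
    = (LINT x|lborel. f (real (Suc k) * ts) x * \<eta> (us k x)) - S k"
    unfolding e using i1 ts_pos by (simp add: S_def)
  define P where "P = (LINT x|lborel. f (real (Suc k) * ts) x * \<eta>1 (us k x) * Zc (us k) (gs k) x)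
        - (LINT x|lborel. 4 * q (us k x) * fx (real (Suc k) * ts) x)"
  have "(S (Suc k) - S k) - ts * J k = A - ts * P"
    unfolding J_def P_def[symmetric] distrib_left D A by simp
  moreover have "\<bar>A - ts * P\<bar> \<le> ts * (27 * B * K * s.C1 * M\<^sup>2 * ts + (B * H + B * (K * (2 * sqrt E + Vk k))) * (24 * E * h + 4 * h * M\<^sup>2))"
    using s.entropy_step unfolding A_def P_def sg stau .
  moreover have "\<dots> \<le> ts * err"
  proof (rule mult_left_mono)
    have V: "Vk k \<le> V0 + 6 * (1 + 8 * E) * R"
      unfolding Vk_def using mult_left_mono[OF k, of "6 * (1 + 8 * E)"] E_nonneg by simp
    have "(B * H + B * (K * (2 * sqrt E + Vk k))) * (24 * E * h + 4 * h * M\<^sup>2)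
       \<le> (B * H + B * (K * (2 * sqrt E + (V0 + 6 * (1 + 8 * E) * R)))) * (24 * E * h + 4 * h * M\<^sup>2)"
      using V s.B0 s.K0 h E_nonneg by (intro mult_right_mono add_mono mult_left_mono) auto
    then show "27 * B * K * s.C1 * M\<^sup>2 * ts + (B * H + B * (K * (2 * sqrt E + Vk k))) * (24 * E * h + 4 * h * M\<^sup>2) \<le> err"
      unfolding err_def s.C1_def by simp
  qed (use ts_pos in simp)
  ultimately show ?thesis by linarith
qed

text \<open>The first level strictly later than R, so that the test function has vanished there,
  while all summed levels k < N still lie within [0, R], where the scheme is controlled.\<close>

definition N where "N = nat \<lfloor>R / ts\<rfloor> + 1"

lemma N_bounds: "R < real N * ts" "real N * ts \<le> R + ts" "k < N \<Longrightarrow> real k * ts \<le> R"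
proof -
  have a: "0 \<le> R / ts" using R ts_pos by simp
  have n: "real (nat \<lfloor>R / ts\<rfloor>) = of_int \<lfloor>R / ts\<rfloor>" using a by simp
  have "R / ts < real N" unfolding N_def using n by simp linarith
  then show "R < real N * ts" using ts_pos by (simp add: pos_divide_less_eq)
  have "real (nat \<lfloor>R / ts\<rfloor>) \<le> R / ts" unfolding n by linarith
  then have l: "real (nat \<lfloor>R / ts\<rfloor>) * ts \<le> R" using ts_pos by (simp add: pos_le_divide_eq)
  then show "real N * ts \<le> R + ts" by (simp add: N_def distrib_right)
  assume "k < N"
  then have "real k \<le> real (nat \<lfloor>R / ts\<rfloor>)" by (simp add: N_def)
  then have "real k * ts \<le> real (nat \<lfloor>R / ts\<rfloor>) * ts" using ts_pos by (intro mult_right_mono) auto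
  then show "real k * ts \<le> R" using l by simp
qed

lemma telescoped:
  "\<bar>(\<Sum>k<N. ts * J k) + S 0\<bar> \<le> (R + ts) * err"
proof -
  have "S N = 0" unfolding S_def using N_bounds(1) R by (simp add: f0)
  then have "(\<Sum>k<N. S (Suc k) - S k) = - S 0" by (simp add: sum_lessThan_telescope)
  then have "(\<Sum>k<N. ts * J k) + S 0 = - (\<Sum>k<N. (S (Suc k) - S k) - ts * J k)"
    by (simp add: sum_subtractf)
  then have "\<bar>(\<Sum>k<N. ts * J k) + S 0\<bar> \<le> (\<Sum>k<N. \<bar>(S (Suc k) - S k) - ts * J k\<bar>)"
    by (simp add: sum_abs)
  also have "\<dots> \<le> (\<Sum>k<N. ts * err)" by (intro sum_mono S_step N_bounds(3)) simp
  also have "\<dots> = (real N * ts) * err" by simp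
  also have "\<dots> \<le> (R + ts) * err"
  proof (rule mult_right_mono[OF N_bounds(2)])
    have "real 0 * ts \<le> R" using R by simp
    from order_trans[OF abs_ge_zero S_step[OF this]] have "0 \<le> ts * err" .
    then show "0 \<le> err" using ts_pos by (simp add: zero_le_mult_iff)
  qed
  finally show ?thesis .
qed

end

section \<open>The family of approximations\<close>

text \<open>The quantity \<open>J\<close> as a function of continuous time, constant on each
  interval between consecutive levels.\<close>

definition Jf :: "(real \<Rightarrow> real) \<Rightarrow> (real \<Rightarrow> real) \<Rightarrow> (real \<Rightarrow> real) \<Rightarrow> (real \<Rightarrow> real \<Rightarrow> real) \<Rightarrow> (real \<Rightarrow> real \<Rightarrow> real) \<Rightarrow>
    real \<Rightarrow> (real \<Rightarrow> real \<Rightarrow> real) \<Rightarrow> (real \<Rightarrow> real \<Rightarrow> real) \<Rightarrow> real \<Rightarrow> real" where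
  "Jf \<eta> \<eta>1 q f fx \<delta> U g t =
     (LINT x|lborel. \<eta> (U t x) * ((f (real (Suc (nat \<lfloor>t / \<delta>\<rfloor>)) * \<delta>) x - f (real (nat \<lfloor>t / \<delta>\<rfloor>) * \<delta>) x) / \<delta>))
     + ((LINT x|lborel. f (real (Suc (nat \<lfloor>t / \<delta>\<rfloor>)) * \<delta>) x * \<eta>1 (U t x) * Zc (U t) (g t) x)
        - (LINT x|lborel. 4 * q (U t x) * fx (real (Suc (nat \<lfloor>t / \<delta>\<rfloor>)) * \<delta>) x))"

text \<open>Everything the limit passage has to know about the scheme. The n-th approximation is
  controlled on [0, n], with bounds that depend on t but not on n. In \<open>entropy\<close> the
  cutoff \<open>L n\<close> is the end of the time step in which R lies, so the balance runs
  slightly beyond the support.\<close>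

locale approximation =
  fixes U g :: "nat \<Rightarrow> real \<Rightarrow> real \<Rightarrow> real" and ts :: "nat \<Rightarrow> real" and u0 :: "real \<Rightarrow> real"
    and E C :: real and \<Gamma> :: "real \<Rightarrow> real"
  assumes C0: "0 \<le> C" and \<Gamma>_mono: "\<And>s t. s \<le> t \<Longrightarrow> \<Gamma> s \<le> \<Gamma> t" and \<Gamma>0: "\<And>t. 0 \<le> t \<Longrightarrow> 0 \<le> \<Gamma> t"
    and ts_pos: "\<And>n. ts n > 0" and ts_lim: "ts \<longlonglongrightarrow> 0"
    and dU: "\<And>n t x. 0 \<le> t \<Longrightarrow> t \<le> real n \<Longrightarrow> (U n t has_real_derivative g n t x) (at x)"
    and gc: "\<And>n t. 0 \<le> t \<Longrightarrow> t \<le> real n \<Longrightarrow> continuous_on UNIV (g n t)"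
    and U2: "\<And>n t. 0 \<le> t \<Longrightarrow> t \<le> real n \<Longrightarrow> integrable lborel (\<lambda>x. (U n t x)\<^sup>2)"
    and g2: "\<And>n t. 0 \<le> t \<Longrightarrow> t \<le> real n \<Longrightarrow> integrable lborel (\<lambda>x. (g n t x)\<^sup>2)"
    and energy: "\<And>n t. 0 \<le> t \<Longrightarrow> t \<le> real n \<Longrightarrow> (LINT x|lborel. (U n t x)\<^sup>2) + (LINT x|lborel. (g n t x)\<^sup>2) \<le> E"
    and UE: "\<And>n t x. 0 \<le> t \<Longrightarrow> t \<le> real n \<Longrightarrow> \<bar>U n t x\<bar> \<le> sqrt E"
    and g\<Gamma>: "\<And>n t x. 0 \<le> t \<Longrightarrow> t \<le> real n \<Longrightarrow> \<bar>g n t x\<bar> \<le> \<Gamma> t"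
    and g1: "\<And>n t. 0 \<le> t \<Longrightarrow> t \<le> real n \<Longrightarrow> integrable lborel (g n t)"
    and g1_le: "\<And>n t. 0 \<le> t \<Longrightarrow> t \<le> real n \<Longrightarrow> (LINT x|lborel. \<bar>g n t x\<bar>) \<le> \<Gamma> t"
    and mg: "\<And>n t. 0 \<le> t \<Longrightarrow> t \<le> real n \<Longrightarrow> modl (\<Gamma> t) (g n t)"
    and inc: "\<And>n s t. 0 \<le> s \<Longrightarrow> s \<le> t \<Longrightarrow> t \<le> real n \<Longrightarrow> integrable lborel (\<lambda>x. U n t x - U n s x)"
    and inc_le: "\<And>n s t. 0 \<le> s \<Longrightarrow> s \<le> t \<Longrightarrow> t \<le> real n \<Longrightarrow> (LINT x|lborel. \<bar>U n t x - U n s x\<bar>) \<le> C * (t - s + ts n)"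
    and initial: "\<And>x. (\<lambda>n. U n 0 x) \<longlonglongrightarrow> u0 x"
    and entropy: "\<And>\<eta> \<eta>1 \<eta>2 q f ft fx B R. entropy_data \<eta> \<eta>1 \<eta>2 q f ft fx B R \<Longrightarrow>
      \<exists>L. (\<forall>n. integrable lborel (\<lambda>t. indicator {0..<L n} t * Jf \<eta> \<eta>1 q f fx (ts n) (U n) (g n) t)) \<and>
        (\<forall>\<^sub>F n in sequentially. R < L n \<and> L n \<le> R + ts n) \<and>
        (\<lambda>n. LINT t|lborel. indicator {0..<L n} t * Jf \<eta> \<eta>1 q f fx (ts n) (U n) (g n) t)
          \<longlonglongrightarrow> - (LINT x|lborel. f 0 x * \<eta> (u0 x))"

text \<open>Absolute continuity of u0 is expressed by the integral formula \<open>FTC\<close>; g0 is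
  a Borel representative of the derivative and may have jumps.\<close>

locale initial_data =
  fixes u0 g0 :: "real \<Rightarrow> real" and V :: real
  assumes u0c: "continuous_on UNIV u0" and FTC: "\<And>x s. s \<ge> 0 \<Longrightarrow> u0 (x + s) - u0 x = cv (win s) g0 x"
    and g0i: "integrable lborel g0" and Vg: "modl V g0"
    and u02: "integrable lborel (\<lambda>x. (u0 x)\<^sup>2)" and g02: "integrable lborel (\<lambda>x. (g0 x)\<^sup>2)"
begin

definition E where "E = (LINT x|lborel. (u0 x)\<^sup>2) + (LINT x|lborel. (g0 x)\<^sup>2)"

lemma E_nonneg: "0 \<le> E" by (simp add: E_def)

definition A where "A = (LINT x|lborel. \<bar>g0 x\<bar>)"

lemma A_nonneg: "0 \<le> A" by (simp add: A_def)

lemma V_nonneg: "0 \<le> V"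
proof -
  have "0 \<le> (LINT x|lborel. \<bar>g0 (x + 1) - g0 x\<bar>)" by (rule Bochner_Integration.integral_nonneg) simp
  from order_trans[OF this conjunct2[OF Vg[unfolded modl_def, rule_format, of 1]]] show ?thesis by simp
qed

lemma win_bm: "bounded_measurable (win s)"
  by (rule bounded_measurableI[where B=1]) (auto simp: win_def indicator_def)

lemma win_integrand: "integrable lborel f \<Longrightarrow> integrable lborel (\<lambda>z. win s z * f (x - z))"
  by (rule integrable_mult_bounded(2)[OF integrable_reflect_shift win_bm])

lemma u0_bound: "\<bar>u0 x\<bar> \<le> A"
proof (rule ccontr)
  assume c: "\<not> \<bar>u0 x\<bar> \<le> A"
  have osc: "\<bar>u0 (y + s) - u0 y\<bar> \<le> A" if "s \<ge> 0" for y s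
  proof -
    have "\<bar>u0 (y + s) - u0 y\<bar> \<le> (LINT z|lborel. \<bar>win s z * g0 (y - z)\<bar>)"
      unfolding FTC[OF that] cv_def by (rule integral_abs_bound)
    also have "\<dots> \<le> (LINT z|lborel. \<bar>g0 (y - z)\<bar>)"
      by (rule integral_mono) (use win_integrand[OF g0i] integrable_reflect_shift[OF g0i] in \<open>auto simp: win_def indicator_def\<close>)
    also have "\<dots> = A" unfolding A_def by (rule integral_reflect_shift)
    finally show ?thesis .
  qed
  have "(\<bar>u0 x\<bar> - A)\<^sup>2 \<le> (u0 y)\<^sup>2" for y
  proof -
    have "\<bar>u0 y - u0 x\<bar> \<le> A"
      using osc[of "y - x" x] osc[of "x - y" y] by (cases "x \<le> y") (auto simp: abs_minus_commute)
    then have "\<bar>u0 x\<bar> - A \<le> \<bar>u0 y\<bar>" by linarith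
    then have "(\<bar>u0 x\<bar> - A)\<^sup>2 \<le> \<bar>u0 y\<bar>\<^sup>2" using c by (intro power_mono) auto
    then show ?thesis by simp
  qed
  from integrable_lower_bound_nonpos[OF u02 this] show False using c by (simp add: not_le)
qed

lemma u0_bm: "bounded_measurable u0" by (rule bounded_measurable_contI[OF u0c u0_bound])

text \<open>A normalized one-sided window. A single average already suffices: it makes u0
  continuously differentiable, the new derivative being a difference quotient of the continuous u0.
  Averaging increases neither the energy nor the modulus.\<close>

definition kn :: "nat \<Rightarrow> real \<Rightarrow> real" where "kn n z = real (Suc n) * win (1 / real (Suc n)) z"

lemma kn: "integrable lborel (kn n)" "\<And>z. 0 \<le> kn n z" "(LINT z|lborel. kn n z) = 1" "(LINT z|lborel. \<bar>kn n z\<bar>) = 1"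
proof -
  show i: "integrable lborel (kn n)" unfolding kn_def[abs_def] using win_integrable by simp
  show nn: "\<And>z. 0 \<le> kn n z" using win_nonneg by (simp add: kn_def)
  show "(LINT z|lborel. kn n z) = 1" unfolding kn_def using win_integral(1)[of "1 / real (Suc n)"] by simp
  then show "(LINT z|lborel. \<bar>kn n z\<bar>) = 1" using nn by simp
qed

lemma kn_bm: "bounded_measurable (kn n)"
  by (rule bounded_measurableI[where B="real (Suc n)"])
    (use win_integrable in \<open>auto simp: kn_def[abs_def] win_def indicator_def\<close>)

lemma kn_integrand: "integrable lborel f \<Longrightarrow> integrable lborel (\<lambda>z. kn n z * f (x - z))"
  by (rule integrable_mult_bounded(2)[OF integrable_reflect_shift kn_bm])

lemma cv_kn: "cv (kn n) f x = real (Suc n) * cv (win (1 / real (Suc n))) f x"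
  by (simp add: cv_def kn_def mult.assoc)

definition U0 where "U0 n = cv (kn n) u0"

definition G0 where "G0 n = cv (kn n) g0"

lemma G0_eq: "G0 n x = real (Suc n) * (u0 (x + 1 / real (Suc n)) - u0 x)"
  unfolding G0_def cv_kn by (subst FTC) simp_all

lemma G0_cont: "continuous_on UNIV (G0 n)"
  unfolding G0_eq[abs_def] by (intro continuous_intros u0c continuous_on_compose2[OF u0c]) auto

lemma dU0: "(U0 n has_real_derivative G0 n x) (at x)"
proof -
  obtain H where H: "\<And>x. (H has_real_derivative u0 x) (at x)" using continuous_antiderivative[OF u0c] by blast
  have "U0 n = (\<lambda>x. real (Suc n) * (H (x + 1 / real (Suc n)) - H x))"
    unfolding U0_def cv_kn[abs_def] by (intro ext) (subst DERIV_increment_eq_cv[OF H u0c], simp_all)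
  moreover have "((\<lambda>x. real (Suc n) * (H (x + 1 / real (Suc n)) - H x)) has_real_derivative G0 n x) (at x)"
    unfolding G0_eq by (intro DERIV_cmult DERIV_diff H iffD1[OF DERIV_shift])
  ultimately show ?thesis by simp
qed

lemma square_contraction:
  assumes f: "f \<in> borel_measurable lborel" "integrable lborel (\<lambda>x. (f x)\<^sup>2)" "\<And>x. integrable lborel (\<lambda>z. kn n z * f (x - z))"
  shows "integrable lborel (\<lambda>x. (cv (kn n) f x)\<^sup>2)" "(LINT x|lborel. (cv (kn n) f x)\<^sup>2) \<le> (LINT x|lborel. (f x)\<^sup>2)"
proof -
  have le: "\<bar>(cv (kn n) f x)\<^sup>2\<bar> \<le> cv (kn n) (\<lambda>x. (f x)\<^sup>2) x" for x
    using cv_square_le[OF kn(1-3) f(1) f(3) kn_integrand[OF f(2)]] by simp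
  have m: "(\<lambda>x. (cv (kn n) f x)\<^sup>2) \<in> borel_measurable lborel"
    using cv_measurable[OF borel_measurable_integrable[OF kn(1)] f(1)] by measurable
  note i = cv_integrable[OF kn(1) f(2)]
  show "integrable lborel (\<lambda>x. (cv (kn n) f x)\<^sup>2)" by (rule integral_le_abs(1)[OF i le m])
  have "(LINT x|lborel. (cv (kn n) f x)\<^sup>2) \<le> (LINT x|lborel. cv (kn n) (\<lambda>x. (f x)\<^sup>2) x)"
    using integral_le_abs(2)[OF i le m] by simp
  also have "\<dots> = (LINT x|lborel. (f x)\<^sup>2)" using cv_integral_nonneg_kernel[OF kn(1) f(2)] kn(3) by simp
  finally show "(LINT x|lborel. (cv (kn n) f x)\<^sup>2) \<le> (LINT x|lborel. (f x)\<^sup>2)" .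
qed

lemma G0_L1: "integrable lborel (G0 n)" "(LINT x|lborel. \<bar>G0 n x\<bar>) \<le> A"
  using cv_integrable[OF kn(1) g0i] cv_L1[OF kn(1) g0i, of n] kn(4) by (auto simp: G0_def A_def)

lemma modl_G0: "modl V (G0 n)"
  unfolding modl_def
proof (intro allI impI)
  fix s :: real assume s: "s \<ge> 0"
  have g: "integrable lborel (\<lambda>x. g0 (x + s) - g0 x)" "(LINT x|lborel. \<bar>g0 (x + s) - g0 x\<bar>) \<le> V * s"
    using Vg s by (auto simp: modl_def)
  have eq: "G0 n (x + s) - G0 n x = cv (kn n) (\<lambda>x. g0 (x + s) - g0 x) x" for x
  proof -
    have "cv (kn n) (\<lambda>x. g0 (x + s) - g0 x) x = (LINT z|lborel. kn n z * g0 (x + s - z) - kn n z * g0 (x - z))"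
      unfolding cv_def by (simp add: right_diff_distrib algebra_simps)
    also have "\<dots> = G0 n (x + s) - G0 n x"
      unfolding G0_def cv_def by (rule Bochner_Integration.integral_diff[OF kn_integrand[OF g0i] kn_integrand[OF g0i]])
    finally show ?thesis by simp
  qed
  show "integrable lborel (\<lambda>x. G0 n (x + s) - G0 n x) \<and> (LINT x|lborel. \<bar>G0 n (x + s) - G0 n x\<bar>) \<le> V * s"
    unfolding eq using cv_integrable[OF kn(1) g(1)] cv_L1[OF kn(1) g(1), of n] kn(4) g(2) by auto
qed

text \<open>In 2 U0 - G0 the first term has modulus at most twice the L^1 norm A of u_x, the second
  at most V.\<close>

definition V0 where "V0 = 2 * A + V"

definition W0 where "W0 n x = 2 * U0 n x - G0 n x"

lemma admissible_initial: "admissible E V0 (U0 n) (W0 n)"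
proof -
  have m: "g0 \<in> borel_measurable lborel" "u0 \<in> borel_measurable lborel" using g0i u0_bm by auto
  note su = square_contraction[OF m(2) u02 cv_integrand[OF kn(1) u0_bm], of n]
  note sg = square_contraction[OF m(1) g02 kn_integrand[OF g0i], of n]
  have "modl (LINT x|lborel. \<bar>G0 n x\<bar>) (U0 n)" by (rule modl_DERIV[OF dU0 G0_cont G0_L1(1)])
  then have "modl A (U0 n)" by (rule modl_mono[OF _ G0_L1(2)])
  from modl_add[OF modl_cmult[OF this, of 2] modl_cmult[OF modl_G0[of n], of "-1"]]
  have "modl V0 (W0 n)" by (simp add: V0_def W0_def[abs_def])
  moreover have "continuous_on UNIV (W0 n)"
    unfolding W0_def[abs_def] by (intro continuous_intros G0_cont DERIV_cont[OF dU0])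
  moreover have e: "2 * U0 n x - W0 n x = G0 n x" for x by (simp add: W0_def)
  ultimately show ?thesis
    unfolding admissible_def e using dU0 su sg by (auto simp: U0_def G0_def E_def)
qed

section \<open>Parameters of the n-th approximation\<close>

definition C where "C = 1 + 8 * E"

definition Tn :: "nat \<Rightarrow> real" where "Tn n = real n + 1"

definition Mn where "Mn n = V0 + 1 + 6 * C * Tn n"

text \<open>Chosen so that h M^2 = 1 / Tn. The consistency error contains h and h M^2, the Taylor
  remainder M^2 times the time step; all of them are then at most a constant times 1 / Tn although M
  grows with n.\<close>

definition hn where "hn n = 1 / (Tn n * (Mn n)\<^sup>2)"

definition tn where "tn n = hn n / (64 * Mn n)"

lemma V0_nonneg: "0 \<le> V0" using A_nonneg V_nonneg by (simp add: V0_def)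

lemma C_ge: "1 \<le> C" using E_nonneg by (simp add: C_def)

lemma Tn_pos: "1 \<le> Tn n" by (simp add: Tn_def)

lemma Mn_ge: "1 \<le> Mn n" using V0_nonneg C_ge Tn_pos[of n] by (simp add: Mn_def)

lemma hn_pos: "hn n > 0" using Mn_ge[of n] Tn_pos[of n] by (simp add: hn_def)

lemma hnM: "hn n * (Mn n)\<^sup>2 = 1 / Tn n" using Mn_ge[of n] Tn_pos[of n] by (simp add: hn_def)

lemma scheme_n: "scheme (U0 n) (W0 n) E V0 (Mn n) (hn n) (Tn n)"
proof
  show "hn n * (Mn n)\<^sup>2 \<le> 1" unfolding hnM using Tn_pos[of n] by simp
  show "V0 + 6 * (1 + 8 * E) * Tn n \<le> Mn n" by (simp add: Mn_def C_def)
qed (use admissible_initial Mn_ge[of n] hn_pos Tn_pos[of n] in auto)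

lemma tn_eq: "scheme.ts (Mn n) (hn n) = tn n"
  using scheme.ts_def[OF scheme_n] by (simp add: tn_def)

lemma tn_pos: "tn n > 0" using hn_pos[of n] Mn_ge[of n] by (simp add: tn_def)

lemma hn_le: "hn n \<le> 1 / Tn n"
proof -
  have "hn n * 1 \<le> hn n * (Mn n)\<^sup>2" using hn_pos[of n] Mn_ge[of n] by (intro mult_left_mono) auto
  then show ?thesis unfolding hnM by simp
qed

lemma Mtn_le: "(Mn n)\<^sup>2 * tn n \<le> 1 / Tn n"
proof -
  have "(Mn n)\<^sup>2 * tn n = (1 / Tn n) / (64 * Mn n)" by (simp add: tn_def hnM[symmetric] mult.commute)
  also have "\<dots> \<le> (1 / Tn n) / 1" using Mn_ge[of n] Tn_pos[of n] by (intro divide_left_mono) auto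
  finally show ?thesis by simp
qed

lemma tn_le: "tn n \<le> 1 / Tn n"
proof -
  have "tn n * 1 \<le> tn n * (Mn n)\<^sup>2" using tn_pos[of n] Mn_ge[of n] by (intro mult_left_mono) auto
  then show ?thesis using Mtn_le[of n] by (simp add: mult.commute)
qed

lemma inverse_Tn_lim: "(\<lambda>n. 1 / Tn n) \<longlonglongrightarrow> 0"
  using LIMSEQ_inverse_Suc by (simp add: Tn_def add.commute)

definition Ua where "Ua n t = scheme.us (U0 n) (W0 n) (Mn n) (hn n) (nat \<lfloor>t / tn n\<rfloor>)"

definition ga where "ga n t = scheme.gs (U0 n) (W0 n) (Mn n) (hn n) (nat \<lfloor>t / tn n\<rfloor>)"

text \<open>One bound for three quantities at time t: the supremum of u_x, at most 2 sqrt E plus the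
  modulus of w; its L^1 norm; and its modulus, which is twice the L^1 bound plus the modulus of
  w.\<close>

definition \<Gamma> where "\<Gamma> t = 2 * (A + (18 * C * t + (2 * V0 + 6 * C * t))) + (V0 + 6 * C * t) + 2 * sqrt E"

lemma floor_step: "0 \<le> t \<Longrightarrow> real (nat \<lfloor>t / tn n\<rfloor>) * tn n \<le> t" "t < real (nat \<lfloor>t / tn n\<rfloor>) * tn n + tn n"
proof -
  have "t / tn n < of_int \<lfloor>t / tn n\<rfloor> + 1" by linarith
  also have "of_int \<lfloor>t / tn n\<rfloor> \<le> real (nat \<lfloor>t / tn n\<rfloor>)" by linarith
  finally have "t / tn n < real (nat \<lfloor>t / tn n\<rfloor>) + 1" by simp
  then show "t < real (nat \<lfloor>t / tn n\<rfloor>) * tn n + tn n"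
    using tn_pos[of n] by (simp add: pos_divide_less_eq distrib_right)
  assume "0 \<le> t"
  then have "0 \<le> t / tn n" using tn_pos[of n] by simp
  then have "real (nat \<lfloor>t / tn n\<rfloor>) \<le> t / tn n" by linarith
  then show "real (nat \<lfloor>t / tn n\<rfloor>) * tn n \<le> t" using tn_pos[of n] by (simp add: pos_le_divide_eq)
qed

lemma approximation: "approximation Ua ga tn u0 E (3 * C) \<Gamma>"
proof
  show "0 \<le> 3 * C" using C_ge by simp
  show "\<Gamma> s \<le> \<Gamma> t" if "s \<le> t" for s t
    unfolding \<Gamma>_def using that C_ge by (intro add_mono mult_left_mono order_refl) auto
  show "0 \<le> \<Gamma> t" if "0 \<le> t" for t
    unfolding \<Gamma>_def using that C_ge A_nonneg V0_nonneg E_nonneg by (intro add_nonneg_nonneg mult_nonneg_nonneg) auto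
  show "tn n > 0" for n by (rule tn_pos)
  show "tn \<longlonglongrightarrow> 0"
    by (rule tendsto_sandwich[OF _ _ tendsto_const inverse_Tn_lim])
      (auto intro!: always_eventually tn_le less_imp_le[OF tn_pos])
  have g00: "scheme.gs (U0 n) (W0 n) (Mn n) (hn n) 0 = G0 n" for n
    by (auto simp: scheme.gs_def[OF scheme_n] scheme.us_0[OF scheme_n] W0_def)
  show initial: "(\<lambda>n. Ua n 0 x) \<longlonglongrightarrow> u0 x" for x
  proof -
    obtain H where H: "\<And>x. (H has_real_derivative u0 x) (at x)" using continuous_antiderivative[OF u0c] by blast
    have "Ua n 0 x = (H (x + 1 / real (Suc n)) - H x) / (1 / real (Suc n))" for n
    proof -
      have "Ua n 0 x = U0 n x" by (simp add: Ua_def scheme.us_0[OF scheme_n])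
      also have "\<dots> = cv (kn n) u0 x" by (simp add: U0_def)
      also have "\<dots> = real (Suc n) * (H (x + 1 / real (Suc n)) - H x)"
        unfolding cv_kn by (subst DERIV_increment_eq_cv[OF H u0c]) simp_all
      finally show ?thesis by simp
    qed
    then show ?thesis using DERIV_quotient_LIMSEQ[OF H LIMSEQ_inverse_Suc] by simp
  qed
  {
    fix n :: nat and t x :: real assume t: "0 \<le> t" "t \<le> real n"
    interpret s: scheme "U0 n" "W0 n" E V0 "Mn n" "hn n" "Tn n" by (rule scheme_n)
    define k where "k = nat \<lfloor>t / tn n\<rfloor>"
    have kt: "real k * tn n \<le> t" using floor_step(1)[OF t(1)] by (simp add: k_def)
    then have k: "real k * s.ts \<le> Tn n" using t by (simp add: tn_eq Tn_def)
    have e: "Ua n t = s.us k" "ga n t = s.gs k" by (auto simp: Ua_def ga_def k_def)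
    note p = s.gs_props[OF k]
    have VkV: "s.Vk k \<le> V0 + 6 * C * t"
      using mult_left_mono[OF kt, of "6 * C"] C_ge by (simp add: s.Vk_def tn_eq C_def)
    have i0: "integrable lborel (s.gs 0)" unfolding g00 by (rule G0_L1)
    note l = s.gs_L1[OF k i0]
    define b where "b = (LINT x|lborel. \<bar>s.gs 0 x\<bar>) + (18 * (1 + 8 * E) * (real k * s.ts) + (s.Vk k + V0))"
    have b_le: "b \<le> A + (18 * C * t + (2 * V0 + 6 * C * t))"
    proof -
      have "18 * C * (real k * tn n) \<le> 18 * C * t" using kt C_ge by (intro mult_left_mono) auto
      then show ?thesis using G0_L1(2)[of n] VkV unfolding b_def g00 tn_eq C_def[symmetric] by linarith
    qed
    have b0: "0 \<le> b" using l(2) unfolding b_def[symmetric] by (meson Bochner_Integration.integral_nonneg abs_ge_zero order_trans)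
    have s0: "0 \<le> sqrt E" using E_nonneg by simp
    have Vt0: "0 \<le> V0 + 6 * C * t" using V0_nonneg C_ge t by simp
    show "(Ua n t has_real_derivative ga n t x) (at x)" "continuous_on UNIV (ga n t)"
      "integrable lborel (\<lambda>x. (Ua n t x)\<^sup>2)" "integrable lborel (\<lambda>x. (ga n t x)\<^sup>2)"
      "(LINT x|lborel. (Ua n t x)\<^sup>2) + (LINT x|lborel. (ga n t x)\<^sup>2) \<le> E"
      "\<bar>Ua n t x\<bar> \<le> sqrt E" "integrable lborel (ga n t)"
      unfolding e using p(1-6) l(1) by auto
    have b2: "2 * b \<le> 2 * (A + (18 * C * t + (2 * V0 + 6 * C * t)))" by (rule mult_left_mono[OF b_le]) simp
    show "\<bar>ga n t x\<bar> \<le> \<Gamma> t" unfolding e \<Gamma>_def using p(7)[of x] VkV b2 b0 by linarith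
    show "(LINT x|lborel. \<bar>ga n t x\<bar>) \<le> \<Gamma> t"
      unfolding e \<Gamma>_def using l(2)[folded b_def] b2 b0 Vt0 s0 by linarith
    have "2 * b + s.Vk k \<le> \<Gamma> t" unfolding \<Gamma>_def using b2 VkV s0 by linarith
    then show "modl (\<Gamma> t) (ga n t)" unfolding e using l(3)[folded b_def] by (rule modl_mono[rotated])
  }
  {
    fix n :: nat and s t :: real assume st: "0 \<le> s" "s \<le> t" "t \<le> real n"
    interpret sc: scheme "U0 n" "W0 n" E V0 "Mn n" "hn n" "Tn n" by (rule scheme_n)
    define j k where "j = nat \<lfloor>s / tn n\<rfloor>" and "k = nat \<lfloor>t / tn n\<rfloor>"
    have jk: "j \<le> k" unfolding j_def k_def using st tn_pos[of n] by (intro nat_mono floor_mono divide_right_mono) auto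
    have kt: "real k * tn n \<le> t" using floor_step(1)[of t n] st by (simp add: k_def)
    then have k: "real k * sc.ts \<le> Tn n + sc.ts" using st tn_pos[of n] by (simp add: tn_eq Tn_def)
    have js: "s < real j * tn n + tn n" using floor_step(2)[of s n] by (simp add: j_def)
    have e: "Ua n t = sc.us k" "Ua n s = sc.us j" by (auto simp: Ua_def j_def k_def)
    note i = sc.us_increment[OF jk k]
    show "integrable lborel (\<lambda>x. Ua n t x - Ua n s x)" unfolding e by (rule i(1))
    have "3 * C * (real k * tn n - real j * tn n) \<le> 3 * C * (t - s + tn n)"
      using kt js C_ge by (intro mult_left_mono) auto
    then show "(LINT x|lborel. \<bar>Ua n t x - Ua n s x\<bar>) \<le> 3 * C * (t - s + tn n)"
      unfolding e using i(2) by (simp add: tn_eq C_def)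
  }
  fix \<eta> \<eta>1 \<eta>2 q f ft fx B R assume "entropy_data \<eta> \<eta>1 \<eta>2 q f ft fx B R"
  then interpret ed: entropy_data \<eta> \<eta>1 \<eta>2 q f ft fx B R .
  obtain H K where HK: "\<And>y. \<bar>y\<bar> \<le> sqrt E \<Longrightarrow> \<bar>\<eta>1 y\<bar> \<le> H" "\<And>y. \<bar>y\<bar> \<le> sqrt E \<Longrightarrow> \<bar>\<eta>2 y\<bar> \<le> K"
    "\<And>y. \<bar>y\<bar> \<le> sqrt E \<Longrightarrow> \<bar>\<eta> y\<bar> \<le> H"
    using ed.bounds_on_range[of "sqrt E"] by metis
  have ses: "scheme_entropy_sum (U0 n) (W0 n) E V0 (Mn n) (hn n) (Tn n) \<eta> \<eta>1 \<eta>2 q f ft fx B R H K" if "R \<le> Tn n" for n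
    by (rule scheme_entropy_sum.intro[OF scheme_n ed.entropy_data_axioms]) (unfold_locales, use HK that in auto)
  define N where "N n = (if R \<le> Tn n then nat \<lfloor>R / tn n\<rfloor> + 1 else 0)" for n
  define L where "L n = real (N n) * tn n" for n
  define a where "a n k = Jf \<eta> \<eta>1 q f fx (tn n) (Ua n) (ga n) (real k * tn n)" for n k
  have fl: "nat \<lfloor>(real k * tn n) / tn n\<rfloor> = k" for n k using tn_pos[of n] by simp
  have Ja: "Jf \<eta> \<eta>1 q f fx (tn n) (Ua n) (ga n) t = a n (nat \<lfloor>t / tn n\<rfloor>)" for n t
    unfolding a_def Jf_def Ua_def ga_def fl ..
  note step = step_function_integral[OF tn_pos]
  have R_ev: "\<forall>\<^sub>F n in sequentially. R \<le> Tn n"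
  proof -
    obtain m :: nat where "R \<le> real m" using real_arch_simple by blast
    then show ?thesis by (auto simp: eventually_sequentially Tn_def intro!: exI[of _ m])
  qed
  \<comment> \<open>As soon as the horizon covers the support, the accumulated error of all steps is
    a constant times 1 / Tn; the constant depends on the entropy and the test function only.\<close>
  have bnd: "\<bar>(LINT t|lborel. indicator {0..<L n} t * Jf \<eta> \<eta>1 q f fx (tn n) (Ua n) (ga n) t)
       + (LINT x|lborel. f 0 x * \<eta> (U0 n x))\<bar>
     \<le> (R + 1) * (27 * B * K * C + (B * H + B * (K * (2 * sqrt E + (V0 + 6 * C * R)))) * (24 * E + 4)) * (1 / Tn n) \<and> R < L n \<and> L n \<le> R + tn n"
    if Rn: "R \<le> Tn n" for n
  proof -
    interpret s: scheme_entropy_sum "U0 n" "W0 n" E V0 "Mn n" "hn n" "Tn n" \<eta> \<eta>1 \<eta>2 q f ft fx B R H K by (rule ses[OF Rn])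
    have N: "N n = s.N" using Rn by (simp add: N_def s.N_def tn_eq)
    have J: "a n k = s.J k" for k
      unfolding a_def Jf_def s.J_def Ua_def ga_def fl tn_eq ..
    have "(LINT t|lborel. indicator {0..<L n} t * Jf \<eta> \<eta>1 q f fx (tn n) (Ua n) (ga n) t) = (\<Sum>k<s.N. tn n * s.J k)"
      unfolding Ja L_def step(2) N J ..
    moreover have "s.S 0 = (LINT x|lborel. f 0 x * \<eta> (U0 n x))" by (simp add: s.S_def s.us_0)
    ultimately have le: "\<bar>(LINT t|lborel. indicator {0..<L n} t * Jf \<eta> \<eta>1 q f fx (tn n) (Ua n) (ga n) t)
       + (LINT x|lborel. f 0 x * \<eta> (U0 n x))\<bar> \<le> (R + tn n) * s.err"
      using s.telescoped by (simp add: tn_eq)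
    have B0: "0 \<le> B" using ed.fB(1)[of 0 0] by linarith
    have H0: "0 \<le> H" and K0: "0 \<le> K" using HK(1)[of 0] HK(2)[of 0] E_nonneg by auto
    define D where "D = B * H + B * (K * (2 * sqrt E + (V0 + 6 * C * R)))"
    have D0: "0 \<le> D" unfolding D_def using B0 H0 K0 E_nonneg V0_nonneg C_ge ed.R by simp
    have "27 * B * K * C * ((Mn n)\<^sup>2 * tn n) \<le> 27 * B * K * C * (1 / Tn n)"
      using Mtn_le B0 K0 C_ge by (intro mult_left_mono) auto
    moreover have "D * (24 * E * hn n + 4 * (hn n * (Mn n)\<^sup>2)) \<le> D * (24 * E * (1 / Tn n) + 4 * (1 / Tn n))"
      using hn_le D0 E_nonneg by (intro mult_left_mono add_mono) (auto simp: hnM)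
    ultimately have "s.err \<le> 27 * B * K * C * (1 / Tn n) + D * (24 * E * (1 / Tn n) + 4 * (1 / Tn n))"
      unfolding s.err_def D_def C_def[symmetric] tn_eq by (simp add: mult.assoc)
    also have "\<dots> = (27 * B * K * C + D * (24 * E + 4)) * (1 / Tn n)"
    proof -
      have "y * i + D * (24 * E * i + 4 * i) = (y + D * (24 * E + 4)) * i" for y i :: real by (simp add: algebra_simps)
      then show ?thesis .
    qed
    finally have "(R + tn n) * s.err \<le> (R + 1) * ((27 * B * K * C + D * (24 * E + 4)) * (1 / Tn n))"
    proof (intro mult_mono)
      have "1 / Tn n \<le> 1" using Tn_pos[of n] by simp
      then show "R + tn n \<le> R + 1" using tn_le[of n] by linarith
      have "0 \<le> (R + s.ts) * s.err" using order_trans[OF abs_ge_zero s.telescoped] .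
      then show "0 \<le> s.err" using ed.R s.ts_pos by (simp add: zero_le_mult_iff)
    qed (use ed.R in auto)
    then show ?thesis
      using le s.N_bounds(1,2) unfolding D_def L_def N tn_eq by (simp add: mult.assoc)
  qed
  have S0: "(\<lambda>n. LINT x|lborel. f 0 x * \<eta> (U0 n x)) \<longlonglongrightarrow> (LINT x|lborel. f 0 x * \<eta> (u0 x))"
  proof (rule integral_dominated_convergence[where w="\<lambda>x. B * H * indicator {-R..R} x"])
    have U0u: "(\<lambda>n. U0 n x) \<longlonglongrightarrow> u0 x" for x
    proof -
      have "Ua n 0 x = U0 n x" for n by (simp add: Ua_def scheme.us_0[OF scheme_n])
      then show ?thesis using initial[of x] by simp
    qed
    show "AE x in lborel. (\<lambda>n. f 0 x * \<eta> (U0 n x)) \<longlonglongrightarrow> f 0 x * \<eta> (u0 x)"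
      by (intro AE_I2 tendsto_intros isCont_tendsto_compose[OF isCont_continuous[OF ed.\<eta>_cont]] U0u)
    show "AE x in lborel. norm (f 0 x * \<eta> (U0 n x)) \<le> B * H * indicator {-R..R} x" for n
    proof (rule AE_I2)
      fix x
      interpret s: scheme "U0 n" "W0 n" E V0 "Mn n" "hn n" "Tn n" by (rule scheme_n)
      have "\<bar>U0 n x\<bar> \<le> sqrt E" using s.gs_props(6)[of 0 x] Tn_pos[of n] by (simp add: s.us_0)
      then have "\<bar>f 0 x\<bar> * \<bar>\<eta> (U0 n x)\<bar> \<le> B * H"
        using ed.fB(1)[of 0 x] HK(3) by (intro mult_mono) (auto intro: order_trans[OF abs_ge_zero])
      then show "norm (f 0 x * \<eta> (U0 n x)) \<le> B * H * indicator {-R..R} x"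
        using ed.f0(1)[of 0 x] by (cases "\<bar>x\<bar> > R") (auto simp: abs_mult abs_le_iff not_less)
    qed
    show "integrable lborel (\<lambda>x. B * H * indicator {-R..R} x)" using integrable_indicator_Icc by simp
    show "(\<lambda>x. f 0 x * \<eta> (u0 x)) \<in> borel_measurable lborel"
      by (intro continuous_measurable_lborel continuous_intros ed.f_cont continuous_on_compose2[OF ed.\<eta>_cont] u0c) auto
    show "(\<lambda>x. f 0 x * \<eta> (U0 n x)) \<in> borel_measurable lborel" for n
      by (intro continuous_measurable_lborel continuous_intros ed.f_cont continuous_on_compose2[OF ed.\<eta>_cont] DERIV_cont[OF dU0]) auto
  qed
  show "\<exists>L. (\<forall>n. integrable lborel (\<lambda>t. indicator {0..<L n} t * Jf \<eta> \<eta>1 q f fx (tn n) (Ua n) (ga n) t)) \<and>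
        (\<forall>\<^sub>F n in sequentially. R < L n \<and> L n \<le> R + tn n) \<and>
        (\<lambda>n. LINT t|lborel. indicator {0..<L n} t * Jf \<eta> \<eta>1 q f fx (tn n) (Ua n) (ga n) t)
          \<longlonglongrightarrow> - (LINT x|lborel. f 0 x * \<eta> (u0 x))"
  proof (intro exI[of _ L] conjI allI)
    show "integrable lborel (\<lambda>t. indicator {0..<L n} t * Jf \<eta> \<eta>1 q f fx (tn n) (Ua n) (ga n) t)" for n
      unfolding Ja L_def by (rule step(1))
    show "\<forall>\<^sub>F n in sequentially. R < L n \<and> L n \<le> R + tn n"
      using R_ev by eventually_elim (use bnd in blast)
    have "(\<lambda>n. (LINT t|lborel. indicator {0..<L n} t * Jf \<eta> \<eta>1 q f fx (tn n) (Ua n) (ga n) t)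
       + (LINT x|lborel. f 0 x * \<eta> (U0 n x))) \<longlonglongrightarrow> 0"
    proof (rule Lim_null_comparison)
      show "\<forall>\<^sub>F n in sequentially. norm ((LINT t|lborel. indicator {0..<L n} t * Jf \<eta> \<eta>1 q f fx (tn n) (Ua n) (ga n) t)
         + (LINT x|lborel. f 0 x * \<eta> (U0 n x)))
        \<le> (R + 1) * (27 * B * K * C + (B * H + B * (K * (2 * sqrt E + (V0 + 6 * C * R)))) * (24 * E + 4)) * (1 / Tn n)"
        using R_ev by eventually_elim (use bnd in \<open>simp only: real_norm_def\<close>)
    qed (rule tendsto_mult_right_zero[OF inverse_Tn_lim])
    from tendsto_diff[OF this S0]
    show "(\<lambda>n. LINT t|lborel. indicator {0..<L n} t * Jf \<eta> \<eta>1 q f fx (tn n) (Ua n) (ga n) t)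
          \<longlonglongrightarrow> - (LINT x|lborel. f 0 x * \<eta> (u0 x))" by simp
  qed
qed

end

section \<open>Bounded convergence in \<open>L\<^sup>1\<close> on bounded intervals\<close>

text \<open>The common supremum bound B is part of the notion: it makes squares and products
  continuous and controls the tails of convolutions, which convergence on bounded intervals leaves
  open.\<close>

definition l1loc :: "real \<Rightarrow> (nat \<Rightarrow> real \<Rightarrow> real) \<Rightarrow> (real \<Rightarrow> real) \<Rightarrow> bool" where
  "l1loc B p q \<longleftrightarrow> (\<forall>n. p n \<in> borel_measurable lborel) \<and> (\<forall>n x. \<bar>p n x\<bar> \<le> B) \<and> q \<in> borel_measurable lborel \<and>
     (\<forall>x. \<bar>q x\<bar> \<le> B) \<and> (\<forall>R. (\<lambda>n. LINT x|lborel. indicator {-R..R} x * \<bar>p n x - q x\<bar>) \<longlonglongrightarrow> 0)"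

lemma integrable_interval_bounded:
  fixes p :: "real \<Rightarrow> real"
  assumes "p \<in> borel_measurable lborel" "\<And>x. \<bar>p x\<bar> \<le> B"
  shows "integrable lborel (\<lambda>x. indicator {a..b} x * p x)"
  by (rule integrable_mult_bounded(1)[OF integrable_indicator_Icc bounded_measurableI[OF assms]])

lemma l1loc_D:
  assumes "l1loc B p q"
  shows "p n \<in> borel_measurable lborel" "\<bar>p n x\<bar> \<le> B" "q \<in> borel_measurable lborel" "\<bar>q x\<bar> \<le> B"
    "(\<lambda>n. LINT x|lborel. indicator {-R..R} x * \<bar>p n x - q x\<bar>) \<longlonglongrightarrow> 0"
    "integrable lborel (\<lambda>x. indicator {a..b} x * \<bar>p n x - q x\<bar>)" "0 \<le> B"
proof -
  have 1: "p n \<in> borel_measurable lborel" "\<bar>p n x\<bar> \<le> B" "q \<in> borel_measurable lborel" "\<bar>q x\<bar> \<le> B" for x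
    using assms by (auto simp: l1loc_def)
  then show "p n \<in> borel_measurable lborel" "\<bar>p n x\<bar> \<le> B" "q \<in> borel_measurable lborel" "\<bar>q x\<bar> \<le> B" by auto
  show "(\<lambda>n. LINT x|lborel. indicator {-R..R} x * \<bar>p n x - q x\<bar>) \<longlonglongrightarrow> 0"
    using assms by (auto simp: l1loc_def)
  have "\<bar>\<bar>p n x - q x\<bar>\<bar> \<le> 2 * B" for x using 1(2,4)[of x] by linarith
  then show "integrable lborel (\<lambda>x. indicator {a..b} x * \<bar>p n x - q x\<bar>)"
    using 1 by (intro integrable_interval_bounded[where B="2 * B"]) auto
  show "0 \<le> B" using 1(2)[of 0] by linarith
qed

lemma l1loc_compare:
  assumes p: "\<And>n. p n \<in> borel_measurable lborel" "\<And>n x. \<bar>p n x\<bar> \<le> B" and q: "q \<in> borel_measurable lborel" "\<And>x. \<bar>q x\<bar> \<le> B"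
    and 1: "l1loc B1 p1 q1" and 2: "l1loc B2 p2 q2" and c: "0 \<le> c1" "0 \<le> c2"
    and le: "\<And>n x. \<bar>p n x - q x\<bar> \<le> c1 * \<bar>p1 n x - q1 x\<bar> + c2 * \<bar>p2 n x - q2 x\<bar>"
  shows "l1loc B p q"
  unfolding l1loc_def
proof (intro conjI allI p q)
  fix R :: real
  let ?I = "\<lambda>p q n. LINT x|lborel. indicator {-R..R} x * \<bar>p n x - q x\<bar>"
  have lim: "(\<lambda>n. c1 * ?I p1 q1 n + c2 * ?I p2 q2 n) \<longlonglongrightarrow> c1 * 0 + c2 * 0"
    by (intro tendsto_intros l1loc_D(5)[OF 1] l1loc_D(5)[OF 2])
  show "?I p q \<longlonglongrightarrow> 0"
  proof (rule Lim_null_comparison)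
    show "\<forall>\<^sub>F n in sequentially. norm (?I p q n) \<le> c1 * ?I p1 q1 n + c2 * ?I p2 q2 n"
    proof (intro always_eventually allI)
      fix n
      have b: "\<bar>\<bar>p n x - q x\<bar>\<bar> \<le> 2 * B" for x using p(2)[of n x] q(2)[of x] by linarith
      have m: "(\<lambda>x. \<bar>p n x - q x\<bar>) \<in> borel_measurable lborel" using p(1)[of n] q(1) by measurable
      have "?I p q n \<le> (LINT x|lborel. c1 * (indicator {-R..R} x * \<bar>p1 n x - q1 x\<bar>) + c2 * (indicator {-R..R} x * \<bar>p2 n x - q2 x\<bar>))"
      proof (rule integral_mono)
        show "integrable lborel (\<lambda>x. indicator {-R..R} x * \<bar>p n x - q x\<bar>)" by (rule integrable_interval_bounded[OF m b])
        show "integrable lborel (\<lambda>x. c1 * (indicator {-R..R} x * \<bar>p1 n x - q1 x\<bar>) + c2 * (indicator {-R..R} x * \<bar>p2 n x - q2 x\<bar>))"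
          using l1loc_D(6)[OF 1, of "-R" R n] l1loc_D(6)[OF 2, of "-R" R n] by auto
        show "indicator {-R..R} x * \<bar>p n x - q x\<bar>
          \<le> c1 * (indicator {-R..R} x * \<bar>p1 n x - q1 x\<bar>) + c2 * (indicator {-R..R} x * \<bar>p2 n x - q2 x\<bar>)" for x
          using le[of n x] by (auto split: split_indicator)
      qed
      also have "\<dots> = c1 * ?I p1 q1 n + c2 * ?I p2 q2 n"
        using l1loc_D(6)[OF 1, of "-R" R n] l1loc_D(6)[OF 2, of "-R" R n] by simp
      finally show "norm (?I p q n) \<le> c1 * ?I p1 q1 n + c2 * ?I p2 q2 n" by simp
    qed
  qed (use lim in simp)
qed

lemma l1loc_pointwise:
  assumes p: "\<And>n. p n \<in> borel_measurable lborel" "\<And>n x. \<bar>p n x\<bar> \<le> B" and lim: "\<And>x. (\<lambda>n. p n x) \<longlonglongrightarrow> q x"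
  shows "l1loc B p q"
proof -
  have q: "q \<in> borel_measurable lborel" by (rule borel_measurable_LIMSEQ_real[OF lim p(1)])
  have qB: "\<bar>q x\<bar> \<le> B" for x
    by (rule LIMSEQ_le_const2[OF tendsto_rabs[OF lim[of x]]]) (use p(2) in auto)
  show ?thesis
    unfolding l1loc_def
  proof (intro conjI allI p q qB)
    fix R :: real
    have "(\<lambda>n. LINT x|lborel. indicator {-R..R} x * \<bar>p n x - q x\<bar>) \<longlonglongrightarrow> integral\<^sup>L lborel (\<lambda>x::real. 0::real)"
    proof (rule integral_dominated_convergence[where w="\<lambda>x. 2 * B * indicator {-R..R} x"])
      show "AE x in lborel. (\<lambda>n. indicator {-R..R} x * \<bar>p n x - q x\<bar>) \<longlonglongrightarrow> 0"
      proof (rule AE_I2)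
        fix x
        have "(\<lambda>n. indicator {-R..R} x * \<bar>p n x - q x\<bar>) \<longlonglongrightarrow> indicator {-R..R} x * \<bar>q x - q x\<bar>"
          by (intro tendsto_intros lim)
        then show "(\<lambda>n. indicator {-R..R} x * \<bar>p n x - q x\<bar>) \<longlonglongrightarrow> 0" by simp
      qed
      show "AE x in lborel. norm (indicator {-R..R} x * \<bar>p n x - q x\<bar>) \<le> 2 * B * indicator {-R..R} x" for n
      proof (rule AE_I2)
        fix x show "norm (indicator {-R..R} x * \<bar>p n x - q x\<bar>) \<le> 2 * B * indicator {-R..R} x"
        proof -
          have "\<bar>p n x - q x\<bar> \<le> 2 * B" using p(2)[of n x] qB[of x] by linarith
          then show ?thesis by (simp split: split_indicator)
        qed
      qed
      show "integrable lborel (\<lambda>x. 2 * B * indicator {-R..R} x)" using integrable_indicator_Icc by simp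
      show "(\<lambda>x. indicator {-R..R} x * \<bar>p n x - q x\<bar>) \<in> borel_measurable lborel" for n
        using p(1)[of n] q by measurable
    qed simp
    then show "(\<lambda>n. LINT x|lborel. indicator {-R..R} x * \<bar>p n x - q x\<bar>) \<longlonglongrightarrow> 0" by simp
  qed
qed

lemma l1loc_add:
  assumes 1: "l1loc B1 p1 q1" and 2: "l1loc B2 p2 q2"
  shows "l1loc (B1 + B2) (\<lambda>n x. p1 n x + p2 n x) (\<lambda>x. q1 x + q2 x)"
proof (rule l1loc_compare[OF _ _ _ _ 1 2, of _ _ _ 1 1])
  show "(\<lambda>x. p1 n x + p2 n x) \<in> borel_measurable lborel" for n using l1loc_D(1)[OF 1, of n] l1loc_D(1)[OF 2, of n] by measurable
  show "(\<lambda>x. q1 x + q2 x) \<in> borel_measurable lborel" using l1loc_D(3)[OF 1] l1loc_D(3)[OF 2] by measurable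
  show "\<bar>p1 n x + p2 n x\<bar> \<le> B1 + B2" for n x using l1loc_D(2)[OF 1, of n x] l1loc_D(2)[OF 2, of n x] by linarith
  show "\<bar>q1 x + q2 x\<bar> \<le> B1 + B2" for x using l1loc_D(4)[OF 1, of x] l1loc_D(4)[OF 2, of x] by linarith
qed auto

lemma l1loc_cmult:
  assumes 1: "l1loc B p q"
  shows "l1loc (\<bar>c\<bar> * B) (\<lambda>n x. c * p n x) (\<lambda>x. c * q x)"
proof (rule l1loc_compare[OF _ _ _ _ 1 1, of _ _ _ "\<bar>c\<bar>" 0])
  show "(\<lambda>x. c * p n x) \<in> borel_measurable lborel" for n using l1loc_D(1)[OF 1, of n] by measurable
  show "(\<lambda>x. c * q x) \<in> borel_measurable lborel" using l1loc_D(3)[OF 1] by measurable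
  show "\<bar>c * p n x\<bar> \<le> \<bar>c\<bar> * B" for n x using l1loc_D(2)[OF 1, of n x] by (simp add: abs_mult mult_left_mono)
  show "\<bar>c * q x\<bar> \<le> \<bar>c\<bar> * B" for x using l1loc_D(4)[OF 1, of x] by (simp add: abs_mult mult_left_mono)
  show "\<bar>c * p n x - c * q x\<bar> \<le> \<bar>c\<bar> * \<bar>p n x - q x\<bar> + 0 * \<bar>p n x - q x\<bar>" for n x
    by (simp add: abs_mult[symmetric] right_diff_distrib)
qed auto

lemma l1loc_diff:
  assumes "l1loc B1 p1 q1" "l1loc B2 p2 q2"
  shows "l1loc (B1 + B2) (\<lambda>n x. p1 n x - p2 n x) (\<lambda>x. q1 x - q2 x)"
  using l1loc_add[OF assms(1) l1loc_cmult[OF assms(2), of "-1"]] by simp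

lemma l1loc_square:
  assumes 1: "l1loc B p q"
  shows "l1loc (B\<^sup>2) (\<lambda>n x. (p n x)\<^sup>2) (\<lambda>x. (q x)\<^sup>2)"
proof (rule l1loc_compare[OF _ _ _ _ 1 1, of _ _ _ "2 * B" 0])
  show "(\<lambda>x. (p n x)\<^sup>2) \<in> borel_measurable lborel" for n using l1loc_D(1)[OF 1, of n] by measurable
  show "(\<lambda>x. (q x)\<^sup>2) \<in> borel_measurable lborel" using l1loc_D(3)[OF 1] by measurable
  show "\<bar>(p n x)\<^sup>2\<bar> \<le> B\<^sup>2" for n x using power_mono[OF l1loc_D(2)[OF 1, of n x], of 2] by simp
  show "\<bar>(q x)\<^sup>2\<bar> \<le> B\<^sup>2" for x using power_mono[OF l1loc_D(4)[OF 1, of x], of 2] by simp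
  show "\<bar>(p n x)\<^sup>2 - (q x)\<^sup>2\<bar> \<le> 2 * B * \<bar>p n x - q x\<bar> + 0 * \<bar>p n x - q x\<bar>" for n x
  proof -
    have "(p n x)\<^sup>2 - (q x)\<^sup>2 = (p n x + q x) * (p n x - q x)" by (simp add: power2_eq_square algebra_simps)
    moreover have "\<bar>p n x + q x\<bar> \<le> 2 * B" using l1loc_D(2)[OF 1, of n x] l1loc_D(4)[OF 1, of x] by linarith
    ultimately show ?thesis by (simp add: abs_mult mult_right_mono)
  qed
qed (use l1loc_D(7)[OF 1] in auto)

lemma l1loc_shift:
  assumes 1: "l1loc B p q"
  shows "l1loc B (\<lambda>n x. p n (x + s)) (\<lambda>x. q (x + s))"
  unfolding l1loc_def
proof (intro conjI allI)
  note [measurable] = l1loc_D(1)[OF 1] l1loc_D(3)[OF 1]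
  show "(\<lambda>x. p n (x + s)) \<in> borel_measurable lborel" for n by measurable
  show "(\<lambda>x. q (x + s)) \<in> borel_measurable lborel" by measurable
  show "\<bar>p n (x + s)\<bar> \<le> B" "\<bar>q (x + s)\<bar> \<le> B" for n x using l1loc_D(2,4)[OF 1] by auto
  fix R :: real
  define S where "S = \<bar>R\<bar> + \<bar>s\<bar>"
  show "(\<lambda>n. LINT x|lborel. indicator {-R..R} x * \<bar>p n (x + s) - q (x + s)\<bar>) \<longlonglongrightarrow> 0"
  proof (rule Lim_null_comparison[OF _ l1loc_D(5)[OF 1, of S]], intro always_eventually allI)
    fix n
    note i = integrable_shift[OF l1loc_D(6)[OF 1, of "-S" S n], of s]
    have "(LINT x|lborel. indicator {-R..R} x * \<bar>p n (x + s) - q (x + s)\<bar>)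
      \<le> (LINT x|lborel. indicator {-S..S} (x + s) * \<bar>p n (x + s) - q (x + s)\<bar>)"
    proof (rule integral_mono_AE[OF _ i AE_I2])
      have "\<bar>\<bar>p n (x + s) - q (x + s)\<bar>\<bar> \<le> 2 * B" for x
        using l1loc_D(2)[OF 1, of n "x + s"] l1loc_D(4)[OF 1, of "x + s"] by linarith
      then show "integrable lborel (\<lambda>x. indicator {-R..R} x * \<bar>p n (x + s) - q (x + s)\<bar>)"
        by (intro integrable_interval_bounded) measurable
    qed (auto simp: S_def split: split_indicator)
    also have "\<dots> = (LINT x|lborel. indicator {-S..S} x * \<bar>p n x - q x\<bar>)"
      using integral_shift[of "\<lambda>x. indicator {-S..S} x * \<bar>p n x - q x\<bar>" s] .
    finally show "norm (LINT x|lborel. indicator {-R..R} x * \<bar>p n (x + s) - q (x + s)\<bar>)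
      \<le> (LINT x|lborel. indicator {-S..S} x * \<bar>p n x - q x\<bar>)" by simp
  qed
qed

lemma integrable_exhaustion:
  fixes p :: "real \<Rightarrow> real"
  assumes p: "p \<in> borel_measurable lborel" "\<And>x. 0 \<le> p x"
    and i: "\<And>n. integrable lborel (\<lambda>x. indicator {-real n..real n} x * p x)"
    and le: "\<And>n. (LINT x|lborel. indicator {-real n..real n} x * p x) \<le> K"
  shows "integrable lborel p" "(LINT x|lborel. p x) \<le> K"
proof -
  let ?f = "\<lambda>n x. indicator {-real n..real n} x * p x"
  have mono: "mono (\<lambda>n. ?f n x)" for x
    using p(2)[of x] by (intro monoI) (auto split: split_indicator)
  have lim: "(\<lambda>n. ?f n x) \<longlonglongrightarrow> p x" for x
  proof -
    obtain N where N: "\<bar>x\<bar> \<le> real N" using real_arch_simple by blast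
    have "?f n x = p x" if "n \<ge> N" for n using N that by (auto simp: abs_le_iff split: split_indicator)
    then show ?thesis by (intro tendsto_eventually) (auto simp: eventually_sequentially)
  qed
  have inc: "incseq (\<lambda>n. LINT x|lborel. ?f n x)"
    by (intro incseq_SucI integral_mono i) (auto simp: p split: split_indicator)
  obtain l where l: "(\<lambda>n. LINT x|lborel. ?f n x) \<longlonglongrightarrow> l"
    using incseq_convergent[OF inc, of K] le by blast
  show "integrable lborel p"
    by (rule integrable_monotone_convergence[OF i _ _ l p(1)]) (use mono lim in auto)
  have "(LINT x|lborel. p x) = l"
    by (rule integral_monotone_convergence[OF i _ _ l p(1)]) (use mono lim in auto)
  then show "(LINT x|lborel. p x) \<le> K" using LIMSEQ_le_const2[OF l] le by auto
qed

text \<open>Convergence gives the bound on each interval {-R..R}, and monotone convergence removes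
  the restriction. The bounds \<open>K n\<close> may vary because time increments of the
  approximations carry an extra \<open>ts n\<close>.\<close>

lemma l1loc_lower_semicontinuous:
  assumes 1: "l1loc B p q" and i: "\<And>n. integrable lborel (p n)" and le: "\<And>n. (LINT x|lborel. \<bar>p n x\<bar>) \<le> K n" and K: "K \<longlonglongrightarrow> k"
  shows "integrable lborel q" "(LINT x|lborel. \<bar>q x\<bar>) \<le> k"
proof -
  have q[measurable]: "q \<in> borel_measurable borel" using l1loc_D(3)[OF 1] by simp
  have iq: "integrable lborel (\<lambda>x. indicator {-R..R} x * \<bar>q x\<bar>)" for R
    by (rule integrable_interval_bounded[where B=B]) (use l1loc_D(4)[OF 1] in auto)
  have b: "(LINT x|lborel. indicator {-R..R} x * \<bar>q x\<bar>) \<le> k" for R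
  proof -
    have "(\<lambda>n. K n + (LINT x|lborel. indicator {-R..R} x * \<bar>p n x - q x\<bar>)) \<longlonglongrightarrow> k + 0"
      by (intro tendsto_add K l1loc_D(5)[OF 1])
    moreover have "(LINT x|lborel. indicator {-R..R} x * \<bar>q x\<bar>) \<le> K n + (LINT x|lborel. indicator {-R..R} x * \<bar>p n x - q x\<bar>)" for n
    proof -
      have "(LINT x|lborel. indicator {-R..R} x * \<bar>q x\<bar>) \<le> (LINT x|lborel. \<bar>p n x\<bar> + indicator {-R..R} x * \<bar>p n x - q x\<bar>)"
      proof (rule integral_mono[OF iq])
        show "integrable lborel (\<lambda>x. \<bar>p n x\<bar> + indicator {-R..R} x * \<bar>p n x - q x\<bar>)" using i l1loc_D(6)[OF 1] by auto
      qed (auto split: split_indicator)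
      also have "\<dots> = (LINT x|lborel. \<bar>p n x\<bar>) + (LINT x|lborel. indicator {-R..R} x * \<bar>p n x - q x\<bar>)"
        using i l1loc_D(6)[OF 1] by simp
      finally show ?thesis using le[of n] by linarith
    qed
    ultimately show ?thesis by (intro LIMSEQ_le_const) auto
  qed
  note e = integrable_exhaustion[of "\<lambda>x. \<bar>q x\<bar>", OF _ _ iq b]
  show "(LINT x|lborel. \<bar>q x\<bar>) \<le> k" by (rule e(2)) auto
  have "integrable lborel (\<lambda>x. \<bar>q x\<bar>)" by (rule e(1)) auto
  then show "integrable lborel q" by (rule Bochner_Integration.integrable_bound) auto
qed

text \<open>The test functions vary with n as well: in the discrete balance they are evaluated at
  grid times and differenced in time.\<close>

lemma l1loc_test:
  assumes 1: "l1loc B p q" and a: "\<And>n. a n \<in> borel_measurable lborel" "\<And>n x. \<bar>a n x\<bar> \<le> A" "\<And>x. (\<lambda>n. a n x) \<longlonglongrightarrow> a' x"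
    and 0: "\<And>n x. \<bar>x\<bar> > R \<Longrightarrow> a n x = 0"
  shows "(\<lambda>n. LINT x|lborel. a n x * p n x) \<longlonglongrightarrow> (LINT x|lborel. a' x * q x)"
proof -
  note [measurable] = l1loc_D(1)[OF 1] l1loc_D(3)[OF 1] a(1)
  have A0: "0 \<le> A" using a(2)[of 0 0] by linarith
  have z: "a n x = indicator {-R..R} x * a n x" for n x
    using 0[of x n] by (auto simp: abs_le_iff not_less split: split_indicator)
  have iap: "integrable lborel (\<lambda>x. a n x * h x)" if h: "h \<in> borel_measurable lborel" "\<And>x. \<bar>h x\<bar> \<le> B'" for n h B'
  proof -
    have "\<bar>a n x * h x\<bar> \<le> A * B'" for x
      unfolding abs_mult using a(2)[of n x] h(2)[of x] A0 by (intro mult_mono) auto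
    then have "integrable lborel (\<lambda>x. indicator {-R..R} x * (a n x * h x))"
      using h(1) a(1)[of n] by (intro integrable_interval_bounded) auto
    then show ?thesis by (subst z) (simp add: mult.assoc)
  qed
  have "(\<lambda>n. LINT x|lborel. a n x * (p n x - q x)) \<longlonglongrightarrow> 0"
  proof (rule Lim_null_comparison)
    show "(\<lambda>n. A * (LINT x|lborel. indicator {-R..R} x * \<bar>p n x - q x\<bar>)) \<longlonglongrightarrow> 0"
      using tendsto_mult_right_zero[OF l1loc_D(5)[OF 1]] .
    show "\<forall>\<^sub>F n in sequentially. norm (LINT x|lborel. a n x * (p n x - q x)) \<le> A * (LINT x|lborel. indicator {-R..R} x * \<bar>p n x - q x\<bar>)"
    proof (intro always_eventually allI)
      fix n
      have pq: "\<bar>p n x - q x\<bar> \<le> 2 * B" for x using l1loc_D(2)[OF 1, of n x] l1loc_D(4)[OF 1, of x] by linarith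
      have ii: "integrable lborel (\<lambda>x. a n x * (p n x - q x))" by (rule iap[OF _ pq]) measurable
      have "\<bar>LINT x|lborel. a n x * (p n x - q x)\<bar> \<le> (LINT x|lborel. \<bar>a n x * (p n x - q x)\<bar>)" by (rule integral_abs_bound)
      also have "\<dots> \<le> (LINT x|lborel. A * (indicator {-R..R} x * \<bar>p n x - q x\<bar>))"
      proof (rule integral_mono)
        show "\<bar>a n x * (p n x - q x)\<bar> \<le> A * (indicator {-R..R} x * \<bar>p n x - q x\<bar>)" for x
          using 0[of x n] mult_right_mono[OF a(2)[of n x], of "\<bar>p n x - q x\<bar>"]
          by (cases "\<bar>x\<bar> > R") (auto simp: abs_mult abs_le_iff not_less intro!: mult_nonneg_nonneg A0)
      qed (use ii l1loc_D(6)[OF 1] in auto)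
      finally show "norm (LINT x|lborel. a n x * (p n x - q x)) \<le> A * (LINT x|lborel. indicator {-R..R} x * \<bar>p n x - q x\<bar>)" by simp
    qed
  qed
  moreover have "(\<lambda>n. LINT x|lborel. a n x * q x) \<longlonglongrightarrow> (LINT x|lborel. a' x * q x)"
  proof (rule integral_dominated_convergence[where w="\<lambda>x. A * B * indicator {-R..R} x"])
    show "AE x in lborel. (\<lambda>n. a n x * q x) \<longlonglongrightarrow> a' x * q x" by (intro AE_I2 tendsto_intros a(3))
    show "AE x in lborel. norm (a n x * q x) \<le> A * B * indicator {-R..R} x" for n
    proof (rule AE_I2)
      fix x
      have "\<bar>a n x\<bar> * \<bar>q x\<bar> \<le> A * B" using a(2)[of n x] l1loc_D(4)[OF 1, of x] A0 by (intro mult_mono) auto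
      then show "norm (a n x * q x) \<le> A * B * indicator {-R..R} x"
        using 0[of x n] by (cases "\<bar>x\<bar> > R") (auto simp: abs_mult abs_le_iff not_less)
    qed
    have "a' \<in> borel_measurable lborel" by (rule borel_measurable_LIMSEQ_real[OF a(3,1)])
    then show "(\<lambda>x. a' x * q x) \<in> borel_measurable lborel" by measurable
    show "integrable lborel (\<lambda>x. A * B * indicator {-R..R} x)" using integrable_indicator_Icc by simp
  qed measurable
  ultimately have "(\<lambda>n. (LINT x|lborel. a n x * (p n x - q x)) + (LINT x|lborel. a n x * q x)) \<longlonglongrightarrow> 0 + (LINT x|lborel. a' x * q x)"
    by (rule tendsto_add)
  moreover have "(LINT x|lborel. a n x * (p n x - q x)) + (LINT x|lborel. a n x * q x) = (LINT x|lborel. a n x * p n x)" for n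
  proof -
    have "integrable lborel (\<lambda>x. a n x * p n x)" "integrable lborel (\<lambda>x. a n x * q x)"
      using iap[OF l1loc_D(1,2)[OF 1]] iap[OF l1loc_D(3,4)[OF 1]] by auto
    then show ?thesis by (simp add: right_diff_distrib)
  qed
  ultimately show ?thesis by simp
qed

text \<open>Convolution turns local L^1 convergence into pointwise convergence. Near x the kernel is
  at most 1 and the L^1 distance decides; far away the functions differ by at most 2B and the kernel
  has little mass.\<close>

lemma l1loc_cv:
  assumes 1: "l1loc B p q" and k: "integrable lborel k" "\<And>z. 0 \<le> k z" "\<And>z. k z \<le> 1"
  shows "(\<lambda>n. cv k (p n) x) \<longlonglongrightarrow> cv k q x"
proof -
  note [measurable] = l1loc_D(1)[OF 1] l1loc_D(3)[OF 1]
  have B0: "0 \<le> B" by (rule l1loc_D(7)[OF 1])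
  have bp: "bounded_measurable (p n)" for n by (rule bounded_measurableI[OF l1loc_D(1,2)[OF 1]])
  have bq: "bounded_measurable q" by (rule bounded_measurableI[OF l1loc_D(3,4)[OF 1]])
  have tail: "(\<lambda>m. LINT z|lborel. (1 - indicator {-real m..real m} z) * k z) \<longlonglongrightarrow> integral\<^sup>L lborel (\<lambda>z::real. 0::real)"
  proof (rule integral_dominated_convergence[where w=k])
    show "AE z in lborel. (\<lambda>m. (1 - indicator {-real m..real m} z) * k z) \<longlonglongrightarrow> 0"
    proof (rule AE_I2)
      fix z :: real
      obtain N where N: "\<bar>z\<bar> \<le> real N" using real_arch_simple by blast
      have "(1 - indicator {-real m..real m} z) * k z = 0" if "m \<ge> N" for m using N that by (auto simp: abs_le_iff split: split_indicator)
      then show "(\<lambda>m. (1 - indicator {-real m..real m} z) * k z) \<longlonglongrightarrow> 0"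
        by (intro tendsto_eventually) (auto simp: eventually_sequentially)
    qed
  qed (use k in \<open>auto split: split_indicator\<close>)
  show ?thesis
  proof (rule LIMSEQ_I)
    fix e :: real assume e: "e > 0"
    define e' where "e' = e / (4 * (B + 1))"
    have e': "e' > 0" using e B0 by (simp add: e'_def)
    from LIMSEQ_D[OF tail e'] obtain m where m0: "\<bar>LINT z|lborel. (1 - indicator {-real m..real m} z) * k z\<bar> < e'" by auto
    define S where "S = real m"
    have m: "(LINT z|lborel. (1 - indicator {-S..S} z) * k z) < e'" using m0 by (simp add: S_def)
    have e2: "2 * B * e' \<le> e / 2" using e B0 by (simp add: e'_def field_simps)
    define R where "R = \<bar>x\<bar> + S"
    from LIMSEQ_D[OF l1loc_D(5)[OF 1, of R], of "e / 2"] e obtain N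
      where N: "\<And>n. n \<ge> N \<Longrightarrow> (LINT y|lborel. indicator {-R..R} y * \<bar>p n y - q y\<bar>) < e / 2" by auto
    have "norm (cv k (p n) x - cv k q x) < e" if n: "n \<ge> N" for n
    proof -
      have ki: "integrable lborel (\<lambda>z. (1 - indicator {-S..S} z) * k z)"
        by (rule integrable_mult_bounded(2)[OF k(1)], rule bounded_measurableI[where B=1]) (auto split: split_indicator)
      have ri: "integrable lborel (\<lambda>z. indicator {-R..R} (x - z) * \<bar>p n (x - z) - q (x - z)\<bar>)"
        by (rule integrable_reflect_shift[OF l1loc_D(6)[OF 1]])
      have di: "integrable lborel (\<lambda>z. k z * (p n (x - z) - q (x - z)))"
        using cv_integrand[OF k(1) bp[of n], of x] cv_integrand[OF k(1) bq, of x] by (simp add: right_diff_distrib)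
      have "cv k (p n) x - cv k q x = (LINT z|lborel. k z * (p n (x - z) - q (x - z)))"
        using cv_integrand[OF k(1) bp[of n], of x] cv_integrand[OF k(1) bq, of x] by (simp add: cv_def right_diff_distrib)
      then have "\<bar>cv k (p n) x - cv k q x\<bar> \<le> (LINT z|lborel. \<bar>k z * (p n (x - z) - q (x - z))\<bar>)"
        by (simp only: integral_abs_bound)
      also have "\<dots> \<le> (LINT z|lborel. indicator {-R..R} (x - z) * \<bar>p n (x - z) - q (x - z)\<bar> + 2 * B * ((1 - indicator {-S..S} z) * k z))"
      proof (rule integral_mono)
        show "\<bar>k z * (p n (x - z) - q (x - z))\<bar>
          \<le> indicator {-R..R} (x - z) * \<bar>p n (x - z) - q (x - z)\<bar> + 2 * B * ((1 - indicator {-S..S} z) * k z)" for z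
        proof (cases "z \<in> {-S..S}")
          case True
          then have "x - z \<in> {-R..R}" by (auto simp: R_def)
          moreover have "k z * \<bar>p n (x - z) - q (x - z)\<bar> \<le> 1 * \<bar>p n (x - z) - q (x - z)\<bar>"
            using k(3) by (intro mult_right_mono) auto
          ultimately show ?thesis using True k(2)[of z] by (simp add: abs_mult)
        next
          case False
          have "\<bar>p n (x - z) - q (x - z)\<bar> \<le> 2 * B"
            using l1loc_D(2)[OF 1, of n "x - z"] l1loc_D(4)[OF 1, of "x - z"] by linarith
          then have "k z * \<bar>p n (x - z) - q (x - z)\<bar> \<le> k z * (2 * B)" using k(2) by (intro mult_left_mono) auto
          then have "\<bar>k z * (p n (x - z) - q (x - z))\<bar> \<le> 2 * B * k z" using k(2)[of z] by (simp add: abs_mult mult.commute)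
          moreover have "0 \<le> indicator {-R..R} (x - z) * \<bar>p n (x - z) - q (x - z)\<bar>" by simp
          moreover have "2 * B * ((1 - indicator {-S..S} z) * k z) = 2 * B * k z" using False by simp
          ultimately show ?thesis by linarith
        qed
      qed (use di ri ki in auto)
      also have "\<dots> = (LINT z|lborel. indicator {-R..R} (x - z) * \<bar>p n (x - z) - q (x - z)\<bar>) + 2 * B * (LINT z|lborel. (1 - indicator {-S..S} z) * k z)"
        using ri ki by simp
      also have "(LINT z|lborel. indicator {-R..R} (x - z) * \<bar>p n (x - z) - q (x - z)\<bar>) = (LINT y|lborel. indicator {-R..R} y * \<bar>p n y - q y\<bar>)"
        by (rule integral_reflect_shift)
      also have "(LINT y|lborel. indicator {-R..R} y * \<bar>p n y - q y\<bar>) + 2 * B * (LINT z|lborel. (1 - indicator {-S..S} z) * k z) < e / 2 + e / 2"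
      proof (rule add_less_le_mono[OF N[OF n]])
        have "2 * B * (LINT z|lborel. (1 - indicator {-S..S} z) * k z) \<le> 2 * B * e'" using m B0 by (intro mult_left_mono) auto
        then show "2 * B * (LINT z|lborel. (1 - indicator {-S..S} z) * k z) \<le> e / 2" using e2 by linarith
      qed
      finally show ?thesis by simp
    qed
    then show "\<exists>N. \<forall>n\<ge>N. norm (cv k (p n) x - cv k q x) < e" by blast
  qed
qed

text \<open>Difference quotients at the dyadic scales \<open>2\<^sup>-\<^sup>j\<close> are Cauchy in \<open>L\<^sup>1\<close> with summable increments, uniformly
  along the sequence; their almost everywhere limit is the weak derivative of the limit.\<close>

lemma derivative_limit:
  assumes dU: "\<And>n x. (U n has_real_derivative g n x) (at x)" and gc: "\<And>n. continuous_on UNIV (g n)"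
    and gB: "\<And>n x. \<bar>g n x\<bar> \<le> B" and mg: "\<And>n. modl B (g n)" and lim: "\<And>x. (\<lambda>n. U n x) \<longlonglongrightarrow> u x"
  obtains v where "l1loc B g v"
proof -
  define r :: "nat \<Rightarrow> real" where "r j = (1/2) ^ j" for j
  have r: "r j > 0" for j by (simp add: r_def)
  define An where "An n j x = (U n (x + r j) - U n x) / r j" for n j x
  define A where "A j x = (u (x + r j) - u x) / r j" for j x
  have B0: "0 \<le> B" using gB[of 0 0] by linarith
  have Uc: "continuous_on UNIV (U n)" for n by (rule DERIV_cont[OF dU])
  have Anc: "continuous_on UNIV (An n j)" for n j
    unfolding An_def[abs_def] by (intro continuous_intros Uc continuous_on_compose2[OF Uc]) (use r[of j] in auto)
  have Anm[measurable]: "An n j \<in> borel_measurable borel" for n j using continuous_measurable_lborel[OF Anc] by simp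
  have AnB: "\<bar>An n j x\<bar> \<le> B" for n j x
    using DERIV_bounded_imp_Lipschitz[OF dU gB, of n "x + r j" x] r[of j] by (simp add: An_def pos_divide_le_eq)
  have Alim: "(\<lambda>n. An n j x) \<longlonglongrightarrow> A j x" for j x
    unfolding An_def A_def by (intro tendsto_intros lim) (use r[of j] in auto)
  have lA: "l1loc B (\<lambda>n. An n j) (A j)" for j by (rule l1loc_pointwise[OF _ AnB Alim]) simp
  have Am[measurable]: "A j \<in> borel_measurable borel" for j using l1loc_D(3)[OF lA] by simp
  have AB: "\<bar>A j x\<bar> \<le> B" for j x by (rule l1loc_D(4)[OF lA])
  have dist: "integrable lborel (\<lambda>x. An n j x - g n x)" "(LINT x|lborel. \<bar>An n j x - g n x\<bar>) \<le> B * r j" for n j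
  proof -
    have gb: "bounded_measurable (g n)" by (rule bounded_measurable_contI[OF gc gB])
    note av = modl_average[OF continuous_measurable_lborel[OF gc[of n]] mg[of n] less_imp_le[OF r[of j]] cv_integrand[OF win_integrable gb]]
    have "An n j x - g n x = (1 / r j) * (cv (win (r j)) (g n) x - r j * g n x)" for x
      unfolding An_def DERIV_increment_eq_cv[OF dU[of n] gc[of n] less_imp_le[OF r[of j]], symmetric] using r[of j] by (simp add: field_simps)
    moreover have "(1 / r j) * (LINT x|lborel. \<bar>cv (win (r j)) (g n) x - r j * g n x\<bar>) \<le> (1 / r j) * (B * (r j)\<^sup>2)"
      using av(2) r[of j] by (intro mult_left_mono) auto
    moreover have "(1 / r j) * (B * (r j)\<^sup>2) = B * r j" using r[of j] by (simp add: power2_eq_square)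
    ultimately show "integrable lborel (\<lambda>x. An n j x - g n x)" "(LINT x|lborel. \<bar>An n j x - g n x\<bar>) \<le> B * r j"
      using av(1) r[of j] by (auto simp: abs_mult)
  qed
  have incr: "integrable lborel (\<lambda>x. A (Suc j) x - A j x)" "(LINT x|lborel. \<bar>A (Suc j) x - A j x\<bar>) \<le> 2 * B * r j" for j
  proof -
    have eq: "An n (Suc j) x - An n j x = 1 * (An n (Suc j) x - g n x) + (-1) * (An n j x - g n x)" for n x by simp
    have n: "integrable lborel (\<lambda>x. An n (Suc j) x - An n j x)" "(LINT x|lborel. \<bar>An n (Suc j) x - An n j x\<bar>) \<le> 2 * B * r j" for n
    proof -
      have "\<bar>1\<bar> * (B * r (Suc j)) + \<bar>-1\<bar> * (B * r j) \<le> 2 * B * r j" using B0 by (simp add: r_def)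
      then show "integrable lborel (\<lambda>x. An n (Suc j) x - An n j x)" "(LINT x|lborel. \<bar>An n (Suc j) x - An n j x\<bar>) \<le> 2 * B * r j"
        unfolding eq using lincomb_L1[OF dist[of n "Suc j"] dist[of n j], of 1 "-1"] by linarith+
    qed
    from l1loc_lower_semicontinuous[OF l1loc_diff[OF lA lA] n tendsto_const]
    show "integrable lborel (\<lambda>x. A (Suc j) x - A j x)" "(LINT x|lborel. \<bar>A (Suc j) x - A j x\<bar>) \<le> 2 * B * r j" by auto
  qed
  have "(\<integral>\<^sup>+x. (\<Sum>j. ennreal \<bar>A (Suc j) x - A j x\<bar>) \<partial>lborel) = (\<Sum>j. \<integral>\<^sup>+x. ennreal \<bar>A (Suc j) x - A j x\<bar> \<partial>lborel)"
    by (rule nn_integral_suminf) measurable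
  also have "\<dots> \<le> (\<Sum>j. ennreal (2 * B * r j))"
  proof (rule suminf_le)
    fix j
    have "(\<integral>\<^sup>+x. ennreal \<bar>A (Suc j) x - A j x\<bar> \<partial>lborel) = ennreal (LINT x|lborel. \<bar>A (Suc j) x - A j x\<bar>)"
      by (rule nn_integral_eq_integral) (use incr in auto)
    also have "\<dots> \<le> ennreal (2 * B * r j)" by (rule ennreal_leI[OF incr(2)])
    finally show "(\<integral>\<^sup>+x. ennreal \<bar>A (Suc j) x - A j x\<bar> \<partial>lborel) \<le> ennreal (2 * B * r j)" .
  qed auto
  also have "\<dots> < \<infinity>"
  proof -
    have "summable (\<lambda>j. 2 * B * r j)" unfolding r_def by (intro summable_mult summable_geometric) simp
    moreover have "0 \<le> 2 * B * r j" for j using B0 less_imp_le[OF r[of j]] by simp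
    ultimately have "(\<Sum>j. ennreal (2 * B * r j)) = ennreal (\<Sum>j. 2 * B * r j)" by (intro suminf_ennreal2)
    then show ?thesis by simp
  qed
  finally have "AE x in lborel. (\<Sum>j. ennreal \<bar>A (Suc j) x - A j x\<bar>) \<noteq> \<infinity>"
    by (intro nn_integral_noteq_infinite) (auto simp: less_top)
  then have conv: "AE x in lborel. convergent (\<lambda>j. A j x)"
  proof eventually_elim
    case (elim x)
    have "summable (\<lambda>j. \<bar>A (Suc j) x - A j x\<bar>)"
      by (rule summable_suminf_not_top) (use elim in auto)
    then have "summable (\<lambda>j. A (Suc j) x - A j x)" by (rule summable_rabs_cancel)
    then have "convergent (\<lambda>n. \<Sum>j<n. A (Suc j) x - A j x)" by (simp add: summable_iff_convergent)
    then have "convergent (\<lambda>n. A n x - A 0 x)" by (simp add: sum_lessThan_telescope[of "\<lambda>j. A j x"])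
    then have "convergent (\<lambda>n. (A n x - A 0 x) + A 0 x)" by (intro convergent_add convergent_const)
    then show ?case by simp
  qed
  \<comment> \<open>Clamping leaves the limit unchanged where it exists and extends the bound by B
    to the exceptional null set, where \<open>lim\<close> is arbitrary.\<close>
  define v where "v x = max (- B) (min B (lim (\<lambda>j. A j x)))" for x
  have vm[measurable]: "v \<in> borel_measurable borel" unfolding v_def[abs_def] by measurable
  have vB: "\<bar>v x\<bar> \<le> B" for x unfolding v_def using B0 by auto
  have vlim: "AE x in lborel. (\<lambda>j. A j x) \<longlonglongrightarrow> v x"
    using conv
  proof eventually_elim
    case (elim x)
    then have l: "(\<lambda>j. A j x) \<longlonglongrightarrow> lim (\<lambda>j. A j x)" by (simp add: convergent_LIMSEQ_iff)
    have "\<bar>lim (\<lambda>j. A j x)\<bar> \<le> B" by (rule LIMSEQ_le_const2[OF tendsto_rabs[OF l]]) (use AB in auto)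
    then have "v x = lim (\<lambda>j. A j x)" by (auto simp: v_def abs_le_iff)
    then show ?case using l by simp
  qed
  have "l1loc B g v"
    unfolding l1loc_def
  proof (intro conjI allI)
    show "g n \<in> borel_measurable lborel" for n by (rule continuous_measurable_lborel[OF gc])
    fix R :: real
    have Av: "(\<lambda>j. LINT x|lborel. indicator {-R..R} x * \<bar>A j x - v x\<bar>) \<longlonglongrightarrow> integral\<^sup>L lborel (\<lambda>x::real. 0::real)"
    proof (rule integral_dominated_convergence[where w="\<lambda>x. 2 * B * indicator {-R..R} x"])
      show "AE x in lborel. (\<lambda>j. indicator {-R..R} x * \<bar>A j x - v x\<bar>) \<longlonglongrightarrow> 0"
        using vlim
      proof eventually_elim
        case (elim x)
        have "(\<lambda>j. indicator {-R..R} x * \<bar>A j x - v x\<bar>) \<longlonglongrightarrow> indicator {-R..R} x * \<bar>v x - v x\<bar>"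
          by (intro tendsto_intros elim)
        then show ?case by simp
      qed
      show "AE x in lborel. norm (indicator {-R..R} x * \<bar>A j x - v x\<bar>) \<le> 2 * B * indicator {-R..R} x" for j
      proof (rule AE_I2)
        fix x show "norm (indicator {-R..R} x * \<bar>A j x - v x\<bar>) \<le> 2 * B * indicator {-R..R} x"
        proof -
          have "\<bar>A j x - v x\<bar> \<le> 2 * B" using AB[of j x] vB[of x] by linarith
          then show ?thesis by (simp split: split_indicator)
        qed
      qed
      show "integrable lborel (\<lambda>x. 2 * B * indicator {-R..R} x)" using integrable_indicator_Icc by simp
    qed measurable
    show "(\<lambda>n. LINT x|lborel. indicator {-R..R} x * \<bar>g n x - v x\<bar>) \<longlonglongrightarrow> 0"
    proof (rule LIMSEQ_I)
      fix e :: real assume e: "e > 0"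
      \<comment> \<open>The scale j is fixed first: the distance of \<open>g n\<close> from its
        difference quotient is at most B 2^-j for all n at once, so only then does n have to be
        large.\<close>
      have "(\<lambda>j. B * r j + (LINT x|lborel. indicator {-R..R} x * \<bar>A j x - v x\<bar>)) \<longlonglongrightarrow> B * 0 + 0"
        unfolding r_def using Av by (intro tendsto_add tendsto_mult tendsto_const LIMSEQ_power_zero) auto
      then obtain j where j: "\<bar>B * r j + (LINT x|lborel. indicator {-R..R} x * \<bar>A j x - v x\<bar>)\<bar> < e / 2"
        using LIMSEQ_D[of _ "B * 0 + 0" "e / 2"] e by fastforce
      from LIMSEQ_D[OF l1loc_D(5)[OF lA[of j], of R], of "e / 2"] e obtain N
        where N: "\<And>n. n \<ge> N \<Longrightarrow> (LINT x|lborel. indicator {-R..R} x * \<bar>An n j x - A j x\<bar>) < e / 2" by auto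
      have "norm ((LINT x|lborel. indicator {-R..R} x * \<bar>g n x - v x\<bar>) - 0) < e" if n: "n \<ge> N" for n
      proof -
        have i1: "integrable lborel (\<lambda>x. indicator {-R..R} x * \<bar>g n x - v x\<bar>)"
          using continuous_measurable_lborel[OF gc[of n]]
          by (intro integrable_interval_bounded[where B="2 * B"]) (use gB[of n] vB in \<open>auto intro: order_trans[OF abs_triangle_ineq4] add_mono[of _ B _ B, simplified]\<close>)
        have i2: "integrable lborel (\<lambda>x. indicator {-R..R} x * \<bar>An n j x - A j x\<bar>)" by (rule l1loc_D(6)[OF lA])
        have i3: "integrable lborel (\<lambda>x. indicator {-R..R} x * \<bar>A j x - v x\<bar>)"
          by (intro integrable_interval_bounded[where B="2 * B"]) (use AB[of j] vB in \<open>auto intro: order_trans[OF abs_triangle_ineq4] add_mono[of _ B _ B, simplified]\<close>)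
        have "(LINT x|lborel. indicator {-R..R} x * \<bar>g n x - v x\<bar>)
          \<le> (LINT x|lborel. \<bar>An n j x - g n x\<bar> + (indicator {-R..R} x * \<bar>An n j x - A j x\<bar> + indicator {-R..R} x * \<bar>A j x - v x\<bar>))"
          by (rule integral_mono) (use i1 i2 i3 dist(1)[of n j] in \<open>auto split: split_indicator\<close>)
        also have "\<dots> = (LINT x|lborel. \<bar>An n j x - g n x\<bar>)
          + ((LINT x|lborel. indicator {-R..R} x * \<bar>An n j x - A j x\<bar>) + (LINT x|lborel. indicator {-R..R} x * \<bar>A j x - v x\<bar>))"
          using i2 i3 dist(1)[of n j] by simp
        finally have "(LINT x|lborel. indicator {-R..R} x * \<bar>g n x - v x\<bar>) < e" using dist(2)[of n j] N[OF n] j by linarith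
        then show ?thesis by simp
      qed
      then show "\<exists>N. \<forall>n\<ge>N. norm ((LINT x|lborel. indicator {-R..R} x * \<bar>g n x - v x\<bar>) - 0) < e" by blast
    qed
  qed (use gB vB in auto)
  then show ?thesis by (rule that)
qed

section \<open>Passage to the limit\<close>

text \<open>A Lipschitz function stays near its value at x on a window of length \<rho>, so a large
  value would cost L^1 norm. The free \<rho> balances the two terms.\<close>

lemma sup_bound_from_L1:
  fixes f :: "real \<Rightarrow> real"
  assumes f: "\<And>x y. \<bar>f x - f y\<bar> \<le> \<Lambda> * \<bar>x - y\<bar>" "integrable lborel f" and \<rho>: "\<rho> > 0"
  shows "\<bar>f x\<bar> \<le> (LINT x|lborel. \<bar>f x\<bar>) / \<rho> + \<Lambda> * \<rho>"
proof -
  have \<Lambda>: "0 \<le> \<Lambda>" using f(1)[of 0 1] by simp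
  have wf: "integrable lborel (\<lambda>z. \<bar>f (x - z)\<bar>)" using integrable_reflect_shift[OF f(2)] by auto
  have "\<rho> * \<bar>f x\<bar> = (LINT z|lborel. win \<rho> z * \<bar>f x\<bar>)" using win_integral(1)[of \<rho>] \<rho> by simp
  also have "\<dots> \<le> (LINT z|lborel. \<bar>f (x - z)\<bar> + \<Lambda> * \<rho> * win \<rho> z)"
  proof (rule integral_mono)
    show "win \<rho> z * \<bar>f x\<bar> \<le> \<bar>f (x - z)\<bar> + \<Lambda> * \<rho> * win \<rho> z" for z
    proof (cases "z \<in> {-\<rho>..0}")
      case True
      have "\<Lambda> * \<bar>x - (x - z)\<bar> \<le> \<Lambda> * \<rho>" using True \<Lambda> by (intro mult_left_mono) auto
      then have "\<bar>f x\<bar> \<le> \<bar>f (x - z)\<bar> + \<Lambda> * \<rho>" using f(1)[of x "x - z"] by linarith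
      then show ?thesis using True by (simp add: win_def)
    qed (simp add: win_def)
  qed (use win_integrable wf in auto)
  also have "\<dots> = (LINT z|lborel. \<bar>f z\<bar>) + \<Lambda> * \<rho> * \<rho>"
    using win_integrable wf win_integral(1)[of \<rho>] \<rho> integral_reflect_shift[of "\<lambda>z. \<bar>f z\<bar>" x] by simp
  finally have "\<rho> * \<bar>f x\<bar> / \<rho> \<le> ((LINT z|lborel. \<bar>f z\<bar>) + \<Lambda> * \<rho> * \<rho>) / \<rho>"
    using \<rho> by (intro divide_right_mono) auto
  then show ?thesis using \<rho> by (simp add: add_divide_distrib)
qed

text \<open>The derivative is the difference quotient with step r, of L^1 norm at most 2/r times
  that of f, up to an averaging error W r.\<close>

lemma derivative_L1_interpolation:
  assumes f: "\<And>x. (f has_real_derivative \<gamma> x) (at x)" "integrable lborel f"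
    and \<gamma>: "continuous_on UNIV \<gamma>" "\<And>x. \<bar>\<gamma> x\<bar> \<le> B" "modl W \<gamma>" and r: "r > 0"
  shows "integrable lborel \<gamma>" "(LINT x|lborel. \<bar>\<gamma> x\<bar>) \<le> 2 / r * (LINT x|lborel. \<bar>f x\<bar>) + W * r"
proof -
  define A where "A = (LINT x|lborel. \<bar>f x\<bar>)"
  have gb: "bounded_measurable \<gamma>" by (rule bounded_measurable_contI[OF \<gamma>(1,2)])
  note av = modl_average[OF continuous_measurable_lborel[OF \<gamma>(1)] \<gamma>(3) less_imp_le[OF r] cv_integrand[OF win_integrable gb]]
  have sh: "(LINT x|lborel. \<bar>f (x + r)\<bar>) \<le> A" "(LINT x|lborel. \<bar>f x\<bar>) \<le> A"
    by (simp_all add: A_def integral_shift[of "\<lambda>x. \<bar>f x\<bar>"])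
  note d = lincomb_L1[OF integrable_shift[OF f(2)] sh(1) f(2) sh(2), of 1 "-1"]
  have eq: "\<gamma> = (\<lambda>x. (1 / r) * (1 * f (x + r) + (-1) * f x) + (- 1 / r) * (cv (win r) \<gamma> x - r * \<gamma> x))"
    unfolding DERIV_increment_eq_cv[OF f(1) \<gamma>(1) less_imp_le[OF r], symmetric] using r by (auto simp: field_simps)
  note l = lincomb_L1[OF d av, of "1 / r" "- 1 / r"]
  show "integrable lborel \<gamma>" by (subst eq, rule l(1))
  have "(LINT x|lborel. \<bar>\<gamma> x\<bar>) \<le> \<bar>1 / r\<bar> * (\<bar>1\<bar> * A + \<bar>-1\<bar> * A) + \<bar>- 1 / r\<bar> * (W * r\<^sup>2)"
    by (subst eq, rule l(2))
  also have "\<dots> = 2 / r * A + W * r" using r by (simp add: power2_eq_square)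
  finally show "(LINT x|lborel. \<bar>\<gamma> x\<bar>) \<le> 2 / r * (LINT x|lborel. \<bar>f x\<bar>) + W * r" unfolding A_def .
qed

lemma l1loc_offset: "l1loc B p q \<Longrightarrow> l1loc B (\<lambda>n. p (n + m)) q"
  unfolding l1loc_def using LIMSEQ_ignore_initial_segment by fast

lemma abs_integral_compact_support_le:
  fixes a p :: "real \<Rightarrow> real"
  assumes "\<And>x. \<bar>a x\<bar> \<le> A" "\<And>x. \<bar>p x\<bar> \<le> P" "\<And>x. \<bar>x\<bar> > R \<Longrightarrow> a x = 0" "R > 0"
    and m: "a \<in> borel_measurable lborel" "p \<in> borel_measurable lborel"
  shows "\<bar>LINT x|lborel. a x * p x\<bar> \<le> 2 * R * (A * P)"
proof -
  have A0: "0 \<le> A" and P0: "0 \<le> P" using assms(1)[of 0] assms(2)[of 0] by linarith+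
  have le: "\<bar>a x * p x\<bar> \<le> A * P * indicator {-R..R} x" for x
  proof (cases "\<bar>x\<bar> > R")
    case False
    have "\<bar>a x\<bar> * \<bar>p x\<bar> \<le> A * P" using assms(1,2) A0 by (intro mult_mono) auto
    then show ?thesis using False by (auto simp: abs_mult abs_le_iff not_less)
  qed (use assms(3) A0 P0 in simp)
  have i: "integrable lborel (\<lambda>x. A * P * indicator {-R..R} x)" using integrable_indicator_Icc by simp
  have mm: "(\<lambda>x. a x * p x) \<in> borel_measurable lborel" using m by measurable
  have "\<bar>LINT x|lborel. a x * p x\<bar> \<le> (LINT x|lborel. \<bar>a x * p x\<bar>)" by (rule integral_abs_bound)
  also have "\<dots> \<le> (LINT x|lborel. A * P * indicator {-R..R} x)" by (rule integral_le_abs(2)[OF i le mm])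
  also have "\<dots> = 2 * R * (A * P)" using assms(4) by simp
  finally show ?thesis .
qed

section \<open>Equicontinuity and a convergent subsequence\<close>

context approximation
begin

lemma E0: "0 \<le> E"
proof -
  have "0 \<le> (LINT x|lborel. (U 0 0 x)\<^sup>2) + (LINT x|lborel. (g 0 0 x)\<^sup>2)" by simp
  from order_trans[OF this energy[of 0 0]] show ?thesis by simp
qed

lemma Uc: "0 \<le> t \<Longrightarrow> t \<le> real n \<Longrightarrow> continuous_on UNIV (U n t)"
  using DERIV_cont dU by blast

lemma U_Lipschitz: "0 \<le> t \<Longrightarrow> t \<le> real n \<Longrightarrow> \<bar>U n t x - U n t y\<bar> \<le> \<Gamma> t * \<bar>x - y\<bar>"
  by (rule DERIV_bounded_imp_Lipschitz[OF dU g\<Gamma>])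

lemma U_time:
  assumes "0 \<le> s" "s \<le> t" "t \<le> real n" "\<rho> > 0"
  shows "\<bar>U n t x - U n s x\<bar> \<le> C * (t - s + ts n) / \<rho> + (\<Gamma> t + \<Gamma> s) * \<rho>"
proof -
  have "\<bar>U n t x - U n s x\<bar> \<le> (LINT x|lborel. \<bar>U n t x - U n s x\<bar>) / \<rho> + (\<Gamma> t + \<Gamma> s) * \<rho>"
  proof (rule sup_bound_from_L1[OF _ inc[OF assms(1-3)] assms(4)])
    show "\<bar>(U n t x - U n s x) - (U n t y - U n s y)\<bar> \<le> (\<Gamma> t + \<Gamma> s) * \<bar>x - y\<bar>" for x y
      using U_Lipschitz[of t n x y] U_Lipschitz[of s n x y] assms unfolding distrib_right by linarith
  qed
  also have "\<dots> \<le> C * (t - s + ts n) / \<rho> + (\<Gamma> t + \<Gamma> s) * \<rho>"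
    using inc_le[OF assms(1-3)] assms(4) by (intro add_right_mono divide_right_mono) auto
  finally show ?thesis .
qed

text \<open>Since r n is at least n, the n-th selected approximation is still controlled on [0, n],
  and the interface carries over unchanged.\<close>

lemma subsequence:
  assumes r: "strict_mono r"
  shows "approximation (\<lambda>n. U (r n)) (\<lambda>n. g (r n)) (\<lambda>n. ts (r n)) u0 E C \<Gamma>"
proof
  have rn: "real n \<le> real (r n)" for n using seq_suble[OF r] by simp
  note le = order_trans[OF _ rn]
  fix n s t x
  show "\<lbrakk>0 \<le> t; t \<le> real n\<rbrakk> \<Longrightarrow> (U (r n) t has_real_derivative g (r n) t x) (at x)" using dU le by blast
  show "\<lbrakk>0 \<le> t; t \<le> real n\<rbrakk> \<Longrightarrow> continuous_on UNIV (g (r n) t)" using gc le by blast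
  show "\<lbrakk>0 \<le> t; t \<le> real n\<rbrakk> \<Longrightarrow> integrable lborel (\<lambda>x. (U (r n) t x)\<^sup>2)" using U2 le by blast
  show "\<lbrakk>0 \<le> t; t \<le> real n\<rbrakk> \<Longrightarrow> integrable lborel (\<lambda>x. (g (r n) t x)\<^sup>2)" using g2 le by blast
  show "\<lbrakk>0 \<le> t; t \<le> real n\<rbrakk> \<Longrightarrow> (LINT x|lborel. (U (r n) t x)\<^sup>2) + (LINT x|lborel. (g (r n) t x)\<^sup>2) \<le> E" using energy le by blast
  show "\<lbrakk>0 \<le> t; t \<le> real n\<rbrakk> \<Longrightarrow> \<bar>U (r n) t x\<bar> \<le> sqrt E" using UE le by blast
  show "\<lbrakk>0 \<le> t; t \<le> real n\<rbrakk> \<Longrightarrow> \<bar>g (r n) t x\<bar> \<le> \<Gamma> t" using g\<Gamma> le by blast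
  show "\<lbrakk>0 \<le> t; t \<le> real n\<rbrakk> \<Longrightarrow> integrable lborel (g (r n) t)" using g1 le by blast
  show "\<lbrakk>0 \<le> t; t \<le> real n\<rbrakk> \<Longrightarrow> (LINT x|lborel. \<bar>g (r n) t x\<bar>) \<le> \<Gamma> t" using g1_le le by blast
  show "\<lbrakk>0 \<le> t; t \<le> real n\<rbrakk> \<Longrightarrow> modl (\<Gamma> t) (g (r n) t)" using mg le by blast
  show "\<lbrakk>0 \<le> s; s \<le> t; t \<le> real n\<rbrakk> \<Longrightarrow> integrable lborel (\<lambda>x. U (r n) t x - U (r n) s x)" using inc le by blast
  show "\<lbrakk>0 \<le> s; s \<le> t; t \<le> real n\<rbrakk> \<Longrightarrow> (LINT x|lborel. \<bar>U (r n) t x - U (r n) s x\<bar>) \<le> C * (t - s + ts (r n))" using inc_le le by blast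
next
  show "(\<lambda>n. ts (r n)) \<longlonglongrightarrow> 0" using LIMSEQ_subseq_LIMSEQ[OF ts_lim r] by (simp add: o_def)
  show "(\<lambda>n. U (r n) 0 x) \<longlonglongrightarrow> u0 x" for x using LIMSEQ_subseq_LIMSEQ[OF initial r] by (simp add: o_def)
  fix \<eta> \<eta>1 \<eta>2 q f ft fx B R assume "entropy_data \<eta> \<eta>1 \<eta>2 q f ft fx B R"
  from entropy[OF this] obtain L where L: "\<And>n. integrable lborel (\<lambda>t. indicator {0..<L n} t * Jf \<eta> \<eta>1 q f fx (ts n) (U n) (g n) t)"
    "\<forall>\<^sub>F n in sequentially. R < L n \<and> L n \<le> R + ts n"
    "(\<lambda>n. LINT t|lborel. indicator {0..<L n} t * Jf \<eta> \<eta>1 q f fx (ts n) (U n) (g n) t) \<longlonglongrightarrow> - (LINT x|lborel. f 0 x * \<eta> (u0 x))"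
    by blast
  show "\<exists>L. (\<forall>n. integrable lborel (\<lambda>t. indicator {0..<L n} t * Jf \<eta> \<eta>1 q f fx (ts (r n)) (U (r n)) (g (r n)) t)) \<and>
        (\<forall>\<^sub>F n in sequentially. R < L n \<and> L n \<le> R + ts (r n)) \<and>
        (\<lambda>n. LINT t|lborel. indicator {0..<L n} t * Jf \<eta> \<eta>1 q f fx (ts (r n)) (U (r n)) (g (r n)) t)
          \<longlonglongrightarrow> - (LINT x|lborel. f 0 x * \<eta> (u0 x))"
  proof (intro exI[of _ "\<lambda>n. L (r n)"] conjI allI L(1))
    show "\<forall>\<^sub>F n in sequentially. R < L (r n) \<and> L (r n) \<le> R + ts (r n)"
      using eventually_subseq[OF r L(2)] .
    show "(\<lambda>n. LINT t|lborel. indicator {0..<L (r n)} t * Jf \<eta> \<eta>1 q f fx (ts (r n)) (U (r n)) (g (r n)) t)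
          \<longlonglongrightarrow> - (LINT x|lborel. f 0 x * \<eta> (u0 x))"
      using LIMSEQ_subseq_LIMSEQ[OF L(3) r] by (simp add: o_def)
  qed
qed (use C0 \<Gamma>_mono \<Gamma>0 ts_pos in auto)

text \<open>A diagonal sequence converges at all rational points. The Lipschitz bound in x and the
  bound in t, which becomes uniform as \<open>ts\<close> tends to 0, make it Cauchy at every other
  point. Before its lifetime covers t an approximation is replaced by 0, which is harmless for the
  limit.\<close>

lemma convergent_subsequence:
  obtains r u where "strict_mono r" "\<And>t x. 0 \<le> t \<Longrightarrow> (\<lambda>n. U (r n) t x) \<longlonglongrightarrow> u t x"
proof -
  define F where "F n p = (if 0 \<le> fst p \<and> fst p \<le> real n then U n (fst p) (snd p) else 0)" for n :: nat and p :: "real \<times> real"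
  have Fb: "norm (F n p) \<le> sqrt E" for n p using UE[of "fst p" n "snd p"] E0 by (auto simp: F_def)
  have "countable (\<rat> \<times> \<rat> :: (real \<times> real) set)" by (intro countable_SIGMA countable_rat)
  then obtain r where r: "strict_mono r" and lim: "\<And>p. p \<in> \<rat> \<times> \<rat> \<Longrightarrow> \<exists>l. (\<lambda>n. F (r n) p) \<longlonglongrightarrow> l"
    using function_convergent_subsequence[of "\<rat> \<times> \<rat>" F "sqrt E"] Fb by blast
  interpret s: approximation "\<lambda>n. U (r n)" "\<lambda>n. g (r n)" "\<lambda>n. ts (r n)" u0 E C \<Gamma> by (rule subsequence[OF r])
  have "\<exists>l. (\<lambda>n. U (r n) t x) \<longlonglongrightarrow> l" if t: "0 \<le> t" for t x
  proof -
    have "Cauchy (\<lambda>n. U (r n) t x)"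
    proof (rule metric_CauchyI)
      fix e :: real assume e: "0 < e"
      \<comment> \<open>\<rho> and \<delta> are chosen so that moving from (t, x) to the rational
        point (s, y) costs three times e/16: the increment in time, the Lipschitz term of
        \<open>U_time\<close>, and the shift in space.\<close>
      define G where "G = 2 * \<Gamma> (t + 1) + 1"
      have \<Gamma>t: "0 \<le> \<Gamma> t" "\<Gamma> t \<le> \<Gamma> (t + 1)" using \<Gamma>0[OF t] \<Gamma>_mono[of t "t + 1"] by auto
      then have G: "G \<ge> 1" "\<Gamma> (t + 1) + \<Gamma> t \<le> G" unfolding G_def by auto
      define \<rho> where "\<rho> = e / (16 * G)"
      have \<rho>: "\<rho> > 0" "G * \<rho> = e / 16" using e G by (auto simp: \<rho>_def)
      define \<delta> where "\<delta> = min 1 (e * \<rho> / (32 * (C + 1)))"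
      have \<delta>: "\<delta> > 0" "\<delta> \<le> 1" "2 * C * \<delta> / \<rho> \<le> e / 16"
      proof -
        show "\<delta> > 0" "\<delta> \<le> 1" using e \<rho> C0 by (auto simp: \<delta>_def)
        have "2 * C * \<delta> \<le> 2 * (C + 1) * (e * \<rho> / (32 * (C + 1)))"
          using C0 e \<rho> by (intro mult_mono) (auto simp: \<delta>_def)
        also have "\<dots> = e / 16 * \<rho>" using C0 by (simp add: field_simps)
        finally show "2 * C * \<delta> / \<rho> \<le> e / 16" using \<rho> by (simp add: pos_divide_le_eq)
      qed
      obtain s where s: "s \<in> \<rat>" "t < s" "s < t + \<delta>" using Rats_dense_in_real[of t "t + \<delta>"] \<delta> by auto
      obtain y where y: "y \<in> \<rat>" "x < y" "y < x + \<rho>" using Rats_dense_in_real[of x "x + \<rho>"] \<rho> by auto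
      have "convergent (\<lambda>n. F (r n) (s, y))" using lim[of "(s, y)"] s y by (auto simp: convergent_def)
      then have "Cauchy (\<lambda>n. F (r n) (s, y))" by (rule convergent_Cauchy)
      from metric_CauchyD[OF this, of "e / 4"] e obtain N1
        where N1: "\<And>m n. m \<ge> N1 \<Longrightarrow> n \<ge> N1 \<Longrightarrow> dist (F (r m) (s, y)) (F (r n) (s, y)) < e / 4" by auto
      from LIMSEQ_D[OF s.ts_lim \<delta>(1)] obtain N2 where N2: "\<And>n. n \<ge> N2 \<Longrightarrow> ts (r n) < \<delta>" using s.ts_pos by fastforce
      obtain N3 :: nat where N3: "t + 1 \<le> real N3" using real_arch_simple by blast
      have near: "\<bar>U (r n) t x - U (r n) s y\<bar> \<le> 3 * (e / 16)" if "n \<ge> N2" "n \<ge> N3" for n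
      proof -
        have n: "s \<le> real n" using s \<delta> N3 that by linarith
        have "\<bar>U (r n) s x - U (r n) t x\<bar> \<le> C * (s - t + ts (r n)) / \<rho> + (\<Gamma> s + \<Gamma> t) * \<rho>"
          by (rule s.U_time[OF t _ n \<rho>(1)]) (use s in simp)
        also have "\<dots> \<le> 2 * C * \<delta> / \<rho> + G * \<rho>"
        proof (intro add_mono divide_right_mono mult_right_mono)
          have "C * (s - t + ts (r n)) \<le> C * (2 * \<delta>)" using s N2[OF that(1)] C0 by (intro mult_left_mono) auto
          then show "C * (s - t + ts (r n)) \<le> 2 * C * \<delta>" by simp
          show "\<Gamma> s + \<Gamma> t \<le> G" using G(2) \<Gamma>_mono[of s "t + 1"] s \<delta> by linarith
        qed (use \<rho> in auto)
        finally have 1: "\<bar>U (r n) s x - U (r n) t x\<bar> \<le> 2 * (e / 16)" using \<delta>(3) \<rho>(2) by linarith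
        have "\<bar>U (r n) s x - U (r n) s y\<bar> \<le> \<Gamma> s * \<bar>x - y\<bar>" by (rule s.U_Lipschitz) (use s t n in auto)
        also have "\<dots> \<le> G * \<rho>"
          using y \<Gamma>_mono[of s "t + 1"] s \<delta> \<Gamma>t G(1) unfolding G_def by (intro mult_mono) auto
        finally have "\<bar>U (r n) s x - U (r n) s y\<bar> \<le> e / 16" using \<rho>(2) by simp
        then show ?thesis using 1 by linarith
      qed
      have Fs: "F (r n) (s, y) = U (r n) s y" if "n \<ge> N3" for n
      proof -
        have "s \<le> real n" using s \<delta> N3 that by linarith
        also have "\<dots> \<le> real (r n)" using seq_suble[OF r] by simp
        finally show ?thesis using s t by (simp add: F_def)
      qed
      show "\<exists>M. \<forall>m\<ge>M. \<forall>n\<ge>M. dist (U (r m) t x) (U (r n) t x) < e"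
      proof (intro exI[of _ "max N1 (max N2 N3)"] allI impI)
        fix m n assume m: "m \<ge> max N1 (max N2 N3)" and n: "n \<ge> max N1 (max N2 N3)"
        then have "\<bar>U (r m) s y - U (r n) s y\<bar> < e / 4" using N1[of m n] Fs by (simp add: dist_real_def)
        moreover have "\<bar>U (r m) t x - U (r m) s y\<bar> \<le> 3 * (e / 16)" "\<bar>U (r n) t x - U (r n) s y\<bar> \<le> 3 * (e / 16)"
          using near m n by auto
        ultimately show "dist (U (r m) t x) (U (r n) t x) < e" unfolding dist_real_def using e by linarith
      qed
    qed
    then show ?thesis by (simp add: Cauchy_convergent_iff convergent_def)
  qed
  then obtain u where "\<And>t x. 0 \<le> t \<Longrightarrow> (\<lambda>n. U (r n) t x) \<longlonglongrightarrow> u t x" by metis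
  then show ?thesis using that[OF r] by blast
qed

end

section \<open>Bounds and continuity of the limit\<close>

locale limit_solution = approximation +
  fixes u :: "real \<Rightarrow> real \<Rightarrow> real"
  assumes conv: "\<And>t x. 0 \<le> t \<Longrightarrow> (\<lambda>n. U n t x) \<longlonglongrightarrow> u t x"
begin

text \<open>The number of initial approximations to drop so that all remaining ones are controlled
  at time t.\<close>

definition N where "N t = nat \<lceil>t\<rceil>"

lemma N: "t \<le> real (n + N t)" unfolding N_def by linarith

lemma N_mono: "s \<le> t \<Longrightarrow> N s \<le> N t" unfolding N_def by (intro nat_mono ceiling_mono)

lemma u_initial: "u 0 x = u0 x" using LIMSEQ_unique[OF conv initial] by simp

text \<open>For each t the derivatives converge along the whole sequence, without a further
  selection that would depend on t; hence the limit can be chosen separately for each of the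
  uncountably many times.\<close>

definition v where "v t = (SOME v. l1loc (\<Gamma> t) (\<lambda>n. g (n + N t) t) v)"

lemma v: assumes t: "0 \<le> t" shows "l1loc (\<Gamma> t) (\<lambda>n. g (n + N t) t) (v t)"
proof -
  obtain w where "l1loc (\<Gamma> t) (\<lambda>n. g (n + N t) t) w"
    by (rule derivative_limit[OF dU[OF t N] gc[OF t N] g\<Gamma>[OF t N] mg[OF t N] LIMSEQ_ignore_initial_segment[OF conv[OF t]]])
  then show ?thesis unfolding v_def by (rule someI[of "l1loc (\<Gamma> t) (\<lambda>n. g (n + N t) t)"])
qed

text \<open>Two times are compared along the same sequence, which has to start late enough for the
  later of the two.\<close>

lemma v_offset: assumes s: "0 \<le> s" "s \<le> t" shows "l1loc (\<Gamma> s) (\<lambda>n. g (n + N t) s) (v s)"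
proof -
  have "n + N t = (n + (N t - N s)) + N s" for n using N_mono[OF s(2)] by simp
  then show ?thesis using l1loc_offset[OF v[OF s(1)], of "N t - N s"] by simp
qed

lemma u_offset: assumes s: "0 \<le> s" "s \<le> t" shows "l1loc (sqrt E) (\<lambda>n. U (n + N t) s) (u s)"
proof (rule l1loc_pointwise)
  have n: "s \<le> real (n + N t)" for n using s N[of t n] by linarith
  show "U (n + N t) s \<in> borel_measurable lborel" for n by (rule continuous_measurable_lborel[OF Uc[OF s(1) n]])
  show "\<bar>U (n + N t) s x\<bar> \<le> sqrt E" for n x by (rule UE[OF s(1) n])
  show "(\<lambda>n. U (n + N t) s x) \<longlonglongrightarrow> u s x" for x by (rule LIMSEQ_ignore_initial_segment[OF conv[OF s(1)]])
qed

lemma u_Lipschitz: assumes t: "0 \<le> t" shows "\<bar>u t x - u t y\<bar> \<le> \<Gamma> t * \<bar>x - y\<bar>"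
proof (rule LIMSEQ_le_const2)
  show "(\<lambda>n. \<bar>U (n + N t) t x - U (n + N t) t y\<bar>) \<longlonglongrightarrow> \<bar>u t x - u t y\<bar>"
    by (intro tendsto_intros LIMSEQ_ignore_initial_segment[OF conv[OF t]])
qed (use U_Lipschitz[OF t N] in auto)

lemma u_cont: assumes t: "0 \<le> t" shows "continuous_on UNIV (u t)"
proof (intro continuous_at_imp_continuous_on ballI)
  fix x
  have "((\<lambda>y. \<Gamma> t * \<bar>y - x\<bar>) \<longlongrightarrow> \<Gamma> t * \<bar>x - x\<bar>) (at x)" by (intro tendsto_intros)
  then have z: "((\<lambda>y. \<Gamma> t * \<bar>y - x\<bar>) \<longlongrightarrow> 0) (at x)" by simp
  have "((\<lambda>y. u t y - u t x) \<longlongrightarrow> 0) (at x)"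
    by (rule Lim_null_comparison[OF _ z]) (auto intro!: always_eventually u_Lipschitz[OF t])
  then show "isCont (u t) x" by (simp add: isCont_def LIM_zero_iff)
qed

lemma u_bound: "0 \<le> t \<Longrightarrow> \<bar>u t x\<bar> \<le> sqrt E" using l1loc_D(4)[OF u_offset[of t t]] by simp

lemma v_measurable: "0 \<le> t \<Longrightarrow> v t \<in> borel_measurable lborel" by (rule l1loc_D(3)[OF v])

lemma v_bound: "0 \<le> t \<Longrightarrow> \<bar>v t x\<bar> \<le> \<Gamma> t" by (rule l1loc_D(4)[OF v])

lemma weak_derivative_limit:
  assumes t: "0 \<le> t" and \<phi>: "\<And>x. (\<phi> has_real_derivative \<phi>' x) (at x)" "continuous_on UNIV \<phi>'"
    and 0: "\<And>x. \<bar>x\<bar> > R \<Longrightarrow> \<phi> x = 0" "\<And>x. \<bar>x\<bar> > R \<Longrightarrow> \<phi>' x = 0"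
  shows "(LINT x|lborel. u t x * \<phi>' x) = - (LINT x|lborel. v t x * \<phi> x)"
proof -
  have \<phi>c: "continuous_on UNIV \<phi>" by (rule DERIV_cont[OF \<phi>(1)])
  have bd: "\<exists>b. \<forall>x. \<bar>p x\<bar> \<le> b" if "continuous_on UNIV p" "\<And>x. \<bar>x\<bar> > R \<Longrightarrow> p x = 0" for p :: "real \<Rightarrow> real"
  proof -
    have "bounded (p ` {-R..R})"
      by (intro compact_imp_bounded compact_continuous_image continuous_on_subset[OF that(1)]) auto
    then obtain b where b: "\<And>x. x \<in> {-R..R} \<Longrightarrow> norm (p x) \<le> b" unfolding bounded_iff by blast
    have "\<bar>p x\<bar> \<le> \<bar>b\<bar>" for x
    proof (cases "\<bar>x\<bar> > R")
      case False
      then have "x \<in> {-R..R}" by (auto simp: abs_le_iff not_less)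
      from b[OF this] show ?thesis by simp
    qed (use that(2) in simp)
    then show ?thesis by blast
  qed
  obtain b1 where b1: "\<And>x. \<bar>\<phi> x\<bar> \<le> b1" using bd[OF \<phi>c 0(1)] by blast
  obtain b2 where b2: "\<And>x. \<bar>\<phi>' x\<bar> \<le> b2" using bd[OF \<phi>(2) 0(2)] by blast
  have 1: "(\<lambda>n. LINT x|lborel. \<phi>' x * U (n + N t) t x) \<longlonglongrightarrow> (LINT x|lborel. \<phi>' x * u t x)"
    by (rule l1loc_test[OF u_offset[OF t order_refl] continuous_measurable_lborel[OF \<phi>(2)] b2 tendsto_const 0(2)])
  have 2: "(\<lambda>n. LINT x|lborel. \<phi> x * g (n + N t) t x) \<longlonglongrightarrow> (LINT x|lborel. \<phi> x * v t x)"
    by (rule l1loc_test[OF v[OF t] continuous_measurable_lborel[OF \<phi>c] b1 tendsto_const 0(1)])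
  have "(LINT x|lborel. \<phi>' x * U (n + N t) t x) = - (LINT x|lborel. \<phi> x * g (n + N t) t x)" for n
  proof -
    have c1: "continuous_on UNIV (\<lambda>x. \<phi>' x * U (n + N t) t x)" by (intro continuous_intros \<phi>(2) Uc[OF t N])
    have c2: "continuous_on UNIV (\<lambda>x. \<phi> x * g (n + N t) t x)" by (intro continuous_intros \<phi>c gc[OF t N])
    have i1: "integrable lborel (\<lambda>x. \<phi>' x * U (n + N t) t x)"
      by (rule integrable_continuous_compact_support[OF c1, of R]) (simp add: 0)
    have i2: "integrable lborel (\<lambda>x. \<phi> x * g (n + N t) t x)"
      by (rule integrable_continuous_compact_support[OF c2, of R]) (simp add: 0)
    have "(LINT x|lborel. \<phi>' x * U (n + N t) t x + \<phi> x * g (n + N t) t x) = 0"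
    proof (rule integral_DERIV_compact_support[where R=R])
      show "((\<lambda>x. \<phi> x * U (n + N t) t x) has_real_derivative \<phi>' x * U (n + N t) t x + \<phi> x * g (n + N t) t x) (at x)" for x
        using DERIV_mult[OF \<phi>(1) dU[OF t N]] by (simp add: mult.commute add.commute)
      show "continuous_on UNIV (\<lambda>x. \<phi>' x * U (n + N t) t x + \<phi> x * g (n + N t) t x)" by (intro continuous_on_add c1 c2)
    qed (use 0 in auto)
    then show ?thesis using i1 i2 by simp
  qed
  then have "(LINT x|lborel. \<phi>' x * u t x) = - (LINT x|lborel. \<phi> x * v t x)"
    using LIMSEQ_unique[OF 1] tendsto_minus[OF 2] by simp
  then show ?thesis by (simp add: mult.commute)
qed

text \<open>Semicontinuity is applied to the sum u^2 + v^2, so that the sharp bound E survives and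
  not merely a bound for each term.\<close>

lemma energy_limit:
  assumes t: "0 \<le> t"
  shows "integrable lborel (\<lambda>x. (u t x)\<^sup>2)" "integrable lborel (\<lambda>x. (v t x)\<^sup>2)"
    "(LINT x|lborel. (u t x)\<^sup>2) + (LINT x|lborel. (v t x)\<^sup>2) \<le> E"
proof -
  have l: "l1loc ((sqrt E)\<^sup>2 + (\<Gamma> t)\<^sup>2) (\<lambda>n x. (U (n + N t) t x)\<^sup>2 + (g (n + N t) t x)\<^sup>2) (\<lambda>x. (u t x)\<^sup>2 + (v t x)\<^sup>2)"
    by (intro l1loc_add l1loc_square v[OF t] u_offset[OF t order_refl])
  have i: "integrable lborel (\<lambda>x. (U (n + N t) t x)\<^sup>2 + (g (n + N t) t x)\<^sup>2)" for n using U2[OF t N] g2[OF t N] by auto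
  have le: "(LINT x|lborel. \<bar>(U (n + N t) t x)\<^sup>2 + (g (n + N t) t x)\<^sup>2\<bar>) \<le> E" for n
    using U2[OF t N, of n] g2[OF t N, of n] energy[OF t N, of n] by simp
  note lsc = l1loc_lower_semicontinuous[OF l i le tendsto_const]
  have m: "(\<lambda>x. (u t x)\<^sup>2) \<in> borel_measurable lborel" "(\<lambda>x. (v t x)\<^sup>2) \<in> borel_measurable lborel"
    using v_measurable[OF t] continuous_measurable_lborel[OF u_cont[OF t]] by measurable
  show iu: "integrable lborel (\<lambda>x. (u t x)\<^sup>2)" by (rule integral_le_abs(1)[OF lsc(1) _ m(1)]) simp
  show iv: "integrable lborel (\<lambda>x. (v t x)\<^sup>2)" by (rule integral_le_abs(1)[OF lsc(1) _ m(2)]) simp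
  show "(LINT x|lborel. (u t x)\<^sup>2) + (LINT x|lborel. (v t x)\<^sup>2) \<le> E" using lsc(2) iu iv by simp
qed

lemma v_L1: assumes t: "0 \<le> t" shows "integrable lborel (v t)" "(LINT x|lborel. \<bar>v t x\<bar>) \<le> \<Gamma> t"
  using l1loc_lower_semicontinuous[OF v[OF t] g1[OF t N] g1_le[OF t N] tendsto_const] by auto

lemma v_modl: assumes t: "0 \<le> t" shows "modl (\<Gamma> t) (v t)"
  unfolding modl_def
proof (intro allI impI)
  fix s :: real assume s: "s \<ge> 0"
  have i: "integrable lborel (\<lambda>x. g (n + N t) t (x + s) - g (n + N t) t x)"
    "(LINT x|lborel. \<bar>g (n + N t) t (x + s) - g (n + N t) t x\<bar>) \<le> \<Gamma> t * s" for n
    using mg[OF t N] s by (auto simp: modl_def)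
  from l1loc_lower_semicontinuous[OF l1loc_diff[OF l1loc_shift[OF v[OF t]] v[OF t]] i tendsto_const]
  show "integrable lborel (\<lambda>x. v t (x + s) - v t x) \<and> (LINT x|lborel. \<bar>v t (x + s) - v t x\<bar>) \<le> \<Gamma> t * s" by auto
qed

text \<open>The estimates for the approximations pass to the limit with \<open>ts n\<close> replaced
  by 0. The scale r remains free and is optimized in \<open>v_Hoelder\<close>.\<close>

lemma time_continuity:
  assumes s: "0 \<le> s" "s \<le> t"
  shows "integrable lborel (\<lambda>x. u t x - u s x)" "(LINT x|lborel. \<bar>u t x - u s x\<bar>) \<le> C * (t - s)"
    "integrable lborel (\<lambda>x. v t x - v s x)"
    "\<And>r. r > 0 \<Longrightarrow> (LINT x|lborel. \<bar>v t x - v s x\<bar>) \<le> 2 / r * (C * (t - s)) + (\<Gamma> t + \<Gamma> s) * r"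
proof -
  have t: "0 \<le> t" using s by simp
  have n: "s \<le> real (n + N t)" for n using s N[of t n] by linarith
  have tsl: "(\<lambda>n. ts (n + N t)) \<longlonglongrightarrow> 0" by (rule LIMSEQ_ignore_initial_segment[OF ts_lim])
  have K: "(\<lambda>n. C * (t - s + ts (n + N t))) \<longlonglongrightarrow> C * (t - s + 0)" by (intro tendsto_intros tsl)
  note l = l1loc_lower_semicontinuous[OF l1loc_diff[OF u_offset[OF t order_refl] u_offset[OF s]] inc[OF s N] inc_le[OF s N] K]
  show "integrable lborel (\<lambda>x. u t x - u s x)" "(LINT x|lborel. \<bar>u t x - u s x\<bar>) \<le> C * (t - s)" using l by auto
  have "integrable lborel (\<lambda>x. v t x - v s x) \<and> (LINT x|lborel. \<bar>v t x - v s x\<bar>) \<le> 2 / r * (C * (t - s)) + (\<Gamma> t + \<Gamma> s) * r"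
    if r: "r > 0" for r
  proof -
    have "integrable lborel (\<lambda>x. g (n + N t) t x - g (n + N t) s x) \<and>
      (LINT x|lborel. \<bar>g (n + N t) t x - g (n + N t) s x\<bar>) \<le> 2 / r * (C * (t - s + ts (n + N t))) + (\<Gamma> t + \<Gamma> s) * r" for n :: nat
    proof -
      have d: "((\<lambda>x. U (n + N t) t x - U (n + N t) s x) has_real_derivative g (n + N t) t x - g (n + N t) s x) (at x)" for x
        by (rule DERIV_diff[OF dU[OF t N] dU[OF s(1) n]])
      have c: "continuous_on UNIV (\<lambda>x. g (n + N t) t x - g (n + N t) s x)"
        by (intro continuous_intros gc[OF t N] gc[OF s(1) n])
      have b: "\<bar>g (n + N t) t x - g (n + N t) s x\<bar> \<le> \<Gamma> t + \<Gamma> s" for x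
        using g\<Gamma>[OF t N, of n x] g\<Gamma>[OF s(1) n, of n x] by linarith
      have m: "modl (\<Gamma> t + \<Gamma> s) (\<lambda>x. g (n + N t) t x - g (n + N t) s x)"
        using modl_add[OF mg[OF t N] modl_cmult[OF mg[OF s(1) n], of "-1"]] by simp
      note i = derivative_L1_interpolation[OF d inc[OF s N] c b m r]
      have "2 / r * (LINT x|lborel. \<bar>U (n + N t) t x - U (n + N t) s x\<bar>) \<le> 2 / r * (C * (t - s + ts (n + N t)))"
        using inc_le[OF s N] r by (intro mult_left_mono) auto
      then show ?thesis using i by linarith
    qed
    then have i: "integrable lborel (\<lambda>x. g (n + N t) t x - g (n + N t) s x)"
      "(LINT x|lborel. \<bar>g (n + N t) t x - g (n + N t) s x\<bar>) \<le> 2 / r * (C * (t - s + ts (n + N t))) + (\<Gamma> t + \<Gamma> s) * r" for n by auto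
    have K2: "(\<lambda>n. 2 / r * (C * (t - s + ts (n + N t))) + (\<Gamma> t + \<Gamma> s) * r) \<longlonglongrightarrow> 2 / r * (C * (t - s + 0)) + (\<Gamma> t + \<Gamma> s) * r"
      by (intro tendsto_intros tsl)
    from l1loc_lower_semicontinuous[OF l1loc_diff[OF v[OF t] v_offset[OF s]] i K2] show ?thesis by auto
  qed
  from this this[of 1] show "integrable lborel (\<lambda>x. v t x - v s x)"
    "\<And>r. r > 0 \<Longrightarrow> (LINT x|lborel. \<bar>v t x - v s x\<bar>) \<le> 2 / r * (C * (t - s)) + (\<Gamma> t + \<Gamma> s) * r" by auto
qed

text \<open>The nonlocal terms converge at every point, being convolutions; the local square of u_x
  converges in L^1 on bounded intervals only.\<close>

lemma Zc_limit:
  assumes t: "0 \<le> t"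
  shows "l1loc (2 * (\<Gamma> t)\<^sup>2 + 6 * E + (\<Gamma> t)\<^sup>2 + (\<Gamma> t)\<^sup>2) (\<lambda>n. Zc (U (n + N t) t) (g (n + N t) t)) (Zc (u t) (v t))"
proof -
  note lu = u_offset[OF t order_refl] and lv = v[OF t]
  have s2: "(sqrt E)\<^sup>2 = E" using E0 by simp
  have l1: "l1loc (2 * (\<Gamma> t)\<^sup>2 + 6 * E) (\<lambda>n x. 2 * (g (n + N t) t x)\<^sup>2 + 6 * (U (n + N t) t x)\<^sup>2) (\<lambda>x. 2 * (v t x)\<^sup>2 + 6 * (u t x)\<^sup>2)"
    using l1loc_add[OF l1loc_cmult[OF l1loc_square[OF lv], of 2] l1loc_cmult[OF l1loc_square[OF lu], of 6]] by (simp add: s2)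
  note l2 = l1loc_square[OF lv]
  have k: "ep z \<le> 1" "em z \<le> 1" for z by (auto simp: ep_def em_def)
  have c1: "continuous_on UNIV (\<lambda>x. 2 * (g (n + N t) t x)\<^sup>2 + 6 * (U (n + N t) t x)\<^sup>2)" for n
    by (intro continuous_intros gc[OF t N] Uc[OF t N])
  have c2: "continuous_on UNIV (\<lambda>x. (g (n + N t) t x)\<^sup>2)" for n by (intro continuous_intros gc[OF t N])
  have "l1loc ((2 * (\<Gamma> t)\<^sup>2 + 6 * E) + (\<Gamma> t)\<^sup>2)
    (\<lambda>n x. Dc (\<lambda>x. 2 * (g (n + N t) t x)\<^sup>2 + 6 * (U (n + N t) t x)\<^sup>2) x + Gc (\<lambda>x. (g (n + N t) t x)\<^sup>2) x)
    (\<lambda>x. Dc (\<lambda>x. 2 * (v t x)\<^sup>2 + 6 * (u t x)\<^sup>2) x + Gc (\<lambda>x. (v t x)\<^sup>2) x)"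
  proof (rule l1loc_pointwise)
    fix n
    show "(\<lambda>x. Dc (\<lambda>x. 2 * (g (n + N t) t x)\<^sup>2 + 6 * (U (n + N t) t x)\<^sup>2) x + Gc (\<lambda>x. (g (n + N t) t x)\<^sup>2) x) \<in> borel_measurable lborel"
      by (intro continuous_measurable_lborel continuous_on_add resolvent_cont(4)[OF c1 l1loc_D(2)[OF l1]] resolvent_cont(3)[OF c2 l1loc_D(2)[OF l2]])
    show "\<bar>Dc (\<lambda>x. 2 * (g (n + N t) t x)\<^sup>2 + 6 * (U (n + N t) t x)\<^sup>2) x + Gc (\<lambda>x. (g (n + N t) t x)\<^sup>2) x\<bar>
      \<le> (2 * (\<Gamma> t)\<^sup>2 + 6 * E) + (\<Gamma> t)\<^sup>2" for x
      using resolvent_bound(4)[OF l1loc_D(1,2)[OF l1], of n x] resolvent_bound(3)[OF l1loc_D(1,2)[OF l2], of n x] by linarith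
  next
    fix x
    show "(\<lambda>n. Dc (\<lambda>x. 2 * (g (n + N t) t x)\<^sup>2 + 6 * (U (n + N t) t x)\<^sup>2) x + Gc (\<lambda>x. (g (n + N t) t x)\<^sup>2) x)
      \<longlonglongrightarrow> Dc (\<lambda>x. 2 * (v t x)\<^sup>2 + 6 * (u t x)\<^sup>2) x + Gc (\<lambda>x. (v t x)\<^sup>2) x"
      unfolding Dc_def Gc_def
      by (intro tendsto_intros l1loc_cv[OF l1 integrable_ep ep_nonneg k(1)] l1loc_cv[OF l1 integrable_em em_nonneg k(2)]
          l1loc_cv[OF l2 integrable_ep ep_nonneg k(1)] l1loc_cv[OF l2 integrable_em em_nonneg k(2)]) auto
  qed
  from l1loc_diff[OF this l2] show ?thesis by (simp add: Zc_def[abs_def])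
qed

end

section \<open>The limit of the entropy balance\<close>

definition Jlim :: "(real \<Rightarrow> real) \<Rightarrow> (real \<Rightarrow> real) \<Rightarrow> (real \<Rightarrow> real) \<Rightarrow> (real \<Rightarrow> real \<Rightarrow> real) \<Rightarrow> (real \<Rightarrow> real \<Rightarrow> real) \<Rightarrow>
    (real \<Rightarrow> real \<Rightarrow> real) \<Rightarrow> (real \<Rightarrow> real \<Rightarrow> real) \<Rightarrow> (real \<Rightarrow> real \<Rightarrow> real) \<Rightarrow> real \<Rightarrow> real" where
  "Jlim \<eta> \<eta>1 q f ft fx u v t = (LINT x|lborel. ft t x * \<eta> (u t x))
     + ((LINT x|lborel. f t x * \<eta>1 (u t x) * Zc (u t) (v t) x) - (LINT x|lborel. fx t x * (4 * q (u t x))))"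

lemma floor_mult_bounds:
  fixes \<delta> t :: real
  assumes "\<delta> > 0" "0 \<le> t"
  shows "real (nat \<lfloor>t / \<delta>\<rfloor>) * \<delta> \<le> t" "t < real (Suc (nat \<lfloor>t / \<delta>\<rfloor>)) * \<delta>"
proof -
  have "0 \<le> t / \<delta>" using assms by simp
  then have "real (nat \<lfloor>t / \<delta>\<rfloor>) \<le> t / \<delta>" "t / \<delta> < real (nat \<lfloor>t / \<delta>\<rfloor>) + 1" by linarith+
  then show "real (nat \<lfloor>t / \<delta>\<rfloor>) * \<delta> \<le> t" "t < real (Suc (nat \<lfloor>t / \<delta>\<rfloor>)) * \<delta>"
    using assms(1) by (auto simp: pos_le_divide_eq pos_divide_less_eq add.commute)
qed

locale entropy_limit = limit_solution + entropy_data +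
  fixes H :: real
  assumes H: "\<And>y. \<bar>y\<bar> \<le> sqrt E \<Longrightarrow> \<bar>\<eta>1 y\<bar> \<le> H" "\<And>y. \<bar>y\<bar> \<le> sqrt E \<Longrightarrow> \<bar>\<eta> y\<bar> \<le> H" "\<And>y. \<bar>y\<bar> \<le> sqrt E \<Longrightarrow> \<bar>q y\<bar> \<le> H"
begin

text \<open>The grid times at or before t and next after t; both tend to t with the step
  length.\<close>

definition tm where "tm n t = real (nat \<lfloor>t / ts n\<rfloor>) * ts n"

definition tp where "tp n t = real (Suc (nat \<lfloor>t / ts n\<rfloor>)) * ts n"

lemma tmp: assumes "0 \<le> t" shows "tm n t \<le> t" "t < tp n t" "tp n t = tm n t + ts n" "\<bar>tp n t - t\<bar> \<le> ts n"
proof -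
  show 1: "tm n t \<le> t" "t < tp n t" "tp n t = tm n t + ts n"
    using floor_mult_bounds[OF ts_pos assms, of n] by (auto simp: tm_def tp_def distrib_right)
  then show "\<bar>tp n t - t\<bar> \<le> ts n" by linarith
qed

lemma tp_lim: assumes t: "0 \<le> t" shows "(\<lambda>n. tp n t) \<longlonglongrightarrow> t"
proof -
  have "(\<lambda>n. tp n t - t) \<longlonglongrightarrow> 0"
    by (rule Lim_null_comparison[OF _ ts_lim]) (use tmp(4)[OF t] in auto)
  then show ?thesis by (simp add: LIM_zero_iff)
qed

lemma increment_MVT:
  assumes t: "0 \<le> t"
  obtains \<xi> where "\<bar>\<xi> - t\<bar> \<le> ts n" "(f (tp n t) x - f (tm n t) x) / ts n = ft \<xi> x"
proof -
  have lt: "tm n t < tp n t" using tmp[OF t, of n] ts_pos[of n] by linarith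
  obtain \<xi> where \<xi>: "tm n t < \<xi>" "\<xi> < tp n t" "f (tp n t) x - f (tm n t) x = (tp n t - tm n t) * ft \<xi> x"
    using MVT2[OF lt, of "\<lambda>s. f s x" "\<lambda>s. ft s x"] ft by blast
  have "tp n t - tm n t = ts n" using tmp(3)[OF t, of n] by simp
  then have "(f (tp n t) x - f (tm n t) x) / ts n = ft \<xi> x" using \<xi>(3) ts_pos[of n] by simp
  moreover have "\<bar>\<xi> - t\<bar> \<le> ts n" using \<xi>(1,2) tmp[OF t, of n] by linarith
  ultimately show ?thesis using that by blast
qed

lemma increment_bound: "0 \<le> t \<Longrightarrow> \<bar>(f (tp n t) x - f (tm n t) x) / ts n\<bar> \<le> B"
  using increment_MVT[of t n x] fB(3) by metis

lemma increment_lim: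
  assumes t: "0 \<le> t" shows "(\<lambda>n. (f (tp n t) x - f (tm n t) x) / ts n) \<longlonglongrightarrow> ft t x"
proof -
  have "\<exists>\<xi>. \<bar>\<xi> - t\<bar> \<le> ts n \<and> (f (tp n t) x - f (tm n t) x) / ts n = ft \<xi> x" for n
    using increment_MVT[OF t, of n x] by blast
  then obtain \<xi> where \<xi>: "\<And>n. \<bar>\<xi> n - t\<bar> \<le> ts n" "\<And>n. (f (tp n t) x - f (tm n t) x) / ts n = ft (\<xi> n) x"
    by metis
  have "(\<lambda>n. \<xi> n - t) \<longlonglongrightarrow> 0" by (rule Lim_null_comparison[OF _ ts_lim]) (use \<xi>(1) in auto)
  then have "\<xi> \<longlonglongrightarrow> t" by (simp add: LIM_zero_iff)
  then have "(\<lambda>n. ft (\<xi> n) x) \<longlonglongrightarrow> ft t x"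
    by (rule isCont_tendsto_compose[OF isCont_continuous[OF ft_cont]])
  then show ?thesis unfolding \<xi>(2) .
qed

lemma f_time_cont: "continuous_on UNIV (\<lambda>s. f s x)" by (rule DERIV_cont[OF ft])

lemma fx_time_cont: "continuous_on UNIV (\<lambda>s. fx s x)"
  by (rule continuous_on_compose2[OF fxc, of UNIV "\<lambda>s. (s, x)", simplified]) (intro continuous_intros)

lemma B0: "0 \<le> B" using fB(1)[of 0 0] by linarith

lemma Jf_eq: "Jf \<eta> \<eta>1 q f fx (ts n) (U n) (g n) t =
   (LINT x|lborel. (f (tp n t) x - f (tm n t) x) / ts n * \<eta> (U n t x))
     + ((LINT x|lborel. f (tp n t) x * \<eta>1 (U n t x) * Zc (U n t) (g n t) x)
        - (LINT x|lborel. fx (tp n t) x * (4 * q (U n t x))))"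
  unfolding Jf_def tm_def[symmetric] tp_def[symmetric] by (simp add: mult.commute)

lemma composite_measurable:
  fixes p :: "real \<Rightarrow> real"
  assumes p: "continuous_on UNIV p" and t: "0 \<le> t" "t \<le> real n"
  shows "(\<lambda>x. p (U n t x)) \<in> borel_measurable lborel"
  by (intro continuous_measurable_lborel continuous_on_compose2[OF p Uc[OF t]] subset_UNIV)

lemma increment_measurable: "(\<lambda>x. (f a x - f b x) / c) \<in> borel_measurable lborel"
  by (intro borel_measurable_divide borel_measurable_diff continuous_measurable_lborel f_cont) auto

lemma test_measurable:
  assumes t: "0 \<le> t" "t \<le> real n"
  shows "(\<lambda>x. f a x * \<eta>1 (U n t x)) \<in> borel_measurable lborel"
  by (intro borel_measurable_times composite_measurable[OF \<eta>1_cont t] continuous_measurable_lborel f_cont)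

lemma test_bound:
  assumes t: "0 \<le> t" "t \<le> real n"
  shows "\<bar>f a x * \<eta>1 (U n t x)\<bar> \<le> B * H"
  unfolding abs_mult using fB(1) H(1)[OF UE[OF t]] B0 by (intro mult_mono) auto

lemma Jf_lim:
  assumes t: "0 \<le> t"
  shows "(\<lambda>n. Jf \<eta> \<eta>1 q f fx (ts n) (U n) (g n) t) \<longlonglongrightarrow> Jlim \<eta> \<eta>1 q f ft fx u v t"
proof -
  have off: "(\<lambda>n. a (n + N t)) \<longlonglongrightarrow> l" if "a \<longlonglongrightarrow> l" for a and l :: real
    using that by (rule LIMSEQ_ignore_initial_segment)
  have uc: "(\<lambda>n. U (n + N t) t x) \<longlonglongrightarrow> u t x" for x by (rule off[OF conv[OF t]])
  have 1: "(\<lambda>n. LINT x|lborel. (f (tp (n + N t) t) x - f (tm (n + N t) t) x) / ts (n + N t) * \<eta> (U (n + N t) t x))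
      \<longlonglongrightarrow> (LINT x|lborel. ft t x * \<eta> (u t x))"
  proof (rule l1loc_test[OF _ increment_measurable])
    show "l1loc H (\<lambda>n x. \<eta> (U (n + N t) t x)) (\<lambda>x. \<eta> (u t x))"
      by (rule l1loc_pointwise[OF composite_measurable[OF \<eta>_cont t N] H(2)[OF UE[OF t N]]
            isCont_tendsto_compose[OF isCont_continuous[OF \<eta>_cont] uc]])
    show "\<bar>(f (tp (n + N t) t) x - f (tm (n + N t) t) x) / ts (n + N t)\<bar> \<le> B" for n x by (rule increment_bound[OF t])
    show "(\<lambda>n. (f (tp (n + N t) t) x - f (tm (n + N t) t) x) / ts (n + N t)) \<longlonglongrightarrow> ft t x" for x
      by (rule off[OF increment_lim[OF t]])
    show "(f (tp (n + N t) t) x - f (tm (n + N t) t) x) / ts (n + N t) = 0" if "\<bar>x\<bar> > R" for n x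
      using f0(1) that by simp
  qed
  have 2: "(\<lambda>n. LINT x|lborel. f (tp (n + N t) t) x * \<eta>1 (U (n + N t) t x) * Zc (U (n + N t) t) (g (n + N t) t) x)
      \<longlonglongrightarrow> (LINT x|lborel. f t x * \<eta>1 (u t x) * Zc (u t) (v t) x)"
  proof (rule l1loc_test[OF Zc_limit[OF t] test_measurable[OF t N] test_bound[OF t N]])
    show "(\<lambda>n. f (tp (n + N t) t) x * \<eta>1 (U (n + N t) t x)) \<longlonglongrightarrow> f t x * \<eta>1 (u t x)" for x
      by (intro tendsto_mult isCont_tendsto_compose[OF isCont_continuous[OF f_time_cont] off[OF tp_lim[OF t]]]
          isCont_tendsto_compose[OF isCont_continuous[OF \<eta>1_cont] uc])
    show "f (tp (n + N t) t) x * \<eta>1 (U (n + N t) t x) = 0" if "\<bar>x\<bar> > R" for n x using f0(1) that by simp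
  qed
  have 3: "(\<lambda>n. LINT x|lborel. fx (tp (n + N t) t) x * (4 * q (U (n + N t) t x)))
      \<longlonglongrightarrow> (LINT x|lborel. fx t x * (4 * q (u t x)))"
  proof (rule l1loc_test[OF _ continuous_measurable_lborel[OF fx_cont] fB(2)])
    have "l1loc H (\<lambda>n x. q (U (n + N t) t x)) (\<lambda>x. q (u t x))"
      by (rule l1loc_pointwise[OF composite_measurable[OF q_cont t N] H(3)[OF UE[OF t N]]
            isCont_tendsto_compose[OF isCont_continuous[OF q_cont] uc]])
    then show "l1loc (\<bar>4\<bar> * H) (\<lambda>n x. 4 * q (U (n + N t) t x)) (\<lambda>x. 4 * q (u t x))" by (rule l1loc_cmult)
    show "(\<lambda>n. fx (tp (n + N t) t) x) \<longlonglongrightarrow> fx t x" for x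
      by (rule isCont_tendsto_compose[OF isCont_continuous[OF fx_time_cont] off[OF tp_lim[OF t]]])
    show "fx (tp (n + N t) t) x = 0" if "\<bar>x\<bar> > R" for n x using f0(2) that by simp
  qed
  have "(\<lambda>n. Jf \<eta> \<eta>1 q f fx (ts (n + N t)) (U (n + N t)) (g (n + N t)) t) \<longlonglongrightarrow> Jlim \<eta> \<eta>1 q f ft fx u v t"
    unfolding Jf_eq Jlim_def by (intro tendsto_add tendsto_diff 1 2 3)
  then show ?thesis by (rule LIMSEQ_offset[where k="N t"])
qed

definition Jb where
  "Jb = 2 * R * (B * H) + (2 * R * (B * H * (2 * (\<Gamma> (R + 1))\<^sup>2 + 6 * E + (\<Gamma> (R + 1))\<^sup>2 + (\<Gamma> (R + 1))\<^sup>2)) + 2 * R * (B * (4 * H)))"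

lemma Jf_bound:
  assumes t: "0 \<le> t" "t \<le> R + 1" "t \<le> real n"
  shows "\<bar>Jf \<eta> \<eta>1 q f fx (ts n) (U n) (g n) t\<bar> \<le> Jb"
proof -
  have G: "0 \<le> \<Gamma> t" "\<Gamma> t \<le> \<Gamma> (R + 1)" using \<Gamma>0[OF t(1)] \<Gamma>_mono[OF t(2)] by auto
  then have G2: "(\<Gamma> t)\<^sup>2 \<le> (\<Gamma> (R + 1))\<^sup>2" by (intro power_mono) auto
  have gb: "(g n t x)\<^sup>2 \<le> (\<Gamma> t)\<^sup>2" for x using power_mono[OF g\<Gamma>[OF t(1,3), of x], of 2] by simp
  have ub: "(U n t x)\<^sup>2 \<le> E" for x using power_mono[OF UE[OF t(1,3), of x], of 2] E0 by simp
  have c1: "continuous_on UNIV (\<lambda>x. 2 * (g n t x)\<^sup>2 + 6 * (U n t x)\<^sup>2)"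
    by (intro continuous_intros gc[OF t(1,3)] Uc[OF t(1,3)])
  have c2: "continuous_on UNIV (\<lambda>x. (g n t x)\<^sup>2)" by (intro continuous_intros gc[OF t(1,3)])
  have b1: "\<bar>2 * (g n t x)\<^sup>2 + 6 * (U n t x)\<^sup>2\<bar> \<le> 2 * (\<Gamma> t)\<^sup>2 + 6 * E" for x
    using gb[of x] ub[of x] zero_le_power2[of "g n t x"] zero_le_power2[of "U n t x"] by linarith
  have b2: "\<bar>(g n t x)\<^sup>2\<bar> \<le> (\<Gamma> t)\<^sup>2" for x using gb[of x] by simp
  have Zb: "\<bar>Zc (U n t) (g n t) x\<bar> \<le> 2 * (\<Gamma> (R + 1))\<^sup>2 + 6 * E + (\<Gamma> (R + 1))\<^sup>2 + (\<Gamma> (R + 1))\<^sup>2" for x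
    using resolvent_bound(4)[OF continuous_measurable_lborel[OF c1] b1, of x]
      resolvent_bound(3)[OF continuous_measurable_lborel[OF c2] b2, of x] b2[of x] G2
    unfolding Zc_def by linarith
  have Zm: "Zc (U n t) (g n t) \<in> borel_measurable lborel"
    unfolding Zc_def[abs_def]
    by (intro continuous_measurable_lborel continuous_on_add continuous_on_diff resolvent_cont(4)[OF c1 b1] resolvent_cont(3)[OF c2 b2] c2)
  have 1: "\<bar>LINT x|lborel. (f (tp n t) x - f (tm n t) x) / ts n * \<eta> (U n t x)\<bar> \<le> 2 * R * (B * H)"
    by (rule abs_integral_compact_support_le[OF increment_bound[OF t(1)] H(2)[OF UE[OF t(1,3)]] _ R increment_measurable composite_measurable[OF \<eta>_cont t(1,3)]])
      (simp add: f0)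
  have 2: "\<bar>LINT x|lborel. f (tp n t) x * \<eta>1 (U n t x) * Zc (U n t) (g n t) x\<bar>
      \<le> 2 * R * (B * H * (2 * (\<Gamma> (R + 1))\<^sup>2 + 6 * E + (\<Gamma> (R + 1))\<^sup>2 + (\<Gamma> (R + 1))\<^sup>2))"
    by (rule abs_integral_compact_support_le[OF test_bound[OF t(1,3)] Zb _ R test_measurable[OF t(1,3)] Zm]) (simp add: f0)
  have q4: "\<bar>4 * q (U n t x)\<bar> \<le> 4 * H" for x using H(3)[OF UE[OF t(1,3)], of x] by linarith
  have qm: "(\<lambda>x. 4 * q (U n t x)) \<in> borel_measurable lborel" using composite_measurable[OF q_cont t(1,3)] by measurable
  have 3: "\<bar>LINT x|lborel. fx (tp n t) x * (4 * q (U n t x))\<bar> \<le> 2 * R * (B * (4 * H))"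
    by (rule abs_integral_compact_support_le[OF fB(2) q4 _ R continuous_measurable_lborel[OF fx_cont] qm]) (simp add: f0)
  show ?thesis unfolding Jf_eq Jb_def using 1 2 3 by linarith
qed

lemma Jlim_zero: assumes "t > R" shows "Jlim \<eta> \<eta>1 q f ft fx u v t = 0"
proof -
  have "\<bar>t\<bar> > R" using assms by simp
  then show ?thesis by (simp add: Jlim_def f0)
qed

text \<open>Dominated convergence in t: the integrands converge for each t and are bounded by
  \<open>Jb\<close> on [0, R + 1]. Integrability of the limit, and with it measurability in t, comes
  out of the same argument.\<close>

lemma entropy_limit:
  "integrable lborel (\<lambda>t. indicator {0..} t * Jlim \<eta> \<eta>1 q f ft fx u v t)"
  "(LINT t|lborel. indicator {0..} t * Jlim \<eta> \<eta>1 q f ft fx u v t) = - (LINT x|lborel. f 0 x * \<eta> (u 0 x))"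
proof -
  obtain L where L: "\<And>n. integrable lborel (\<lambda>t. indicator {0..<L n} t * Jf \<eta> \<eta>1 q f fx (ts n) (U n) (g n) t)"
    "\<forall>\<^sub>F n in sequentially. R < L n \<and> L n \<le> R + ts n"
    "(\<lambda>n. LINT t|lborel. indicator {0..<L n} t * Jf \<eta> \<eta>1 q f fx (ts n) (U n) (g n) t) \<longlonglongrightarrow> - (LINT x|lborel. f 0 x * \<eta> (u0 x))"
    using entropy[OF entropy_data_axioms] by blast
  let ?J = "\<lambda>n t. indicator {0..<L n} t * Jf \<eta> \<eta>1 q f fx (ts n) (U n) (g n) t"
  let ?Jl = "\<lambda>t. indicator {0..} t * Jlim \<eta> \<eta>1 q f ft fx u v t"
  have "\<forall>\<^sub>F n in sequentially. ts n < 1" using order_tendstoD(2)[OF ts_lim, of 1] by simp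
  then obtain m where m: "\<And>n. n \<ge> m \<Longrightarrow> R < L n" "\<And>n. n \<ge> m \<Longrightarrow> L n \<le> R + ts n" "\<And>n. n \<ge> m \<Longrightarrow> ts n < 1"
    using eventually_conj[OF L(2)] unfolding eventually_sequentially by (metis (no_types, lifting))
  \<comment> \<open>From this index on the cutoff lies between R and R + 1, and the approximations
    are controlled on all of [0, R + 1].\<close>
  define k where "k = max m (nat \<lceil>R + 1\<rceil>)"
  have k: "R < L (n + k)" "L (n + k) \<le> R + ts (n + k)" "ts (n + k) < 1" "R + 1 \<le> real (n + k)" for n
    using m[of "n + k"] by (auto simp: k_def max_def split: if_splits) linarith+
  have lim: "(\<lambda>n. ?J (n + k) t) \<longlonglongrightarrow> ?Jl t" for t
  proof -
    consider "t < 0" | "0 \<le> t" "t \<le> R" | "R < t" by linarith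
    then show ?thesis
    proof cases
      case 2
      have "indicator {0..<L (n + k)} t = (1::real)" for n using 2 k(1)[of n] by simp
      then show ?thesis using LIMSEQ_ignore_initial_segment[OF Jf_lim[OF 2(1)], of k] 2 by simp
    next
      case 3
      then have t0: "0 \<le> t" using R by simp
      have "(\<lambda>n. ts (n + k)) \<longlonglongrightarrow> 0" by (rule LIMSEQ_ignore_initial_segment[OF ts_lim])
      then have "\<forall>\<^sub>F n in sequentially. ts (n + k) < t - R" using 3 by (intro order_tendstoD(2)) auto
      then have "\<forall>\<^sub>F n in sequentially. ?J (n + k) t = ?Jl t"
      proof eventually_elim
        case (elim n)
        then have "t \<notin> {0..<L (n + k)}" using k(2)[of n] by auto
        then show ?case using Jlim_zero[OF 3] by simp
      qed
      then show ?thesis by (rule tendsto_eventually)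
    qed simp
  qed
  have bnd: "norm (?J (n + k) t) \<le> Jb * indicator {0..R + 1} t" for n t
  proof (cases "t \<in> {0..<L (n + k)}")
    case True
    then have "0 \<le> t" "t \<le> R + 1" using k(2,3)[of n] by auto
    moreover have "t \<le> real (n + k)" using k(4)[of n] \<open>t \<le> R + 1\<close> by linarith
    ultimately show ?thesis using Jf_bound[of t "n + k"] True by simp
  next
    case False
    have "0 \<le> Jb" using order_trans[OF abs_ge_zero Jf_bound[of 0 0]] R by simp
    then show ?thesis using False by simp
  qed
  have Jm: "?J (n + k) \<in> borel_measurable lborel" for n using L(1) by auto
  have Jlm: "?Jl \<in> borel_measurable lborel" by (rule borel_measurable_LIMSEQ_real[OF lim Jm])
  have w: "integrable lborel (\<lambda>t. Jb * indicator {0..R + 1} t)" using integrable_indicator_Icc by simp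
  show "integrable lborel ?Jl"
    by (rule integrable_dominated_convergence[OF Jlm Jm w AE_I2 AE_I2]) (use lim bnd in auto)
  have "(\<lambda>n. LINT t|lborel. ?J (n + k) t) \<longlonglongrightarrow> (LINT t|lborel. ?Jl t)"
    by (rule integral_dominated_convergence[OF Jlm Jm w AE_I2 AE_I2]) (use lim bnd in auto)
  from LIMSEQ_unique[OF this LIMSEQ_ignore_initial_segment[OF L(3)]]
  show "(LINT t|lborel. ?Jl t) = - (LINT x|lborel. f 0 x * \<eta> (u 0 x))" by (simp add: u_initial)
qed

end

section \<open>Weak derivatives and total variation\<close>

lemma AE_lebesgueI: "AE x in lborel. P x \<Longrightarrow> AE x in lebesgue. P x"
  by (rule AE_completion)

lemma lebesgue_measurableI: "f \<in> borel_measurable lborel \<Longrightarrow> f \<in> borel_measurable lebesgue"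
  by (rule measurable_completion)

lemma integrable_lebesgue_iff:
  fixes f :: "real \<Rightarrow> real"
  shows "f \<in> borel_measurable lborel \<Longrightarrow> integrable lebesgue f \<longleftrightarrow> integrable lborel f"
  by (rule integrable_completion)

lemma integral_lebesgue_eq:
  fixes f :: "real \<Rightarrow> real"
  shows "f \<in> borel_measurable lborel \<Longrightarrow> (LINT x|lebesgue. f x) = (LINT x|lborel. f x)"
  by (rule integral_completion)

text \<open>The means of transfer: a chosen weak derivative is only Lebesgue measurable, and inside
  an integral it is exchanged for its Borel representative.\<close>

lemma integral_lebesgue_AE_eq:
  fixes f g :: "real \<Rightarrow> real"
  assumes "f \<in> borel_measurable lebesgue" "g \<in> borel_measurable lborel" "AE x in lebesgue. f x = g x"
  shows "(LINT x|lebesgue. f x) = (LINT x|lborel. g x)"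
  using integral_cong_AE[OF assms(1) lebesgue_measurableI[OF assms(2)] assms(3)] integral_lebesgue_eq[OF assms(2)] by simp

lemma loc_integrable_measurable:
  assumes "loc_integrable f" shows "f \<in> borel_measurable lebesgue"
proof (rule borel_measurable_LIMSEQ_real)
  fix x
  obtain N where N: "\<bar>x\<bar> \<le> real N" using real_arch_simple by blast
  have "indicator {-real n..real n} x * f x = f x" if "n \<ge> N" for n
    using N that by (auto simp: abs_le_iff split: split_indicator)
  then show "(\<lambda>n. indicator {-real n..real n} x * f x) \<longlonglongrightarrow> f x"
    by (intro tendsto_eventually) (auto simp: eventually_sequentially)
next
  fix n
  have "integrable lebesgue (\<lambda>x. indicator {-real n..real n} x * f x)"
    using assms by (simp add: loc_integrable_def set_integrable_def)
  then show "(\<lambda>x. indicator {-real n..real n} x * f x) \<in> borel_measurable lebesgue" by auto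
qed

lemma loc_integrable_bounded:
  assumes "f \<in> borel_measurable lborel" "\<And>x. \<bar>f x\<bar> \<le> B"
  shows "loc_integrable f"
  unfolding loc_integrable_def set_integrable_def
proof (intro allI)
  fix a b
  have "integrable lborel (\<lambda>x. indicator {a..b} x * f x)" by (rule integrable_interval_bounded[OF assms])
  then show "integrable lebesgue (\<lambda>x. indicator {a..b} x *\<^sub>R f x)" using assms(1) by (simp add: integrable_completion)
qed

lemma loc_integrable_integrable:
  assumes "integrable lborel f" shows "loc_integrable f"
  unfolding loc_integrable_def set_integrable_def
proof (intro allI)
  fix a b
  have "integrable lborel (\<lambda>x. indicator {a..b} x * f x)" by (intro integrable_mult_indicator[of "{a..b}" lborel f, simplified] assms) 
  then show "integrable lebesgue (\<lambda>x. indicator {a..b} x *\<^sub>R f x)" using assms by (simp add: integrable_completion)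
qed

lemma has_weak_deriv_diff:
  assumes 1: "has_weak_deriv f g" and 2: "has_weak_deriv f' g'"
  shows "has_weak_deriv (\<lambda>x. f x - f' x) (\<lambda>x. g x - g' x)"
proof -
  have "loc_integrable (\<lambda>x. f x - f' x)" "loc_integrable (\<lambda>x. g x - g' x)"
    using 1 2 by (auto simp: has_weak_deriv_def loc_integrable_def intro!: set_integral_diff)
  moreover have "(LINT x|lebesgue. (f x - f' x) * deriv \<phi> x) = - (LINT x|lebesgue. (g x - g' x) * \<phi> x)" if \<phi>: "test_function \<phi>" for \<phi>
    using 1 2 \<phi> weak_deriv_integrable[OF 1 \<phi>] weak_deriv_integrable[OF 2 \<phi>]
    by (simp add: has_weak_deriv_def left_diff_distrib)
  ultimately show ?thesis by (simp add: has_weak_deriv_def)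
qed

lemma has_weak_deriv_cong_AE:
  assumes 1: "has_weak_deriv f g" and f': "loc_integrable f'" "AE x in lebesgue. f x = f' x"
    and g': "loc_integrable g'" "AE x in lebesgue. g x = g' x"
  shows "has_weak_deriv f' g'"
  unfolding has_weak_deriv_def
proof (intro conjI f' g' allI impI)
  fix \<phi> :: "real \<Rightarrow> real" assume \<phi>: "test_function \<phi>"
  have m: "\<phi> \<in> borel_measurable lebesgue" "deriv \<phi> \<in> borel_measurable lebesgue"
    using continuous_imp_lebesgue_measurable test_function_cont[OF \<phi>] test_function_deriv_cont(1)[OF \<phi>] by auto
  note m = m loc_integrable_measurable[OF f'(1)] loc_integrable_measurable[OF g'(1)]
  have "(LINT x|lebesgue. f' x * deriv \<phi> x) = (LINT x|lebesgue. f x * deriv \<phi> x)"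
    by (rule integral_cong_AE) (use m weak_deriv_integrable(1)[OF 1 \<phi>] f'(2) in auto)
  also have "\<dots> = - (LINT x|lebesgue. g x * \<phi> x)" using 1 \<phi> by (simp add: has_weak_deriv_def)
  also have "(LINT x|lebesgue. g x * \<phi> x) = (LINT x|lebesgue. g' x * \<phi> x)"
    by (rule integral_cong_AE) (use m weak_deriv_integrable(2)[OF 1 \<phi>] g'(2) in auto)
  finally show "(LINT x|lebesgue. f' x * deriv \<phi> x) = - (LINT x|lebesgue. g' x * \<phi> x)" .
qed

lemma test_function_bounds:
  fixes \<phi> :: "real \<Rightarrow> real"
  assumes \<phi>: "test_function \<phi>"
  obtains R B where "R > 0" "\<And>x. \<bar>x\<bar> > R \<Longrightarrow> \<phi> x = 0" "\<And>x. \<bar>x\<bar> > R \<Longrightarrow> deriv \<phi> x = 0"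
    "\<And>x. \<bar>\<phi> x\<bar> \<le> B" "\<And>x. \<bar>deriv \<phi> x\<bar> \<le> B"
proof -
  obtain R where R: "R > 0" "\<And>x. \<bar>x\<bar> > R \<Longrightarrow> \<phi> x = 0" using test_function_support[OF \<phi>] by auto
  have R': "deriv \<phi> x = 0" if "\<bar>x\<bar> > R" for x by (rule test_function_deriv_support[OF R(2) that])
  have bd: "\<exists>b. \<forall>x. \<bar>p x\<bar> \<le> b" if "continuous_on UNIV p" "\<And>x. \<bar>x\<bar> > R \<Longrightarrow> p x = 0" for p :: "real \<Rightarrow> real"
  proof -
    have "bounded (p ` {-R..R})"
      by (intro compact_imp_bounded compact_continuous_image continuous_on_subset[OF that(1)]) auto
    then obtain b where b: "\<And>x. x \<in> {-R..R} \<Longrightarrow> norm (p x) \<le> b" unfolding bounded_iff by blast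
    have "\<bar>p x\<bar> \<le> \<bar>b\<bar>" for x
    proof (cases "\<bar>x\<bar> > R")
      case False
      then have "x \<in> {-R..R}" by (auto simp: abs_le_iff not_less)
      from b[OF this] show ?thesis by simp
    qed (use that(2) in simp)
    then show ?thesis by blast
  qed
  obtain b1 where b1: "\<And>x. \<bar>\<phi> x\<bar> \<le> b1" using bd[OF test_function_cont[OF \<phi>] R(2)] by blast
  obtain b2 where b2: "\<And>x. \<bar>deriv \<phi> x\<bar> \<le> b2" using bd[OF test_function_deriv_cont(1)[OF \<phi>] R'] by blast
  show ?thesis
    by (rule that[of R "max b1 b2"]) (use R R' b1 b2 in \<open>auto simp: le_max_iff_disj\<close>)
qed

lemma test_function_bm:
  assumes "test_function \<phi>"
  shows "bounded_measurable \<phi>" "bounded_measurable (deriv \<phi>)"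
  using test_function_bounds[OF assms] test_function_cont[OF assms] test_function_deriv_cont(1)[OF assms]
  by (metis bounded_measurable_contI)+

lemma has_weak_deriv_lborelI:
  assumes f: "f \<in> borel_measurable lborel" "loc_integrable f" and g: "g \<in> borel_measurable lborel" "loc_integrable g"
    and eq: "\<And>\<phi>. test_function \<phi> \<Longrightarrow> (LINT x|lborel. f x * deriv \<phi> x) = - (LINT x|lborel. g x * \<phi> x)"
  shows "has_weak_deriv f g"
  unfolding has_weak_deriv_def
proof (intro conjI f g allI impI)
  fix \<phi> :: "real \<Rightarrow> real" assume \<phi>: "test_function \<phi>"
  have m: "(\<lambda>x. f x * deriv \<phi> x) \<in> borel_measurable lborel" "(\<lambda>x. g x * \<phi> x) \<in> borel_measurable lborel"
    using f g test_function_bm[OF \<phi>] by (auto simp: bounded_measurable_def)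
  show "(LINT x|lebesgue. f x * deriv \<phi> x) = - (LINT x|lebesgue. g x * \<phi> x)"
    unfolding integral_lebesgue_eq[OF m(1)] integral_lebesgue_eq[OF m(2)] by (rule eq[OF \<phi>])
qed

text \<open>Here p is a square such as u_x^2 and need not be continuous, so the pointwise derivative
  formulas do not apply to it. By duality the convolutions fall on the test function, for which they
  do.\<close>

lemma resolvent_weak_deriv:
  assumes p: "integrable lborel p" "\<And>x. \<bar>p x\<bar> \<le> B"
  shows "has_weak_deriv (Gc p) (Dc p)" "has_weak_deriv (Dc p) (\<lambda>x. Gc p x - p x)"
proof -
  have pm: "p \<in> borel_measurable lborel" using p by auto
  note r = resolvent_L1[OF p(1) order_refl]
  have dual: "(LINT x|lborel. cv ep p x * h x) = (LINT x|lborel. p x * cv em h x)"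
    "(LINT x|lborel. cv em p x * h x) = (LINT x|lborel. p x * cv ep h x)" if h: "bounded_measurable h" for h
    using cv_dual[OF integrable_ep p(1) h] cv_dual[OF integrable_em p(1) h]
      cv_reflect_ep[OF bounded_measurable_D[OF h]] cv_reflect_em[OF bounded_measurable_D[OF h]] by simp_all
  have iep: "integrable lborel (\<lambda>x. cv ep p x * h x)" "integrable lborel (\<lambda>x. cv em p x * h x)" if h: "bounded_measurable h" for h
    by (intro integrable_mult_bounded(1) cv_integrable integrable_ep integrable_em p h)+
  have cvb: "bounded_measurable (cv ep h)" "bounded_measurable (cv em h)" if h: "continuous_on UNIV h" "\<And>x. \<bar>h x\<bar> \<le> b" for h b
    using bounded_measurable_contI[OF cv_continuous[OF integrable_ep h] cv_ep_bound[OF continuous_measurable_lborel[OF h(1)] h(2)]]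
      bounded_measurable_contI[OF cv_continuous[OF integrable_em h] cv_em_bound[OF continuous_measurable_lborel[OF h(1)] h(2)]] by auto
  have Gd: "(LINT x|lborel. Gc p x * h x) = (1/2) * (LINT x|lborel. p x * cv em h x) + (1/2) * (LINT x|lborel. p x * cv ep h x)"
    if h: "bounded_measurable h" for h
  proof -
    have "Gc p x * h x = (1/2) * (cv ep p x * h x) + (1/2) * (cv em p x * h x)" for x by (simp add: Gc_def algebra_simps)
    then show ?thesis using iep[OF h] dual[OF h] by simp
  qed
  have Dd: "(LINT x|lborel. Dc p x * h x) = (1/2) * (LINT x|lborel. p x * cv ep h x) - (1/2) * (LINT x|lborel. p x * cv em h x)"
    if h: "bounded_measurable h" for h
  proof -
    have "Dc p x * h x = (1/2) * (cv em p x * h x) - (1/2) * (cv ep p x * h x)" for x by (simp add: Dc_def algebra_simps)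
    then show ?thesis using iep[OF h] dual[OF h] by simp
  qed
  {
    fix \<phi> :: "real \<Rightarrow> real" assume \<phi>: "test_function \<phi>"
    obtain R b where b: "\<And>x. \<bar>\<phi> x\<bar> \<le> b" "\<And>x. \<bar>deriv \<phi> x\<bar> \<le> b" using test_function_bounds[OF \<phi>] by metis
    note bm = test_function_bm[OF \<phi>] and c = test_function_cont[OF \<phi>] test_function_deriv_cont[OF \<phi>]
    have e: "cv ep (deriv \<phi>) x = \<phi> x - cv ep \<phi> x" "cv em (deriv \<phi>) x = cv em \<phi> x - \<phi> x" for x
      using cv_ep_deriv[OF c(3) c(2) b] cv_em_deriv[OF c(3) c(2) b] by auto
    have i: "integrable lborel (\<lambda>x. p x * \<phi> x)" "integrable lborel (\<lambda>x. p x * cv ep \<phi> x)" "integrable lborel (\<lambda>x. p x * cv em \<phi> x)"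
      by (intro integrable_mult_bounded(1) p(1) bm cvb[OF c(1) b(1)])+
    have E: "(LINT x|lborel. p x * (\<phi> x - cv ep \<phi> x)) = (LINT x|lborel. p x * \<phi> x) - (LINT x|lborel. p x * cv ep \<phi> x)"
      "(LINT x|lborel. p x * (cv em \<phi> x - \<phi> x)) = (LINT x|lborel. p x * cv em \<phi> x) - (LINT x|lborel. p x * \<phi> x)"
      using i by (simp_all add: right_diff_distrib)
    have "(LINT x|lborel. Gc p x * deriv \<phi> x) = - (LINT x|lborel. Dc p x * \<phi> x)"
      unfolding Gd[OF bm(2)] Dd[OF bm(1)] e E by (simp add: field_simps)
    moreover have "(LINT x|lborel. Dc p x * deriv \<phi> x) = - (LINT x|lborel. (Gc p x - p x) * \<phi> x)"
    proof -
      have "(LINT x|lborel. (Gc p x - p x) * \<phi> x) = (LINT x|lborel. Gc p x * \<phi> x) - (LINT x|lborel. p x * \<phi> x)"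
        using integrable_mult_bounded(1)[OF r(5) bm(1)] i(1) by (simp add: left_diff_distrib)
      then show ?thesis unfolding Gd[OF bm(1)] Dd[OF bm(2)] e E by (simp add: field_simps)
    qed
    ultimately have "(LINT x|lborel. Gc p x * deriv \<phi> x) = - (LINT x|lborel. Dc p x * \<phi> x)"
      "(LINT x|lborel. Dc p x * deriv \<phi> x) = - (LINT x|lborel. (Gc p x - p x) * \<phi> x)" by auto
  }
  note eq = this
  have i: "integrable lborel (\<lambda>x. Gc p x - p x)" using r p by auto
  show "has_weak_deriv (Gc p) (Dc p)"
    by (rule has_weak_deriv_lborelI) (use r eq(1) in \<open>auto intro: loc_integrable_integrable\<close>)
  show "has_weak_deriv (Dc p) (\<lambda>x. Gc p x - p x)"
    by (rule has_weak_deriv_lborelI) (use r i eq(2) in \<open>auto intro: loc_integrable_integrable\<close>)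
qed

lemma convolve_G:
  assumes p': "bounded_measurable p'" and f: "f \<in> borel_measurable lebesgue" "AE x in lebesgue. f x = p' x"
  shows "convolve G f = Gc p'"
proof
  fix x
  have Gm[measurable]: "G \<in> borel_measurable borel" unfolding G_def[abs_def] by measurable
  have pm[measurable]: "p' \<in> borel_measurable borel" using p' by (auto simp: bounded_measurable_def)
  have "convolve G f x = (LINT y|lborel. G (x - y) * p' y)"
    unfolding convolve_def
  proof (rule integral_lebesgue_AE_eq)
    have Gx: "(\<lambda>y. G (x - y)) \<in> borel_measurable lebesgue" by (intro lebesgue_measurableI) measurable
    show "(\<lambda>y. G (x - y) * f y) \<in> borel_measurable lebesgue" using Gx f(1) by (rule borel_measurable_times)
    show "(\<lambda>y. G (x - y) * p' y) \<in> borel_measurable lborel" by measurable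
    show "AE y in lebesgue. G (x - y) * f y = G (x - y) * p' y" using f(2) by eventually_elim simp
  qed
  also have "\<dots> = (LINT z|lborel. G z * p' (x - z))"
    using integral_reflect_shift[of "\<lambda>y. G (x - y) * p' y" x] by simp
  also have "\<dots> = (LINT z|lborel. (1/2) * (ep z * p' (x - z)) + (1/2) * (em z * p' (x - z)))"
    by (intro Bochner_Integration.integral_cong refl) (auto simp: G_def ep_def em_def)
  also have "\<dots> = Gc p' x"
    using cv_integrand[OF integrable_ep p', of x] cv_integrand[OF integrable_em p', of x]
    by (simp add: Gc_def cv_def)
  finally show "convolve G f x = Gc p' x" .
qed

text \<open>Tested with \<open>\<phi>\<close>, the difference f(x + s) - f x is s times f tested
  with the derivative of an average of \<open>\<phi>\<close>. That average is an admissible test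
  function, so the duality lemma gives V s on every bounded interval.\<close>

lemma modl_if_variation_bounded:
  assumes f: "integrable lborel f"
    and V: "\<And>\<phi>. test_function \<phi> \<Longrightarrow> (\<And>x. \<bar>\<phi> x\<bar> \<le> 1) \<Longrightarrow> (LINT x|lborel. f x * deriv \<phi> x) \<le> V"
  shows "modl V f"
  unfolding modl_def
proof (intro allI impI conjI)
  fix s :: real assume s0: "s \<ge> 0"
  show i: "integrable lborel (\<lambda>x. f (x + s) - f x)" using f integrable_shift[OF f] by auto
  have fm: "f \<in> borel_measurable lborel" using f by auto
  show "(LINT x|lborel. \<bar>f (x + s) - f x\<bar>) \<le> V * s"
  proof (cases "s = 0")
    case False
    then have s: "s > 0" using s0 by simp
    have key: "(LINT x|lebesgue. (f (x + s) - f x) * \<phi> x) \<le> V * s" if \<phi>: "test_function \<phi>" "\<And>x. \<bar>\<phi> x\<bar> \<le> 1" for \<phi>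
    proof -
      obtain F R where F: "\<And>x. (F has_real_derivative \<phi> x) (at x)" "\<And>k. Ck k F" "R > 0"
        "\<And>x. x \<le> - R \<Longrightarrow> F x = F (-R)" "\<And>x. R \<le> x \<Longrightarrow> F x = F R" "(LINT x|lborel. \<phi> x) = F R - F (-R)"
        by (rule test_function_antideriv[OF \<phi>(1)], rule that)
      \<comment> \<open>Minus the mean of \<open>\<phi>\<close> over [x - s, x]: it is bounded by 1
        like \<open>\<phi>\<close> and vanishes off the support enlarged by s.\<close>
      define \<psi> where "\<psi> x = (1 / s) * (F (- s + 1 * x) - F x)" for x
      have t\<psi>: "test_function \<psi>"
      proof (rule test_functionI[where a="-R" and b="R + s"])
        show "Ck k \<psi>" for k unfolding \<psi>_def[abs_def] by (rule Ck_mult[OF Ck_const Ck_diff[OF Ck_affine[OF F(2)] F(2)]])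
        show "\<psi> x = 0" if "x \<notin> {-R..R + s}" for x
        proof (cases "x < - R")
          case True
          then show ?thesis using F(4)[of x] F(4)[of "- s + 1 * x"] s by (simp add: \<psi>_def)
        next
          case False
          then have "R \<le> x" "R \<le> - s + 1 * x" using that s by auto
          then show ?thesis using F(5)[of x] F(5)[of "- s + 1 * x"] by (simp add: \<psi>_def)
        qed
      qed
      have \<psi>1: "\<bar>\<psi> x\<bar> \<le> 1" for x
        using DERIV_bounded_imp_Lipschitz[OF F(1) \<phi>(2), of "- s + 1 * x" x] s
        unfolding \<psi>_def abs_mult by simp
      have "((\<lambda>x. F (- s + 1 * x)) has_real_derivative \<phi> (- s + 1 * x) * 1) (at x)" for x
        by (rule DERIV_chain2[OF F(1)]) (auto intro!: derivative_eq_intros)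
      from DERIV_cmult[OF DERIV_diff[OF this F(1)], of "1 / s"]
      have d\<psi>: "deriv \<psi> x = (1 / s) * (\<phi> (x - s) - \<phi> x)" for x
        unfolding \<psi>_def[abs_def] by (intro DERIV_imp_deriv) simp
      note bm = test_function_bm(1)[OF \<phi>(1)]
      have i1: "integrable lborel (\<lambda>x. f x * \<phi> x)" by (rule integrable_mult_bounded(1)[OF f bm])
      have i2: "integrable lborel (\<lambda>x. f (x + s) * \<phi> x)" by (rule integrable_mult_bounded(1)[OF integrable_shift[OF f] bm])
      have i3: "integrable lborel (\<lambda>x. f x * \<phi> (x - s))" using integrable_shift_diff[OF i2, of s] by simp
      have "(LINT x|lborel. (f (x + s) - f x) * \<phi> x) = (LINT x|lborel. f (x + s) * \<phi> x) - (LINT x|lborel. f x * \<phi> x)"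
        using i1 i2 by (simp add: left_diff_distrib)
      also have "(LINT x|lborel. f (x + s) * \<phi> x) = (LINT x|lborel. f x * \<phi> (x - s))"
        using integral_shift[of "\<lambda>x. f x * \<phi> (x - s)" s] by simp
      also have "(LINT x|lborel. f x * \<phi> (x - s)) - (LINT x|lborel. f x * \<phi> x) = (LINT x|lborel. f x * \<phi> (x - s) - f x * \<phi> x)"
        using i1 i3 by simp
      also have "\<dots> = (LINT x|lborel. s * (f x * deriv \<psi> x))"
        by (intro Bochner_Integration.integral_cong refl) (use s in \<open>simp add: d\<psi> algebra_simps\<close>)
      also have "\<dots> = s * (LINT x|lborel. f x * deriv \<psi> x)" by simp
      also have "\<dots> \<le> s * V" using V[OF t\<psi> \<psi>1] s by (intro mult_left_mono) auto
      finally have "(LINT x|lborel. (f (x + s) - f x) * \<phi> x) \<le> V * s" by (simp add: mult.commute)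
      moreover have "(\<lambda>x. (f (x + s) - f x) * \<phi> x) \<in> borel_measurable lborel" using fm bm by (auto simp: bounded_measurable_def)
      ultimately show ?thesis by (simp add: integral_lebesgue_eq)
    qed
    have le: "(LINT x|lborel. indicator {-real n..real n} x * \<bar>f (x + s) - f x\<bar>) \<le> V * s" for n
    proof -
      have "set_integrable lebesgue {-real n..real n} (\<lambda>x. f (x + s) - f x)"
        using loc_integrable_integrable[OF i] by (simp add: loc_integrable_def)
      from test_function_duality[OF this key]
      have "(LINT x|lebesgue. \<bar>indicator {-real n..real n} x * (f (x + s) - f x)\<bar>) \<le> V * s" by simp
      moreover have "(\<lambda>x. \<bar>indicator {-real n..real n} x * (f (x + s) - f x)\<bar>) \<in> borel_measurable lborel" using fm by measurable
      ultimately show ?thesis by (simp add: integral_lebesgue_eq abs_mult)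
    qed
    have m: "(\<lambda>x. \<bar>f (x + s) - f x\<bar>) \<in> borel_measurable lborel" using fm by measurable
    have ii: "integrable lborel (\<lambda>x. indicator {-real n..real n} x * \<bar>f (x + s) - f x\<bar>)" for n
      by (rule integral_le_abs(1)[OF Bochner_Integration.integrable_abs[OF i]]) (use m in \<open>auto split: split_indicator\<close>)
    show ?thesis by (rule integrable_exhaustion(2)[OF m abs_ge_zero ii le])
  qed simp
qed

text \<open>The converse: the derivative of \<open>\<phi>\<close> is a limit of backward difference
  quotients, and a translation moves each of them onto f.\<close>

lemma variation_le_modl:
  assumes f: "integrable lborel f" and V: "modl V f" and \<phi>: "test_function \<phi>" "\<And>x. \<bar>\<phi> x\<bar> \<le> 1"
  shows "(LINT x|lborel. f x * deriv \<phi> x) \<le> V"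
proof -
  obtain R b where b: "\<And>x. \<bar>\<phi> x\<bar> \<le> b" "\<And>x. \<bar>deriv \<phi> x\<bar> \<le> b" using test_function_bounds[OF \<phi>(1)] by metis
  define s where "s n = 1 / real (Suc n)" for n
  have s: "s n > 0" for n by (simp add: s_def)
  note c = test_function_cont[OF \<phi>(1)] test_function_deriv_cont[OF \<phi>(1)]
  have [measurable]: "\<phi> \<in> borel_measurable borel" "deriv \<phi> \<in> borel_measurable borel" "f \<in> borel_measurable borel"
    using continuous_measurable_lborel[OF c(1)] continuous_measurable_lborel[OF c(2)] f by auto
  have lim: "(\<lambda>n. LINT x|lborel. f x * ((\<phi> (x - s n) - \<phi> x) / - s n)) \<longlonglongrightarrow> (LINT x|lborel. f x * deriv \<phi> x)"
  proof (rule integral_dominated_convergence[where w="\<lambda>x. b * \<bar>f x\<bar>"])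
    show "AE x in lborel. (\<lambda>n. f x * ((\<phi> (x - s n) - \<phi> x) / - s n)) \<longlonglongrightarrow> f x * deriv \<phi> x"
    proof (intro AE_I2 tendsto_mult tendsto_const)
      fix x
      have "(\<lambda>n. - s n) \<longlonglongrightarrow> 0" using tendsto_minus[OF LIMSEQ_inverse_Suc] by (simp add: s_def)
      from DERIV_quotient_LIMSEQ[OF c(3) this, of x] s
      show "(\<lambda>n. (\<phi> (x - s n) - \<phi> x) / - s n) \<longlonglongrightarrow> deriv \<phi> x" by (simp add: less_imp_neq[symmetric])
    qed
    show "AE x in lborel. norm (f x * ((\<phi> (x - s n) - \<phi> x) / - s n)) \<le> b * \<bar>f x\<bar>" for n
    proof (rule AE_I2)
      fix x
      have "\<bar>\<phi> (x - s n) - \<phi> x\<bar> \<le> b * \<bar>(x - s n) - x\<bar>" by (rule DERIV_bounded_imp_Lipschitz[OF c(3) b(2)])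
      then have "\<bar>(\<phi> (x - s n) - \<phi> x) / - s n\<bar> \<le> b" using s[of n] by (simp add: pos_divide_le_eq abs_divide)
      then have "\<bar>f x\<bar> * \<bar>(\<phi> (x - s n) - \<phi> x) / - s n\<bar> \<le> \<bar>f x\<bar> * b" by (rule mult_left_mono) simp
      then show "norm (f x * ((\<phi> (x - s n) - \<phi> x) / - s n)) \<le> b * \<bar>f x\<bar>" by (simp add: abs_mult mult.commute)
    qed
  qed (use f in auto)
  moreover have "(LINT x|lborel. f x * ((\<phi> (x - s n) - \<phi> x) / - s n)) \<le> V" for n
  proof -
    note bm = test_function_bm(1)[OF \<phi>(1)]
    have i1: "integrable lborel (\<lambda>x. f x * \<phi> x)" by (rule integrable_mult_bounded(1)[OF f bm])
    have i2: "integrable lborel (\<lambda>x. f (x + s n) * \<phi> x)" by (rule integrable_mult_bounded(1)[OF integrable_shift[OF f] bm])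
    have i3: "integrable lborel (\<lambda>x. f x * \<phi> (x - s n))" using integrable_shift_diff[OF i2, of "s n"] by simp
    have m: "integrable lborel (\<lambda>x. f (x + s n) - f x)" "(LINT x|lborel. \<bar>f (x + s n) - f x\<bar>) \<le> V * s n"
      using V s[of n] by (auto simp: modl_def)
    have "f x * ((\<phi> (x - s n) - \<phi> x) / - s n) = (1 / s n) * (f x * \<phi> x) - (1 / s n) * (f x * \<phi> (x - s n))" for x
      using s[of n] by (simp add: field_simps)
    then have "(LINT x|lborel. f x * ((\<phi> (x - s n) - \<phi> x) / - s n)) = (1 / s n) * ((LINT x|lborel. f x * \<phi> x) - (LINT x|lborel. f x * \<phi> (x - s n)))"
      using i1 i3 by (simp add: right_diff_distrib)
    also have "(LINT x|lborel. f x * \<phi> (x - s n)) = (LINT x|lborel. f (x + s n) * \<phi> x)"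
      using integral_shift[of "\<lambda>x. f x * \<phi> (x - s n)" "s n"] by simp
    also have "(LINT x|lborel. f x * \<phi> x) - (LINT x|lborel. f (x + s n) * \<phi> x) = (LINT x|lborel. (f x - f (x + s n)) * \<phi> x)"
      using i1 i2 by (simp add: left_diff_distrib)
    also have "(LINT x|lborel. (f x - f (x + s n)) * \<phi> x) \<le> (LINT x|lborel. \<bar>f (x + s n) - f x\<bar>)"
    proof (rule integral_mono)
      show "integrable lborel (\<lambda>x. (f x - f (x + s n)) * \<phi> x)" using i1 i2 by (simp add: left_diff_distrib)
      show "(f x - f (x + s n)) * \<phi> x \<le> \<bar>f (x + s n) - f x\<bar>" for x
      proof -
        have "(f x - f (x + s n)) * \<phi> x \<le> \<bar>f x - f (x + s n)\<bar> * \<bar>\<phi> x\<bar>" by (simp add: abs_mult[symmetric])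
        also have "\<dots> \<le> \<bar>f x - f (x + s n)\<bar> * 1" by (intro mult_left_mono \<phi>(2)) simp
        finally show ?thesis by (simp add: abs_minus_commute)
      qed
    qed (use m in auto)
    then have "(1 / s n) * (LINT x|lborel. (f x - f (x + s n)) * \<phi> x) \<le> (1 / s n) * (V * s n)"
      using m(2) s[of n] by (intro mult_left_mono) auto
    finally show ?thesis using s[of n] by simp
  qed
  ultimately show ?thesis by (intro LIMSEQ_le_const2) auto
qed

text \<open>The integral of g from minus infinity has weak derivative g by Fubini, so it differs
  from u0 by a function with vanishing weak derivative, that is, by a constant almost
  everywhere.\<close>

lemma absolutely_continuous_representative:
  assumes u: "has_weak_deriv u0 d" and g: "integrable lborel g" "AE x in lebesgue. d x = g x"
  obtains w where "continuous_on UNIV w" "\<And>x s. s \<ge> 0 \<Longrightarrow> w (x + s) - w x = cv (win s) g x" "AE x in lebesgue. u0 x = w x"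
proof -
  have gm[measurable]: "g \<in> borel_measurable borel" using g by auto
  define w where "w x = (LINT y|lborel. indicator {..x} y * g y)" for x
  have ig: "integrable lborel (\<lambda>y. indicator {..x} y * g y)" for x
    by (rule integral_le_abs(1)[where g="\<lambda>y. \<bar>g y\<bar>"]) (use g in \<open>auto split: split_indicator\<close>)
  have wb: "\<bar>w x\<bar> \<le> (LINT y|lborel. \<bar>g y\<bar>)" for x
  proof -
    have "\<bar>w x\<bar> \<le> (LINT y|lborel. \<bar>indicator {..x} y * g y\<bar>)" unfolding w_def by (rule integral_abs_bound)
    also have "\<dots> \<le> (LINT y|lborel. \<bar>g y\<bar>)" by (rule integral_mono) (use ig g in \<open>auto split: split_indicator\<close>)
    finally show ?thesis .
  qed
  have FTC: "w (x + s) - w x = cv (win s) g x" if s: "s \<ge> 0" for x s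
  proof -
    have "w (x + s) - w x = (LINT y|lborel. indicator {..x + s} y * g y - indicator {..x} y * g y)"
      unfolding w_def using ig by simp
    also have "\<dots> = (LINT y|lborel. win s (x - y) * g (x - (x - y)))"
    proof (rule integral_cong_AE)
      show "AE y in lborel. indicator {..x + s} y * g y - indicator {..x} y * g y = win s (x - y) * g (x - (x - y))"
        using AE_lborel_singleton[of x] by eventually_elim (use s in \<open>auto simp: win_def split: split_indicator\<close>)
    qed measurable
    also have "\<dots> = cv (win s) g x" unfolding cv_def by (rule integral_reflect_shift)
    finally show ?thesis .
  qed
  have wc: "continuous_on UNIV w"
  proof (intro continuous_at_imp_continuous_on ballI continuous_at_sequentiallyI)
    fix x and a :: "nat \<Rightarrow> real" assume a: "a \<longlonglongrightarrow> x"
    show "(\<lambda>n. w (a n)) \<longlonglongrightarrow> w x"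
      unfolding w_def
    proof (rule integral_dominated_convergence[where w="\<lambda>y. \<bar>g y\<bar>"])
      show "AE y in lborel. (\<lambda>n. indicator {..a n} y * g y) \<longlonglongrightarrow> indicator {..x} y * g y"
        using AE_lborel_singleton[of x]
      proof eventually_elim
        case (elim y)
        have "\<forall>\<^sub>F n in sequentially. indicator {..a n} y = (indicator {..x} y :: real)"
        proof (cases "y < x")
          case True
          from order_tendstoD(1)[OF a True] show ?thesis by eventually_elim (use True in auto)
        next
          case False
          then have "x < y" using elim by simp
          from order_tendstoD(2)[OF a this] show ?thesis by eventually_elim (use \<open>x < y\<close> in auto)
        qed
        then have "\<forall>\<^sub>F n in sequentially. indicator {..a n} y * g y = indicator {..x} y * g y" by eventually_elim simp
        then show ?case by (rule tendsto_eventually)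
      qed
      show "AE y in lborel. norm (indicator {..a n} y * g y) \<le> \<bar>g y\<bar>" for n by (auto split: split_indicator)
    qed (use g in auto)
  qed
  have wm: "w \<in> borel_measurable lborel" by (rule continuous_measurable_lborel[OF wc])
  have hw: "has_weak_deriv w g"
  proof (rule has_weak_deriv_lborelI[OF wm loc_integrable_bounded[OF wm wb] _ loc_integrable_integrable[OF g(1)]])
    show "g \<in> borel_measurable lborel" using gm by simp
    fix \<phi> :: "real \<Rightarrow> real" assume \<phi>: "test_function \<phi>"
    note c = test_function_cont[OF \<phi>] test_function_deriv_cont[OF \<phi>]
    obtain R b where R: "R > 0" "\<And>x. \<bar>x\<bar> > R \<Longrightarrow> \<phi> x = 0" "\<And>x. \<bar>x\<bar> > R \<Longrightarrow> deriv \<phi> x = 0"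
      using test_function_bounds[OF \<phi>] by metis
    have i\<phi>: "integrable lborel (deriv \<phi>)" by (rule integrable_continuous_compact_support[OF c(2) R(3)])
    have [measurable]: "deriv \<phi> \<in> borel_measurable borel" using i\<phi> by auto
    have pm: "(\<lambda>(x, y). indicator {..x} y * g y * deriv \<phi> x) \<in> borel_measurable (lborel \<Otimes>\<^sub>M lborel)"
    proof -
      have "(\<lambda>(x, y). indicator {..x} y * g y * deriv \<phi> x) = (\<lambda>(x, y). (if y \<le> x then 1 else 0) * g y * deriv \<phi> x)"
        by (auto simp: fun_eq_iff)
      then show ?thesis by simp
    qed
    have pi: "integrable (lborel \<Otimes>\<^sub>M lborel) (\<lambda>(x, y). indicator {..x} y * g y * deriv \<phi> x)"
    proof (rule Bochner_Integration.integrable_bound[OF _ pm])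
      show "integrable (lborel \<Otimes>\<^sub>M lborel) (\<lambda>(x, y). deriv \<phi> x * g y)"
        by (rule lborel_pair.Fubini_integrable) (use i\<phi> g in \<open>auto simp: abs_mult\<close>)
      show "AE z in lborel \<Otimes>\<^sub>M lborel. norm (case z of (x, y) \<Rightarrow> indicator {..x} y * g y * deriv \<phi> x)
          \<le> norm (case z of (x, y) \<Rightarrow> deriv \<phi> x * g y)"
        by (intro AE_I2) (simp add: split_beta abs_mult indicator_def)
    qed
    have inner: "(LINT x|lborel. indicator {..x} y * g y * deriv \<phi> x) = - (g y * \<phi> y)" for y
    proof -
      have "(LINT x|lborel. indicator {..x} y * g y * deriv \<phi> x) = g y * (LINT x|lborel. deriv \<phi> x * indicator {y..max y (R + 1)} x)"
      proof -
        have "indicator {..x} y * g y * deriv \<phi> x = g y * (deriv \<phi> x * indicator {y..max y (R + 1)} x)" for x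
          using R(3)[of x] R(1) by (auto split: split_indicator)
        then show ?thesis by (simp only: integral_mult_right_zero)
      qed
      also have "(LINT x|lborel. deriv \<phi> x * indicator {y..max y (R + 1)} x) = \<phi> (max y (R + 1)) - \<phi> y"
        by (rule integral_FTC_Icc_real) (use c(3) isCont_continuous[OF c(2)] in auto)
      also have "\<phi> (max y (R + 1)) = 0" using R(1) by (intro R(2)) (auto simp: max_def)
      finally show ?thesis by simp
    qed
    have "(LINT x|lborel. w x * deriv \<phi> x) = (LINT x|lborel. LINT y|lborel. indicator {..x} y * g y * deriv \<phi> x)"
      unfolding w_def by simp
    also have "\<dots> = (LINT y|lborel. LINT x|lborel. indicator {..x} y * g y * deriv \<phi> x)"
      by (rule lborel_pair.Fubini_integral[OF pi, symmetric])
    also have "\<dots> = - (LINT y|lborel. g y * \<phi> y)" unfolding inner by simp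
    finally show "(LINT x|lborel. w x * deriv \<phi> x) = - (LINT x|lborel. g x * \<phi> x)" .
  qed
  have "has_weak_deriv (\<lambda>x. u0 x - w x) (\<lambda>_. 0)"
  proof (rule has_weak_deriv_cong_AE[OF has_weak_deriv_diff[OF u hw]])
    show "loc_integrable (\<lambda>x. u0 x - w x)" using has_weak_deriv_diff[OF u hw] by (simp add: has_weak_deriv_def)
    show "AE x in lebesgue. d x - g x = 0" using g(2) by eventually_elim simp
    show "loc_integrable (\<lambda>_. 0)" by (simp add: loc_integrable_def set_integrable_def)
  qed simp
  then obtain c where c: "AE x in lebesgue. u0 x - w x = c" by (rule weak_deriv_zero_imp_const)
  show ?thesis
  proof (rule that[of "\<lambda>x. w x + c"])
    show "continuous_on UNIV (\<lambda>x. w x + c)" by (intro continuous_intros wc)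
    show "w (x + s) + c - (w x + c) = cv (win s) g x" if "s \<ge> 0" for x s using FTC[OF that, of x] by simp
    show "AE x in lebesgue. u0 x = w x + c" using c by eventually_elim simp
  qed
qed

section \<open>Entropies and test functions\<close>

lemma test_function_partials:
  fixes \<phi> :: "real \<times> real \<Rightarrow> real"
  assumes \<phi>: "test_function \<phi>"
  obtains ft fx B R where "\<And>t x. ((\<lambda>y. \<phi> (t, y)) has_real_derivative fx t x) (at x)"
    "\<And>t x. ((\<lambda>s. \<phi> (s, x)) has_real_derivative ft t x) (at t)"
    "continuous_on UNIV (\<lambda>p. fx (fst p) (snd p))" "continuous_on UNIV (\<lambda>p. ft (fst p) (snd p))"
    "\<And>t x. \<bar>\<phi> (t, x)\<bar> \<le> B" "\<And>t x. \<bar>fx t x\<bar> \<le> B" "\<And>t x. \<bar>ft t x\<bar> \<le> B" "R > 0"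
    "\<And>t x. \<bar>t\<bar> > R \<or> \<bar>x\<bar> > R \<Longrightarrow> \<phi> (t, x) = 0" "\<And>t x. \<bar>t\<bar> > R \<or> \<bar>x\<bar> > R \<Longrightarrow> fx t x = 0"
    "\<And>t x. \<bar>t\<bar> > R \<or> \<bar>x\<bar> > R \<Longrightarrow> ft t x = 0"
proof -
  have "Ck (Suc 0) \<phi>" using \<phi> by (simp add: test_function_def)
  then obtain g where g: "\<And>p. (\<phi> has_derivative (\<lambda>h. g p \<bullet> h)) (at p)"
    "\<And>b. b \<in> Basis \<Longrightarrow> continuous_on UNIV (\<lambda>p. g p \<bullet> b)"
    unfolding Ck.simps by blast
  define fx where "fx t x = g (t, x) \<bullet> (0, 1)" for t x
  define ft where "ft t x = g (t, x) \<bullet> (1, 0)" for t x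
  have dx: "((\<lambda>y. \<phi> (t, y)) has_real_derivative fx t x) (at x)" for t x
  proof -
    have "((\<lambda>y. (t, y)) has_derivative (\<lambda>h. (0, h))) (at x)" by (auto intro!: derivative_eq_intros)
    from has_derivative_compose[OF this g(1)]
    have "((\<lambda>y. \<phi> (t, y)) has_derivative (\<lambda>h. g (t, x) \<bullet> (0, h))) (at x)" .
    moreover have "(\<lambda>h. g (t, x) \<bullet> (0, h)) = (*) (fx t x)" by (auto simp: fx_def inner_prod_def)
    ultimately show ?thesis by (simp add: has_field_derivative_def)
  qed
  have dt: "((\<lambda>s. \<phi> (s, x)) has_real_derivative ft t x) (at t)" for t x
  proof -
    have "((\<lambda>s. (s, x)) has_derivative (\<lambda>h. (h, 0))) (at t)" by (auto intro!: derivative_eq_intros)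
    from has_derivative_compose[OF this g(1)]
    have "((\<lambda>s. \<phi> (s, x)) has_derivative (\<lambda>h. g (t, x) \<bullet> (h, 0))) (at t)" .
    moreover have "(\<lambda>h. g (t, x) \<bullet> (h, 0)) = (*) (ft t x)" by (auto simp: ft_def inner_prod_def)
    ultimately show ?thesis by (simp add: has_field_derivative_def)
  qed
  have cx: "continuous_on UNIV (\<lambda>p. fx (fst p) (snd p))" and ct: "continuous_on UNIV (\<lambda>p. ft (fst p) (snd p))"
    using g(2)[of "(0, 1)"] g(2)[of "(1, 0)"] by (simp_all add: fx_def ft_def Basis_prod_def)
  have c: "continuous_on UNIV (\<lambda>p. \<phi> (fst p, snd p))"
    using has_derivative_continuous[OF g(1)] by (simp add: continuous_on_eq_continuous_at)
  obtain R where R: "R > 0" "\<And>p. norm p > R \<Longrightarrow> \<phi> p = 0" by (rule test_function_support[OF \<phi>], rule that)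
  have 0: "\<phi> (t, x) = 0" if "\<bar>t\<bar> > R \<or> \<bar>x\<bar> > R" for t x
  proof (rule R(2))
    have "\<bar>t\<bar> \<le> norm (t, x)" "\<bar>x\<bar> \<le> norm (t, x)" using norm_fst_le[of t x] norm_snd_le[of x t] by simp_all
    then show "norm (t, x) > R" using that by linarith
  qed
  have x0: "fx t x = 0" if "\<bar>t\<bar> > R \<or> \<bar>x\<bar> > R" for t x
  proof -
    have "deriv (\<lambda>y. \<phi> (t, y)) x = 0"
    proof (cases "\<bar>t\<bar> > R")
      case True
      then have "(\<lambda>y. \<phi> (t, y)) = (\<lambda>_. 0)" using 0 by auto
      then show ?thesis by simp
    qed (use that 0 in \<open>auto intro!: test_function_deriv_support[of R "\<lambda>y. \<phi> (t, y)" x]\<close>)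
    then show ?thesis using DERIV_imp_deriv[OF dx] by simp
  qed
  have t0: "ft t x = 0" if "\<bar>t\<bar> > R \<or> \<bar>x\<bar> > R" for t x
  proof -
    have "deriv (\<lambda>s. \<phi> (s, x)) t = 0"
    proof (cases "\<bar>x\<bar> > R")
      case True
      then have "(\<lambda>s. \<phi> (s, x)) = (\<lambda>_. 0)" using 0 by auto
      then show ?thesis by simp
    qed (use that 0 in \<open>auto intro!: test_function_deriv_support[of R "\<lambda>s. \<phi> (s, x)" t]\<close>)
    then show ?thesis using DERIV_imp_deriv[OF dt] by simp
  qed
  have bd: "\<exists>b. \<forall>t x. \<bar>p t x\<bar> \<le> b"
    if pc: "continuous_on UNIV (\<lambda>z. p (fst z) (snd z))" and p0: "\<And>t x. \<bar>t\<bar> > R \<or> \<bar>x\<bar> > R \<Longrightarrow> p t x = 0"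
    for p :: "real \<Rightarrow> real \<Rightarrow> real"
  proof -
    have "bounded ((\<lambda>z. p (fst z) (snd z)) ` ({-R..R} \<times> {-R..R}))"
      by (intro compact_imp_bounded compact_continuous_image continuous_on_subset[OF pc] compact_Times compact_Icc subset_UNIV)
    then obtain b where b: "\<And>z. z \<in> {-R..R} \<times> {-R..R} \<Longrightarrow> norm (p (fst z) (snd z)) \<le> b" unfolding bounded_iff by blast
    have "\<bar>p t x\<bar> \<le> \<bar>b\<bar>" for t x
    proof (cases "\<bar>t\<bar> > R \<or> \<bar>x\<bar> > R")
      case False
      then have "(t, x) \<in> {-R..R} \<times> {-R..R}" by (auto simp: abs_le_iff not_less)
      from b[OF this] show ?thesis by simp
    qed (use p0 in simp)
    then show ?thesis by blast
  qed
  obtain b where b: "\<And>t x. \<bar>\<phi> (t, x)\<bar> \<le> b" using bd[OF c 0] by blast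
  obtain bx where bx: "\<And>t x. \<bar>fx t x\<bar> \<le> bx" using bd[OF cx x0] by blast
  obtain bt where bt: "\<And>t x. \<bar>ft t x\<bar> \<le> bt" using bd[OF ct t0] by blast
  show ?thesis
  proof (rule that[OF dx dt cx ct _ _ _ R(1) 0 x0 t0])
    show "\<bar>\<phi> (t, x)\<bar> \<le> max b (max bx bt)" for t x using b[of t x] by linarith
    show "\<bar>fx t x\<bar> \<le> max b (max bx bt)" for t x using bx[of t x] by linarith
    show "\<bar>ft t x\<bar> \<le> max b (max bx bt)" for t x using bt[of t x] by linarith
  qed
qed

lemma entropy_data_exists:
  fixes \<phi> :: "real \<times> real \<Rightarrow> real"
  assumes \<phi>: "test_function \<phi>" and \<eta>: "Ck 2 \<eta>" and q: "\<And>y. (q has_real_derivative y * deriv \<eta> y) (at y)"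
  obtains \<eta>2 ft fx B R where "entropy_data \<eta> (deriv \<eta>) \<eta>2 q (\<lambda>t x. \<phi> (t, x)) ft fx B R"
proof -
  have "Ck (Suc (Suc 0)) \<eta>" using \<eta> by (simp add: numeral_2_eq_2)
  then obtain \<eta>1 \<eta>2 where d: "\<And>y. (\<eta> has_real_derivative \<eta>1 y) (at y)" "\<And>y. (\<eta>1 has_real_derivative \<eta>2 y) (at y)"
    "Ck 0 \<eta>2" unfolding Ck_Suc_real by blast
  have "deriv \<eta> = \<eta>1" using DERIV_imp_deriv[OF d(1)] by auto
  note d = d[folded this]
  show ?thesis
  proof (rule test_function_partials[OF \<phi>])
    fix fx ft B R
    assume *: "\<And>t x. ((\<lambda>y. \<phi> (t, y)) has_real_derivative fx t x) (at x)"
      "\<And>t x. ((\<lambda>s. \<phi> (s, x)) has_real_derivative ft t x) (at t)"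
      "continuous_on UNIV (\<lambda>p. fx (fst p) (snd p))" "continuous_on UNIV (\<lambda>p. ft (fst p) (snd p))"
      "\<And>t x. \<bar>\<phi> (t, x)\<bar> \<le> B" "\<And>t x. \<bar>fx t x\<bar> \<le> B" "\<And>t x. \<bar>ft t x\<bar> \<le> B" "R > 0"
      "\<And>t x. \<bar>t\<bar> > R \<or> \<bar>x\<bar> > R \<Longrightarrow> \<phi> (t, x) = 0" "\<And>t x. \<bar>t\<bar> > R \<or> \<bar>x\<bar> > R \<Longrightarrow> fx t x = 0"
      "\<And>t x. \<bar>t\<bar> > R \<or> \<bar>x\<bar> > R \<Longrightarrow> ft t x = 0"
    have "entropy_data \<eta> (deriv \<eta>) \<eta>2 q (\<lambda>t x. \<phi> (t, x)) ft fx B R"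
      by (rule entropy_data.intro[OF d(1,2) _ q *]) (use d(3) in simp)
    then show ?thesis by (rule that)
  qed
qed

section \<open>The norms of the limit\<close>

lemma H1I:
  assumes f: "f \<in> borel_measurable lborel" "integrable lborel (\<lambda>x. (f x)\<^sup>2)"
    and g: "g \<in> borel_measurable lborel" "integrable lborel (\<lambda>x. (g x)\<^sup>2)" and fg: "has_weak_deriv f g"
  shows "f \<in> H1" "H1_norm f = sqrt ((LINT x|lborel. (f x)\<^sup>2) + (LINT x|lborel. (g x)\<^sup>2))"
proof -
  have m: "(\<lambda>x. (f x)\<^sup>2) \<in> borel_measurable lborel" "(\<lambda>x. (g x)\<^sup>2) \<in> borel_measurable lborel" using f g by auto
  have "f \<in> L2" "g \<in> L2"
    using f g m by (auto simp: L2_def lebesgue_measurableI integrable_lebesgue_iff)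
  then show "f \<in> H1" using fg by (auto simp: H1_def)
  have wm: "weak_deriv f \<in> borel_measurable lebesgue"
    using has_weak_deriv_weak_deriv[OF fg] by (auto simp: has_weak_deriv_def intro: loc_integrable_measurable)
  have "(LINT x|lebesgue. (weak_deriv f x)\<^sup>2) = (LINT x|lborel. (g x)\<^sup>2)"
    by (rule integral_lebesgue_AE_eq[OF borel_measurable_power[OF wm] m(2)]) (use AE_weak_deriv[OF fg] in eventually_elim, simp)
  then show "H1_norm f = sqrt ((LINT x|lborel. (f x)\<^sup>2) + (LINT x|lborel. (g x)\<^sup>2))"
    by (simp add: H1_norm_def integral_lebesgue_eq[OF m(1)])
qed

lemma total_variation_bounds:
  assumes f: "f \<in> borel_measurable lebesgue" "AE x in lebesgue. f x = g x" and g: "integrable lborel g" "modl V g"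
  shows "0 \<le> total_variation f" "total_variation f \<le> ereal V"
proof -
  have eq: "(LINT x|lebesgue. f x * deriv \<phi> x) = (LINT x|lborel. g x * deriv \<phi> x)" if \<phi>: "test_function \<phi>" for \<phi>
  proof (rule integral_lebesgue_AE_eq)
    have m: "deriv \<phi> \<in> borel_measurable lborel" using test_function_bm(2)[OF \<phi>] by auto
    show "(\<lambda>x. f x * deriv \<phi> x) \<in> borel_measurable lebesgue"
      by (rule borel_measurable_times[OF f(1) lebesgue_measurableI[OF m]])
    show "(\<lambda>x. g x * deriv \<phi> x) \<in> borel_measurable lborel"
      by (rule borel_measurable_times[OF borel_measurable_integrable[OF g(1)] m])
    show "AE x in lebesgue. f x * deriv \<phi> x = g x * deriv \<phi> x" using f(2) by eventually_elim simp
  qed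
  show "total_variation f \<le> ereal V"
    unfolding total_variation_def
    by (rule SUP_least) (use eq variation_le_modl[OF g] in auto)
  \<comment> \<open>The zero test function excludes minus infinity as the value of the supremum, so
    that \<open>real_of_ereal\<close> later returns the true variation.\<close>
  have t0: "test_function (\<lambda>x::real. 0::real)" by (rule test_functionI[OF Ck_const]) simp
  have "ereal (LINT x|lebesgue. f x * deriv (\<lambda>x. 0) x) \<le> total_variation f"
    unfolding total_variation_def by (rule SUP_upper) (use t0 in simp)
  then show "0 \<le> total_variation f" unfolding zero_ereal_def by simp
qed

text \<open>A curve that is continuous from the left is approximated by sampling it on finer and finer grids.\<close>

lemma strongly_measurable_left_continuous:
  fixes F :: "real \<Rightarrow> real \<Rightarrow> real"
  assumes I: "I \<in> sets lebesgue" "\<And>t. t \<in> I \<Longrightarrow> 0 \<le> t" and X: "\<And>t. 0 \<le> t \<Longrightarrow> F t \<in> X"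
    and lim: "\<And>t a. t \<in> I \<Longrightarrow> a \<longlonglongrightarrow> t \<Longrightarrow> (\<And>n::nat. 0 \<le> a n) \<Longrightarrow> (\<And>n. a n \<le> t) \<Longrightarrow> (\<lambda>n. N (\<lambda>x. F t x - F (a n) x)) \<longlonglongrightarrow> 0"
  shows "strongly_measurable I X N F"
  unfolding strongly_measurable_def
\<comment> \<open>The curve is evaluated at the last multiple of 1/(n+1) before t; capping t at n
  leaves finitely many sample times, hence a simple function.\<close>
proof (intro exI[of _ "\<lambda>n t. F (real (nat \<lfloor>min t (real n) / (1 / real (Suc n))\<rfloor>) * (1 / real (Suc n)))"] conjI allI AE_I2)
  define \<delta> where "\<delta> n = 1 / real (Suc n)" for n
  define a where "a n t = real (nat \<lfloor>min t (real n) / \<delta> n\<rfloor>) * \<delta> n" for n t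
  have \<delta>: "\<delta> n > 0" for n by (simp add: \<delta>_def)
  have sp: "space (lebesgue_on I) = I" by simp
  have a0: "0 \<le> a n t" for n t using \<delta>[of n] by (simp add: a_def)
  have ab: "a n t \<le> min t (real n)" "min t (real n) < a n t + \<delta> n" if "0 \<le> t" for n t
    using floor_mult_bounds[OF \<delta>, of "min t (real n)" n] that by (auto simp: a_def distrib_right)
  fix n
  have "simple_function (lebesgue_on I) (a n)"
  proof (rule simple_function_borel_measurable)
    have "a n \<in> borel_measurable borel" unfolding a_def[abs_def] by measurable
    then have "a n \<in> borel_measurable lebesgue" by (intro lebesgue_measurableI) simp
    then show "a n \<in> borel_measurable (lebesgue_on I)" by (rule measurable_restrict_space1)
    have "a n ` I \<subseteq> (\<lambda>k. real k * \<delta> n) ` {..n * Suc n}"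
    proof
      fix y assume "y \<in> a n ` I"
      then obtain t where t: "t \<in> I" "y = a n t" by blast
      have "a n t \<le> real n" using ab(1)[OF I(2)[OF t(1)], of n] by simp
      then have "real (nat \<lfloor>min t (real n) / \<delta> n\<rfloor>) \<le> real n * real (Suc n)"
        by (simp add: a_def \<delta>_def pos_divide_le_eq)
      then have "nat \<lfloor>min t (real n) / \<delta> n\<rfloor> \<le> n * Suc n" by (metis of_nat_le_iff of_nat_mult)
      then show "y \<in> (\<lambda>k. real k * \<delta> n) ` {..n * Suc n}" unfolding t(2) a_def by blast
    qed
    then show "finite (a n ` space (lebesgue_on I))" unfolding sp by (rule finite_subset) simp
  qed
  from simple_function_compose[OF this, of F]
  show "simple_function (lebesgue_on I) (\<lambda>t. F (real (nat \<lfloor>min t (real n) / (1 / real (Suc n))\<rfloor>) * (1 / real (Suc n))))"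
    by (simp add: comp_def a_def \<delta>_def)
  show "(\<lambda>t. F (real (nat \<lfloor>min t (real n) / (1 / real (Suc n))\<rfloor>) * (1 / real (Suc n)))) ` I \<subseteq> X"
    by (intro image_subsetI X) simp
  fix t assume "t \<in> space (lebesgue_on I)"
  then have t: "t \<in> I" "0 \<le> t" using I(2) by auto
  then show "F t \<in> X" using X by blast
  have "(\<lambda>n. a n t) \<longlonglongrightarrow> t"
  proof -
    have "\<forall>\<^sub>F n in sequentially. t \<le> real n" using filterlim_real_sequentially by (simp add: filterlim_at_top)
    then have "\<forall>\<^sub>F n in sequentially. norm (a n t - t) \<le> \<delta> n"
    proof eventually_elim
      case (elim n)
      then show ?case using ab[OF t(2), of n] by (simp add: min_absorb1)
    qed
    then have "(\<lambda>n. a n t - t) \<longlonglongrightarrow> 0"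
      by (rule Lim_null_comparison) (use LIMSEQ_inverse_Suc in \<open>simp add: \<delta>_def\<close>)
    then show ?thesis by (simp add: LIM_zero_iff)
  qed
  from lim[OF t(1) this a0] ab(1)[OF t(2)]
  show "(\<lambda>n. N (\<lambda>x. F t x - F (real (nat \<lfloor>min t (real n) / (1 / real (Suc n))\<rfloor>) * (1 / real (Suc n))) x)) \<longlonglongrightarrow> 0"
    by (simp add: a_def \<delta>_def)
qed

lemma sqrt_increment_LIMSEQ:
  fixes a :: "nat \<Rightarrow> real"
  assumes "a \<longlonglongrightarrow> t" shows "(\<lambda>n. K * sqrt (t - a n)) \<longlonglongrightarrow> 0"
proof -
  from assms have "(\<lambda>n. K * sqrt (t - a n)) \<longlonglongrightarrow> K * sqrt (t - t)" by (intro tendsto_intros)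
  then show ?thesis by simp
qed

text \<open>L^1 continuity in time together with a common supremum bound yields L^2 continuity,
  which the H^1 norm requires.\<close>

lemma difference_square:
  fixes f g :: "real \<Rightarrow> real"
  assumes i: "integrable lborel (\<lambda>x. f x - g x)" and b: "\<And>x. \<bar>f x\<bar> \<le> K" "\<And>x. \<bar>g x\<bar> \<le> K"
  shows "integrable lborel (\<lambda>x. (f x - g x)\<^sup>2)" "(LINT x|lborel. (f x - g x)\<^sup>2) \<le> 2 * K * (LINT x|lborel. \<bar>f x - g x\<bar>)"
proof -
  have le: "\<bar>(f x - g x)\<^sup>2\<bar> \<le> 2 * K * \<bar>f x - g x\<bar>" for x
  proof -
    have "\<bar>f x - g x\<bar> \<le> 2 * K" using b[of x] by linarith
    then have "\<bar>f x - g x\<bar> * \<bar>f x - g x\<bar> \<le> 2 * K * \<bar>f x - g x\<bar>" by (rule mult_right_mono) simp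
    then show ?thesis by (simp add: power2_eq_square abs_mult)
  qed
  have w: "integrable lborel (\<lambda>x. 2 * K * \<bar>f x - g x\<bar>)" using i by auto
  have m: "(\<lambda>x. (f x - g x)\<^sup>2) \<in> borel_measurable lborel" by (rule borel_measurable_power[OF borel_measurable_integrable[OF i]])
  show "integrable lborel (\<lambda>x. (f x - g x)\<^sup>2)" by (rule integral_le_abs(1)[OF w le m])
  show "(LINT x|lborel. (f x - g x)\<^sup>2) \<le> 2 * K * (LINT x|lborel. \<bar>f x - g x\<bar>)"
    using integral_le_abs(2)[OF w le m] by simp
qed

section \<open>Membership of the limit in the prescribed function spaces\<close>

context limit_solution
begin

lemma u_measurable: "0 \<le> t \<Longrightarrow> u t \<in> borel_measurable lborel"
  by (rule continuous_measurable_lborel[OF u_cont])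

lemma u_weak_deriv: assumes t: "0 \<le> t" shows "has_weak_deriv (u t) (v t)"
proof (rule has_weak_deriv_lborelI[OF u_measurable[OF t] loc_integrable_bounded[OF u_measurable[OF t] u_bound[OF t]]
      v_measurable[OF t] loc_integrable_integrable[OF v_L1(1)[OF t]]])
  fix \<phi> :: "real \<Rightarrow> real" assume \<phi>: "test_function \<phi>"
  obtain R where R: "\<And>x. \<bar>x\<bar> > R \<Longrightarrow> \<phi> x = 0" "\<And>x. \<bar>x\<bar> > R \<Longrightarrow> deriv \<phi> x = 0"
    using test_function_bounds[OF \<phi>] by metis
  show "(LINT x|lborel. u t x * deriv \<phi> x) = - (LINT x|lborel. v t x * \<phi> x)"
    by (rule weak_derivative_limit[OF t test_function_deriv_cont(2,1)[OF \<phi>] R])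
qed

lemma weak_deriv_u: assumes t: "0 \<le> t"
  shows "weak_deriv (u t) \<in> borel_measurable lebesgue" "AE x in lebesgue. weak_deriv (u t) x = v t x"
  using has_weak_deriv_weak_deriv[OF u_weak_deriv[OF t]] AE_weak_deriv[OF u_weak_deriv[OF t]]
  by (auto simp: has_weak_deriv_def intro: loc_integrable_measurable)

lemma u_H1: assumes t: "0 \<le> t"
  shows "u t \<in> H1" "H1_norm (u t) \<le> sqrt E"
proof -
  note h = H1I[OF u_measurable[OF t] energy_limit(1)[OF t] v_measurable[OF t] energy_limit(2)[OF t] u_weak_deriv[OF t]]
  show "u t \<in> H1" by (rule h(1))
  show "H1_norm (u t) \<le> sqrt E" unfolding h(2) by (rule real_sqrt_le_mono[OF energy_limit(3)[OF t]])
qed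

text \<open>The choice r = sqrt(t - s) balances the terms (t - s)/r and r of the interpolation
  estimate, giving exponent 1/2 in time.\<close>

lemma v_Hoelder:
  assumes st: "0 \<le> s" "s \<le> t"
  shows "(LINT x|lborel. \<bar>v t x - v s x\<bar>) \<le> (2 * C + 2 * \<Gamma> t) * sqrt (t - s)"
proof (cases "s = t")
  case False
  define r where "r = sqrt (t - s)"
  have r: "r > 0" "r * r = t - s" using st False by (auto simp: r_def)
  have "(LINT x|lborel. \<bar>v t x - v s x\<bar>) \<le> 2 / r * (C * (r * r)) + (\<Gamma> t + \<Gamma> s) * r"
    using time_continuity(4)[OF st r(1)] by (simp add: r(2))
  also have "\<dots> \<le> 2 / r * (C * (r * r)) + (\<Gamma> t + \<Gamma> t) * r"
    using \<Gamma>_mono[OF st(2)] r(1) by (intro add_left_mono mult_right_mono) auto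
  also have "\<dots> = (2 * C + 2 * \<Gamma> t) * r" using r(1) by (simp add: algebra_simps)
  finally show ?thesis by (simp add: r_def)
qed simp

lemma v_LIMSEQ:
  assumes "0 \<le> t" "a \<longlonglongrightarrow> t" "\<And>n::nat. 0 \<le> a n" "\<And>n. a n \<le> t"
  shows "(\<lambda>n. LINT x|lborel. \<bar>v t x - v (a n) x\<bar>) \<longlonglongrightarrow> 0"
  by (rule Lim_null_comparison[OF _ sqrt_increment_LIMSEQ[OF assms(2), of "2 * C + 2 * \<Gamma> t"]])
    (use v_Hoelder[OF assms(3,4)] in auto)

lemma u_LIMSEQ:
  assumes "a \<longlonglongrightarrow> t" "\<And>n::nat. 0 \<le> a n" "\<And>n. a n \<le> t"
  shows "(\<lambda>n. LINT x|lborel. \<bar>u t x - u (a n) x\<bar>) \<longlonglongrightarrow> 0"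
proof (rule Lim_null_comparison)
  show "\<forall>\<^sub>F n in sequentially. norm (LINT x|lborel. \<bar>u t x - u (a n) x\<bar>) \<le> C * (t - a n)"
    using time_continuity(2)[OF assms(2,3)] by auto
  have "(\<lambda>n. C * (t - a n)) \<longlonglongrightarrow> C * (t - t)" by (intro tendsto_intros assms(1))
  then show "(\<lambda>n. C * (t - a n)) \<longlonglongrightarrow> 0" by simp
qed

lemma u_Linf_H1: "Linf_H1 u"
  unfolding Linf_H1_def
proof
  show "ess_bounded {0<..} H1 H1_norm u"
    unfolding ess_bounded_def by (intro exI[of _ "sqrt E"] AE_I2) (use u_H1 in auto)
  show "strongly_measurable {0<..} H1 H1_norm u"
  proof (rule strongly_measurable_left_continuous)
    fix t :: real and a :: "nat \<Rightarrow> real" assume "t \<in> {0<..}" and a: "a \<longlonglongrightarrow> t" "\<And>n. 0 \<le> a n" "\<And>n. a n \<le> t"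
    then have t: "0 \<le> t" by simp
    have gt: "\<bar>v (a n) x\<bar> \<le> \<Gamma> t" for n x using order_trans[OF v_bound[OF a(2)] \<Gamma>_mono[OF a(3)]] .
    note du = difference_square[OF time_continuity(1)[OF a(2,3)] u_bound[OF t] u_bound[OF a(2)]]
    note dv = difference_square[OF time_continuity(3)[OF a(2,3)] v_bound[OF t] gt]
    let ?e = "\<lambda>n. sqrt (2 * sqrt E * (LINT x|lborel. \<bar>u t x - u (a n) x\<bar>) + 2 * \<Gamma> t * (LINT x|lborel. \<bar>v t x - v (a n) x\<bar>))"
    show "(\<lambda>n. H1_norm (\<lambda>x. u t x - u (a n) x)) \<longlonglongrightarrow> 0"
    proof (rule Lim_null_comparison)
      have "?e \<longlonglongrightarrow> sqrt (2 * sqrt E * 0 + 2 * \<Gamma> t * 0)"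
        by (intro tendsto_intros u_LIMSEQ v_LIMSEQ t a)
      then show "?e \<longlonglongrightarrow> 0" by simp
      have "H1_norm (\<lambda>x. u t x - u (a n) x) = sqrt ((LINT x|lborel. (u t x - u (a n) x)\<^sup>2) + (LINT x|lborel. (v t x - v (a n) x)\<^sup>2))" for n
        by (rule H1I(2)[OF borel_measurable_diff[OF u_measurable[OF t] u_measurable[OF a(2)]] du(1)
              borel_measurable_diff[OF v_measurable[OF t] v_measurable[OF a(2)]] dv(1)
              has_weak_deriv_diff[OF u_weak_deriv[OF t] u_weak_deriv[OF a(2)]]])
      then have "norm (H1_norm (\<lambda>x. u t x - u (a n) x)) \<le> ?e n" for n
        using add_mono[OF du(2) dv(2), of n n] by simp
      then show "\<forall>\<^sub>F n in sequentially. norm (H1_norm (\<lambda>x. u t x - u (a n) x)) \<le> ?e n" by simp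
    qed
  qed (use u_H1 in auto)
qed

lemma weak_deriv_u_L1: assumes t: "0 \<le> t" shows "weak_deriv (u t) \<in> L1" "L1_norm (weak_deriv (u t)) \<le> \<Gamma> t"
proof -
  note w = weak_deriv_u[OF t]
  have i: "integrable lebesgue (v t)" using v_L1(1)[OF t] integrable_lebesgue_iff[OF v_measurable[OF t]] by simp
  have "AE x in lebesgue. v t x = weak_deriv (u t) x" using w(2) by eventually_elim simp
  from integrable_cong_AE_imp[OF i w(1) this]
  show "weak_deriv (u t) \<in> L1" by (simp add: L1_def)
  have "(LINT x|lebesgue. \<bar>weak_deriv (u t) x\<bar>) = (LINT x|lborel. \<bar>v t x\<bar>)"
    by (rule integral_lebesgue_AE_eq) (use w v_measurable[OF t] in \<open>auto elim: eventually_mono\<close>)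
  then show "L1_norm (weak_deriv (u t)) \<le> \<Gamma> t" using v_L1(2)[OF t] by (simp add: L1_norm_def)
qed

lemma weak_deriv_u_Linf_L1_BV: "Linf_L1_BV T (\<lambda>t. weak_deriv (u t))"
  unfolding Linf_L1_BV_def
proof
  show "ess_bounded {0<..<T} (L1 \<inter> BV) L1_BV_norm (\<lambda>t. weak_deriv (u t))"
    unfolding ess_bounded_def
  proof (intro exI[of _ "2 * \<Gamma> T"] AE_I2)
    fix t assume "t \<in> space (lebesgue_on {0<..<T})"
    then have t: "0 \<le> t" "t \<le> T" by auto
    note tv = total_variation_bounds[OF weak_deriv_u[OF t(1)] v_L1(1)[OF t(1)] v_modl[OF t(1)]]
    have "weak_deriv (u t) \<in> BV"
      using has_weak_deriv_weak_deriv[OF u_weak_deriv[OF t(1)]] tv(2) by (auto simp: BV_def has_weak_deriv_def le_less_trans)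
    moreover have "real_of_ereal (total_variation (weak_deriv (u t))) \<le> \<Gamma> t"
      using tv by (cases "total_variation (weak_deriv (u t))") auto
    ultimately show "weak_deriv (u t) \<in> L1 \<inter> BV \<and> L1_BV_norm (weak_deriv (u t)) \<le> 2 * \<Gamma> T"
      using weak_deriv_u_L1[OF t(1)] \<Gamma>_mono[OF t(2)] by (auto simp: L1_BV_norm_def)
  qed
  show "strongly_measurable {0<..<T} L1 L1_norm (\<lambda>t. weak_deriv (u t))"
  proof (rule strongly_measurable_left_continuous)
    fix t :: real and a :: "nat \<Rightarrow> real" assume "t \<in> {0<..<T}" and a: "a \<longlonglongrightarrow> t" "\<And>n. 0 \<le> a n" "\<And>n. a n \<le> t"
    then have t: "0 \<le> t" by simp
    have "L1_norm (\<lambda>x. weak_deriv (u t) x - weak_deriv (u (a n)) x) = (LINT x|lborel. \<bar>v t x - v (a n) x\<bar>)" for n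
      unfolding L1_norm_def
    proof (rule integral_lebesgue_AE_eq)
      show "(\<lambda>x. \<bar>weak_deriv (u t) x - weak_deriv (u (a n)) x\<bar>) \<in> borel_measurable lebesgue"
        using weak_deriv_u(1)[OF t] weak_deriv_u(1)[OF a(2)[of n]] by measurable
      show "(\<lambda>x. \<bar>v t x - v (a n) x\<bar>) \<in> borel_measurable lborel"
        using v_measurable[OF t] v_measurable[OF a(2)[of n]] by measurable
      show "AE x in lebesgue. \<bar>weak_deriv (u t) x - weak_deriv (u (a n)) x\<bar> = \<bar>v t x - v (a n) x\<bar>"
        using weak_deriv_u(2)[OF t] weak_deriv_u(2)[OF a(2)[of n]] by eventually_elim simp
    qed
    then show "(\<lambda>n. L1_norm (\<lambda>x. weak_deriv (u t) x - weak_deriv (u (a n)) x)) \<longlonglongrightarrow> 0"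
      using v_LIMSEQ[OF t a] by simp
  qed (use weak_deriv_u_L1 in auto)
qed

text \<open>The two chosen weak derivatives are identified as a sum, since both are multiplied by
  the same factors in the weak formulation; the sum is \<open>Zc\<close>, the object the scheme
  converges to.\<close>

lemma source_term:
  assumes t: "0 \<le> t"
  shows "weak_deriv (P1 (u t)) \<in> borel_measurable lebesgue"
    "weak_deriv (weak_deriv (P2 (u t))) \<in> borel_measurable lebesgue"
    "AE x in lebesgue. weak_deriv (P1 (u t)) x + weak_deriv (weak_deriv (P2 (u t))) x = Zc (u t) (v t) x"
proof -
  define p1 where "p1 x = 2 * (v t x)\<^sup>2 + 6 * (u t x)\<^sup>2" for x
  define p2 where "p2 x = (v t x)\<^sup>2" for x
  note e = energy_limit(1,2)[OF t] and w = weak_deriv_u[OF t]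
  have um: "u t \<in> borel_measurable lebesgue" by (rule lebesgue_measurableI[OF u_measurable[OF t]])
  have v2: "(v t x)\<^sup>2 \<le> (\<Gamma> t)\<^sup>2" for x using v_bound[OF t, of x] by (rule abs_le_square_iff[THEN iffD1, OF order_trans[OF _ abs_ge_self]])
  have u2: "(u t x)\<^sup>2 \<le> E" for x
    using abs_le_square_iff[THEN iffD1, OF order_trans[OF u_bound[OF t, of x] abs_ge_self]] E0 by simp
  have i: "integrable lborel p1" "integrable lborel p2" using e by (auto simp: p1_def[abs_def] p2_def[abs_def])
  have b: "\<bar>p1 x\<bar> \<le> 2 * (\<Gamma> t)\<^sup>2 + 6 * E" "\<bar>p2 x\<bar> \<le> (\<Gamma> t)\<^sup>2" for x
    using v2[of x] u2[of x] by (auto simp: p1_def p2_def)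
  have P1: "P1 (u t) = Gc p1"
    unfolding P1_def
  proof (rule convolve_G[OF bounded_measurableI[OF borel_measurable_integrable[OF i(1)] b(1)]])
    show "(\<lambda>x. 2 * (weak_deriv (u t) x)\<^sup>2 + 6 * (u t x)\<^sup>2) \<in> borel_measurable lebesgue" using um w(1) by measurable
    show "AE x in lebesgue. 2 * (weak_deriv (u t) x)\<^sup>2 + 6 * (u t x)\<^sup>2 = p1 x"
      using w(2) by eventually_elim (simp add: p1_def)
  qed
  have P2: "P2 (u t) = Gc p2"
    unfolding P2_def
  proof (rule convolve_G[OF bounded_measurableI[OF borel_measurable_integrable[OF i(2)] b(2)]])
    show "(\<lambda>x. (weak_deriv (u t) x)\<^sup>2) \<in> borel_measurable lebesgue" using w(1) by measurable
    show "AE x in lebesgue. (weak_deriv (u t) x)\<^sup>2 = p2 x"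
      using w(2) by eventually_elim (simp add: p2_def)
  qed
  note r1 = resolvent_weak_deriv[OF i(1) b(1)] and r2 = resolvent_weak_deriv[OF i(2) b(2)]
  have m: "weak_deriv f \<in> borel_measurable lebesgue" if "has_weak_deriv f g" for f g
    using has_weak_deriv_weak_deriv[OF that] by (auto simp: has_weak_deriv_def intro: loc_integrable_measurable)
  \<comment> \<open>The inner \<open>weak_deriv\<close> is itself an arbitrary choice, equal to
    \<open>Dc p2\<close> almost everywhere only, so its weak derivative is obtained by
    congruence.\<close>
  have d2: "has_weak_deriv (weak_deriv (Gc p2)) (\<lambda>x. Gc p2 x - p2 x)"
  proof (rule has_weak_deriv_cong_AE[OF r2(2)])
    show "loc_integrable (weak_deriv (Gc p2))" using has_weak_deriv_weak_deriv[OF r2(1)] by (simp add: has_weak_deriv_def)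
    show "loc_integrable (\<lambda>x. Gc p2 x - p2 x)" using r2(2) by (simp add: has_weak_deriv_def)
    show "AE x in lebesgue. Dc p2 x = weak_deriv (Gc p2) x" using AE_weak_deriv[OF r2(1)] by eventually_elim simp
  qed simp
  show "weak_deriv (P1 (u t)) \<in> borel_measurable lebesgue" unfolding P1 by (rule m[OF r1(1)])
  show "weak_deriv (weak_deriv (P2 (u t))) \<in> borel_measurable lebesgue" unfolding P2 by (rule m[OF d2])
  show "AE x in lebesgue. weak_deriv (P1 (u t)) x + weak_deriv (weak_deriv (P2 (u t))) x = Zc (u t) (v t) x"
    unfolding P1 P2 using AE_weak_deriv[OF r1(1)] AE_weak_deriv[OF d2]
    by eventually_elim (simp add: Zc_def p1_def[abs_def] p2_def[abs_def])
qed

end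

section \<open>The entropy identity in terms of weak derivatives\<close>

context entropy_limit
begin

text \<open>For each fixed time the inner integral of the definition is \<open>Jlim\<close>. This
  needs equality almost everywhere in x only, so the chosen weak derivatives need no joint
  measurability in (t, x).\<close>

lemma time_slice:
  assumes t: "0 \<le> t"
  shows "(LINT x|lebesgue. \<eta> (u t x) * ft t x - 4 * q (u t x) * fx t x + \<eta>1 (u t x) * weak_deriv (P1 (u t)) x * f t x
      + \<eta>1 (u t x) * weak_deriv (weak_deriv (P2 (u t))) x * f t x) = Jlim \<eta> \<eta>1 q f ft fx u v t"
proof -
  let ?Z = "Zc (u t) (v t)"
  note s = source_term[OF t]
  have ftc: "continuous_on UNIV (ft t)"
    by (rule continuous_on_compose2[OF ftc, of UNIV "\<lambda>x. (t, x)", simplified]) (intro continuous_intros)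
  have uc: "continuous_on UNIV (\<lambda>x. p (u t x))" if "continuous_on UNIV p" for p :: "real \<Rightarrow> real"
    by (rule continuous_on_compose2[OF that u_cont[OF t]]) simp
  have bm: "bounded_measurable (\<lambda>x. \<eta> (u t x))" "bounded_measurable (\<lambda>x. \<eta>1 (u t x))" "bounded_measurable (\<lambda>x. 4 * q (u t x))"
  proof -
    show "bounded_measurable (\<lambda>x. \<eta> (u t x))" by (rule bounded_measurable_contI[OF uc[OF \<eta>_cont] H(2)[OF u_bound[OF t]]])
    show "bounded_measurable (\<lambda>x. \<eta>1 (u t x))" by (rule bounded_measurable_contI[OF uc[OF \<eta>1_cont] H(1)[OF u_bound[OF t]]])
    have "\<bar>4 * q (u t x)\<bar> \<le> 4 * H" for x using H(3)[OF u_bound[OF t, of x]] by (simp add: abs_mult)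
    then show "bounded_measurable (\<lambda>x. 4 * q (u t x))"
      by (rule bounded_measurable_contI[OF uc[OF continuous_on_mult_left[OF q_cont]]])
  qed
  have Zm: "bounded_measurable ?Z" by (rule bounded_measurableI[OF l1loc_D(3,4)[OF Zc_limit[OF t]]])
  have i: "integrable lborel (ft t)" "integrable lborel (f t)" "integrable lborel (fx t)"
    by (rule integrable_continuous_compact_support[of _ R]; use ftc f_cont fx_cont f0 in simp)+
  note I = integrable_mult_bounded(1)[OF i(1) bm(1)] integrable_mult_bounded(1)[OF integrable_mult_bounded(1)[OF i(2) bm(2)] Zm]
    integrable_mult_bounded(1)[OF i(3) bm(3)]
  have L: "h \<in> borel_measurable lebesgue" if "integrable lborel h" for h :: "real \<Rightarrow> real"
    by (rule lebesgue_measurableI[OF borel_measurable_integrable[OF that]])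
  have L': "h \<in> borel_measurable lebesgue" if "bounded_measurable h" for h :: "real \<Rightarrow> real"
    by (rule lebesgue_measurableI[OF bounded_measurable_D[OF that]])
  have qm: "(\<lambda>x. q (u t x)) \<in> borel_measurable lebesgue" by (rule continuous_imp_lebesgue_measurable[OF uc[OF q_cont]])
  have "(LINT x|lebesgue. \<eta> (u t x) * ft t x - 4 * q (u t x) * fx t x + \<eta>1 (u t x) * weak_deriv (P1 (u t)) x * f t x
      + \<eta>1 (u t x) * weak_deriv (weak_deriv (P2 (u t))) x * f t x)
    = (LINT x|lborel. ft t x * \<eta> (u t x) + (f t x * \<eta>1 (u t x) * ?Z x - fx t x * (4 * q (u t x))))"
  proof (rule integral_lebesgue_AE_eq)
    show "(\<lambda>x. \<eta> (u t x) * ft t x - 4 * q (u t x) * fx t x + \<eta>1 (u t x) * weak_deriv (P1 (u t)) x * f t x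
      + \<eta>1 (u t x) * weak_deriv (weak_deriv (P2 (u t))) x * f t x) \<in> borel_measurable lebesgue"
      by (intro borel_measurable_add borel_measurable_diff borel_measurable_times borel_measurable_const s(1,2) L[OF i(1)] L[OF i(2)] L[OF i(3)]
          L'[OF bm(1)] L'[OF bm(2)] qm)
    show "(\<lambda>x. ft t x * \<eta> (u t x) + (f t x * \<eta>1 (u t x) * ?Z x - fx t x * (4 * q (u t x)))) \<in> borel_measurable lborel"
      by (intro borel_measurable_add borel_measurable_diff borel_measurable_integrable I)
    show "AE x in lebesgue. \<eta> (u t x) * ft t x - 4 * q (u t x) * fx t x + \<eta>1 (u t x) * weak_deriv (P1 (u t)) x * f t x
      + \<eta>1 (u t x) * weak_deriv (weak_deriv (P2 (u t))) x * f t x = ft t x * \<eta> (u t x) + (f t x * \<eta>1 (u t x) * ?Z x - fx t x * (4 * q (u t x)))"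
      using s(3)
    proof eventually_elim
      case (elim x)
      show ?case unfolding elim[symmetric] by (simp add: algebra_simps)
    qed
  qed
  also have "\<dots> = Jlim \<eta> \<eta>1 q f ft fx u v t" unfolding Jlim_def using I by simp
  finally show ?thesis .
qed

lemma entropy_equality:
  "(LINT t:{0<..}|lebesgue. LINT x|lebesgue. \<eta> (u t x) * ft t x - 4 * q (u t x) * fx t x + \<eta>1 (u t x) * weak_deriv (P1 (u t)) x * f t x
      + \<eta>1 (u t x) * weak_deriv (weak_deriv (P2 (u t))) x * f t x) = - (LINT x|lborel. f 0 x * \<eta> (u 0 x))"
proof -
  let ?J = "\<lambda>t. indicator {0..} t * Jlim \<eta> \<eta>1 q f ft fx u v t"
  have Jm: "?J \<in> borel_measurable lborel" by (rule borel_measurable_integrable[OF entropy_limit(1)])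
  then have m: "(\<lambda>t. indicator {0<..} t * ?J t) \<in> borel_measurable lborel" by measurable
  have "(LINT t:{0<..}|lebesgue. LINT x|lebesgue. \<eta> (u t x) * ft t x - 4 * q (u t x) * fx t x + \<eta>1 (u t x) * weak_deriv (P1 (u t)) x * f t x
      + \<eta>1 (u t x) * weak_deriv (weak_deriv (P2 (u t))) x * f t x) = (LINT t|lebesgue. indicator {0<..} t * ?J t)"
    unfolding set_lebesgue_integral_def
    by (intro Bochner_Integration.integral_cong refl) (auto simp: time_slice indicator_def)
  also have "\<dots> = (LINT t|lborel. indicator {0<..} t * ?J t)" by (rule integral_lebesgue_eq[OF m])
  also have "\<dots> = (LINT t|lborel. ?J t)"
  proof (rule integral_cong_AE[OF m Jm])
    \<comment> \<open>The definition integrates over positive times, the limit over nonnegative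
      ones; they differ in the single time 0.\<close>
    show "AE t in lborel. indicator {0<..} t * ?J t = ?J t"
      using AE_lborel_singleton[of 0] by eventually_elim (auto simp: indicator_def)
  qed
  finally show ?thesis by (simp only: entropy_limit(2))
qed

end

context limit_solution
begin

text \<open>The function w stands for the given initial datum, which agrees with the continuous
  function \<open>u 0\<close> up to a null set. Convexity of the entropy does not enter, which
  admits the linear entropy as well.\<close>

lemma entropy_identity:
  assumes \<phi>: "test_function \<phi>" and \<eta>: "Ck 2 \<eta>" and q: "\<And>y. (q has_real_derivative y * deriv \<eta> y) (at y)"
    and w: "w \<in> borel_measurable lebesgue" "AE x in lebesgue. w x = u 0 x"
  shows "(LINT t:{0<..}|lebesgue. LINT x|lebesgue.
             \<eta> (u t x) * dt \<phi> t x - 4 * q (u t x) * dx \<phi> t x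
             + deriv \<eta> (u t x) * weak_deriv (P1 (u t)) x * \<phi> (t, x)
             + deriv \<eta> (u t x) * weak_deriv (weak_deriv (P2 (u t))) x * \<phi> (t, x))
        + (LINT x|lebesgue. \<eta> (w x) * \<phi> (0, x)) = 0"
proof -
  obtain \<eta>2 ft fx B R where "entropy_data \<eta> (deriv \<eta>) \<eta>2 q (\<lambda>t x. \<phi> (t, x)) ft fx B R"
    by (rule entropy_data_exists[OF \<phi> \<eta> q])
  then interpret ed: entropy_data \<eta> "deriv \<eta>" \<eta>2 q "\<lambda>t x. \<phi> (t, x)" ft fx B R .
  obtain H K where HK: "\<And>y. \<bar>y\<bar> \<le> sqrt E \<Longrightarrow> \<bar>deriv \<eta> y\<bar> \<le> H" "\<And>y. \<bar>y\<bar> \<le> sqrt E \<Longrightarrow> \<bar>\<eta>2 y\<bar> \<le> K"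
    "\<And>y. \<bar>y\<bar> \<le> sqrt E \<Longrightarrow> \<bar>\<eta> y\<bar> \<le> H" "\<And>y. \<bar>y\<bar> \<le> sqrt E \<Longrightarrow> \<bar>q y\<bar> \<le> H"
    by (rule ed.bounds_on_range[of "sqrt E"], rule that)
  interpret el: entropy_limit U g ts u0 E C \<Gamma> u \<eta> "deriv \<eta>" \<eta>2 q "\<lambda>t x. \<phi> (t, x)" ft fx B R H
    by unfold_locales (use HK in auto)
  have d: "dt \<phi> t x = ft t x" "dx \<phi> t x = fx t x" for t x
    using DERIV_imp_deriv[OF ed.ft] DERIV_imp_deriv[OF ed.fx] by auto
  have "(LINT x|lebesgue. \<eta> (w x) * \<phi> (0, x)) = (LINT x|lborel. \<phi> (0, x) * \<eta> (u 0 x))"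
  proof (rule integral_lebesgue_AE_eq)
    have \<eta>m: "\<eta> \<in> borel_measurable borel" using continuous_measurable_lborel[OF ed.\<eta>_cont] by simp
    show "(\<lambda>x. \<eta> (w x) * \<phi> (0, x)) \<in> borel_measurable lebesgue"
      by (intro borel_measurable_times measurable_compose[OF w(1) \<eta>m] continuous_imp_lebesgue_measurable ed.f_cont)
    show "(\<lambda>x. \<phi> (0, x) * \<eta> (u 0 x)) \<in> borel_measurable lborel"
      by (intro borel_measurable_times measurable_compose[OF u_measurable \<eta>m] continuous_measurable_lborel ed.f_cont order_refl)
    show "AE x in lebesgue. \<eta> (w x) * \<phi> (0, x) = \<phi> (0, x) * \<eta> (u 0 x)" using w(2) by eventually_elim simp
  qed
  then show ?thesis unfolding d el.entropy_equality by simp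
qed

lemma global_entropy_weak_solution_limit:
  assumes w: "w \<in> borel_measurable lebesgue" "AE x in lebesgue. w x = u 0 x" "H1_norm w = sqrt E"
  shows "global_entropy_weak_solution w u"
  unfolding global_entropy_weak_solution_def global_weak_solution_def
proof (intro conjI allI impI u_Linf_H1 weak_deriv_u_Linf_L1_BV)
  fix \<phi> :: "real \<times> real \<Rightarrow> real" assume \<phi>: "test_function \<phi>"
  \<comment> \<open>The flux of the linear entropy: 4 q is then 2 y^2, the flux of the weak
    formulation.\<close>
  have q: "((\<lambda>y. y\<^sup>2 / 2) has_real_derivative y * deriv (\<lambda>y. y) y) (at y)" for y :: real
    by (auto intro!: derivative_eq_intros)
  have 2: "4 * (y\<^sup>2 / 2) = 2 * y\<^sup>2" for y :: real by simp
  from entropy_identity[OF \<phi> Ck_ident q w(1,2)]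
  show "(LINT t:{0<..}|lebesgue. LINT x|lebesgue.
             u t x * dt \<phi> t x - 2 * (u t x)\<^sup>2 * dx \<phi> t x
             + weak_deriv (P1 (u t)) x * \<phi> (t, x)
             + weak_deriv (weak_deriv (P2 (u t))) x * \<phi> (t, x))
        + (LINT x|lebesgue. w x * \<phi> (0, x)) = 0"
    unfolding 2 deriv_ident mult_1 .
next
  fix t :: real assume "t > 0"
  then show "u t \<in> H1" "H1_norm (u t) \<le> H1_norm w" using u_H1[of t] w(3) by auto
next
  fix \<eta> q :: "real \<Rightarrow> real"
  assume *: "convex_on UNIV \<eta> \<and> Ck 2 \<eta> \<and> (\<forall>v. (q has_real_derivative v * deriv \<eta> v) (at v))"
  show "entropy_inequality \<eta> q w u"
    unfolding entropy_inequality_def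
  proof (intro allI impI)
    fix \<phi> :: "real \<times> real \<Rightarrow> real" assume "test_function \<phi> \<and> (\<forall>t\<ge>0. \<forall>x. \<phi> (t, x) \<ge> 0)"
    then have \<phi>: "test_function \<phi>" by blast
    have \<eta>: "Ck 2 \<eta>" and q: "\<And>y. (q has_real_derivative y * deriv \<eta> y) (at y)" using * by blast+
    show "(LINT t:{0<..}|lebesgue. LINT x|lebesgue.
             \<eta> (u t x) * dt \<phi> t x - 4 * q (u t x) * dx \<phi> t x
             + deriv \<eta> (u t x) * weak_deriv (P1 (u t)) x * \<phi> (t, x)
             + deriv \<eta> (u t x) * weak_deriv (weak_deriv (P2 (u t))) x * \<phi> (t, x))
        + (LINT x|lebesgue. \<eta> (w x) * \<phi> (0, x)) \<ge> 0"
      by (rule eq_refl[OF entropy_identity[OF \<phi> \<eta> q w(1,2), symmetric]])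
  qed
qed

end

section \<open>Existence\<close>

text \<open>The given class is replaced by a continuous function and its weak derivative by a Borel
  function. The energy of the pair is exactly the squared H^1 norm of the datum, as required for the
  final norm inequality with constant 1.\<close>

lemma initial_representative:
  assumes u0: "u0 \<in> H1" and d: "weak_deriv u0 \<in> L1 \<inter> BV"
  obtains w g0 V where "initial_data w g0 V" "AE x in lebesgue. u0 x = w x" "H1_norm u0 = sqrt (initial_data.E w g0)"
proof -
  obtain g where g: "g \<in> L2" "has_weak_deriv u0 g" and u2: "u0 \<in> L2" using u0 by (auto simp: H1_def)
  let ?d = "weak_deriv u0"
  note hd = has_weak_deriv_weak_deriv[OF g(2)]
  have di: "integrable lebesgue ?d" using d by (simp add: L1_def)
  obtain g0 where g0: "g0 \<in> borel_measurable lborel" "AE x in lborel. ?d x = g0 x"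
    using completion_ex_borel_measurable_real[of ?d lborel] di by (auto simp: borel_measurable_integrable)
  note ae = AE_lebesgueI[OF g0(2)] and m0 = lebesgue_measurableI[OF g0(1)]
  have i0: "integrable lborel g0"
    using integrable_cong_AE_imp[OF di m0] ae integrable_lebesgue_iff[OF g0(1)] by (auto elim: eventually_mono)
  have g2: "integrable lborel (\<lambda>x. (g0 x)\<^sup>2)"
  proof -
    have "integrable lebesgue (\<lambda>x. (g x)\<^sup>2)" using g(1) by (simp add: L2_def)
    moreover have "AE x in lebesgue. (g x)\<^sup>2 = (g0 x)\<^sup>2" using AE_weak_deriv[OF g(2)] ae by eventually_elim simp
    ultimately have "integrable lebesgue (\<lambda>x. (g0 x)\<^sup>2)" by (rule integrable_cong_AE_imp[OF _ borel_measurable_power[OF m0]])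
    then show ?thesis using g0(1) by (simp add: integrable_lebesgue_iff)
  qed
  define V where "V = real_of_ereal (total_variation ?d)"
  have V: "(LINT x|lborel. g0 x * deriv \<phi> x) \<le> V" if \<phi>: "test_function \<phi>" "\<And>x. \<bar>\<phi> x\<bar> \<le> 1" for \<phi>
  proof -
    have "(LINT x|lebesgue. ?d x * deriv \<phi> x) = (LINT x|lborel. g0 x * deriv \<phi> x)"
    proof (rule integral_lebesgue_AE_eq)
      have m: "deriv \<phi> \<in> borel_measurable lborel" using test_function_bm(2)[OF \<phi>(1)] by auto
      show "(\<lambda>x. ?d x * deriv \<phi> x) \<in> borel_measurable lebesgue"
        by (rule borel_measurable_times[OF borel_measurable_integrable[OF di] lebesgue_measurableI[OF m]])
      show "(\<lambda>x. g0 x * deriv \<phi> x) \<in> borel_measurable lborel" by (rule borel_measurable_times[OF g0(1) m])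
      show "AE x in lebesgue. ?d x * deriv \<phi> x = g0 x * deriv \<phi> x" using ae by eventually_elim simp
    qed
    moreover have "ereal (LINT x|lebesgue. ?d x * deriv \<phi> x) \<le> total_variation ?d"
      unfolding total_variation_def by (rule SUP_upper) (use \<phi> in simp)
    moreover have "total_variation ?d < \<infinity>" using d by (simp add: BV_def)
    ultimately show ?thesis unfolding V_def by (cases "total_variation ?d") auto
  qed
  show ?thesis
  proof (rule absolutely_continuous_representative[OF hd i0 ae])
    fix w assume w: "continuous_on UNIV w" "\<And>x s. s \<ge> 0 \<Longrightarrow> w (x + s) - w x = cv (win s) g0 x" "AE x in lebesgue. u0 x = w x"
    have wm: "w \<in> borel_measurable lborel" by (rule continuous_measurable_lborel[OF w(1)])
    have u2': "u0 \<in> borel_measurable lebesgue" "integrable lebesgue (\<lambda>x. (u0 x)\<^sup>2)" using u2 by (auto simp: L2_def)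
    have "AE x in lebesgue. (u0 x)\<^sup>2 = (w x)\<^sup>2" using w(3) by eventually_elim simp
    note u2'' = this and wsq = borel_measurable_power[OF wm, of 2]
    have "integrable lebesgue (\<lambda>x. (w x)\<^sup>2)"
      by (rule integrable_cong_AE_imp[OF u2'(2) lebesgue_measurableI[OF wsq]]) (use u2'' in \<open>auto elim: eventually_mono\<close>)
    then have w2: "integrable lborel (\<lambda>x. (w x)\<^sup>2)" using wsq by (simp add: integrable_lebesgue_iff)
    have id: "initial_data w g0 V"
      by (rule initial_data.intro[OF w(1,2) i0 modl_if_variation_bounded[OF i0 V] w2 g2])
    have "(LINT x|lebesgue. (u0 x)\<^sup>2) = (LINT x|lborel. (w x)\<^sup>2)"
      by (rule integral_lebesgue_AE_eq[OF borel_measurable_power[OF u2'(1)] wsq u2''])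
    moreover have "(LINT x|lebesgue. (?d x)\<^sup>2) = (LINT x|lborel. (g0 x)\<^sup>2)"
      by (rule integral_lebesgue_AE_eq[OF borel_measurable_power[OF borel_measurable_integrable[OF di]] borel_measurable_power[OF g0(1)]])
        (use ae in eventually_elim, simp)
    ultimately have "H1_norm u0 = sqrt (initial_data.E w g0)" by (simp add: H1_norm_def initial_data.E_def[OF id])
    from that[OF id w(3) this] show ?thesis .
  qed
qed

theorem theorem1p3:
  fixes u0 :: "real \<Rightarrow> real"
  assumes "u0 \<in> H1"
    and "weak_deriv u0 \<in> L1 \<inter> BV"
  shows "\<exists>u :: real \<Rightarrow> real \<Rightarrow> real. global_entropy_weak_solution u0 u"
proof (rule initial_representative[OF assms])
  fix w g0 V assume id: "initial_data w g0 V" and w: "AE x in lebesgue. u0 x = w x" and n: "H1_norm u0 = sqrt (initial_data.E w g0)"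
  interpret initial_data w g0 V by (rule id)
  interpret ap: approximation Ua ga tn w E "3 * C" \<Gamma> by (rule approximation)
  show ?thesis
  proof (rule ap.convergent_subsequence)
    fix r u assume r: "strict_mono r" and lim: "\<And>t x. 0 \<le> t \<Longrightarrow> (\<lambda>n. Ua (r n) t x) \<longlonglongrightarrow> u t x"
    interpret limit_solution "\<lambda>n. Ua (r n)" "\<lambda>n. ga (r n)" "\<lambda>n. tn (r n)" w E "3 * C" \<Gamma> u
      by (rule limit_solution.intro[OF ap.subsequence[OF r] limit_solution_axioms.intro[OF lim]])
    have "u0 \<in> borel_measurable lebesgue" using assms(1) by (auto simp: H1_def L2_def)
    moreover have "AE x in lebesgue. u0 x = u 0 x" using w by eventually_elim (simp add: u_initial)
    ultimately have "global_entropy_weak_solution u0 u" using n by (rule global_entropy_weak_solution_limit)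
    then show ?thesis by blast
  qed
qed

end
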